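(* Let $n\ge1$, $s\in(0,1)$ and $a=1-2s\in(-1,1)$. Let $u:\mathbb{R}^n\to\mathbb{R}$ be a smooth bounded function which is integrable, and let $v$ be the solution of $$\mathrm{div}(y^a\nabla v)=0\ \text{in }\mathbb{R}^n\times(0,1),\qquad v_y(x,1)=0\ \text{on }\mathbb{R}^n\times\{1\},\qquad v(x,0)=u(x)\ \text{on }\mathbb{R}^n\times\{0\}$$ obtained as the unique minimizer of $\mathcal{E}_K$ in the class $\mathcal{H}_u$. Then $$\mathcal{E}_K(v)=\frac12\int_{\mathbb{R}^n\times(0,1)}y^a|\nabla v|^2\,dx\,dy=\frac{1}{2(2\pi)^n}\int_{\mathbb{R}^n}S_s(\xi)\,|\widehat{u}(\xi)|^2\,d\xi .$$
   Context: Points of the slab $\mathbb{R}^n\times[0,1]$ are written $(x,y)$. For functions $w$ on the slab, $\mathcal{E}_K(w):=\frac12\int_{\mathbb{R}^n\times(0,1)}y^a|\nabla w|^2\,dx\,dy$, and $$\mathcal{H}_u:=\{w\in H^1_{\mathrm{loc}}(\mathbb{R}^n\times(0,1),y^a)\ :\ w(x,0)=u(x)\ \text{for a.e. }x\in\mathbb{R}^n\},$$ where $H^1_{\mathrm{loc}}(\mathbb{R}^n\times(0,1),y^a)$ is the space of functions belonging to the weighted Sobolev space $H^1(B_R\times(0,1),y^a)$ for every ball $B_R\subset\mathbb{R}^n$, and $w(\cdot,0)$ is the trace at $y=0$. Fourier transform convention: $\widehat{u}(\xi)=\int_{\mathbb{R}^n}u(x)e^{-ix\cdot\xi}\,dx$.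 The symbol $S_s$ is, for $\xi\neq0$, $$S_s(\xi):=c_1(s)\,\frac{J_{1-s}(-i|\xi|)}{J_{s-1}(-i|\xi|)}\,|\xi|^{2s},\qquad c_1(s):=i\left(\frac{1-i}{2}\right)^{4s-2}\frac{\Gamma(1-s)}{\Gamma(s)},$$ where $J_k$ is the Bessel function of the first kind of order $k$; complex powers and $J_k$ are taken with principal branches. *)

theory Defs
  imports "HOL-Analysis.Analysis" "HOL-Real_Asymp.Real_Asymp"
begin

section \<open>Smooth functions and test functions\<close>

primrec C_k :: "nat \<Rightarrow> ('a::euclidean_space \<Rightarrow> real) \<Rightarrow> bool" where
  "C_k 0 f \<longleftrightarrow> continuous_on UNIV f"
| "C_k (Suc k) f \<longleftrightarrow>
     f differentiable_on UNIV \<and> (\<forall>b\<in>Basis. C_k k (\<lambda>x. frechet_derivative f (at x) b))"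

definition smooth :: "('a::euclidean_space \<Rightarrow> real) \<Rightarrow> bool" where
  "smooth f \<longleftrightarrow> (\<forall>k. C_k k f)"

definition test_function :: "'a::euclidean_space set \<Rightarrow> ('a \<Rightarrow> real) \<Rightarrow> bool" where
  "test_function \<Omega> \<phi> \<longleftrightarrow>
     smooth \<phi> \<and> compact (closure {x. \<phi> x \<noteq> 0}) \<and> closure {x. \<phi> x \<noteq> 0} \<subseteq> \<Omega>"


section \<open>Weighted Sobolev spaces on subsets of the slab\<close>

definition locally_integrable ::
    "'a::euclidean_space set \<Rightarrow> ('a \<Rightarrow> 'b::euclidean_space) \<Rightarrow> bool" where
  "locally_integrable \<Omega> f \<longleftrightarrow> (\<forall>K. compact K \<and> K \<subseteq> \<Omega> \<longrightarrow> f absolutely_integrable_on K)"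

definition has_weak_gradient ::
    "'a::euclidean_space set \<Rightarrow> ('a \<Rightarrow> real) \<Rightarrow> ('a \<Rightarrow> 'a) \<Rightarrow> bool" where
  "has_weak_gradient \<Omega> w g \<longleftrightarrow>
     locally_integrable \<Omega> w \<and> locally_integrable \<Omega> g \<and>
     (\<forall>\<phi>. test_function \<Omega> \<phi> \<longrightarrow>
        (\<forall>b\<in>Basis.
           (LINT p:\<Omega>|lebesgue. w p * frechet_derivative \<phi> (at p) b) =
           - (LINT p:\<Omega>|lebesgue. (g p \<bullet> b) * \<phi> p)))"

text \<open>For open \<open>\<Omega>\<close> the weak gradient is determined almost everywhere on \<open>\<Omega>\<close>, so the integrals
  below do not depend on the representative that is chosen here.\<close>

definition weak_gradient :: "'a::euclidean_space set \<Rightarrow> ('a \<Rightarrow> real) \<Rightarrow> ('a \<Rightarrow> 'a)" where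
  "weak_gradient \<Omega> w = (SOME g. has_weak_gradient \<Omega> w g)"

text \<open>Points of the slab are pairs \<open>(x, y)\<close>, so the weight \<open>y\<^sup>a\<close> at \<open>p\<close> is \<open>snd p powr a\<close>.
  The functional below is the square of the norm of \<open>H\<^sup>1(\<Omega>, y\<^sup>a)\<close>.\<close>

definition H1_sqnorm ::
    "real \<Rightarrow> ('a::euclidean_space \<times> real) set \<Rightarrow> ('a \<times> real \<Rightarrow> real) \<Rightarrow> ennreal" where
  "H1_sqnorm a \<Omega> w =
     (\<integral>\<^sup>+p\<in>\<Omega>. ennreal (snd p powr a * ((w p)\<^sup>2 + (norm (weak_gradient \<Omega> w p))\<^sup>2)) \<partial>lebesgue)"

definition H1 :: "real \<Rightarrow> ('a::euclidean_space \<times> real) set \<Rightarrow> ('a \<times> real \<Rightarrow> real) set" where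
  "H1 a \<Omega> = {w. (\<exists>g. has_weak_gradient \<Omega> w g) \<and> H1_sqnorm a \<Omega> w < \<infinity>}"

definition slab :: "('a::euclidean_space \<times> real) set" where
  "slab = UNIV \<times> {0<..<1}"

definition H1_loc :: "real \<Rightarrow> ('a::euclidean_space \<times> real \<Rightarrow> real) set" where
  "H1_loc a = {w. \<forall>c R. R > 0 \<longrightarrow> w \<in> H1 a (ball c R \<times> {0<..<1})}"

text \<open>The trace operator at \<open>y = 0\<close> is the continuous extension to \<open>H\<^sup>1(B \<times> (0,1), y\<^sup>a)\<close>, with
  values in \<open>L\<^sup>2(B)\<close>, of the restriction \<open>\<phi> \<mapsto> \<phi>(\<cdot>, 0)\<close> defined on the dense subspace of
  functions that are continuous up to the boundary. The trace is a class modulo null sets, so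
  \<open>has_trace a B w h\<close> says that the trace of \<open>w\<close> is equal to \<open>h\<close> almost everywhere on \<open>B\<close>.\<close>

definition has_trace ::
    "real \<Rightarrow> 'a::euclidean_space set \<Rightarrow> ('a \<times> real \<Rightarrow> real) \<Rightarrow> ('a \<Rightarrow> real) \<Rightarrow> bool" where
  "has_trace a B w h \<longleftrightarrow>
     h \<in> borel_measurable (lebesgue_on B) \<and>
     (\<exists>\<phi> :: nat \<Rightarrow> 'a \<times> real \<Rightarrow> real.
        (\<forall>k. \<phi> k \<in> H1 a (B \<times> {0<..<1}) \<and> continuous_on (closure (B \<times> {0<..<1})) (\<phi> k)) \<and>
        (\<lambda>k. H1_sqnorm a (B \<times> {0<..<1}) (\<lambda>p. \<phi> k p - w p)) \<longlonglongrightarrow> 0 \<and>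
        (\<lambda>k. \<integral>\<^sup>+x\<in>B. ennreal ((\<phi> k (x, 0) - h x)\<^sup>2) \<partial>lebesgue) \<longlonglongrightarrow> 0)"

definition H_class ::
    "real \<Rightarrow> ('a::euclidean_space \<Rightarrow> real) \<Rightarrow> ('a \<times> real \<Rightarrow> real) set" where
  "H_class a u = {w \<in> H1_loc a. \<forall>c R. R > 0 \<longrightarrow> has_trace a (ball c R) w u}"

definition E_K :: "real \<Rightarrow> ('a::euclidean_space \<times> real \<Rightarrow> real) \<Rightarrow> ennreal" where
  "E_K a w =
     1 / 2 * (\<integral>\<^sup>+p\<in>slab. ennreal (snd p powr a * (norm (weak_gradient slab w p))\<^sup>2) \<partial>lebesgue)"


section \<open>Fourier transform and the symbol\<close>

definition fourier :: "('a::euclidean_space \<Rightarrow> real) \<Rightarrow> 'a \<Rightarrow> complex" where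
  "fourier u \<xi> = (LINT x|lborel. complex_of_real (u x) * exp (- \<i> * complex_of_real (x \<bullet> \<xi>)))"

definition Bessel_J :: "complex \<Rightarrow> complex \<Rightarrow> complex" where
  "Bessel_J \<nu> z =
     (z / 2) powr \<nu> *
     (\<Sum>k. (- 1) ^ k * rGamma (of_nat k + \<nu> + 1) / fact k * (z / 2) ^ (2 * k))"

definition c\<^sub>1 :: "real \<Rightarrow> complex" where
  "c\<^sub>1 s = \<i> * ((1 - \<i>) / 2) powr of_real (4 * s - 2) * of_real (Gamma (1 - s) / Gamma s)"

definition S_symbol :: "real \<Rightarrow> 'a::euclidean_space \<Rightarrow> complex" where
  "S_symbol s \<xi> =
     c\<^sub>1 s * (Bessel_J (of_real (1 - s)) (- \<i> * of_real (norm \<xi>)) /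
             Bessel_J (of_real (s - 1)) (- \<i> * of_real (norm \<xi>))) *
     of_real (norm \<xi> powr (2 * s))"

text \<open>The symbol takes positive real values off the origin, although it is given by a complex
  formula; hence no information is lost when its real part is integrated.\<close>

lemma Bessel_J_neg_imaginary:
  assumes "\<nu> > -1" "r > (0::real)"
  obtains I where "I > 0"
    "Bessel_J (of_real \<nu>) (- \<i> * of_real r) = exp (- \<i> * of_real (pi / 2 * \<nu>)) * of_real I"
proof -
  define c where "c k = (r / 2) ^ (2 * k) / (fact k * Gamma (real k + \<nu> + 1))" for k
  have Gpos: "Gamma (real k + \<nu> + 1) > 0" for k
    using assms by (intro Gamma_real_pos) auto
  have cpos: "c k > 0" for k
    unfolding c_def using assms Gpos[of k] by auto
  have csuc: "c (Suc k) = (r / 2)\<^sup>2 / ((real k + 1) * (real k + \<nu> + 1)) * c k" for k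
  proof -
    have "Gamma (real (Suc k) + \<nu> + 1) = (real k + \<nu> + 1) * Gamma (real k + \<nu> + 1)"
      using Gamma_plus1[of "real k + \<nu> + 1"] plus_one_in_nonpos_Ints_imp assms
        nonpos_Ints_nonpos[of "real k + \<nu> + 1"]
      by (force simp: add_ac)
    thus ?thesis
      by (simp add: c_def power2_eq_square ac_simps)
  qed
  have "(\<lambda>k. (r / 2)\<^sup>2 / ((real k + 1) * (real k + \<nu> + 1))) \<longlonglongrightarrow> 0"
    by real_asymp
  hence "\<forall>\<^sub>F k in sequentially. (r / 2)\<^sup>2 / ((real k + 1) * (real k + \<nu> + 1)) < 1 / 2"
    by (rule order_tendstoD) auto
  then obtain N where N: "\<And>k. k \<ge> N \<Longrightarrow> (r / 2)\<^sup>2 / ((real k + 1) * (real k + \<nu> + 1)) < 1 / 2"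
    by (auto simp: eventually_at_top_linorder)
  have summ: "summable c"
  proof (rule summable_ratio_test[of "1/2" N])
    fix k assume "N \<le> k"
    have "c (Suc k) \<le> 1 / 2 * c k"
      unfolding csuc using N[OF \<open>N \<le> k\<close>] cpos[of k] by (intro mult_right_mono) auto
    thus "norm (c (Suc k)) \<le> 1 / 2 * norm (c k)"
      using cpos[of k] cpos[of "Suc k"] by simp
  qed auto
  have term_eq: "(- 1) ^ k * rGamma (of_nat k + of_real \<nu> + 1) / fact k
          * (- \<i> * of_real r / 2) ^ (2 * k) = complex_of_real (c k)" for k
  proof -
    have "(- \<i> * of_real r / 2) ^ (2 * k) = ((- \<i> * of_real r / 2)\<^sup>2 :: complex) ^ k"
      by (simp add: power_mult)
    also have "(- \<i> * of_real r / 2)\<^sup>2 = - (of_real ((r / 2)\<^sup>2) :: complex)"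
      by (simp add: power2_eq_square field_simps)
    also have "\<dots> ^ k = (- 1) ^ k * of_real ((r / 2) ^ (2 * k))"
      by (subst power_minus) (simp add: power_mult)
    finally have 1: "(- \<i> * of_real r / 2 :: complex) ^ (2 * k)
      = (- 1) ^ k * of_real ((r / 2) ^ (2 * k))" .
    have 2: "rGamma (of_nat k + of_real \<nu> + 1 :: complex)
               = of_real (1 / Gamma (real k + \<nu> + 1))"
      using rGamma_complex_of_real[of "real k + \<nu> + 1"]
      by (simp add: rGamma_inverse_Gamma divide_inverse)
    have 3: "(- 1 :: complex) ^ k * (- 1) ^ k = 1"
      by (simp flip: power_add)
    have "(- 1) ^ k * rGamma (of_nat k + of_real \<nu> + 1) / fact k
          * (- \<i> * of_real r / 2) ^ (2 * k) =
          ((- 1 :: complex) ^ k * (- 1) ^ k) * (of_real (1 / Gamma (real k + \<nu> + 1)) / fact k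
            * of_real ((r / 2) ^ (2 * k)))"
      unfolding 1 2 by (simp only: mult_ac times_divide_eq_right times_divide_eq_left)
    thus ?thesis unfolding 3 by (simp add: c_def field_simps)
  qed
  have "Ln (- \<i> * of_real r / 2) = of_real (ln (r / 2)) - \<i> * of_real (pi / 2)"
    using Ln_times_of_real[of "r/2" "-\<i>"] Ln_of_real[of "r/2"] assms by (simp add: ac_simps)
  hence "(- \<i> * of_real r / 2) powr of_real \<nu>
           = exp (of_real \<nu> * (of_real (ln (r / 2)) - \<i> * of_real (pi / 2)))"
    using assms by (simp add: powr_def)
  also have "\<dots> = exp (- \<i> * of_real (pi / 2 * \<nu>) + of_real (\<nu> * ln (r / 2)))"
    by (rule arg_cong[where f = exp]) (simp add: field_simps)
  also have "\<dots> = exp (- \<i> * of_real (pi / 2 * \<nu>)) * of_real ((r / 2) powr \<nu>)"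
    unfolding exp_add exp_of_real using assms by (simp add: powr_def)
  finally have "(- \<i> * of_real r / 2) powr of_real \<nu>
           = exp (- \<i> * of_real (pi / 2 * \<nu>)) * of_real ((r / 2) powr \<nu>)" .
  moreover have "(\<Sum>k. complex_of_real (c k)) = of_real (\<Sum>k. c k)"
    using summ by (rule suminf_of_real[symmetric])
  ultimately have "Bessel_J (of_real \<nu>) (- \<i> * of_real r) =
     exp (- \<i> * of_real (pi / 2 * \<nu>)) * of_real ((r / 2) powr \<nu> * (\<Sum>k. c k))"
    unfolding Bessel_J_def term_eq by simp
  moreover have "(r / 2) powr \<nu> * (\<Sum>k. c k) > 0"
    using assms suminf_pos[OF summ cpos] by simp
  ultimately show thesis using that by blast
qed

lemma S_symbol_pos:
  fixes \<xi> :: "'a::euclidean_space"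
  assumes "0 < s" "s < 1" "\<xi> \<noteq> 0"
  shows "S_symbol s \<xi> \<in> \<real>" "Re (S_symbol s \<xi>) > 0"
proof -
  have r: "norm \<xi> > 0" using assms by simp
  obtain A where A: "A > 0" "Bessel_J (of_real (1 - s)) (- \<i> * of_real (norm \<xi>)) =
      exp (- \<i> * of_real (pi / 2 * (1 - s))) * of_real A"
    using Bessel_J_neg_imaginary[of "1 - s" "norm \<xi>"] r assms by auto
  obtain B where B: "B > 0" "Bessel_J (of_real (s - 1)) (- \<i> * of_real (norm \<xi>)) =
      exp (- \<i> * of_real (pi / 2 * (s - 1))) * of_real B"
    using Bessel_J_neg_imaginary[of "s - 1" "norm \<xi>"] r assms by auto
  have e: "(1 - \<i>) / 2 = exp (of_real (ln (1 / sqrt 2)) - \<i> * of_real (pi / 4))"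
    by (simp add: exp_diff exp_of_real)
       (simp add: complex_eq_iff Re_divide Im_divide exp_minus Re_exp Im_exp
          cos_45 sin_45 field_simps power2_eq_square flip: exp_of_real)
  have "Ln ((1 - \<i>) / 2) = of_real (ln (1 / sqrt 2)) - \<i> * of_real (pi / 4)"
    unfolding e using pi_gt_zero by (intro Ln_exp; simp; linarith)
  hence c1: "c\<^sub>1 s = \<i> * exp (of_real (4 * s - 2) * (of_real (ln (1 / sqrt 2)) - \<i> * of_real (pi / 4)))
                * of_real (Gamma (1 - s) / Gamma s)"
    by (simp add: c\<^sub>1_def powr_def)
  define D where "D = exp ((4 * s - 2) * ln (1 / sqrt 2)) * (Gamma (1 - s) / Gamma s)
                       * (A / B) * norm \<xi> powr (2 * s)"
  have exp_i_half_pi: "exp (\<i> * of_real (pi / 2)) = \<i>"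
    using cis_conv_exp[of "pi / 2"] cis_pi_half by (simp add: mult_ac)
  have Dpos: "D > 0" unfolding D_def using A B assms r by (auto intro!: mult_pos_pos divide_pos_pos Gamma_real_pos)
  have "S_symbol s \<xi> = exp (\<i> * of_real (pi / 2)) *
      exp (of_real (4 * s - 2) * (of_real (ln (1 / sqrt 2)) - \<i> * of_real (pi / 4))) *
      (exp (- \<i> * of_real (pi / 2 * (1 - s))) / exp (- \<i> * of_real (pi / 2 * (s - 1)))) *
      of_real ((Gamma (1 - s) / Gamma s) * (A / B) * norm \<xi> powr (2 * s))"
    unfolding S_symbol_def c1 A(2) B(2) exp_i_half_pi by (simp add: mult_ac)
  also have "\<dots> = exp (of_real ((4 * s - 2) * ln (1 / sqrt 2))) *
      of_real ((Gamma (1 - s) / Gamma s) * (A / B) * norm \<xi> powr (2 * s))"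
    unfolding exp_add[symmetric] exp_diff[symmetric]
    by (rule arg_cong2[where f = "(*)"], rule arg_cong[where f = exp])
       (simp_all add: field_simps)
  also have "\<dots> = of_real D"
    unfolding D_def exp_of_real by (simp only: of_real_mult mult.assoc)
  finally have S: "S_symbol s \<xi> = of_real D" .
  show "S_symbol s \<xi> \<in> \<real>" "Re (S_symbol s \<xi>) > 0" unfolding S using Dpos by auto
qed

end

theory Submission
  imports Defs "HOL-Probability.Probability"
begin

text \<open>Separation of variables leads to profiles \<open>th\<close> on \<open>(0, 1)\<close> with \<open>(y^a th')' = r^2 y^a th\<close>, \<open>th 0 = 1\<close>, \<open>th' 1 = 0\<close>,
  given by modified Bessel series; the flux \<open>q = - y^a th'\<close> for \<open>r = |xi|\<close> takes the value \<open>S_s xi\<close> at \<open>y = 0\<close>.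
  Superposing the waves \<open>th y * e^(i x xi)\<close> with amplitude \<open>fourier u\<close> gives a competitor whose energy is bounded by the
  right-hand side (the amplitude is first damped by a Gaussian, so that the trace is attained continuously).
  For the converse bound, the weak gradient \<open>g\<close> of an arbitrary member of the class is tested against localised plane waves.
  As these waves solve the equation, only the trace \<open>u\<close> survives when the localisation is removed; integrating over
  \<open>1/rho \<le> |xi| \<le> rho\<close> shows that the truncated right-hand side \<open>X\<close> is the weighted inner product of \<open>g\<close> with the
  gradient of a superposition whose energy is at most \<open>X\<close>, so \<open>X \<le> (E + X) / 2\<close> for the energy \<open>E\<close> of \<open>g\<close>.\<close>

section \<open>Smooth functions and bumps\<close>

text \<open>Minimality enters only through comparison with the competitor; the lower bound is proved
  for every member of the class. Two obstacles shape it. A member has only an \<open>L2\<close>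
  trace, so the identity linking \<open>g\<close> to \<open>u\<close> is proved for functions
  continuous up to \<open>y = 0\<close> and carried over by the convergence that defines the trace;
  derivatives of vertical cutoffs act in the limit as the value at 0 minus the value at 1, and the
  Neumann condition cancels the latter. Secondly, cutting a plane wave off at radius
  \<open>R\<close> leaves errors with a factor \<open>1 / R\<close>, integrated over a cylinder of
  radius \<open>R\<close>; from dimension two on, Cauchy-Schwarz for a single frequency does not
  make them small. They are therefore superposed over the frequencies first: by Plancherel the
  superposition has finite weighted energy on the whole slab, and the factor \<open>1 / R\<close>
  wins. The amplitude is \<open>fourier u / (2 * pi) ^ n\<close> on the annulus, because then the
  source term and the Plancherel bound for the energy of the superposition are the same number
  \<open>X\<close>.\<close>

lemma C_k_SucI:
 fixes f :: "'a::euclidean_space => real"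
 assumes "!!x. (f has_derivative D x) (at x)" "!!b. b \<in> Basis ==> C_k k (%x. D x b)"
 shows "C_k (Suc k) f"
proof -
 have "frechet_derivative f (at x) = D x" for x
  using frechet_derivative_at[OF assms(1)[of x]] by simp
 thus ?thesis using assms unfolding C_k.simps differentiable_on_def differentiable_def by auto
qed

lemma C_k_Suc_has_derivative:
 fixes f :: "'a::euclidean_space => real"
 assumes "C_k (Suc k) f"
 shows "(f has_derivative frechet_derivative f (at x)) (at x)"
 using assms by (auto simp: differentiable_on_def frechet_derivative_works)

lemma C_k_SucD: "C_k (Suc k) f ==> C_k k f"
proof (induction k arbitrary: f)
 case 0 thus ?case by (auto intro: differentiable_imp_continuous_on)
next
 case (Suc k) thus ?case by (metis C_k.simps(2))
qed

lemma C_k_const: "C_k k (%x::'a::euclidean_space. c)"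
proof (induction k arbitrary: c)
 case (Suc k)
 show ?case by (rule C_k_SucI[where D="%_ _. 0"]) (auto simp: Suc)
qed auto

lemma C_k_add: "C_k k f ==> C_k k g ==> C_k k (%x. f x + g x)"
proof (induction k arbitrary: f g)
 case 0 thus ?case by (auto intro!: continuous_intros)
next
 case (Suc k)
 note d = C_k_Suc_has_derivative[OF Suc.prems(1)] C_k_Suc_has_derivative[OF Suc.prems(2)]
 show ?case
  by (rule C_k_SucI[OF has_derivative_add[OF d(1) d(2)]]) (use Suc in auto)
qed

lemma C_k_mult: "C_k k f ==> C_k k g ==> C_k k (%x. f x * g x)"
proof (induction k arbitrary: f g)
 case 0 thus ?case by (auto intro!: continuous_intros)
next
 case (Suc k)
 note d = C_k_Suc_has_derivative[OF Suc.prems(1)] C_k_Suc_has_derivative[OF Suc.prems(2)]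
 show ?case
  by (rule C_k_SucI[OF has_derivative_mult[OF d(1) d(2)]])
   (intro C_k_add Suc.IH, use Suc.prems C_k_SucD in auto)
qed

lemma C_k_cmult: "C_k k f ==> C_k k (%x. c * f x)"
 by (intro C_k_mult C_k_const)

lemma C_k_sum: "(!!i. i \<in> I ==> C_k k (f i)) ==> C_k k (%x. \<Sum>i\<in>I. f i x)"
 by (induction I rule: infinite_finite_induct) (auto intro: C_k_add C_k_const)

lemma C_k_prod: "(!!i. i \<in> I ==> C_k k (f i)) ==> C_k k (%x. \<Prod>i\<in>I. f i x)"
 by (induction I rule: infinite_finite_induct) (auto intro: C_k_mult C_k_const)

lemma C_k_compose_affine:
 fixes f :: "'b::euclidean_space => real" and L :: "'a::euclidean_space => 'b"
 assumes L: "bounded_linear L"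
 shows "C_k k f ==> C_k k (%p. f (L p + t))"
proof (induction k arbitrary: f)
 case 0 thus ?case
  using continuous_on_compose2[of UNIV f UNIV "%p. L p + t"]
   continuous_on_add[OF linear_continuous_on[OF L] continuous_on_const, of UNIV t] by simp
next
 case (Suc k)
 have d: "((%p. f (L p + t)) has_derivative (%v. frechet_derivative f (at (L x + t)) (L v))) (at x)" for x
  by (rule has_derivative_compose[OF _ C_k_Suc_has_derivative[OF Suc.prems]])
   (use L in \<open>auto intro!: derivative_eq_intros bounded_linear_imp_has_derivative\<close>)
 \<comment> \<open>\<open>C_k\<close> only controls the partial derivatives in basis directions, so
   the derivative along \<open>L v\<close> is expanded in coordinates before the induction
   hypothesis is applied.\<close>
 have lin: "frechet_derivative f (at y) (L v) =
   (\<Sum>b\<in>Basis. (L v \<bullet> b) * frechet_derivative f (at y) b)" for y v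
 proof -
  have l: "linear (frechet_derivative f (at y))"
   using C_k_Suc_has_derivative[OF Suc.prems] has_derivative_linear by blast
  have "frechet_derivative f (at y) (L v) = frechet_derivative f (at y) (\<Sum>b\<in>Basis. (L v \<bullet> b) *\<^sub>R b)"
   by (simp add: euclidean_representation)
  thus ?thesis by (simp add: linear_sum[OF l] linear_cmul[OF l])
 qed
 show ?case
 proof (rule C_k_SucI[OF d])
  fix b :: 'a
  show "C_k k (%x. frechet_derivative f (at (L x + t)) (L b))"
   unfolding lin using Suc.prems by (intro C_k_sum C_k_cmult Suc.IH) auto
 qed
qed

lemma C_k_real_SucI:
 fixes f :: "real => real"
 assumes "!!x. (f has_real_derivative f' x) (at x)" "C_k k f'"
 shows "C_k (Suc k) f"
 by (rule C_k_SucI[where D="%x h. f' x * h"]) (use assms in \<open>auto simp: has_field_derivative_def\<close>)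

lemma C_k_sin_cos: "C_k k (sin :: real => real) \<and> C_k k (cos :: real => real)"
proof (induction k)
 case 0 thus ?case by (auto intro!: continuous_intros)
next
 case (Suc k)
 have "C_k k (%x. (-1) * sin (x::real))" using Suc by (blast intro: C_k_cmult)
 hence m: "C_k k (%x. - sin (x::real))" by simp
 have "C_k (Suc k) (sin::real=>real)"
  by (rule C_k_real_SucI[of _ cos]) (use Suc in \<open>auto intro!: derivative_eq_intros\<close>)
 moreover have "C_k (Suc k) (cos::real=>real)"
  by (rule C_k_real_SucI[OF _ m]) (auto intro!: derivative_eq_intros)
 ultimately show ?case ..
qed

lemma smooth_const: "smooth (%x. c)"
 and smooth_add: "smooth f ==> smooth g ==> smooth (%x. f x + g x)"
 and smooth_mult: "smooth f ==> smooth g ==> smooth (%x. f x * g x)"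
 and smooth_sum: "(!!i. i \<in> I ==> smooth (F i)) ==> smooth (%x. \<Sum>i\<in>I. F i x)"
 and smooth_prod: "(!!i. i \<in> I ==> smooth (F i)) ==> smooth (%x. \<Prod>i\<in>I. F i x)"
 unfolding smooth_def by (auto intro: C_k_const C_k_add C_k_mult C_k_sum C_k_prod)

lemma smooth_compose_affine:
 "bounded_linear L ==> smooth f ==> smooth (%p. f (L p + t))"
 unfolding smooth_def by (auto intro: C_k_compose_affine)

lemma smooth_has_derivative:
 "smooth f ==> (f has_derivative frechet_derivative f (at x)) (at x)"
 unfolding smooth_def using C_k_Suc_has_derivative by blast

lemma smooth_partial:
 "smooth f ==> b \<in> Basis ==> smooth (%x. frechet_derivative f (at x) b)"
 unfolding smooth_def by (metis C_k.simps(2))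

lemma smooth_continuous: "smooth f ==> continuous_on S f"
 unfolding smooth_def using C_k.simps(1) continuous_on_subset by blast

lemma smooth_sin_inner: "smooth (%x. sin (x \<bullet> xi))"
 and smooth_cos_inner: "smooth (%x. cos (x \<bullet> xi))"
proof -
 have s: "smooth (sin::real=>real)" "smooth (cos::real=>real)"
  unfolding smooth_def using C_k_sin_cos by auto
 show "smooth (%x. sin (x \<bullet> xi))" "smooth (%x. cos (x \<bullet> xi))"
  using smooth_compose_affine[of "%x. x \<bullet> xi" _ 0, OF bounded_linear_inner_left] s by fastforce+
qed

section \<open>Finite differentiability on subsets of the line\<close>

text \<open>The profiles are smooth inside \<open>(0, 1)\<close> but in general not at 0, so
  \<open>C_k\<close>, which speaks of the whole space, does not apply to them. The derivatives are
  two-sided, which suits open intervals.\<close>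

primrec C_k_on :: "nat => real set => (real => real) => bool" where
 "C_k_on 0 J f \<longleftrightarrow> continuous_on J f"
| "C_k_on (Suc k) J f \<longleftrightarrow> (\<exists>f'. (\<forall>y\<in>J. (f has_real_derivative f' y) (at y)) \<and> C_k_on k J f')"

lemma C_k_on_SucI:
 "(!!y. y \<in> J ==> (f has_real_derivative f' y) (at y)) ==> C_k_on k J f' ==> C_k_on (Suc k) J f"
 by auto

lemma C_k_on_SucD: "C_k_on (Suc k) J f ==> C_k_on k J f"
proof (induction k arbitrary: f)
 case 0 thus ?case by (auto intro: DERIV_isCont continuous_at_imp_continuous_on)
next
 case (Suc k) thus ?case by (metis C_k_on.simps(2))
qed

lemma C_k_on_continuous: "C_k_on k J f ==> continuous_on J f"
 by (induction k) (auto dest: C_k_on_SucD simp del: C_k_on.simps(2))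

lemma C_k_on_const: "C_k_on k J (%x. c)"
proof (induction k arbitrary: c)
 case (Suc k) show ?case by (rule C_k_on_SucI[where f'="%_. 0", OF _ Suc]) (auto)
qed auto

lemma C_k_on_add: "C_k_on k J f ==> C_k_on k J g ==> C_k_on k J (%x. f x + g x)"
proof (induction k arbitrary: f g)
 case 0 thus ?case by (auto intro!: continuous_intros)
next
 case (Suc k)
 then obtain f' g' where "\<forall>y\<in>J. (f has_real_derivative f' y) (at y)" "C_k_on k J f'"
  "\<forall>y\<in>J. (g has_real_derivative g' y) (at y)" "C_k_on k J g'" by auto
 thus ?case by (intro C_k_on_SucI[OF _ Suc.IH[of f' g']]) (auto intro!: derivative_intros)
qed

lemma C_k_on_mult: "C_k_on k J f ==> C_k_on k J g ==> C_k_on k J (%x. f x * g x)"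
proof (induction k arbitrary: f g)
 case 0 thus ?case by (auto intro!: continuous_intros)
next
 case (Suc k)
 then obtain f' g' where d: "\<forall>y\<in>J. (f has_real_derivative f' y) (at y)" "C_k_on k J f'"
  "\<forall>y\<in>J. (g has_real_derivative g' y) (at y)" "C_k_on k J g'" by auto
 have "C_k_on k J (%x. f x * g' x + f' x * g x)"
  using d Suc.prems C_k_on_SucD by (intro C_k_on_add Suc.IH) blast+
 thus ?case by (rule C_k_on_SucI[rotated]) (use d in \<open>auto intro!: derivative_eq_intros\<close>)
qed

lemma C_k_on_ident: "C_k_on k J (%x. x)"
proof (cases k)
 case (Suc j)
 show ?thesis unfolding Suc
  by (rule C_k_on_SucI[where f'="%_. 1"]) (auto intro: C_k_on_const)
qed simp

lemma C_k_on_diff: "C_k_on k J f ==> C_k_on k J g ==> C_k_on k J (%x. f x - g x)"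
proof -
 assume a: "C_k_on k J f" "C_k_on k J g"
 have "C_k_on k J (%x. f x + (-1) * g x)"
  by (intro C_k_on_add C_k_on_mult C_k_on_const a)
 thus ?thesis by simp
qed

lemma C_k_on_powr: "J \<subseteq> {0<..} ==> C_k_on k J (%x. x powr \<gamma>)"
proof (induction k arbitrary: \<gamma>)
 case 0 thus ?case by (auto intro!: continuous_intros)
next
 case (Suc k)
 show ?case
  by (rule C_k_on_SucI[OF _ C_k_on_mult[OF C_k_on_const Suc.IH[OF Suc.prems]]])
   (use Suc.prems in \<open>auto intro!: derivative_eq_intros\<close>)
qed

section \<open>Smooth bumps and their derivatives\<close>

text \<open>The parameter \<open>e\<close> scales the exponent: for fixed \<open>e > 0\<close> its
  poles make all derivatives vanish at the ends, and as \<open>e\<close> tends to 0 the bumps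
  converge to the indicator of the open interval.\<close>

definition bump :: "real => real => real => real => real" where
 "bump e \<alpha> \<beta> y = (if \<alpha> < y \<and> y < \<beta> then exp (- e / (y - \<alpha>) - e / (\<beta> - y)) else 0)"

lemma power_over_fact_le_exp:
 assumes "x \<ge> (0::real)" shows "x ^ j / fact j \<le> exp x"
proof -
 have "(\<Sum>n\<in>{j}. inverse (fact n) *\<^sub>R x ^ n) \<le> (\<Sum>n. inverse (fact n) *\<^sub>R x ^ n)"
  by (rule sum_le_suminf) (use assms summable_exp_generic[of x] in auto)
 thus ?thesis by (simp add: exp_def field_simps)
qed

text \<open>A single term of the exponential series at \<open>e / X\<close> already dominates the
  power.\<close>

lemma exp_minus_inverse_le:
 assumes "e > 0" "X > (0::real)"
 shows "exp (- e / X) \<le> fact j / e ^ j * X ^ j"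
 using power_over_fact_le_exp[of "e / X" j] assms
 by (simp add: exp_minus field_simps power_divide)

text \<open>Differentiating \<open>f * bump\<close> produces poles at \<open>\<alpha>\<close> and
  \<open>\<beta>\<close>. Recording their order \<open>m\<close> gives a family that is closed under
  differentiation up to sums.\<close>

definition wbump :: "real => real => real => nat => (real => real) => real => real" where
 "wbump e \<alpha> \<beta> m f y = f y / ((y - \<alpha>) * (\<beta> - y)) ^ m * bump e \<alpha> \<beta> y"

text \<open>Each of the two exponential factors beats every pole. One is estimated with
  \<open>m + 2\<close> powers, which leaves a square, the other with \<open>m\<close> powers, which
  leaves a constant; exchanging the roles gives the bound at the other end.\<close>

lemma wbump_le:
 assumes e: "e > 0" and f: "continuous_on J f" "{\<alpha>..\<beta>} \<subseteq> J"
 obtains K where "!!y. \<bar>wbump e \<alpha> \<beta> m f y\<bar> \<le> K * (y - \<alpha>)\<^sup>2" "!!y. \<bar>wbump e \<alpha> \<beta> m f y\<bar> \<le> K * (y - \<beta>)\<^sup>2"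
proof -
 have "compact (f ` {\<alpha>..\<beta>})" using f by (intro compact_continuous_image) (auto intro: continuous_on_subset)
 then obtain M where M: "!!y. y \<in> {\<alpha>..\<beta>} ==> \<bar>f y\<bar> \<le> M" "M > 0"
  using compact_imp_bounded[THEN bounded_pos[THEN iffD1]] by (metis imageI real_norm_def)
 define A where "A j = (fact j / e ^ j :: real)" for j
 have A: "A j > 0" for j using e by (simp add: A_def)
 define K where "K = M * A (m+2) * A m"
 have *: "\<bar>wbump e \<alpha> \<beta> m f y\<bar> \<le> K * (y - \<alpha>)\<^sup>2 \<and> \<bar>wbump e \<alpha> \<beta> m f y\<bar> \<le> K * (y - \<beta>)\<^sup>2" for y
 proof (cases "\<alpha> < y \<and> y < \<beta>")
  case False
  have "K \<ge> 0" using M A[of m] A[of "m+2"] by (simp add: K_def)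
  thus ?thesis using False by (auto simp: wbump_def bump_def)
 next
  case True
  define X Y where "X = y - \<alpha>" and "Y = \<beta> - y"
  have XY: "X > 0" "Y > 0" using True by (auto simp: X_def Y_def)
  have b: "exp (- e / X) / X ^ m \<le> A m" "exp (- e / Y) / Y ^ m \<le> A m"
    "exp (- e / X) / X ^ m \<le> A (m+2) * X\<^sup>2" "exp (- e / Y) / Y ^ m \<le> A (m+2) * Y\<^sup>2"
   using exp_minus_inverse_le[OF e XY(1), of m] exp_minus_inverse_le[OF e XY(2), of m]
    exp_minus_inverse_le[OF e XY(1), of "m+2"] exp_minus_inverse_le[OF e XY(2), of "m+2"] XY
   unfolding A_def[symmetric] by (simp_all add: divide_le_eq power_add mult_ac power2_eq_square)
  have eq: "\<bar>wbump e \<alpha> \<beta> m f y\<bar> = \<bar>f y\<bar> * ((exp (- e / X) / X ^ m) * (exp (- e / Y) / Y ^ m))"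
  proof -
   have "wbump e \<alpha> \<beta> m f y = f y / (X * Y) ^ m * exp (- e / X + - e / Y)"
    using True by (simp add: wbump_def bump_def X_def Y_def)
   also have "... = f y * ((exp (- e / X) / X ^ m) * (exp (- e / Y) / Y ^ m))"
    by (simp only: exp_add power_mult_distrib) simp
   finally show ?thesis using XY by (simp add: abs_mult)
  qed
  have f: "\<bar>f y\<bar> \<le> M" using True M by auto
  have "\<bar>wbump e \<alpha> \<beta> m f y\<bar> \<le> M * ((A (m+2) * X\<^sup>2) * A m)"
   unfolding eq using b f XY M A by (intro mult_mono) (auto intro: less_imp_le)
  moreover have "\<bar>wbump e \<alpha> \<beta> m f y\<bar> \<le> M * (A m * (A (m+2) * Y\<^sup>2))"
   unfolding eq using b f XY M A by (intro mult_mono) (auto intro: less_imp_le)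
  ultimately show ?thesis by (simp add: K_def X_def Y_def power2_commute[of y \<beta>] mult_ac)
 qed
 show ?thesis using that[of K] * by blast
qed

lemma DERIV_zero_quadratic:
 fixes g :: "real => real"
 assumes "!!y. \<bar>g y\<bar> \<le> K * (y - x)\<^sup>2"
 shows "(g has_real_derivative 0) (at x)"
proof -
 have "g x = 0" using assms[of x] by simp
 have K: "K \<ge> 0" using assms[of "x+1"] by (smt (verit) mult_cancel_left1 power2_eq_square)
 have "((%h. (g (x + h) - g x) / h) \<longlongrightarrow> 0) (at 0)"
 proof (rule Lim_null_comparison)
  show "\<forall>\<^sub>F h in at 0. norm ((g (x + h) - g x) / h) \<le> K * \<bar>h\<bar>"
  proof (rule always_eventually, safe)
   fix h show "norm ((g (x + h) - g x) / h) \<le> K * \<bar>h\<bar>"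
    using assms[of "x+h"] \<open>g x = 0\<close> K
    by (cases "h = 0") (auto simp: abs_mult divide_simps power2_eq_square)
  qed
  show "((%h. K * \<bar>h\<bar>) \<longlongrightarrow> 0) (at 0)" by (auto intro!: tendsto_eq_intros)
 qed
 thus ?thesis by (simp add: DERIV_def)
qed

text \<open>Inside, the three summands come from \<open>f\<close>, from the pole factor and from the
  exponent. At an end point the quadratic bound forces the derivative 0, which is also the value of
  the right-hand side there; outside everything is locally 0.\<close>

lemma wbump_DERIV:
 assumes e: "e > 0" and f: "continuous_on J f" "!!y. y \<in> J ==> (f has_real_derivative f' y) (at y)"
  and J: "{\<alpha>..\<beta>} \<subseteq> J"
 shows "(wbump e \<alpha> \<beta> m f has_real_derivative
  (wbump e \<alpha> \<beta> m f' y + (wbump e \<alpha> \<beta> (Suc m) (%y. - real m * ((\<beta> - y) - (y - \<alpha>)) * f y) y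
   + wbump e \<alpha> \<beta> (m + 2) (%y. e * ((\<beta> - y)\<^sup>2 - (y - \<alpha>)\<^sup>2) * f y) y))) (at y)"
proof -
 consider "\<alpha> < y \<and> y < \<beta>" | "y = \<alpha> \<or> y = \<beta>" | "y \<notin> {\<alpha>..\<beta>}" by force
 thus ?thesis
 proof cases
  case 1
  define X Y where "X = y - \<alpha>" and "Y = \<beta> - y"
  have XY: "X > 0" "Y > 0" using 1 by (auto simp: X_def Y_def)
  have fd: "(f has_real_derivative f' y) (at y)" by (rule f(2)) (use 1 J in auto)
  define P where "P z = ((z - \<alpha>) * (\<beta> - z))" for z
  define E where "E z = exp (- e / (z - \<alpha>) - e / (\<beta> - z))" for z
  have Py: "P y = X * Y" "P y \<noteq> 0" using XY by (auto simp: P_def X_def Y_def)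
  have dP: "(P has_real_derivative (Y - X)) (at y)"
   unfolding P_def by (auto intro!: derivative_eq_intros simp: X_def Y_def)
  have dPm: "((%z. inverse (P z) ^ m) has_real_derivative (- real m * (Y - X) / P y ^ Suc m)) (at y)"
   using Py(2) by (auto intro!: derivative_eq_intros dP simp: field_simps power_Suc[symmetric]
     simp del: power_Suc split: nat.splits) (cases m; simp add: field_simps)
  have dE: "(E has_real_derivative E y * (e / X\<^sup>2 - e / Y\<^sup>2)) (at y)"
   unfolding E_def using 1 by (auto intro!: derivative_eq_intros simp: X_def Y_def power2_eq_square)
  have "((%z. f z * inverse (P z) ^ m * E z) has_real_derivative
   (f' y * inverse (P y) ^ m * E y + (f y * (- real m * (Y - X) / P y ^ Suc m) * E y
    + f y * inverse (P y) ^ m * (E y * (e / X\<^sup>2 - e / Y\<^sup>2))))) (at y)"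
   by (rule DERIV_cong[OF DERIV_mult[OF DERIV_mult[OF fd dPm] dE]]) (simp add: algebra_simps)
  also have "f y * inverse (P y) ^ m * (E y * (e / X\<^sup>2 - e / Y\<^sup>2)) =
   e * (Y\<^sup>2 - X\<^sup>2) * f y / P y ^ (m+2) * E y"
  proof -
   have "e / X\<^sup>2 - e / Y\<^sup>2 = e * (Y\<^sup>2 - X\<^sup>2) / P y ^ 2"
    using XY by (simp add: Py field_simps power2_eq_square)
   hence "f y * inverse (P y) ^ m * (E y * (e / X\<^sup>2 - e / Y\<^sup>2)) =
    f y * inverse (P y) ^ m * (E y * (e * (Y\<^sup>2 - X\<^sup>2) / P y ^ 2))" by (simp only:)
   also have "... = e * (Y\<^sup>2 - X\<^sup>2) * f y / P y ^ (m+2) * E y"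
    by (simp add: power_add power2_eq_square divide_inverse power_inverse mult_ac)
   finally show ?thesis .
  qed
  finally have D: "((%z. f z * inverse (P z) ^ m * E z) has_real_derivative
   (f' y * inverse (P y) ^ m * E y + (f y * (- real m * (Y - X) / P y ^ Suc m) * E y
    + e * (Y\<^sup>2 - X\<^sup>2) * f y / P y ^ (m+2) * E y))) (at y)" .
  have W: "(wbump e \<alpha> \<beta> m f has_real_derivative
   (f' y * inverse (P y) ^ m * E y + (f y * (- real m * (Y - X) / P y ^ Suc m) * E y
    + e * (Y\<^sup>2 - X\<^sup>2) * f y / P y ^ (m+2) * E y))) (at y)"
   by (rule has_field_derivative_transform_within_open[OF D, of "{\<alpha><..<\<beta>}"])
    (use 1 in \<open>auto simp: wbump_def bump_def P_def E_def divide_inverse power_inverse power_mult_distrib\<close>)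
  show ?thesis
   by (rule DERIV_cong[OF W])
    (use 1 in \<open>simp add: wbump_def bump_def P_def E_def X_def Y_def divide_inverse power_inverse power_mult_distrib mult_ac\<close>)
 next
  case 2
  obtain K where K: "!!y. \<bar>wbump e \<alpha> \<beta> m f y\<bar> \<le> K * (y - \<alpha>)\<^sup>2" "!!y. \<bar>wbump e \<alpha> \<beta> m f y\<bar> \<le> K * (y - \<beta>)\<^sup>2"
   using wbump_le[OF e f(1) J, of m] by blast
  have "wbump e \<alpha> \<beta> j h y = 0" for j h using 2 by (auto simp: wbump_def bump_def)
  thus ?thesis using 2 DERIV_zero_quadratic[OF K(1)] DERIV_zero_quadratic[OF K(2)] by auto
 next
  case 3
  have "(wbump e \<alpha> \<beta> m f has_real_derivative 0) (at y)"
   by (rule has_field_derivative_transform_within_open[of "%_. 0" _ _ "- {\<alpha>..\<beta>}"])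
    (use 3 in \<open>auto simp: wbump_def bump_def\<close>)
  moreover have "wbump e \<alpha> \<beta> j h y = 0" for j h using 3 by (auto simp: wbump_def bump_def)
  ultimately show ?thesis by simp
 qed
qed

lemma wbump_continuous:
 assumes e: "e > 0" and f: "continuous_on J f" and J: "{\<alpha>..\<beta>} \<subseteq> J"
 shows "continuous_on UNIV (wbump e \<alpha> \<beta> m f)"
proof -
 obtain K where K: "!!y. \<bar>wbump e \<alpha> \<beta> m f y\<bar> \<le> K * (y - \<alpha>)\<^sup>2" "!!y. \<bar>wbump e \<alpha> \<beta> m f y\<bar> \<le> K * (y - \<beta>)\<^sup>2"
  using wbump_le[OF e f(1) J, of m] by blast
 have "isCont (wbump e \<alpha> \<beta> m f) y" for y
 proof -
  consider "\<alpha> < y \<and> y < \<beta>" | "y = \<alpha> \<or> y = \<beta>" | "y \<notin> {\<alpha>..\<beta>}" by force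
  thus ?thesis
  proof cases
   case 1
   have "continuous_on {\<alpha><..<\<beta>} (%y. f y / ((y - \<alpha>) * (\<beta> - y)) ^ m * exp (- e / (y - \<alpha>) - e / (\<beta> - y)))"
    using J by (auto intro!: continuous_intros continuous_on_subset[OF f])
   hence "continuous_on {\<alpha><..<\<beta>} (wbump e \<alpha> \<beta> m f)"
    by (rule continuous_on_eq) (auto simp: wbump_def bump_def)
   thus ?thesis using 1 by (simp add: continuous_on_eq_continuous_at)
  next
   case 2
   thus ?thesis using DERIV_zero_quadratic[OF K(1)] DERIV_zero_quadratic[OF K(2)] DERIV_isCont by blast
  next
   case 3
   have "continuous_on (- {\<alpha>..\<beta>}) (wbump e \<alpha> \<beta> m f)"
    by (rule continuous_on_eq[of _ "%_. 0"]) (auto simp: wbump_def bump_def)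
   thus ?thesis using 3 by (simp add: continuous_on_eq_continuous_at open_Compl)
  qed
 qed
 thus ?thesis by (simp add: continuous_at_imp_continuous_on)
qed

text \<open>The derivative changes both \<open>f\<close> and the order of the pole, so the induction
  is generalised over both.\<close>

lemma C_k_wbump:
 assumes e: "e > 0" and J: "{\<alpha>..\<beta>} \<subseteq> J"
 shows "C_k_on k J f ==> C_k k (wbump e \<alpha> \<beta> m f)"
proof (induction k arbitrary: f m)
 case 0 thus ?case using wbump_continuous[OF e _ J] by simp
next
 case (Suc k)
 then obtain f' where f': "!!y. y \<in> J ==> (f has_real_derivative f' y) (at y)" "C_k_on k J f'" by auto
 note fk = C_k_on_SucD[OF Suc.prems]
 show ?case
 proof (rule C_k_real_SucI[OF wbump_DERIV[OF e C_k_on_continuous[OF Suc.prems] f'(1) J]])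
  show "C_k k (%y. wbump e \<alpha> \<beta> m f' y + (wbump e \<alpha> \<beta> (Suc m) (%y. - real m * ((\<beta> - y) - (y - \<alpha>)) * f y) y
   + wbump e \<alpha> \<beta> (m + 2) (%y. e * ((\<beta> - y)\<^sup>2 - (y - \<alpha>)\<^sup>2) * f y) y))"
   unfolding power2_eq_square
   by (intro C_k_add Suc.IH f' C_k_on_mult C_k_on_diff C_k_on_const C_k_on_ident fk)
 qed auto
qed

lemma smooth_times_bump:
 assumes "e > 0" "{\<alpha>..\<beta>} \<subseteq> J" "!!k. C_k_on k J f"
 shows "smooth (%y. f y * bump e \<alpha> \<beta> y)"
 using C_k_wbump[OF assms(1,2) assms(3), of _ 0] unfolding smooth_def wbump_def by simp

lemma smooth_bump: "e > 0 ==> smooth (bump e \<alpha> \<beta>)"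
 using smooth_times_bump[of e \<alpha> \<beta> UNIV "%_. 1"] C_k_on_const by (simp add: eta_contract_eq)

lemma bump_bounds:
 assumes e: "e > 0"
 shows "0 \<le> bump e \<alpha> \<beta> y" "bump e \<alpha> \<beta> y \<le> 1"
proof -
 show "0 \<le> bump e \<alpha> \<beta> y" by (simp add: bump_def)
 have "- e / (y - \<alpha>) - e / (\<beta> - y) \<le> 0" if "\<alpha> < y" "y < \<beta>"
  using divide_pos_pos[of e "y - \<alpha>"] divide_pos_pos[of e "\<beta> - y"] that e by linarith
 thus "bump e \<alpha> \<beta> y \<le> 1" by (auto simp: bump_def)
qed

section \<open>Test functions\<close>

lemma smooth_compose_linear:
 assumes "bounded_linear L" "smooth f" shows "smooth (%p. f (L p))"
 using smooth_compose_affine[OF assms, where t=0] by (simp only: add_0_right)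

lemma smooth_compose_fst:
 fixes h :: "'a::euclidean_space => real"
 assumes "smooth h" shows "smooth (%p::'a \<times> 'b::euclidean_space. h (fst p))"
 by (rule smooth_compose_linear[OF bounded_linear_fst assms])

lemma smooth_compose_snd:
 fixes h :: "'a::euclidean_space => real"
 assumes "smooth h" shows "smooth (%p::'b::euclidean_space \<times> 'a. h (snd p))"
 by (rule smooth_compose_linear[OF bounded_linear_snd assms])

lemma test_functionI:
 assumes "smooth \<phi>" "compact K" "K \<subseteq> \<Omega>" "!!x. x \<notin> K ==> \<phi> x = 0"
 shows "test_function \<Omega> \<phi>"
proof -
 have "closure {x. \<phi> x \<noteq> 0} \<subseteq> K"
  using assms by (intro closure_minimal) (auto intro: compact_imp_closed)
 moreover from this have "K \<inter> closure {x. \<phi> x \<noteq> 0} = closure {x. \<phi> x \<noteq> 0}" by blast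
 hence "compact (closure {x. \<phi> x \<noteq> 0})"
  using compact_Int_closed[OF assms(2) closed_closure, of "{x. \<phi> x \<noteq> 0}"] by simp
 ultimately show ?thesis unfolding test_function_def using assms(1,3) by blast
qed

lemma test_function_bounds:
 assumes "test_function \<Omega> \<phi>"
 shows "\<exists>K M. smooth \<phi> \<and> compact K \<and> K \<subseteq> \<Omega> \<and> M > 0 \<and>
  (\<forall>x. x \<notin> K --> \<phi> x = 0 \<and> (\<forall>b. frechet_derivative \<phi> (at x) b = 0)) \<and>
  (\<forall>x. \<bar>\<phi> x\<bar> \<le> M \<and> (\<forall>b\<in>Basis. \<bar>frechet_derivative \<phi> (at x) b\<bar> \<le> M))"
proof -
 define K where "K = closure {x. \<phi> x \<noteq> 0}"
 have K: "compact K" "K \<subseteq> \<Omega>" "smooth \<phi>" using assms by (auto simp: test_function_def K_def)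
 have z: "\<phi> x = 0" if "x \<notin> K" for x using that closure_subset[of "{x. \<phi> x \<noteq> 0}"] unfolding K_def by blast
 have dz: "frechet_derivative \<phi> (at x) b = 0" if "x \<notin> K" for x b
 proof -
  have "(\<phi> has_derivative (%_. 0)) (at x)"
   by (rule has_derivative_transform_within_open[of "%_. 0" _ _ _ "- K"])
    (use that z compact_imp_closed[OF K(1)] in \<open>simp_all add: open_Compl\<close>)
  thus ?thesis using frechet_derivative_at[of \<phi> "%_. 0" x] by (simp add: fun_eq_iff)
 qed
 have bd: "\<exists>M>0. \<forall>x. \<bar>f x\<bar> \<le> M" if "smooth f" "!!x. x \<notin> K ==> f x = 0" for f :: "'a => real"
 proof -
  have "bounded (f ` K)" using K that by (intro compact_imp_bounded compact_continuous_image smooth_continuous)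
  then obtain M where M: "M > 0" "\<forall>x\<in>K. \<bar>f x\<bar> \<le> M" unfolding bounded_pos by auto
  have "\<bar>f x\<bar> \<le> M" for x using M that(2)[of x] by (cases "x \<in> K") auto
  thus ?thesis using M(1) by blast
 qed
 obtain M0 where M0: "M0 > 0" "\<forall>x. \<bar>\<phi> x\<bar> \<le> M0" using bd[OF K(3) z] by auto
 have "\<exists>M. M > 0 \<and> (\<forall>x. \<bar>frechet_derivative \<phi> (at x) b\<bar> \<le> M)" if "b \<in> Basis" for b
  using bd[OF smooth_partial[OF K(3) that] dz] by blast
 hence "\<forall>b\<in>Basis. \<exists>M. M > 0 \<and> (\<forall>x. \<bar>frechet_derivative \<phi> (at x) b\<bar> \<le> M)" by blast
 from bchoice[OF this] obtain Mb where Mb': "\<forall>b\<in>Basis. Mb b > 0 \<and> (\<forall>x. \<bar>frechet_derivative \<phi> (at x) b\<bar> \<le> Mb b)" ..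
 hence Mb: "!!b. b \<in> Basis ==> Mb b > 0"
   "!!b x. b \<in> Basis ==> \<bar>frechet_derivative \<phi> (at x) b\<bar> \<le> Mb b"
  by auto
 define S where "S = sum Mb Basis"
 have S: "Mb b \<le> S" if "b \<in> Basis" for b
  unfolding S_def using that Mb(1) by (intro member_le_sum) (auto intro: less_imp_le)
 have S0: "S \<ge> 0" unfolding S_def using Mb(1) by (intro sum_nonneg) (auto intro: less_imp_le)
 have 1: "\<bar>frechet_derivative \<phi> (at x) b\<bar> \<le> M0 + S" if "b \<in> Basis" for x b
  using Mb(2)[OF that, of x] S[OF that] M0(1) by linarith
 have 2: "\<bar>\<phi> x\<bar> \<le> M0 + S" for x using M0(2)[rule_format, of x] S0 by linarith
 have 3: "M0 + S > 0" using M0 S0 by simp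
 show ?thesis
  by (rule exI[of _ K], rule exI[of _ "M0 + S"]) (intro conjI allI impI ballI K z dz 1 2 3; assumption)
qed

lemma test_function_mono: "test_function \<Omega> \<phi> ==> \<Omega> \<subseteq> \<Omega>' ==> test_function \<Omega>' \<phi>"
 unfolding test_function_def by (elim conjE, intro conjI) (assumption, assumption, erule order_trans)

lemma test_function_tensor:
 fixes h :: "'a::euclidean_space => real" and \<kappa> :: "real => real"
 assumes "test_function B h" "smooth \<kappa>" "!!y. y \<notin> {\<alpha>..\<beta>} ==> \<kappa> y = 0" "{\<alpha>..\<beta>} \<subseteq> Y"
 shows "test_function (B \<times> Y) (%p. h (fst p) * \<kappa> (snd p))"
proof -
 from test_function_bounds[OF assms(1)]
 obtain K where K': "smooth h \<and> compact K \<and> K \<subseteq> B \<and> (\<forall>x. x \<notin> K --> h x = 0)"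
  by blast
 hence K: "smooth h" "compact K" "K \<subseteq> B" and K4: "\<forall>x. x \<notin> K --> h x = 0" by simp_all
 show ?thesis
 proof (rule test_functionI[of _ "K \<times> {\<alpha>..\<beta>}"])
  show "smooth (%p. h (fst p) * \<kappa> (snd p))"
   by (rule smooth_mult[OF smooth_compose_fst[OF K(1)] smooth_compose_snd[OF assms(2)]])
  show "compact (K \<times> {\<alpha>..\<beta>})" by (rule compact_Times[OF K(2) compact_Icc])
  show "K \<times> {\<alpha>..\<beta>} \<subseteq> B \<times> Y" by (rule Sigma_mono[OF K(3) assms(4)])
  fix x assume "x \<notin> K \<times> {\<alpha>..\<beta>}"
  hence "fst x \<notin> K \<or> snd x \<notin> {\<alpha>..\<beta>}" by (cases x) auto
  thus "h (fst x) * \<kappa> (snd x) = 0"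
  proof
   assume "fst x \<notin> K" thus ?thesis using K4 by simp
  next
   assume "snd x \<notin> {\<alpha>..\<beta>}" thus ?thesis using assms(3) by simp
  qed
 qed
qed

lemma frechet_derivative_tensor:
 fixes h :: "'a::euclidean_space => real" and \<kappa> :: "real => real"
 assumes "smooth h" "(\<kappa> has_real_derivative \<kappa>') (at (snd p))"
 shows "frechet_derivative (%p. h (fst p) * \<kappa> (snd p)) (at p) v =
  frechet_derivative h (at (fst p)) (fst v) * \<kappa> (snd p) + h (fst p) * (\<kappa>' * snd v)"
proof -
 have 1: "((%p. h (fst p)) has_derivative (%v. frechet_derivative h (at (fst p)) (fst v))) (at p)"
  by (rule has_derivative_compose[OF _ smooth_has_derivative[OF assms(1)]])
   (auto intro!: derivative_eq_intros)
 have 2: "((%p. \<kappa> (snd p)) has_derivative (%v. \<kappa>' * snd v)) (at p)"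
  by (rule has_derivative_compose[where f=snd and g=\<kappa>, OF _ assms(2)[unfolded has_field_derivative_def]])
   (auto intro!: derivative_eq_intros)
 show ?thesis
  using frechet_derivative_at[OF has_derivative_mult[OF 1 2], symmetric] by (simp add: algebra_simps)
qed

text \<open>A smooth substitute for the indicator of a box, to which it converges as
  \<open>e\<close> tends to 0; the product form keeps each factor one-dimensional.\<close>

definition box_bump :: "real => 'a::euclidean_space => 'a => 'a => real" where
 "box_bump e l r p = (\<Prod>b\<in>Basis. bump e (l \<bullet> b) (r \<bullet> b) (p \<bullet> b))"

lemma smooth_box_bump: "e > 0 ==> smooth (box_bump e l r)"
 unfolding box_bump_def
proof (intro smooth_prod)
 fix b assume "e > 0"
 thus "smooth (%x. bump e (l \<bullet> b) (r \<bullet> b) (x \<bullet> b))"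
  by (intro smooth_compose_linear[OF bounded_linear_inner_left] smooth_bump)
qed

lemma box_bump_bounds:
 assumes "e > 0" shows "0 \<le> box_bump e l r p" "box_bump e l r p \<le> 1"
 unfolding box_bump_def using bump_bounds[OF assms] by (auto intro: prod_nonneg prod_le_1)

lemma box_bump_eq_0: "p \<notin> box l r ==> box_bump e l r p = 0"
 by (auto simp: box_bump_def bump_def mem_box)

lemma test_function_box_bump: "e > 0 ==> cbox l r \<subseteq> \<Omega> ==> test_function \<Omega> (box_bump e l r)"
 using box_subset_cbox[of l r]
 by (intro test_functionI[OF smooth_box_bump compact_cbox, of e l r \<Omega> l r] box_bump_eq_0) auto

lemma bump_tendsto: "(%k. bump (1 / real (Suc k)) \<alpha> \<beta> y) \<longlonglongrightarrow> (if \<alpha> < y \<and> y < \<beta> then 1 else 0)"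
proof (cases "\<alpha> < y \<and> y < \<beta>")
 case True
 have "(%k. exp (- (1 / real (Suc k)) / (y - \<alpha>) - (1 / real (Suc k)) / (\<beta> - y))) \<longlonglongrightarrow> exp (- 0 / (y - \<alpha>) - 0 / (\<beta> - y))"
  using True by (intro tendsto_intros lim_1_over_n[THEN LIMSEQ_Suc]) auto
 thus ?thesis using True by (simp add: bump_def)
qed (auto simp: bump_def)

lemma box_bump_tendsto: "(%k. box_bump (1 / real (Suc k)) l r p) \<longlonglongrightarrow> indicator (box l r) p"
proof -
 have "(%k. box_bump (1 / real (Suc k)) l r p) \<longlonglongrightarrow>
   (\<Prod>b\<in>Basis. if l \<bullet> b < p \<bullet> b \<and> p \<bullet> b < r \<bullet> b then 1 else 0)"
  unfolding box_bump_def by (intro tendsto_prod bump_tendsto)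
 also have "(\<Prod>b\<in>Basis. if l \<bullet> b < p \<bullet> b \<and> p \<bullet> b < r \<bullet> b then 1 else (0::real)) = indicator (box l r) p"
  by (auto simp: indicator_def mem_box)
 finally show ?thesis .
qed

section \<open>The du Bois-Reymond lemma\<close>

text \<open>Lebesgue differentiation along cubes with lowest corner \<open>x\<close>: the averages
  are 0 and converge to \<open>f x\<close> outside a negligible set. The boundary of the box joins
  the exceptional set, so that small cubes stay inside.\<close>

lemma AE_zero_if_cbox_integrals_zero:
 fixes f :: "'a::euclidean_space => real"
 assumes f: "f absolutely_integrable_on cbox l r"
  and z: "!!l' r'. cbox l' r' \<subseteq> cbox l r ==> integral (cbox l' r') f = 0"
 shows "AE p in lebesgue. p \<in> cbox l r --> f p = 0"
proof -
 define F where "F p = (if p \<in> cbox l r then f p else 0)" for p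
 have FU: "F integrable_on UNIV"
  using f unfolding F_def absolutely_integrable_on_def integrable_restrict_UNIV by blast
 hence "F integrable_on cbox a b" for a b using integrable_on_subcbox by blast
 then obtain N where N: "negligible N"
   "!!x e. \<lbrakk>x \<notin> N; 0 < e\<rbrakk> \<Longrightarrow> \<exists>d>0. \<forall>h. 0 < h \<and> h < d -->
     norm(integral (cbox x (x + h *\<^sub>R One)) F /\<^sub>R h ^ DIM('a) - F x) < e"
  using integrable_ccontinuous_explicit by blast
 have "negligible (N \<union> (cbox l r - box l r))"
  using N(1) negligible_frontier_interval by (intro negligible_Un)
 moreover have "f x = 0" if x: "x \<in> cbox l r" "x \<notin> N \<union> (cbox l r - box l r)" for x
 proof -
  have xb: "x \<in> box l r" "x \<notin> N" using x by auto
  obtain a b where ab: "cbox a b \<subseteq> box l r" "x \<in> box a b" using open_contains_cbox[OF open_box xb(1)] by metis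
  \<comment> \<open>The cubes only extend from \<open>x\<close> in the positive directions, so only
    the distances to the upper faces of the box around \<open>x\<close> matter.\<close>
  define m where "m = Min ((%i. b \<bullet> i - x \<bullet> i) ` Basis)"
  have m: "m > 0" using ab by (auto simp: m_def mem_box)
  have sub: "cbox x (x + h *\<^sub>R One) \<subseteq> cbox l r" if "0 < h" "h < m" for h
  proof -
   have h1: "h \<le> b \<bullet> i - x \<bullet> i" if "i \<in> Basis" for i
    using \<open>h < m\<close> Min_le[of "(%i. b \<bullet> i - x \<bullet> i) ` Basis" "b \<bullet> i - x \<bullet> i"] that by (auto simp: m_def)
   have "cbox x (x + h *\<^sub>R One) \<subseteq> cbox a b"
   proof
    fix z assume z: "z \<in> cbox x (x + h *\<^sub>R One)"
    have "a \<bullet> i \<le> z \<bullet> i \<and> z \<bullet> i \<le> b \<bullet> i" if "i \<in> Basis" for i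
    proof -
     have "x \<bullet> i \<le> z \<bullet> i" "z \<bullet> i \<le> x \<bullet> i + h" "a \<bullet> i < x \<bullet> i"
      using z ab(2) that by (auto simp: mem_box inner_add_left)
     thus ?thesis using h1[OF that] by linarith
    qed
    thus "z \<in> cbox a b" by (simp add: mem_box)
   qed
   thus ?thesis using ab(1) box_subset_cbox by blast
  qed
  have "\<bar>F x\<bar> < e" if "e > 0" for e
  proof -
   obtain d where d: "d > 0" "!!h. 0 < h ==> h < d ==> norm(integral (cbox x (x + h *\<^sub>R One)) F /\<^sub>R h ^ DIM('a) - F x) < e"
    using N(2)[OF xb(2) \<open>e > 0\<close>] by auto
   define h where "h = min d m / 2"
   have h: "0 < h" "h < d" "h < m" using d m by (auto simp: h_def)
   have "integral (cbox x (x + h *\<^sub>R One)) F = integral (cbox x (x + h *\<^sub>R One)) f"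
    by (rule integral_cong) (use sub[of h] h in \<open>auto simp: F_def\<close>)
   also have "... = 0" using z sub h by auto
   finally show ?thesis using d(2)[of h] h by simp
  qed
  hence "F x = 0" by (metis less_irrefl zero_less_abs_iff)
  thus ?thesis using x by (simp add: F_def)
 qed
 ultimately show ?thesis
  by (intro AE_I'[of "N \<union> (cbox l r - box l r)"]) (auto simp: negligible_iff_null_sets)
qed

text \<open>The smooth box bumps are bounded by 1 and tend to the indicator of an open box, so all
  integrals of \<open>f\<close> over boxes in \<open>\<Omega>\<close> vanish; countably many closed
  boxes cover \<open>\<Omega>\<close>.\<close>

lemma fundamental_lemma:
 fixes f :: "'a::euclidean_space => real"
 assumes \<Omega>: "open \<Omega>" and f: "locally_integrable \<Omega> f"
  and z: "!!\<phi>. test_function \<Omega> \<phi> ==> (LINT p:\<Omega>|lebesgue. f p * \<phi> p) = 0"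
 shows "AE p in lebesgue. p \<in> \<Omega> --> f p = 0"
proof -
 have box: "AE p in lebesgue. p \<in> cbox l r --> f p = 0" if lr: "cbox l r \<subseteq> \<Omega>" for l r
 proof (rule AE_zero_if_cbox_integrals_zero)
  show "f absolutely_integrable_on cbox l r" using f lr by (auto simp: locally_integrable_def)
  fix l' r' assume sub: "cbox l' r' \<subseteq> cbox l r"
  have ai: "f absolutely_integrable_on cbox l' r'" using f lr sub by (auto simp: locally_integrable_def)
  define g where "g p = indicator (cbox l' r') p * f p" for p
  have g: "integrable lebesgue g" using ai by (simp add: set_integrable_def g_def[abs_def])
  have bm: "box_bump e l' r' \<in> borel_measurable lebesgue" if "e > 0" for e
   by (intro measurable_completion)
    (simp add: borel_measurable_continuous_onI[OF smooth_continuous[OF smooth_box_bump[OF that]]])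
  have "(%k. LINT p|lebesgue. g p * box_bump (1 / real (Suc k)) l' r' p) \<longlonglongrightarrow> (LINT p|lebesgue. g p * indicator (box l' r') p)"
  proof (rule integral_dominated_convergence[where w="%p. \<bar>g p\<bar>"])
   show "AE p in lebesgue. (%k. g p * box_bump (1 / real (Suc k)) l' r' p) \<longlonglongrightarrow> g p * indicator (box l' r') p"
    by (intro AE_I2 tendsto_intros box_bump_tendsto)
   show "AE p in lebesgue. norm (g p * box_bump (1 / real (Suc k)) l' r' p) \<le> \<bar>g p\<bar>" for k
    using box_bump_bounds[of "1 / real (Suc k)" l' r'] by (intro AE_I2) (auto simp: abs_mult intro!: mult_left_le)
   show "integrable lebesgue (%p. \<bar>g p\<bar>)" using g by auto
   show "(%p. g p * indicator (box l' r') p) \<in> borel_measurable lebesgue"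
    by (intro borel_measurable_times borel_measurable_integrable[OF g] borel_measurable_indicator) auto
   show "(%p. g p * box_bump (1 / real (Suc k)) l' r' p) \<in> borel_measurable lebesgue" for k
    by (intro borel_measurable_times borel_measurable_integrable[OF g] bm) auto
  qed
  moreover have "(LINT p|lebesgue. g p * box_bump (1 / real (Suc k)) l' r' p) = 0" for k
  proof -
   have "(LINT p|lebesgue. g p * box_bump (1 / real (Suc k)) l' r' p) = (LINT p:\<Omega>|lebesgue. f p * box_bump (1 / real (Suc k)) l' r' p)"
    unfolding set_lebesgue_integral_def
   proof (rule Bochner_Integration.integral_cong[OF refl])
    fix p show "g p * box_bump (1 / real (Suc k)) l' r' p = indicat_real \<Omega> p *\<^sub>R (f p * box_bump (1 / real (Suc k)) l' r' p)"
    proof (cases "p \<in> box l' r'")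
     case True
     hence "p \<in> cbox l' r'" "p \<in> \<Omega>" using box_subset_cbox[of l' r'] sub lr by blast+
     thus ?thesis by (simp add: g_def)
    qed (simp add: box_bump_eq_0)
   qed
   also have "... = 0" using sub lr by (intro z test_function_box_bump) auto
   finally show ?thesis .
  qed
  ultimately have "(LINT p|lebesgue. g p * indicator (box l' r') p) = 0"
   by (simp add: LIMSEQ_const_iff)
  also have "(LINT p|lebesgue. g p * indicator (box l' r') p) = (LINT p:box l' r'|lebesgue. f p)"
   unfolding set_lebesgue_integral_def
   using box_subset_cbox[of l' r'] by (intro Bochner_Integration.integral_cong) (auto simp: g_def indicator_def)
  also have "... = integral (box l' r') f"
   using ai by (intro set_lebesgue_integral_eq_integral set_integrable_subset[OF ai]) (auto simp: box_subset_cbox)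
  finally show "integral (cbox l' r') f = 0" by (simp add: integral_open_interval)
 qed
 have "\<exists>D. countable D \<and> D \<subseteq> Pow \<Omega> \<and> (\<forall>X\<in>D. \<exists>a b. X = cbox a b) \<and> \<Union>D = \<Omega>"
 proof (rule open_countable_Union_open_cbox[OF \<Omega>])
  fix D assume "countable D" "D \<subseteq> Pow \<Omega>" "!!X. X \<in> D ==> \<exists>a b. X = cbox a b" "\<Union>D = \<Omega>"
  thus ?thesis by (intro exI[of _ D] conjI ballI)
 qed
 then obtain D where D: "countable D" "D \<subseteq> Pow \<Omega>" "\<forall>X\<in>D. \<exists>a b. X = cbox a b" "\<Union>D = \<Omega>"
  by (elim exE conjE)
 have "AE p in lebesgue. \<forall>X\<in>D. p \<in> X --> f p = 0"
 proof (subst AE_ball_countable[OF D(1)], intro ballI)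
  fix X assume "X \<in> D"
  from bspec[OF D(3) this] obtain a b where ab: "X = cbox a b" by (elim exE)
  have "cbox a b \<subseteq> \<Omega>" using D(2) \<open>X \<in> D\<close> ab by auto
  thus "AE p in lebesgue. p \<in> X --> f p = 0" unfolding ab by (rule box)
 qed
 thus ?thesis
 proof (rule eventually_mono)
  fix p assume p: "\<forall>X\<in>D. p \<in> X --> f p = 0"
  show "p \<in> \<Omega> --> f p = 0" unfolding D(4)[symmetric] using p by auto
 qed
qed

section \<open>Weak gradients\<close>

lemma borel_measurable_lebesgue_continuous:
 fixes f :: "'a::euclidean_space => 'b::topological_space"
 shows "continuous_on UNIV f ==> f \<in> borel_measurable lebesgue"
 by (intro measurable_completion) (simp add: borel_measurable_continuous_onI)

text \<open>On a finite union of closed boxes \<open>f\<close> is integrable, hence measurable;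
  \<open>\<Omega>\<close> is an increasing union of such sets, along which the truncations of
  \<open>f\<close> converge pointwise.\<close>

lemma locally_integrable_measurable:
 fixes f :: "'a::euclidean_space => 'b::euclidean_space"
 assumes \<Omega>: "open \<Omega>" and f: "locally_integrable \<Omega> f"
 shows "(%p. indicator \<Omega> p *\<^sub>R f p) \<in> borel_measurable lebesgue"
proof -
 have "\<exists>D. countable D \<and> D \<subseteq> Pow \<Omega> \<and> (\<forall>X\<in>D. \<exists>a b. X = cbox a b) \<and> \<Union>D = \<Omega>"
 proof (rule open_countable_Union_open_cbox[OF \<Omega>])
  fix D assume "countable D" "D \<subseteq> Pow \<Omega>" "!!X. X \<in> D ==> \<exists>a b. X = cbox a b" "\<Union>D = \<Omega>"
  thus ?thesis by (intro exI[of _ D] conjI ballI)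
 qed
 then obtain D where D: "countable D" "D \<subseteq> Pow \<Omega>" "\<forall>X\<in>D. \<exists>a b. X = cbox a b" "\<Union>D = \<Omega>"
  by (elim exE conjE)
 show ?thesis
 proof (cases "D = {}")
  case True thus ?thesis using D by simp
 next
  case False
  define A where "A = from_nat_into D"
  have rA: "range A = D" unfolding A_def using False D(1) by (rule range_from_nat_into)
  define K where "K n = (\<Union>i\<le>n. A i)" for n
  have AD: "A i \<in> D" for i using rA by blast
  have "compact (A i)" for i using bspec[OF D(3) AD[of i]] by auto
  hence "compact (K n)" for n unfolding K_def by (intro compact_UN) auto
  moreover have K\<Omega>: "K n \<subseteq> \<Omega>" for n using AD D(2) unfolding K_def by auto
  ultimately have "f absolutely_integrable_on (K n)" for n
   using f by (simp add: locally_integrable_def)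
  hence m: "(%p. indicator (K n) p *\<^sub>R f p) \<in> borel_measurable lebesgue" for n
   unfolding set_integrable_def by (rule borel_measurable_integrable)
  show ?thesis
  proof (rule borel_measurable_LIMSEQ_metric[OF m])
   fix p
   show "(%n. indicator (K n) p *\<^sub>R f p) \<longlonglongrightarrow> indicator \<Omega> p *\<^sub>R f p"
   proof (cases "p \<in> \<Omega>")
    case True
    then obtain i where i: "p \<in> A i" using D(4) rA by blast
    have "p \<in> K n" if "n \<ge> i" for n using i that by (auto simp: K_def)
    hence "eventually (%n. indicator (K n) p *\<^sub>R f p = indicator \<Omega> p *\<^sub>R f p) sequentially"
     using True by (intro eventually_sequentiallyI[of i]) simp
    thus ?thesis by (rule tendsto_eventually)
   next
    case False
    hence "p \<notin> K n" for n using K\<Omega> by blast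
    thus ?thesis using False by simp
   qed
  qed
 qed
qed

lemma integrable_times_compact_support:
 fixes f \<phi> :: "'a::euclidean_space => real"
 assumes f: "f absolutely_integrable_on K" and K: "K \<subseteq> \<Omega>" and m: "\<phi> \<in> borel_measurable lebesgue"
  and z: "\<forall>x. x \<notin> K --> \<phi> x = 0" and b: "\<forall>x. \<bar>\<phi> x\<bar> \<le> M"
 shows "set_integrable lebesgue \<Omega> (%p. f p * \<phi> p)"
proof -
 have g: "integrable lebesgue (%p. indicator K p *\<^sub>R f p)" using f unfolding set_integrable_def .
 have "integrable lebesgue (%p. (indicator K p *\<^sub>R f p) * \<phi> p)"
 proof (rule Bochner_Integration.integrable_bound[OF integrable_mult_right[OF integrable_norm[OF g], of M]])
  show "(%p. (indicator K p *\<^sub>R f p) * \<phi> p) \<in> borel_measurable lebesgue"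
   by (intro borel_measurable_times borel_measurable_integrable[OF g] m)
  show "AE x in lebesgue. norm (indicat_real K x *\<^sub>R f x * \<phi> x) \<le> norm (M * norm (indicat_real K x *\<^sub>R f x))"
  proof (rule AE_I2)
   fix x show "norm (indicat_real K x *\<^sub>R f x * \<phi> x) \<le> norm (M * norm (indicat_real K x *\<^sub>R f x))"
    using b[rule_format, of x] by (auto simp: abs_mult mult.commute[of M] indicator_def intro!: mult_left_mono)
  qed
 qed
 also have "(%p. (indicator K p *\<^sub>R f p) * \<phi> p) = (%p. indicat_real \<Omega> p *\<^sub>R (f p * \<phi> p))"
  using z K by (force simp: indicator_def)
 finally show ?thesis unfolding set_integrable_def .
qed

lemma set_integral_restrict_support:
 fixes F :: "'a => real"
 assumes "!!p. p \<in> \<Omega> ==> p \<notin> \<Omega>' ==> F p = 0" "\<Omega>' \<subseteq> \<Omega>"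
 shows "(LINT p:\<Omega>|M. F p) = (LINT p:\<Omega>'|M. F p)"
 unfolding set_lebesgue_integral_def using assms
 by (intro Bochner_Integration.integral_cong) (auto simp: indicator_def)

lemma weak_gradient_integrable:
 assumes "has_weak_gradient \<Omega> w g" "test_function \<Omega> \<phi>" "b \<in> Basis"
 shows "set_integrable lebesgue \<Omega> (%p. w p * frechet_derivative \<phi> (at p) b)"
  "set_integrable lebesgue \<Omega> (%p. (g p \<bullet> b) * \<phi> p)"
proof -
 from test_function_bounds[OF assms(2)] obtain K M where K: "smooth \<phi>" "compact K" "K \<subseteq> \<Omega>"
  "\<forall>x. x \<notin> K --> \<phi> x = 0 \<and> (\<forall>b. frechet_derivative \<phi> (at x) b = 0)"
  "\<forall>x. \<bar>\<phi> x\<bar> \<le> M \<and> (\<forall>b\<in>Basis. \<bar>frechet_derivative \<phi> (at x) b\<bar> \<le> M)"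
  by (elim exE conjE)
 have w: "w absolutely_integrable_on K" and g: "g absolutely_integrable_on K"
  using assms(1) K(2,3) unfolding has_weak_gradient_def locally_integrable_def by auto
 show "set_integrable lebesgue \<Omega> (%p. w p * frechet_derivative \<phi> (at p) b)"
  by (rule integrable_times_compact_support[OF w K(3), of _ M])
   (use K assms(3) in \<open>auto intro!: borel_measurable_lebesgue_continuous smooth_continuous smooth_partial\<close>)
 show "set_integrable lebesgue \<Omega> (%p. (g p \<bullet> b) * \<phi> p)"
  by (rule integrable_times_compact_support[OF absolutely_integrable_component[OF g] K(3), of _ M])
   (use K in \<open>auto intro!: borel_measurable_lebesgue_continuous smooth_continuous\<close>)
qed

lemma has_weak_gradient_ibp:
 "has_weak_gradient \<Omega> w g ==> test_function \<Omega> \<phi> ==> b \<in> Basis ==>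
  (LINT p:\<Omega>|lebesgue. w p * frechet_derivative \<phi> (at p) b) = - (LINT p:\<Omega>|lebesgue. (g p \<bullet> b) * \<phi> p)"
 unfolding has_weak_gradient_def by blast

lemma locally_integrable_diff:
 "locally_integrable \<Omega> f ==> locally_integrable \<Omega> g ==> locally_integrable \<Omega> (%p. f p - g p)"
 unfolding locally_integrable_def by (auto intro: set_integral_diff(1))

lemma has_weak_gradient_diff:
 assumes "has_weak_gradient \<Omega> w1 g1" "has_weak_gradient \<Omega> w2 g2"
 shows "has_weak_gradient \<Omega> (%p. w1 p - w2 p) (%p. g1 p - g2 p)"
 unfolding has_weak_gradient_def
proof (intro conjI allI impI ballI)
 show "locally_integrable \<Omega> (%p. w1 p - w2 p)" "locally_integrable \<Omega> (%p. g1 p - g2 p)"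
  using assms unfolding has_weak_gradient_def by (auto intro: locally_integrable_diff)
 fix \<phi> and b :: 'a assume t: "test_function \<Omega> \<phi>" and b: "b \<in> Basis"
 note i = weak_gradient_integrable[OF assms(1) t b] weak_gradient_integrable[OF assms(2) t b]
 note e = has_weak_gradient_ibp[OF assms(1) t b] has_weak_gradient_ibp[OF assms(2) t b]
 show "(LINT p:\<Omega>|lebesgue. (w1 p - w2 p) * frechet_derivative \<phi> (at p) b) = - (LINT p:\<Omega>|lebesgue. ((g1 p - g2 p) \<bullet> b) * \<phi> p)"
  using set_integral_diff(2)[OF i(1) i(3)] set_integral_diff(2)[OF i(2) i(4)] e
  by (simp add: left_diff_distrib inner_diff_left)
qed

text \<open>Each component of the difference of two gradients integrates to 0 against all test
  functions, because it is a gradient component of \<open>w - w\<close>.\<close>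

lemma has_weak_gradient_unique:
 assumes \<Omega>: "open \<Omega>" and g: "has_weak_gradient \<Omega> w g1" "has_weak_gradient \<Omega> w g2"
 shows "AE p in lebesgue. p \<in> \<Omega> --> g1 p = g2 p"
proof -
 have "AE p in lebesgue. p \<in> \<Omega> --> (g1 p - g2 p) \<bullet> b = 0" if b: "b \<in> Basis" for b
 proof (rule fundamental_lemma[OF \<Omega>])
  have "locally_integrable \<Omega> (%p. g1 p - g2 p)"
   using g unfolding has_weak_gradient_def by (auto intro: locally_integrable_diff)
  thus "locally_integrable \<Omega> (%p. (g1 p - g2 p) \<bullet> b)"
   unfolding locally_integrable_def by (auto intro: absolutely_integrable_component)
  fix \<phi> assume t: "test_function \<Omega> \<phi>"
  show "(LINT p:\<Omega>|lebesgue. (g1 p - g2 p) \<bullet> b * \<phi> p) = 0"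
   using has_weak_gradient_ibp[OF has_weak_gradient_diff[OF g] t b] by simp
 qed
 hence "AE p in lebesgue. \<forall>b\<in>Basis. p \<in> \<Omega> --> (g1 p - g2 p) \<bullet> b = 0"
  by (intro AE_finite_allI) auto
 thus ?thesis
 proof (rule eventually_mono, intro impI)
  fix p assume p: "\<forall>b\<in>Basis. p \<in> \<Omega> --> (g1 p - g2 p) \<bullet> b = 0" "p \<in> \<Omega>"
  show "g1 p = g2 p" by (rule euclidean_eqI) (use p in \<open>auto simp: inner_diff_left\<close>)
 qed
qed

lemma has_weak_gradient_mono:
 assumes g: "has_weak_gradient \<Omega> w g" and sub: "\<Omega>' \<subseteq> \<Omega>"
 shows "has_weak_gradient \<Omega>' w g"
 unfolding has_weak_gradient_def
proof (intro conjI allI impI ballI)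
 show "locally_integrable \<Omega>' w" "locally_integrable \<Omega>' g"
  using g sub unfolding has_weak_gradient_def locally_integrable_def by auto
 fix \<phi> and b :: 'a assume t: "test_function \<Omega>' \<phi>" and b: "b \<in> Basis"
 from test_function_bounds[OF t] obtain K M where K: "K \<subseteq> \<Omega>'"
  "\<forall>x. x \<notin> K --> \<phi> x = 0 \<and> (\<forall>b. frechet_derivative \<phi> (at x) b = 0)"
  by (elim exE conjE)
 have z: "\<phi> x = 0" "frechet_derivative \<phi> (at x) b = 0" if "x \<notin> \<Omega>'" for x
 proof -
  have "x \<notin> K" using K(1) that by blast
  thus "\<phi> x = 0" "frechet_derivative \<phi> (at x) b = 0" using K(2) by simp_all
 qed
 have "(LINT p:\<Omega>|lebesgue. w p * frechet_derivative \<phi> (at p) b) = (LINT p:\<Omega>'|lebesgue. w p * frechet_derivative \<phi> (at p) b)"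
  "(LINT p:\<Omega>|lebesgue. (g p \<bullet> b) * \<phi> p) = (LINT p:\<Omega>'|lebesgue. (g p \<bullet> b) * \<phi> p)"
  using z sub by (auto intro!: set_integral_restrict_support)
 thus "(LINT p:\<Omega>'|lebesgue. w p * frechet_derivative \<phi> (at p) b) = - (LINT p:\<Omega>'|lebesgue. (g p \<bullet> b) * \<phi> p)"
  using has_weak_gradient_ibp[OF g test_function_mono[OF t sub] b] by simp
qed

text \<open>The arbitrary choice inside \<open>weak_gradient\<close> is removed here: norms and
  energies may be computed with any weak gradient at hand.\<close>

lemma weak_gradient_AE_eq:
 assumes "open \<Omega>" "has_weak_gradient \<Omega> w g"
 shows "AE p in lebesgue. p \<in> \<Omega> --> weak_gradient \<Omega> w p = g p"
proof -
 have "has_weak_gradient \<Omega> w (weak_gradient \<Omega> w)"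
  unfolding weak_gradient_def by (rule someI[of _ g]) (rule assms(2))
 thus ?thesis using has_weak_gradient_unique assms by blast
qed

lemma H1_sqnorm_eq:
 assumes "open \<Omega>" "has_weak_gradient \<Omega> w g"
 shows "H1_sqnorm a \<Omega> w =
  (\<integral>\<^sup>+p\<in>\<Omega>. ennreal (snd p powr a * ((w p)\<^sup>2 + (norm (g p))\<^sup>2)) \<partial>lebesgue)"
 unfolding H1_sqnorm_def
 by (rule nn_integral_cong_AE, rule eventually_mono[OF weak_gradient_AE_eq[OF assms]])
  (auto simp: indicator_def)

lemma open_slab: "open slab"
 unfolding slab_def by (intro open_Times) auto

lemma E_K_eq:
 assumes "has_weak_gradient slab w g"
 shows "E_K a w = 1 / 2 * (\<integral>\<^sup>+p\<in>slab. ennreal (snd p powr a * (norm (g p))\<^sup>2) \<partial>lebesgue)"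
 unfolding E_K_def
 by (rule arg_cong[where f="times (1/2)"], rule nn_integral_cong_AE,
   rule eventually_mono[OF weak_gradient_AE_eq[OF open_slab assms]]) (auto simp: indicator_def)

lemma compact_subset_slab:
 assumes "compact K" "K \<subseteq> slab"
 shows "\<exists>N. K \<subseteq> ball 0 (real (Suc N)) \<times> {0<..<1}"
proof -
 have "bounded (fst ` K)" using assms by (intro compact_imp_bounded compact_continuous_image continuous_intros)
 then obtain r where r: "\<forall>x\<in>fst ` K. norm x \<le> r" unfolding bounded_iff by blast
 obtain N where N: "r < real N" using reals_Archimedean2 by blast
 have "p \<in> ball 0 (real (Suc N)) \<times> {0<..<1}" if "p \<in> K" for p
  using that r N assms(2) by (cases p) (fastforce simp: slab_def)
 thus ?thesis by blast
qed

text \<open>Membership is known cylinder by cylinder, while the energy refers to one gradient on the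
  slab. By uniqueness the local gradients agree almost everywhere, and every compact support lies in
  one cylinder.\<close>

lemma H1_loc_has_weak_gradient_slab:
 fixes w :: "'a::euclidean_space \<times> real => real"
 assumes w: "w \<in> H1_loc a"
 shows "\<exists>g. has_weak_gradient slab w g"
proof -
 define \<Omega> where "\<Omega> N = (ball 0 (real (Suc N)) \<times> {0<..<1} :: ('a \<times> real) set)" for N
 have op: "open (\<Omega> N)" for N unfolding \<Omega>_def by (intro open_Times) auto
 have mono: "\<Omega> N \<subseteq> \<Omega> M" if "N \<le> M" for N M using that unfolding \<Omega>_def by auto
 have \<Omega>slab: "\<Omega> N \<subseteq> slab" for N by (auto simp: \<Omega>_def slab_def)
 have "\<exists>g. has_weak_gradient (\<Omega> N) w g" for N
  using w unfolding H1_loc_def H1_def \<Omega>_def by (auto simp: Ball_def)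
 then obtain g where g: "!!N. has_weak_gradient (\<Omega> N) w (g N)" by metis
 \<comment> \<open>At each point the gradient of the first cylinder containing it is used; outside a
   null set it agrees with all later ones.\<close>
 define n where "n p = (LEAST N. p \<in> \<Omega> N)" for p
 define G where "G p = g (n p) p" for p
 have "AE p in lebesgue. p \<in> \<Omega> N --> g N p = g M p" if "N \<le> M" for N M
  using has_weak_gradient_unique[OF op g has_weak_gradient_mono[OF g mono[OF that]]] .
 hence "AE p in lebesgue. \<forall>N M. N \<le> M --> p \<in> \<Omega> N --> g N p = g M p"
  unfolding AE_all_countable by (auto intro: AE_I2)
 hence AEG: "AE p in lebesgue. p \<in> \<Omega> M --> G p = g M p" for M
 proof (rule eventually_mono, intro impI)
  fix p assume p: "\<forall>N M. N \<le> M --> p \<in> \<Omega> N --> g N p = g M p" "p \<in> \<Omega> M"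
  have "n p \<le> M" "p \<in> \<Omega> (n p)" unfolding n_def using p(2) by (auto intro: Least_le LeastI)
  thus "G p = g M p" unfolding G_def using p by blast
 qed
 from AEG have "\<exists>S. negligible S \<and> (\<forall>p. p \<in> \<Omega> M --> p \<notin> S --> G p = g M p)" for M
  unfolding eventually_ae_filter negligible_iff_null_sets by (fastforce simp: space_completion)
 then obtain S where S: "!!M. negligible (S M)" "!!M p. p \<in> \<Omega> M ==> p \<notin> S M ==> G p = g M p"
  by metis
 have GK: "G absolutely_integrable_on K" if K: "compact K" "K \<subseteq> \<Omega> M" for K M
 proof (rule absolutely_integrable_spike[OF _ S(1)[of M]])
  show "g M absolutely_integrable_on K"
   using g[of M] K unfolding has_weak_gradient_def locally_integrable_def by auto
 qed (use S(2) K in auto)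
 have "has_weak_gradient slab w G"
  unfolding has_weak_gradient_def
 proof (intro conjI allI impI ballI)
  show "locally_integrable slab w" "locally_integrable slab G"
   unfolding locally_integrable_def
  proof (safe)
   fix K :: "('a \<times> real) set" assume K: "compact K" "K \<subseteq> slab"
   then obtain M where M: "K \<subseteq> \<Omega> M" using compact_subset_slab unfolding \<Omega>_def by blast
   show "w absolutely_integrable_on K"
    using g[of M] K M unfolding has_weak_gradient_def locally_integrable_def by auto
   show "G absolutely_integrable_on K" using GK K M by blast
  qed
  fix \<phi> :: "'a \<times> real => real" and b :: "'a \<times> real" assume t: "test_function slab \<phi>" and b: "b \<in> Basis"
  from test_function_bounds[OF t] obtain K B where K: "smooth \<phi>" "compact K" "K \<subseteq> slab"
   "\<forall>x. x \<notin> K --> \<phi> x = 0 \<and> (\<forall>b. frechet_derivative \<phi> (at x) b = 0)"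
   "\<forall>x. \<bar>\<phi> x\<bar> \<le> B \<and> (\<forall>b\<in>Basis. \<bar>frechet_derivative \<phi> (at x) b\<bar> \<le> B)"
   by (elim exE conjE)
  obtain M where M: "K \<subseteq> \<Omega> M" using compact_subset_slab[OF K(2,3)] unfolding \<Omega>_def by blast
  have zK: "\<phi> x = 0" "frechet_derivative \<phi> (at x) b = 0" if "x \<notin> K" for x
   using K(4)[rule_format, OF that] by blast+
  have tM: "test_function (\<Omega> M) \<phi>" by (rule test_functionI[OF K(1,2) M zK(1)])
  have z: "\<phi> x = 0" "frechet_derivative \<phi> (at x) b = 0" if "x \<notin> \<Omega> M" for x
  proof -
   have "x \<notin> K" using M that by blast
   thus "\<phi> x = 0" "frechet_derivative \<phi> (at x) b = 0" using zK by blast+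
  qed
  have "(LINT p:slab|lebesgue. w p * frechet_derivative \<phi> (at p) b) = (LINT p:\<Omega> M|lebesgue. w p * frechet_derivative \<phi> (at p) b)"
   using z \<Omega>slab by (intro set_integral_restrict_support) auto
  also have "... = - (LINT p:\<Omega> M|lebesgue. (g M p \<bullet> b) * \<phi> p)"
   by (rule has_weak_gradient_ibp[OF g tM b])
  also have "(LINT p:\<Omega> M|lebesgue. (g M p \<bullet> b) * \<phi> p) = (LINT p:\<Omega> M|lebesgue. (G p \<bullet> b) * \<phi> p)"
   unfolding set_lebesgue_integral_def
  proof (rule integral_cong_AE)
   show "(%p. indicat_real (\<Omega> M) p *\<^sub>R (g M p \<bullet> b * \<phi> p)) \<in> borel_measurable lebesgue"
    using weak_gradient_integrable(2)[OF g tM b] unfolding set_integrable_def by (rule borel_measurable_integrable)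
   show "(%p. indicat_real (\<Omega> M) p *\<^sub>R (G p \<bullet> b * \<phi> p)) \<in> borel_measurable lebesgue"
   proof (rule borel_measurable_integrable)
    have "set_integrable lebesgue (\<Omega> M) (%p. G p \<bullet> b * \<phi> p)"
     by (rule integrable_times_compact_support[OF absolutely_integrable_component[OF GK[OF K(2) M]] M, of _ B])
      (use K in \<open>auto intro!: borel_measurable_lebesgue_continuous smooth_continuous\<close>)
    thus "integrable lebesgue (%p. indicat_real (\<Omega> M) p *\<^sub>R (G p \<bullet> b * \<phi> p))" unfolding set_integrable_def .
   qed
   show "AE p in lebesgue. indicat_real (\<Omega> M) p *\<^sub>R (g M p \<bullet> b * \<phi> p) = indicat_real (\<Omega> M) p *\<^sub>R (G p \<bullet> b * \<phi> p)"
   proof (rule eventually_mono[OF AEG[of M]])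
    fix p assume "p \<in> \<Omega> M --> G p = g M p"
    thus "indicat_real (\<Omega> M) p *\<^sub>R (g M p \<bullet> b * \<phi> p) = indicat_real (\<Omega> M) p *\<^sub>R (G p \<bullet> b * \<phi> p)"
     by (cases "p \<in> \<Omega> M") simp_all
   qed
  qed
  also have "... = (LINT p:slab|lebesgue. (G p \<bullet> b) * \<phi> p)"
   using z \<Omega>slab by (intro set_integral_restrict_support[symmetric]) auto
  finally show "(LINT p:slab|lebesgue. w p * frechet_derivative \<phi> (at p) b) = - (LINT p:slab|lebesgue. (G p \<bullet> b) * \<phi> p)" .
 qed
 thus ?thesis by blast
qed

section \<open>Classical integration by parts\<close>

text \<open>By translation invariance the difference quotients have integral 0. The mean value
  theorem bounds them by the supremum of the derivative, so dominated convergence passes this on to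
  the derivative.\<close>

lemma integral_partial_derivative_compact_support:
 fixes F :: "'a::euclidean_space => real"
 assumes F: "!!x. (F has_derivative F' x) (at x)" and K: "compact K"
  and z: "!!x. x \<notin> K ==> F x = 0" "!!x. x \<notin> K ==> F' x b = 0"
  and c: "continuous_on UNIV (%x. F' x b)"
 shows "integrable lborel (%x. F' x b)" "(LINT x|lborel. F' x b) = 0"
proof -
 have cF: "continuous_on UNIV F" using F by (meson differentiable_def differentiable_imp_continuous_on differentiable_on_def has_derivative_at_withinI)
 have i: "integrable lborel f" if "continuous_on UNIV f" "!!x. x \<notin> K ==> f x = 0" for f :: "'a => real"
 proof -
  have "integrable lborel (%x. indicator K x *\<^sub>R f x)"
   using that K by (intro borel_integrable_compact) (auto intro: continuous_on_subset)
  also have "(%x. indicator K x *\<^sub>R f x) = f" using that(2) by (force simp: indicator_def)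
  finally show ?thesis .
 qed
 show int: "integrable lborel (%x. F' x b)" using i[OF c z(2)] .
 have iF: "integrable lborel F" using i[OF cF z(1)] .
 have "bounded ((%x. F' x b) ` K)" using K c by (intro compact_imp_bounded compact_continuous_image) (auto intro: continuous_on_subset)
 then obtain M where M: "M > 0" "\<forall>x\<in>K. \<bar>F' x b\<bar> \<le> M" unfolding bounded_pos by auto
 have M': "\<bar>F' x b\<bar> \<le> M" for x using M z(2)[of x] by (cases "x \<in> K") auto
 obtain R where R: "\<forall>x\<in>K. norm x \<le> R" using compact_imp_bounded[OF K] unfolding bounded_iff by blast
 define h where "h k = 1 / real (Suc k)" for k
 have h: "h k > 0" "h k \<le> 1" for k by (auto simp: h_def)
 define G where "G k x = (F (x + h k *\<^sub>R b) - F x) / h k" for k x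
 have dl: "((%t. F (x + t *\<^sub>R b)) has_real_derivative F' (x + t *\<^sub>R b) b) (at t)" for x t
 proof -
  have "((%t. F (x + t *\<^sub>R b)) has_derivative (%s. F' (x + t *\<^sub>R b) (s *\<^sub>R b))) (at t)"
   by (rule has_derivative_compose[OF _ F]) (auto intro!: derivative_eq_intros)
  moreover have "F' (x + t *\<^sub>R b) (s *\<^sub>R b) = F' (x + t *\<^sub>R b) b * s" for s
   using linear_cmul[OF has_derivative_linear[OF F]] by simp
  ultimately show ?thesis by (simp add: has_field_derivative_def)
 qed
 have Gb: "\<bar>G k x\<bar> \<le> M" for k x
 proof -
  obtain t where t: "F (x + h k *\<^sub>R b) - F (x + 0 *\<^sub>R b) = (h k - 0) * F' (x + t *\<^sub>R b) b"
   using MVT2[OF h(1)[of k], of "%t. F (x + t *\<^sub>R b)" "%t. F' (x + t *\<^sub>R b) b"] dl by metis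
  have "G k x = F' (x + t *\<^sub>R b) b" using t h(1)[of k] unfolding G_def by (simp add: field_simps)
  thus ?thesis using M' by simp
 qed
 \<comment> \<open>The steps \<open>h k\<close> are at most 1, so all difference quotients vanish
   outside one ball, which supplies the integrable bound.\<close>
 have G0: "G k x = 0" if "x \<notin> cball 0 (R + norm b)" for k x
 proof -
  have nx: "norm x > R + norm b" using that by simp
  hence "x \<notin> K" using R by (smt (verit) norm_ge_zero)
  moreover have "norm (h k *\<^sub>R b) \<le> norm b" using h[of k] by (simp add: mult_left_le_one_le)
  hence "norm (x + h k *\<^sub>R b) > R" using nx norm_triangle_ineq2[of x "- (h k *\<^sub>R b)"] by simp
  hence "x + h k *\<^sub>R b \<notin> K" using R by force
  ultimately show ?thesis using z(1) by (simp add: G_def)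
 qed
 have transl: "integrable lborel (%x. F (x + c))" "(LINT x|lborel. F (x + c)) = (LINT x|lborel. F x)" for c
 proof -
  have m: "F \<in> borel_measurable borel" using cF by (rule borel_measurable_continuous_onI)
  have d: "distr lborel borel (%x. x + c) = lborel"
   using lborel_distr_plus[of c] by (metis (no_types, lifting) add.commute ext)
  show "integrable lborel (%x. F (x + c))"
   using integrable_distr_eq[of "%x. x + c" lborel borel F] m iF d by simp
  show "(LINT x|lborel. F (x + c)) = (LINT x|lborel. F x)"
   using integral_distr[of "%x. x + c" lborel borel F] m d by simp
 qed
 have "(%k. LINT x|lborel. G k x) \<longlonglongrightarrow> (LINT x|lborel. F' x b)"
 proof (rule integral_dominated_convergence[where w="%x. indicator (cball 0 (R + norm b)) x *\<^sub>R M"])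
  show "(%x. F' x b) \<in> borel_measurable lborel" using c by (simp add: borel_measurable_continuous_onI)
  show "G k \<in> borel_measurable lborel" for k unfolding G_def
   using transl(1) iF by (intro borel_measurable_divide borel_measurable_diff borel_measurable_const) auto
  show "integrable lborel (%x. indicat_real (cball (0::'a) (R + norm b)) x *\<^sub>R M)"
   by (intro borel_integrable_compact) auto
  show "AE x in lborel. norm (G k x) \<le> indicat_real (cball 0 (R + norm b)) x *\<^sub>R M" for k
  proof (rule AE_I2)
   fix x show "norm (G k x) \<le> indicat_real (cball 0 (R + norm b)) x *\<^sub>R M"
    using Gb[of k x] G0[of x k] by (cases "x \<in> cball 0 (R + norm b)") auto
  qed
  show "AE x in lborel. (%k. G k x) \<longlonglongrightarrow> F' x b"
  proof (rule AE_I2)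
   fix x
   have "(%t. (F (x + t *\<^sub>R b) - F x) / t) \<midarrow>0\<rightarrow> F' x b"
    using dl[of x 0] by (simp add: DERIV_def)
   moreover have "filterlim h (at 0) sequentially"
    unfolding filterlim_at h_def using lim_1_over_n[THEN LIMSEQ_Suc] by (auto intro: always_eventually)
   ultimately show "(%k. G k x) \<longlonglongrightarrow> F' x b"
    unfolding G_def by (rule filterlim_compose)
  qed
 qed
 moreover have "(LINT x|lborel. G k x) = 0" for k
  unfolding G_def using transl iF by simp
 ultimately show "(LINT x|lborel. F' x b) = 0" by (simp add: LIMSEQ_const_iff)
qed

text \<open>\<open>w\<close> is differentiable on \<open>\<Omega>\<close> only. The product with
  \<open>\<phi>\<close> is extended by 0 and stays differentiable, because \<open>\<phi>\<close>
  vanishes off a compact subset of \<open>\<Omega>\<close>.\<close>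

lemma classical_ibp:
 fixes w :: "'a::euclidean_space => real"
 assumes \<Omega>: "open \<Omega>" and t: "test_function \<Omega> \<phi>" and b: "b \<in> Basis"
  and w: "!!p. p \<in> \<Omega> ==> (w has_derivative w' p) (at p)"
  and c: "continuous_on \<Omega> (%p. w' p b)"
 shows "(LINT p:\<Omega>|lebesgue. w p * frechet_derivative \<phi> (at p) b) = - (LINT p:\<Omega>|lebesgue. w' p b * \<phi> p)"
proof -
 from test_function_bounds[OF t] obtain K M where K: "smooth \<phi>" "compact K" "K \<subseteq> \<Omega>"
  "\<forall>x. x \<notin> K --> \<phi> x = 0 \<and> (\<forall>b. frechet_derivative \<phi> (at x) b = 0)"
  "\<forall>x. \<bar>\<phi> x\<bar> \<le> M \<and> (\<forall>b\<in>Basis. \<bar>frechet_derivative \<phi> (at x) b\<bar> \<le> M)"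
  by (elim exE conjE)
 have cw: "continuous_on \<Omega> w"
  using w by (meson continuous_at_imp_continuous_on has_derivative_continuous)
 define F where "F p = (if p \<in> \<Omega> then w p * \<phi> p else 0)" for p
 define F' where "F' p v = (if p \<in> \<Omega> then w p * frechet_derivative \<phi> (at p) v + w' p v * \<phi> p else 0)" for p v
 have clK: "closed K" using K(2) by (rule compact_imp_closed)
 have dF: "(F has_derivative F' p) (at p)" for p
 proof (cases "p \<in> \<Omega>")
  case True
  have "((%p. w p * \<phi> p) has_derivative (%v. w p * frechet_derivative \<phi> (at p) v + w' p v * \<phi> p)) (at p)"
   by (rule has_derivative_mult[OF w[OF True] smooth_has_derivative[OF K(1)]])
  hence "(F has_derivative (%v. w p * frechet_derivative \<phi> (at p) v + w' p v * \<phi> p)) (at p)"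
   by (rule has_derivative_transform_within_open[OF _ \<Omega> True]) (simp add: F_def)
  thus ?thesis using True by (simp add: F'_def[abs_def])
 next
  case False
  have "(F has_derivative (%_. 0)) (at p)"
   by (rule has_derivative_transform_within_open[of "%_. 0" _ _ _ "- K"])
    (use False K clK in \<open>auto simp: F_def open_Compl\<close>)
  thus ?thesis using False by (simp add: F'_def[abs_def])
 qed
 have cF: "continuous_on UNIV (%p. F' p b)"
 proof -
  have 1: "continuous_on \<Omega> (%p. F' p b)"
  proof (rule continuous_on_eq)
   show "continuous_on \<Omega> (%p. w p * frechet_derivative \<phi> (at p) b + w' p b * \<phi> p)"
    by (intro continuous_intros cw c smooth_continuous[OF K(1)] smooth_continuous[OF smooth_partial[OF K(1) b]])
  qed (simp add: F'_def)
  have 2: "continuous_on (- K) (%p. F' p b)"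
   by (rule continuous_on_eq[of _ "%_. 0"]) (use K(4) in \<open>auto simp: F'_def\<close>)
  have "continuous_on (\<Omega> \<union> - K) (%p. F' p b)"
   using \<Omega> clK by (intro continuous_on_open_Un 1 2) auto
  moreover have "\<Omega> \<union> - K = UNIV" using K(3) by auto
  ultimately show ?thesis by simp
 qed
 have z: "F p = 0" "F' p b = 0" if "p \<notin> K" for p using K(4) that by (auto simp: F_def F'_def)
 have 0: "(LINT p|lborel. F' p b) = 0"
  by (rule integral_partial_derivative_compact_support[OF dF K(2) z cF])
 have "continuous_on K w" "continuous_on K (%p. w' p b)" using cw c K(3) continuous_on_subset by blast+
 hence "integrable lborel (%p. indicator K p *\<^sub>R w p)" "integrable lborel (%p. indicator K p *\<^sub>R w' p b)"
  using borel_integrable_compact[OF K(2)] by blast+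
 hence ai: "w absolutely_integrable_on K" "(%p. w' p b) absolutely_integrable_on K"
  unfolding set_integrable_def
  by (subst integrable_completion; use borel_measurable_integrable in fastforce)+
 have i1: "set_integrable lebesgue \<Omega> (%p. w p * frechet_derivative \<phi> (at p) b)"
  by (rule integrable_times_compact_support[OF ai(1) K(3), of _ M])
   (use K b in \<open>auto intro!: borel_measurable_lebesgue_continuous smooth_continuous smooth_partial\<close>)
 have i2: "set_integrable lebesgue \<Omega> (%p. w' p b * \<phi> p)"
  by (rule integrable_times_compact_support[OF ai(2) K(3), of _ M])
   (use K in \<open>auto intro!: borel_measurable_lebesgue_continuous smooth_continuous\<close>)
 have "(LINT p:\<Omega>|lebesgue. w p * frechet_derivative \<phi> (at p) b) + (LINT p:\<Omega>|lebesgue. w' p b * \<phi> p)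
   = (LINT p:\<Omega>|lebesgue. w p * frechet_derivative \<phi> (at p) b + w' p b * \<phi> p)"
  using set_integral_add(2)[OF i1 i2] by simp
 also have "... = (LINT p|lebesgue. F' p b)"
  unfolding set_lebesgue_integral_def by (intro Bochner_Integration.integral_cong) (auto simp: F'_def)
 also have "... = (LINT p|lborel. F' p b)"
  using cF by (intro integral_completion) (simp add: borel_measurable_continuous_onI)
 finally show ?thesis using 0 by simp
qed

section \<open>Fourier inversion and Plancherel\<close>

text \<open>Lebesgue measure on a Euclidean space is the image of the product measure indexed by the
  basis, so integrals of tensor products factor.\<close>

lemma lborel_integral_prod_Basis:
 fixes f :: "'a::euclidean_space => real => 'b::{real_normed_field,banach,second_countable_topology}"
 assumes f: "!!b. b \<in> Basis ==> integrable lborel (f b)"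
 shows "integrable lborel (%x. \<Prod>b\<in>Basis. f b (x \<bullet> b))"
  and "(LINT x|lborel. (\<Prod>b\<in>Basis. f b (x \<bullet> b))) = (\<Prod>b\<in>Basis. LINT t|lborel. f b t)"
proof -
 interpret product_sigma_finite "%_::'a. lborel :: real measure" ..
 let ?T = "%g::'a => real. \<Sum>b\<in>Basis. g b *\<^sub>R b"
 have fm[measurable]: "f b \<in> borel_measurable borel" if "b \<in> Basis" for b
  using borel_measurable_integrable[OF f[OF that]] by simp
 have T: "?T \<in> measurable (\<Pi>\<^sub>M b\<in>Basis. lborel) borel"
 proof (intro borel_measurable_sum borel_measurable_scaleR borel_measurable_const)
  fix b :: 'a assume "b \<in> Basis"
  from measurable_component_singleton[OF this, of "%_. lborel"]
  show "(%g. g b) \<in> borel_measurable (\<Pi>\<^sub>M b\<in>Basis. lborel)" by simp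
 qed
 have m: "(%x::'a. \<Prod>b\<in>Basis. f b (x \<bullet> b)) \<in> borel_measurable borel"
  by (intro borel_measurable_prod measurable_compose[OF _ fm]) auto
 have eq: "(\<Prod>b\<in>Basis. f b (?T g \<bullet> b)) = (\<Prod>b\<in>Basis. f b (g b))" for g
  by (intro prod.cong refl) (simp add: inner_sum_left inner_Basis if_distrib[of "times _"] sum.delta cong: if_cong)
 have i: "integrable (\<Pi>\<^sub>M b\<in>Basis. lborel) (%g. \<Prod>b\<in>Basis. f b (g b))"
  by (intro product_integrable_prod f) auto
 have L: "(lborel :: 'a measure) = distr (\<Pi>\<^sub>M b\<in>Basis. lborel) borel ?T" by (rule lborel_eq)
 show "integrable lborel (%x. \<Prod>b\<in>Basis. f b (x \<bullet> b))"
  using i by (subst L, subst integrable_distr_eq[OF T m]) (simp add: eq)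
 show "(LINT x|lborel. (\<Prod>b\<in>Basis. f b (x \<bullet> b))) = (\<Prod>b\<in>Basis. LINT t|lborel. f b t)"
  by (subst L, subst integral_distr[OF T m]) (simp add: eq product_integral_prod f)
qed

text \<open>The characteristic function of the standard normal distribution, rescaled by
  \<open>c = sqrt (2 * eps)\<close>, which turns \<open>x\<^sup>2 / 2\<close> into
  \<open>eps * x\<^sup>2\<close>.\<close>

lemma gauss_FT_real:
 assumes e: "eps > 0"
 shows "integrable lborel (%x. exp (- eps * x\<^sup>2))"
  and "(LINT x|lborel. complex_of_real (exp (- eps * x\<^sup>2)) * exp (\<i> * of_real (x * xi))) =
   of_real (sqrt (pi / eps) * exp (- xi\<^sup>2 / (4 * eps)))"
proof -
 define c where "c = sqrt (2 * eps)"
 have c: "c > 0" "c\<^sup>2 = 2 * eps" using e by (auto simp: c_def)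
 have sd: "std_normal_density (c * x) = (1 / sqrt (2 * pi)) * exp (- eps * x\<^sup>2)" for x
  using c by (simp add: std_normal_density_def power_mult_distrib)
 have "integrable lborel std_normal_density"
  using integrable_normal_density[of 1 0] by simp
 hence "integrable lborel (%x. std_normal_density (0 + c * x))"
  using c by (intro lborel_integrable_real_affine) auto
 hence "integrable lborel (%x. sqrt (2 * pi) * std_normal_density (0 + c * x))"
  by (rule integrable_mult_right)
 thus "integrable lborel (%x. exp (- eps * x\<^sup>2))"
  unfolding sd add_0_left by simp
 define t where "t = xi / c"
 have "complex_of_real (exp (- (t^2) / 2)) = char std_normal_distribution t"
  by (simp add: char_std_normal_distribution)
 also have "... = (LINT x|lborel. std_normal_density x *\<^sub>R exp (\<i> * complex_of_real (t * x)))"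
  unfolding char_def by (subst integral_density) (auto simp: normal_density_nonneg)
 also have "... = \<bar>c\<bar> *\<^sub>R (LINT x|lborel. std_normal_density (0 + c * x) *\<^sub>R exp (\<i> * complex_of_real (t * (0 + c * x))))"
  using c by (intro lborel_integral_real_affine) auto
 also have "... = c *\<^sub>R (LINT x|lborel. (1 / sqrt (2 * pi)) *\<^sub>R (complex_of_real (exp (- eps * x\<^sup>2)) * exp (\<i> * of_real (x * xi))))"
  using c unfolding add_0_left sd by (simp add: t_def scaleR_conv_of_real mult_ac)
 also have "... = (c / sqrt (2 * pi)) *\<^sub>R (LINT x|lborel. complex_of_real (exp (- eps * x\<^sup>2)) * exp (\<i> * of_real (x * xi)))"
  unfolding integral_scaleR_right by simp
 finally have eq: "(LINT x|lborel. complex_of_real (exp (- eps * x\<^sup>2)) * exp (\<i> * of_real (x * xi)))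
  = (sqrt (2 * pi) / c) *\<^sub>R complex_of_real (exp (- (t^2) / 2))"
  using c by (simp add: field_simps)
 have 1: "sqrt (2 * pi) / c = sqrt (pi / eps)"
  unfolding c_def real_sqrt_divide[symmetric] using e by simp
 have 2: "- (t^2) / 2 = - xi\<^sup>2 / (4 * eps)" using c e by (simp add: t_def power_divide)
 show "(LINT x|lborel. complex_of_real (exp (- eps * x\<^sup>2)) * exp (\<i> * of_real (x * xi))) =
   of_real (sqrt (pi / eps) * exp (- xi\<^sup>2 / (4 * eps)))"
  unfolding eq 1 2 by (simp add: scaleR_conv_of_real)
qed

text \<open>The transform of \<open>exp (- eps * (norm x)\<^sup>2)\<close>. Without normalisation
  its total mass is \<open>(2 * pi) ^ DIM('a)\<close> for every \<open>eps\<close>, which is the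
  source of this constant in all later estimates.\<close>

definition gauss_kernel :: "real => 'a::euclidean_space => real" where
 "gauss_kernel eps v = sqrt (pi / eps) ^ DIM('a) * exp (- (norm v)\<^sup>2 / (4 * eps))"

lemma norm_sq_sum_Basis: "(norm (x::'a::euclidean_space))\<^sup>2 = (\<Sum>b\<in>Basis. (x \<bullet> b)\<^sup>2)"
 unfolding power2_norm_eq_inner by (subst euclidean_inner) (simp add: power2_eq_square)

lemma gauss_integrable:
 assumes e: "eps > 0"
 shows "integrable lborel (%x::'a::euclidean_space. exp (- eps * (norm x)\<^sup>2))"
proof -
 have "(%x::'a. exp (- eps * (norm x)\<^sup>2)) = (%x. \<Prod>b\<in>Basis. exp (- eps * (x \<bullet> b)\<^sup>2))"
  unfolding norm_sq_sum_Basis by (simp add: sum_distrib_left exp_sum)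
 thus ?thesis using lborel_integral_prod_Basis(1)[of "%b t. exp (- eps * t\<^sup>2)"] gauss_FT_real(1)[OF e] by simp
qed

lemma norm_exp_ii: "norm (exp (\<i> * complex_of_real t)) = 1" "norm (exp (- \<i> * complex_of_real t)) = 1"
 "norm (exp (- (\<i> * complex_of_real t))) = 1"
 by (simp_all add: norm_exp_eq_Re)

lemma gauss_FT:
 assumes e: "eps > 0"
 shows "(LINT x|lborel. complex_of_real (exp (- eps * (norm x)\<^sup>2)) * exp (\<i> * of_real (x \<bullet> xi))) =
   of_real (gauss_kernel eps (xi::'a::euclidean_space))"
proof -
 define f where "f b t = complex_of_real (exp (- eps * t\<^sup>2)) * exp (\<i> * of_real (t * (xi \<bullet> b)))" for b t
 have f: "integrable lborel (f b)" for b
  unfolding f_def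
  by (rule Bochner_Integration.integrable_bound[OF gauss_FT_real(1)[OF e]]) (auto simp: norm_mult norm_exp_ii)
 have "complex_of_real (exp (- eps * (norm x)\<^sup>2)) * exp (\<i> * of_real (x \<bullet> xi)) = (\<Prod>b\<in>Basis. f b (x \<bullet> b))" for x
 proof -
  have "(\<Prod>b\<in>Basis. f b (x \<bullet> b)) = of_real (\<Prod>b\<in>Basis. exp (- eps * (x \<bullet> b)\<^sup>2)) * (\<Prod>b\<in>Basis. exp (\<i> * of_real ((x \<bullet> b) * (xi \<bullet> b))))"
   by (simp add: f_def prod.distrib)
  also have "(\<Prod>b\<in>Basis. exp (- eps * (x \<bullet> b)\<^sup>2)) = exp (- eps * (norm x)\<^sup>2)"
   unfolding norm_sq_sum_Basis by (simp add: sum_distrib_left exp_sum)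
  also have "(\<Prod>b\<in>Basis. exp (\<i> * complex_of_real ((x \<bullet> b) * (xi \<bullet> b)))) = exp (\<i> * of_real (x \<bullet> xi))"
   unfolding euclidean_inner[of x xi] of_real_sum sum_distrib_left exp_sum[OF finite_Basis] ..
  finally show ?thesis ..
 qed
 hence "(LINT x|lborel. complex_of_real (exp (- eps * (norm x)\<^sup>2)) * exp (\<i> * of_real (x \<bullet> xi))) =
  (\<Prod>b\<in>Basis. LINT t|lborel. f b t)"
  using lborel_integral_prod_Basis(2)[of f] f by simp
 also have "... = (\<Prod>b\<in>Basis. of_real (sqrt (pi / eps) * exp (- (xi \<bullet> b)\<^sup>2 / (4 * eps))))"
  unfolding f_def gauss_FT_real(2)[OF e] ..
 also have "... = of_real (sqrt (pi / eps) ^ DIM('a) * (\<Prod>b\<in>Basis. exp (- (xi \<bullet> b)\<^sup>2 / (4 * eps))))"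
  by (simp add: prod.distrib)
 also have "(\<Prod>b\<in>Basis. exp (- (xi \<bullet> b)\<^sup>2 / (4 * eps))) = exp (- (norm xi)\<^sup>2 / (4 * eps))"
 proof -
  have "- (norm xi)\<^sup>2 / (4 * eps) = (\<Sum>b\<in>Basis. - (xi \<bullet> b)\<^sup>2 / (4 * eps))"
   unfolding norm_sq_sum_Basis by (simp add: sum_negf sum_divide_distrib)
  thus ?thesis by (simp only: exp_sum[OF finite_Basis])
 qed
 finally show ?thesis by (simp add: gauss_kernel_def)
qed

lemma gauss_integral:
 assumes e: "eps > 0"
 shows "(LINT x|lborel. exp (- eps * (norm (x::'a::euclidean_space))\<^sup>2)) = sqrt (pi / eps) ^ DIM('a)"
proof -
 have "complex_of_real (LINT x|lborel. exp (- eps * (norm (x::'a))\<^sup>2)) = of_real (sqrt (pi / eps) ^ DIM('a))"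
  using gauss_FT[OF e, of "0::'a"] by (simp add: gauss_kernel_def)
 thus ?thesis by (rule of_real_eq_iff[THEN iffD1])
qed

lemma gauss_kernel_integral:
 assumes e: "eps > 0"
 shows "integrable lborel (gauss_kernel eps :: 'a::euclidean_space => real)"
  and "(LINT x|lborel. gauss_kernel eps (x::'a)) = (2 * pi) ^ DIM('a)"
proof -
 have k: "gauss_kernel eps = (%x::'a. sqrt (pi / eps) ^ DIM('a) * exp (- (1 / (4 * eps)) * (norm x)\<^sup>2))"
  by (simp add: gauss_kernel_def fun_eq_iff)
 show "integrable lborel (gauss_kernel eps :: 'a => real)"
  unfolding k using gauss_integrable[of "1 / (4 * eps)"] e by (intro integrable_mult_right) auto
 have "(LINT x|lborel. gauss_kernel eps (x::'a)) = sqrt (pi / eps) ^ DIM('a) * sqrt (pi / (1 / (4 * eps))) ^ DIM('a)"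
  unfolding k using gauss_integral[of "1 / (4 * eps)", where 'a='a] e by simp
 also have "... = (sqrt (pi / eps) * sqrt (pi / (1 / (4 * eps)))) ^ DIM('a)" by (simp add: power_mult_distrib)
 also have "sqrt (pi / eps) * sqrt (pi / (1 / (4 * eps))) = 2 * pi"
  unfolding real_sqrt_mult[symmetric] using e by (simp add: real_sqrt_mult power2_eq_square[symmetric])
 finally show "(LINT x|lborel. gauss_kernel eps (x::'a)) = (2 * pi) ^ DIM('a)" .
qed

lemma gauss_kernel_nonneg: "eps > 0 ==> gauss_kernel eps v \<ge> 0"
 by (simp add: gauss_kernel_def)

lemma gauss_kernel_measurable[measurable]: "gauss_kernel eps \<in> borel_measurable borel"
 unfolding gauss_kernel_def by measurable

section \<open>Fubini and the one-sided Plancherel inequality\<close>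

text \<open>Uses of Fubini's theorem for Bochner integrals below obtain their integrability from
  such a product bound.\<close>

lemma (in pair_sigma_finite) integrable_tensor_bound:
 fixes F :: "_ => 'e::{banach,second_countable_topology}"
 assumes g: "integrable M1 (g :: _ => real)" and h: "integrable M2 (h :: _ => real)"
  and F: "F \<in> borel_measurable (M1 \<Otimes>\<^sub>M M2)" and b: "!!x y. norm (F (x, y)) \<le> g x * h y"
 shows "integrable (M1 \<Otimes>\<^sub>M M2) F"
proof -
 have [measurable]: "g \<in> borel_measurable M1" "h \<in> borel_measurable M2"
  using g h by auto
 have "integrable (M1 \<Otimes>\<^sub>M M2) (%p. g (fst p) * h (snd p))"
  by (rule Fubini_integrable) (use g h in \<open>auto simp: abs_mult intro!: AE_I2\<close>)
 thus ?thesis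
 proof (rule Bochner_Integration.integrable_bound[OF _ F], intro AE_I2)
  fix p show "norm (F p) \<le> norm (g (fst p) * h (snd p))"
   using order_trans[OF b[of "fst p" "snd p"] abs_ge_self] by (simp only: prod.collapse real_norm_def)
 qed
qed

lemma lborel_integral_reflect_translate:
 fixes g :: "'a::euclidean_space => ennreal"
 assumes [measurable]: "g \<in> borel_measurable borel"
 shows "(\<integral>\<^sup>+y. g (x - y) \<partial>lborel) = (\<integral>\<^sup>+y. g y \<partial>lborel)"
proof -
 have "(lborel :: 'a measure) = distr lborel borel (%y. x - y)"
  using lborel_affine[of "-1" x] by (simp add: density_1)
 hence "(\<integral>\<^sup>+y. g y \<partial>lborel) = (\<integral>\<^sup>+y. g y \<partial>distr lborel borel (%y. x - y))" by metis
 also have "... = (\<integral>\<^sup>+y. g (x - y) \<partial>lborel)" by (subst nn_integral_distr) auto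
 finally show ?thesis ..
qed

lemma ennreal_half: "ennreal (1/2) = 1/2"
 using divide_ennreal[of 1 2] by simp

lemma ennreal_half_sum:
 assumes "X \<ge> 0" "Y \<ge> 0"
 shows "ennreal ((1/2) * X + (1/2) * Y) = (1/2) * ennreal X + (1/2) * ennreal Y"
proof -
 have "ennreal ((1/2) * X + (1/2) * Y) = ennreal ((1/2) * X) + ennreal ((1/2) * Y)"
  using assms by (intro ennreal_plus) auto
 also have "ennreal ((1/2) * X) = ennreal (1/2) * ennreal X" using assms by (intro ennreal_mult) auto
 also have "ennreal ((1/2) * Y) = ennreal (1/2) * ennreal Y" using assms by (intro ennreal_mult) auto
 finally show ?thesis unfolding ennreal_half .
qed

text \<open>The inverse transform without the factor \<open>1 / (2 * pi) ^ DIM('a)\<close>, which is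
  put into the amplitudes instead.\<close>

definition ift :: "('a::euclidean_space => complex) => 'a => complex" where
 "ift f x = (LINT xi|lborel. f xi * exp (\<i> * of_real (x \<bullet> xi)))"

lemma ift_measurable[measurable]:
 assumes [measurable]: "f \<in> borel_measurable borel"
 shows "ift f \<in> borel_measurable borel"
 unfolding ift_def by measurable

lemma ift_bound: "norm (ift f x) \<le> (LINT xi|lborel. norm (f xi))"
 unfolding ift_def using integral_norm_bound[of lborel "%xi. f xi * exp (\<i> * of_real (x \<bullet> xi))"]
 by (simp add: norm_mult norm_exp_ii)

text \<open>\<open>f\<close> is integrable but perhaps not square integrable, so the right-hand side
  may be infinite. A Gaussian damping legitimises Fubini and turns the left-hand side into a
  quadratic form in \<open>f\<close> whose kernel has mass \<open>(2 * pi) ^ DIM('a)\<close> in each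
  variable; Schur's test bounds it, and Fatou's lemma removes the damping.\<close>

lemma Plancherel_le:
 fixes f :: "'a::euclidean_space => complex"
 assumes f: "integrable lborel f"
 shows "(\<integral>\<^sup>+x. ennreal ((norm (ift f x))\<^sup>2) \<partial>lborel) \<le> ennreal ((2 * pi) ^ DIM('a)) * (\<integral>\<^sup>+xi. ennreal ((norm (f xi))\<^sup>2) \<partial>lborel)"
proof -
 have fm[measurable]: "f \<in> borel_measurable borel" using borel_measurable_integrable[OF f] by simp
 have cm: "(%z. cnj z) \<in> borel_measurable borel"
  by (intro borel_measurable_continuous_onI continuous_intros)
 have [measurable]: "(%x. cnj (f x)) \<in> borel_measurable borel" "(%x. cnj (ift f x)) \<in> borel_measurable borel"
  by (intro measurable_compose[OF _ cm], measurable)+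
 define B where "B = (LINT xi|lborel. norm (f xi))"
 have iB: "norm (ift f x) \<le> B" for x unfolding B_def by (rule ift_bound)
 have B0: "B \<ge> 0" unfolding B_def by simp
 define C where "C = ennreal ((2 * pi) ^ DIM('a)) * (\<integral>\<^sup>+xi. ennreal ((norm (f xi))\<^sup>2) \<partial>lborel)"
 have main: "(\<integral>\<^sup>+x. ennreal (exp (- eps * (norm x)\<^sup>2) * (norm (ift f x))\<^sup>2) \<partial>lborel) \<le> C" if e: "eps > 0" for eps
 proof -
  define g where "g x = exp (- eps * (norm (x::'a))\<^sup>2)" for x
  have gi: "integrable lborel g" unfolding g_def by (rule gauss_integrable[OF e])
  have gm[measurable]: "g \<in> borel_measurable borel" unfolding g_def by measurable
  have g0: "g x \<ge> 0" for x by (simp add: g_def)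
  define I where "I = (LINT x|lborel. g x * (norm (ift f x))\<^sup>2)"
  have "integrable lborel (%x. g x * (norm (ift f x))\<^sup>2)"
  proof (rule Bochner_Integration.integrable_bound[OF integrable_mult_left[OF gi, of "B\<^sup>2"]])
   show "AE x in lborel. norm (g x * (norm (ift f x))\<^sup>2) \<le> norm (g x * B\<^sup>2)"
    using iB g0 by (intro AE_I2) (auto simp: abs_mult intro!: mult_left_mono power_mono)
  qed auto
  hence "(\<integral>\<^sup>+x. ennreal (g x * (norm (ift f x))\<^sup>2) \<partial>lborel) = ennreal I"
   unfolding I_def using g0 by (intro nn_integral_eq_integral) auto
  also have "ennreal I \<le> C"
  proof -
   have "complex_of_real I = (LINT x|lborel. of_real (g x) * (ift f x * cnj (ift f x)))"
    unfolding I_def integral_complex_of_real[symmetric]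
    by (intro Bochner_Integration.integral_cong) (auto simp: complex_norm_square[symmetric] simp flip: of_real_power)
   also have "... = (LINT x|lborel. LINT xi|lborel. of_real (g x) * cnj (ift f x) * (f xi * exp (\<i> * of_real (x \<bullet> xi))))"
    unfolding ift_def[of f] integral_mult_right_zero by (simp add: mult_ac)
   also have "... = (LINT xi|lborel. LINT x|lborel. of_real (g x) * cnj (ift f x) * (f xi * exp (\<i> * of_real (x \<bullet> xi))))"
   proof (rule lborel_pair.Fubini_integral[symmetric])
    show "integrable (lborel \<Otimes>\<^sub>M lborel) (%(x, xi). of_real (g x) * cnj (ift f x) * (f xi * exp (\<i> * of_real (x \<bullet> xi))))"
    proof (rule lborel_pair.integrable_tensor_bound[OF integrable_mult_left[OF gi, of B] integrable_norm[OF f]])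
     show "norm (case (x, xi) of (x, xi) => of_real (g x) * cnj (ift f x) * (f xi * exp (\<i> * of_real (x \<bullet> xi)))) \<le> g x * B * norm (f xi)" for x xi
      using iB[of x] g0[of x] by (auto simp: norm_mult norm_exp_ii intro!: mult_right_mono mult_left_mono)
    qed measurable
   qed
   also have "... = (LINT xi|lborel. f xi * (LINT \<eta>|lborel. cnj (f \<eta>) * of_real (gauss_kernel eps (xi - \<eta>))))"
   proof (intro Bochner_Integration.integral_cong refl)
    fix xi :: 'a
    have cnj_ift: "cnj (ift f x) = (LINT \<eta>|lborel. cnj (f \<eta>) * exp (- (\<i> * of_real (x \<bullet> \<eta>))))" for x
    proof -
     have "cnj (ift f x) = (LINT \<eta>|lborel. cnj (f \<eta> * exp (\<i> * of_real (x \<bullet> \<eta>))))"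
      unfolding ift_def by (rule Bochner_Integration.integral_cnj[symmetric])
     thus ?thesis by (simp add: exp_cnj)
    qed
    have "(LINT x|lborel. of_real (g x) * cnj (ift f x) * (f xi * exp (\<i> * of_real (x \<bullet> xi))))
     = f xi * (LINT x|lborel. of_real (g x) * exp (\<i> * of_real (x \<bullet> xi)) * cnj (ift f x))"
     by (subst integral_mult_right_zero[symmetric]) (simp add: mult_ac)
    also have "(LINT x|lborel. of_real (g x) * exp (\<i> * of_real (x \<bullet> xi)) * cnj (ift f x))
     = (LINT x|lborel. LINT \<eta>|lborel. of_real (g x) * exp (\<i> * of_real (x \<bullet> xi)) * (cnj (f \<eta>) * exp (- (\<i> * of_real (x \<bullet> \<eta>)))))"
     unfolding cnj_ift by simp
    also have "... = (LINT \<eta>|lborel. LINT x|lborel. of_real (g x) * exp (\<i> * of_real (x \<bullet> xi)) * (cnj (f \<eta>) * exp (- (\<i> * of_real (x \<bullet> \<eta>)))))"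
    proof (rule lborel_pair.Fubini_integral[symmetric])
     show "integrable (lborel \<Otimes>\<^sub>M lborel) (%(x, \<eta>). of_real (g x) * exp (\<i> * of_real (x \<bullet> xi)) * (cnj (f \<eta>) * exp (- (\<i> * of_real (x \<bullet> \<eta>)))))"
     proof (rule lborel_pair.integrable_tensor_bound[OF gi integrable_norm[OF f]])
      show "norm (case (x, \<eta>) of (x, \<eta>) => of_real (g x) * exp (\<i> * of_real (x \<bullet> xi)) * (cnj (f \<eta>) * exp (- (\<i> * of_real (x \<bullet> \<eta>))))) \<le> g x * norm (f \<eta>)" for x \<eta>
       using g0[of x] by (auto simp: norm_mult norm_exp_ii)
     qed measurable
    qed
    also have "... = (LINT \<eta>|lborel. cnj (f \<eta>) * (LINT x|lborel. of_real (exp (- eps * (norm x)\<^sup>2)) * exp (\<i> * of_real (x \<bullet> (xi - \<eta>)))))"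
    proof (intro Bochner_Integration.integral_cong refl)
     fix \<eta> :: 'a
     have "of_real (g x) * exp (\<i> * of_real (x \<bullet> xi)) * (cnj (f \<eta>) * exp (- (\<i> * of_real (x \<bullet> \<eta>))))
      = cnj (f \<eta>) * (of_real (exp (- eps * (norm x)\<^sup>2)) * exp (\<i> * of_real (x \<bullet> (xi - \<eta>))))" for x
     proof -
      have "exp (\<i> * of_real (x \<bullet> (xi - \<eta>))) = exp (\<i> * of_real (x \<bullet> xi)) * exp (- (\<i> * of_real (x \<bullet> \<eta>)))"
       by (simp add: exp_add[symmetric] inner_diff_right algebra_simps)
      thus ?thesis by (simp add: g_def mult_ac)
     qed
     thus "(LINT x|lborel. of_real (g x) * exp (\<i> * of_real (x \<bullet> xi)) * (cnj (f \<eta>) * exp (- (\<i> * of_real (x \<bullet> \<eta>)))))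
      = cnj (f \<eta>) * (LINT x|lborel. of_real (exp (- eps * (norm x)\<^sup>2)) * exp (\<i> * of_real (x \<bullet> (xi - \<eta>))))"
      by (simp only: integral_mult_right_zero)
    qed
    also have "... = (LINT \<eta>|lborel. cnj (f \<eta>) * of_real (gauss_kernel eps (xi - \<eta>)))"
     unfolding gauss_FT[OF e] ..
    finally show "(LINT x|lborel. of_real (g x) * cnj (ift f x) * (f xi * exp (\<i> * of_real (x \<bullet> xi))))
     = f xi * (LINT \<eta>|lborel. cnj (f \<eta>) * of_real (gauss_kernel eps (xi - \<eta>)))" .
   qed
   finally have I: "complex_of_real I = (LINT xi|lborel. f xi * (LINT \<eta>|lborel. cnj (f \<eta>) * of_real (gauss_kernel eps (xi - \<eta>))))" .
   \<comment> \<open>This holds for every \<open>h\<close>: the Bochner integral of a non-integrable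
     function is 0.\<close>
   have nb: "ennreal (norm (integral\<^sup>L lborel h)) \<le> (\<integral>\<^sup>+x. ennreal (norm (h x)) \<partial>lborel)" for h :: "'a => complex"
    by (cases "integrable lborel h") (auto simp: integral_norm_bound_ennreal not_integrable_integral_eq)
   have I0: "I \<ge> 0" unfolding I_def using g0 by (intro integral_nonneg_AE) auto
   let ?K = "%xi \<eta>. ennreal (gauss_kernel eps (xi - \<eta> :: 'a))"
   let ?s = "%xi. ennreal ((norm (f xi))\<^sup>2)"
   have Kint: "(\<integral>\<^sup>+\<eta>. ?K xi \<eta> \<partial>lborel) = ennreal ((2 * pi) ^ DIM('a))" for xi
   proof -
    have "(\<integral>\<^sup>+\<eta>. ?K xi \<eta> \<partial>lborel) = (\<integral>\<^sup>+v. ennreal (gauss_kernel eps (v::'a)) \<partial>lborel)"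
     by (rule lborel_integral_reflect_translate[of "%v. ennreal (gauss_kernel eps v)" xi]) measurable
    also have "... = ennreal (LINT v|lborel. gauss_kernel eps (v::'a))"
     by (rule nn_integral_eq_integral[OF gauss_kernel_integral(1)[OF e]])
      (intro AE_I2 gauss_kernel_nonneg[OF e])
    finally show ?thesis unfolding gauss_kernel_integral(2)[OF e] .
   qed
   have Ksym: "?K xi \<eta> = ?K \<eta> xi" for xi \<eta> by (simp add: gauss_kernel_def norm_minus_commute)
   have "ennreal I = ennreal (norm (complex_of_real I))" using I0 by simp
   also have "... \<le> (\<integral>\<^sup>+xi. ennreal (norm (f xi * (LINT \<eta>|lborel. cnj (f \<eta>) * of_real (gauss_kernel eps (xi - \<eta>))))) \<partial>lborel)"
    unfolding I by (rule nb)
   also have "... \<le> (\<integral>\<^sup>+xi. ennreal (norm (f xi)) * (\<integral>\<^sup>+\<eta>. ennreal (norm (cnj (f \<eta>) * of_real (gauss_kernel eps (xi - \<eta>)))) \<partial>lborel) \<partial>lborel)"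
    unfolding norm_mult[of "f _"] ennreal_mult'' [OF norm_ge_zero]
    by (intro nn_integral_mono mult_left_mono nb) auto
   \<comment> \<open>Schur's test: the product of the two moduli is at most half the sum of their
     squares, and each half integrates to \<open>C / 2\<close> by the mass and the symmetry of the
     kernel.\<close>
   also have "... \<le> (\<integral>\<^sup>+xi. (\<integral>\<^sup>+\<eta>. (1/2) * (?s xi * ?K xi \<eta>) + (1/2) * (?s \<eta> * ?K xi \<eta>) \<partial>lborel) \<partial>lborel)"
   proof (intro nn_integral_mono)
    fix xi :: 'a
    have "ennreal (norm (f xi)) * (\<integral>\<^sup>+\<eta>. ennreal (norm (cnj (f \<eta>) * of_real (gauss_kernel eps (xi - \<eta>)))) \<partial>lborel)
     = (\<integral>\<^sup>+\<eta>. ennreal (norm (f xi)) * ennreal (norm (cnj (f \<eta>) * of_real (gauss_kernel eps (xi - \<eta>)))) \<partial>lborel)"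
     by (rule nn_integral_cmult[symmetric]) measurable
    also have "... \<le> (\<integral>\<^sup>+\<eta>. (1/2) * (?s xi * ?K xi \<eta>) + (1/2) * (?s \<eta> * ?K xi \<eta>) \<partial>lborel)"
    proof (intro nn_integral_mono)
     fix \<eta> :: 'a
     let ?k = "gauss_kernel eps (xi - \<eta>)"
     have k: "?k \<ge> 0" by (rule gauss_kernel_nonneg[OF e])
     have "norm (f xi) * (norm (f \<eta>) * ?k) \<le> (1/2) * ((norm (f xi))\<^sup>2 * ?k) + (1/2) * ((norm (f \<eta>))\<^sup>2 * ?k)"
     proof -
      have "norm (f xi) * norm (f \<eta>) \<le> (1/2) * (norm (f xi))\<^sup>2 + (1/2) * (norm (f \<eta>))\<^sup>2"
       using sum_squares_bound[of "norm (f xi)" "norm (f \<eta>)"] by simp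
      from mult_right_mono[OF this k] show ?thesis by (simp add: algebra_simps)
     qed
     hence "ennreal (norm (f xi) * (norm (f \<eta>) * ?k)) \<le> ennreal ((1/2) * ((norm (f xi))\<^sup>2 * ?k) + (1/2) * ((norm (f \<eta>))\<^sup>2 * ?k))"
      by (rule ennreal_leI)
     also have "... = (1/2) * (?s xi * ennreal ?k) + (1/2) * (?s \<eta> * ennreal ?k)"
      using k by (subst ennreal_half_sum) (auto simp: ennreal_mult)
     finally show "ennreal (norm (f xi)) * ennreal (norm (cnj (f \<eta>) * of_real ?k)) \<le> (1/2) * (?s xi * ?K xi \<eta>) + (1/2) * (?s \<eta> * ?K xi \<eta>)"
      using k by (simp add: norm_mult ennreal_mult)
    qed
    finally show "ennreal (norm (f xi)) * (\<integral>\<^sup>+\<eta>. ennreal (norm (cnj (f \<eta>) * of_real (gauss_kernel eps (xi - \<eta>)))) \<partial>lborel)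
     \<le> (\<integral>\<^sup>+\<eta>. (1/2) * (?s xi * ?K xi \<eta>) + (1/2) * (?s \<eta> * ?K xi \<eta>) \<partial>lborel)" .
   qed
   also have "... = (\<integral>\<^sup>+xi. (1/2) * (?s xi * ennreal ((2 * pi) ^ DIM('a))) \<partial>lborel) + (\<integral>\<^sup>+xi. (\<integral>\<^sup>+\<eta>. (1/2) * (?s \<eta> * ?K xi \<eta>) \<partial>lborel) \<partial>lborel)"
   proof -
    have "(\<integral>\<^sup>+\<eta>. (1/2) * (?s xi * ?K xi \<eta>) + (1/2) * (?s \<eta> * ?K xi \<eta>) \<partial>lborel)
     = (1/2) * (?s xi * ennreal ((2 * pi) ^ DIM('a))) + (\<integral>\<^sup>+\<eta>. (1/2) * (?s \<eta> * ?K xi \<eta>) \<partial>lborel)" for xi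
     by (subst nn_integral_add) (auto simp: nn_integral_cmult Kint)
    note eq = this
    show ?thesis unfolding eq by (rule nn_integral_add) measurable
   qed
   also have "(\<integral>\<^sup>+xi. (\<integral>\<^sup>+\<eta>. (1/2) * (?s \<eta> * ?K xi \<eta>) \<partial>lborel) \<partial>lborel) = (\<integral>\<^sup>+\<eta>. (\<integral>\<^sup>+xi. (1/2) * (?s \<eta> * ?K xi \<eta>) \<partial>lborel) \<partial>lborel)"
    by (rule lborel_pair.Fubini'[symmetric]) measurable
   also have "... = (\<integral>\<^sup>+\<eta>. (1/2) * (?s \<eta> * ennreal ((2 * pi) ^ DIM('a))) \<partial>lborel)"
    by (subst Ksym) (simp add: nn_integral_cmult Kint)
   also have "(\<integral>\<^sup>+xi. (1/2) * (?s xi * ennreal ((2 * pi) ^ DIM('a))) \<partial>lborel) = (1/2) * C"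
    by (simp add: nn_integral_cmult nn_integral_multc C_def mult_ac)
   also have "(1/2) * C + (1/2) * C = C"
   proof -
    have "(1/2::ennreal) + 1/2 = 1"
     unfolding ennreal_half[symmetric] by (subst ennreal_plus[symmetric]) auto
    thus ?thesis by (simp only: distrib_right[symmetric] mult_1_left)
   qed
   finally show ?thesis .
  qed
  finally show ?thesis unfolding g_def .
 qed
 \<comment> \<open>Fatou's lemma, with damping parameters \<open>1 / real (Suc k)\<close> tending to
   0.\<close>
 have "(\<integral>\<^sup>+x. ennreal ((norm (ift f x))\<^sup>2) \<partial>lborel) \<le> liminf (%k. \<integral>\<^sup>+x. ennreal (exp (- (1 / real (Suc k)) * (norm x)\<^sup>2) * (norm (ift f x))\<^sup>2) \<partial>lborel)"
 proof -
  have "ennreal ((norm (ift f x))\<^sup>2) = liminf (%k. ennreal (exp (- (1 / real (Suc k)) * (norm x)\<^sup>2) * (norm (ift f x))\<^sup>2))" for x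
  proof -
   have "(%k. exp (- (1 / real (Suc k)) * (norm x)\<^sup>2) * (norm (ift f x))\<^sup>2) \<longlonglongrightarrow> exp (- 0 * (norm x)\<^sup>2) * (norm (ift f x))\<^sup>2"
    by (intro tendsto_intros lim_1_over_n[THEN LIMSEQ_Suc])
   hence "(%k. ennreal (exp (- (1 / real (Suc k)) * (norm x)\<^sup>2) * (norm (ift f x))\<^sup>2)) \<longlonglongrightarrow> ennreal ((norm (ift f x))\<^sup>2)"
    by (intro tendsto_ennrealI) simp
   thus ?thesis by (intro lim_imp_Liminf[symmetric]) auto
  qed
  thus ?thesis by (simp only:) (rule nn_integral_liminf, measurable)
 qed
 also have "... \<le> C"
  by (intro Liminf_le) (auto intro!: always_eventually main[of "1 / real (Suc _)", simplified])
 finally show ?thesis unfolding C_def .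
qed

text \<open>No coordinate exceeds the norm, so the power is at most the product of the integrable
  functions \<open>1 / (1 + t\<^sup>2)\<close> of the single coordinates; hence the exponent
  \<open>DIM('a)\<close>.\<close>

lemma integrable_inverse_one_plus_norm:
 "integrable lborel (%x::'a::euclidean_space. 1 / (1 + (norm x)\<^sup>2) ^ DIM('a))"
proof -
 have i1: "integrable lborel (%t::real. 1 / (1 + t\<^sup>2))"
  using integrable_inverse_1_plus_square by (simp add: set_integrable_def divide_inverse)
 show ?thesis
 proof (rule Bochner_Integration.integrable_bound[OF lborel_integral_prod_Basis(1)[of "%_ t. 1 / (1 + t\<^sup>2)", OF i1]])
  show "AE x in lborel. norm (1 / (1 + (norm (x::'a))\<^sup>2) ^ DIM('a)) \<le> norm (\<Prod>b\<in>Basis. 1 / (1 + (x \<bullet> b)\<^sup>2))"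
  proof (intro AE_I2)
  fix x :: 'a
  have "(\<Prod>b\<in>(Basis::'a set). 1 / (1 + (norm x)\<^sup>2)) \<le> (\<Prod>b\<in>Basis. 1 / (1 + (x \<bullet> b)\<^sup>2))"
  proof (intro prod_mono conjI)
   fix b :: 'a assume b: "b \<in> Basis"
   have "(x \<bullet> b)\<^sup>2 \<le> (norm x)\<^sup>2" using Basis_le_norm[OF b, of x] by (simp add: abs_le_square_iff[symmetric])
   thus "1 / (1 + (norm x)\<^sup>2) \<le> 1 / (1 + (x \<bullet> b)\<^sup>2)" by (intro divide_left_mono mult_pos_pos add_pos_nonneg) auto
  qed auto
  thus "norm (1 / (1 + (norm x)\<^sup>2) ^ DIM('a)) \<le> norm (\<Prod>b\<in>Basis. 1 / (1 + (x \<bullet> b)\<^sup>2))"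
   by (simp add: power_one_over abs_prod prod_nonneg)
  qed
 qed auto
qed

section \<open>The one-dimensional profiles\<close>

definition Bessel_coeff :: "real => nat => real" where
 "Bessel_coeff \<nu> k = rGamma (real k + \<nu> + 1) / fact k"

text \<open>\<open>(x / 2) powr \<nu> * Bessel_series \<nu> (x\<^sup>2 / 4)\<close> is the modified
  Bessel function \<open>I_\<nu>\<close> at \<open>x > 0\<close>. Splitting the power off leaves a
  power series in the square, which is harmless at 0.\<close>

definition Bessel_series :: "real => real => real" where
 "Bessel_series \<nu> z = (\<Sum>k. Bessel_coeff \<nu> k * z ^ k)"

lemma Bessel_coeff_Suc: "Bessel_coeff \<nu> (Suc k) * (real k + \<nu> + 1) * (real k + 1) = Bessel_coeff \<nu> k"
proof -
 have "(real k + \<nu> + 1) * rGamma (real k + \<nu> + 1 + 1) = rGamma (real k + \<nu> + 1)" by (rule rGamma_plus1)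
 hence r: "rGamma (real k + \<nu> + 1) = (real k + \<nu> + 1) * rGamma (real (Suc k) + \<nu> + 1)" by (simp add: add_ac)
 have f: "fact (Suc k) = (real k + 1) * fact k" by (simp add: add.commute)
 show ?thesis unfolding Bessel_coeff_def r f by simp
qed

lemma Bessel_coeff_pos: "\<nu> > -1 ==> Bessel_coeff \<nu> k > 0"
 unfolding Bessel_coeff_def rGamma_inverse_Gamma by (intro divide_pos_pos positive_imp_inverse_positive Gamma_real_pos) auto

lemma summable_Bessel_series:
 assumes \<nu>: "\<nu> > -1"
 shows "summable (%k. Bessel_coeff \<nu> k * z ^ k)"
proof -
 have "(%k. \<bar>z\<bar> / ((real k + \<nu> + 1) * (real k + 1))) \<longlonglongrightarrow> 0" by real_asymp
 hence "\<forall>\<^sub>F k in sequentially. \<bar>z\<bar> / ((real k + \<nu> + 1) * (real k + 1)) < 1 / 2"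
  by (rule order_tendstoD) auto
 then obtain N where N: "!!k. k \<ge> N ==> \<bar>z\<bar> / ((real k + \<nu> + 1) * (real k + 1)) < 1 / 2"
  by (auto simp: eventually_at_top_linorder)
 show ?thesis
 proof (rule summable_ratio_test[of "1/2" N])
  fix k assume k: "N \<le> k"
  define d where "d = (real k + \<nu> + 1) * (real k + 1)"
  have d: "d > 0" using \<nu> by (auto simp: d_def intro!: mult_pos_pos)
  have e: "Bessel_coeff \<nu> (Suc k) = Bessel_coeff \<nu> k / d"
   using Bessel_coeff_Suc[of \<nu> k] d by (simp add: d_def field_simps)
  have "norm (Bessel_coeff \<nu> (Suc k) * z ^ Suc k) = (\<bar>z\<bar> / d) * norm (Bessel_coeff \<nu> k * z ^ k)"
   unfolding e using d by (simp add: abs_mult)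
  also have "... \<le> (1/2) * norm (Bessel_coeff \<nu> k * z ^ k)"
   using N[OF k] unfolding d_def by (intro mult_right_mono) auto
  finally show "norm (Bessel_coeff \<nu> (Suc k) * z ^ Suc k) \<le> 1 / 2 * norm (Bessel_coeff \<nu> k * z ^ k)" .
 qed auto
qed

text \<open>Termwise: the factor \<open>k + 1\<close> cancels against the factorial, and the shifted
  argument of \<open>rGamma\<close> amounts to raising the order by one.\<close>

lemma DERIV_Bessel_series:
 assumes \<nu>: "\<nu> > -1"
 shows "(Bessel_series \<nu> has_real_derivative Bessel_series (\<nu> + 1) z) (at z)"
proof -
 have "diffs (Bessel_coeff \<nu>) k = Bessel_coeff (\<nu> + 1) k" for k
  by (simp add: diffs_def Bessel_coeff_def add_ac divide_simps)
 hence "diffs (Bessel_coeff \<nu>) = Bessel_coeff (\<nu> + 1)" by blast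
 thus ?thesis
  unfolding Bessel_series_def
  using termdiffs_strong_converges_everywhere[OF summable_Bessel_series[OF \<nu>], of z] by simp
qed

text \<open>In terms of modified Bessel functions this is \<open>I_(\<nu> - 1) x - I_(\<nu> + 1) x =
  (2 * \<nu> / x) * I_\<nu> x\<close> at \<open>z = x\<^sup>2 / 4\<close>, compared coefficient by
  coefficient.\<close>

lemma Bessel_series_recurrence:
 assumes \<nu>: "\<nu> > 0"
 shows "z * Bessel_series (\<nu> + 1) z + \<nu> * Bessel_series \<nu> z = Bessel_series (\<nu> - 1) z"
proof -
 have c: "Bessel_coeff (\<nu> + 1) k + \<nu> * Bessel_coeff \<nu> (Suc k) = Bessel_coeff (\<nu> - 1) (Suc k)" for k
 proof -
  define G where "G = rGamma (real k + \<nu> + 2)"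
  have "(real k + \<nu> + 1) * rGamma (real k + \<nu> + 1 + 1) = rGamma (real k + \<nu> + 1)" by (rule rGamma_plus1)
  hence r: "rGamma (real k + \<nu> + 1) = (real k + \<nu> + 1) * G" by (simp add: G_def add_ac)
  have e: "Bessel_coeff (\<nu> + 1) k = G / fact k" "Bessel_coeff \<nu> (Suc k) = G / ((real k + 1) * fact k)"
   "Bessel_coeff (\<nu> - 1) (Suc k) = (real k + \<nu> + 1) * G / ((real k + 1) * fact k)"
   unfolding r[symmetric] by (simp_all add: Bessel_coeff_def G_def add_ac)
  have "real k + 1 \<noteq> 0" by simp
  thus ?thesis unfolding e by (simp add: divide_simps) (simp add: algebra_simps)
 qed
 have c0: "\<nu> * Bessel_coeff \<nu> 0 = Bessel_coeff (\<nu> - 1) 0"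
  using rGamma_plus1[of \<nu>] by (simp add: Bessel_coeff_def)
 note s = summable_Bessel_series[of "\<nu> + 1" z] summable_Bessel_series[of "\<nu>" z] summable_Bessel_series[of "\<nu> - 1" z]
 have s2: "summable (%k. Bessel_coeff \<nu> (Suc k) * z ^ Suc k)"
  using summable_Suc_iff[THEN iffD2, OF s(2)] \<nu> by simp
 have s3: "summable (%k. Bessel_coeff (\<nu> - 1) (Suc k) * z ^ Suc k)"
  using summable_Suc_iff[THEN iffD2, OF s(3)] \<nu> by simp
 have s1: "summable (%k. Bessel_coeff (\<nu> + 1) k * z ^ k)" using s(1) \<nu> by simp
 have "Bessel_series (\<nu> - 1) z = (\<Sum>k. Bessel_coeff (\<nu> - 1) (Suc k) * z ^ Suc k) + Bessel_coeff (\<nu> - 1) 0"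
  unfolding Bessel_series_def using suminf_split_head[OF s(3)] \<nu> by simp
 also have "(\<Sum>k. Bessel_coeff (\<nu> - 1) (Suc k) * z ^ Suc k) = (\<Sum>k. z * (Bessel_coeff (\<nu> + 1) k * z ^ k) + \<nu> * (Bessel_coeff \<nu> (Suc k) * z ^ Suc k))"
  unfolding c[symmetric] by (simp add: algebra_simps)
 also have "... = (\<Sum>k. z * (Bessel_coeff (\<nu> + 1) k * z ^ k)) + (\<Sum>k. \<nu> * (Bessel_coeff \<nu> (Suc k) * z ^ Suc k))"
  by (intro suminf_add[symmetric] summable_mult s1 s2)
 also have "(\<Sum>k. z * (Bessel_coeff (\<nu> + 1) k * z ^ k)) = z * Bessel_series (\<nu> + 1) z"
  unfolding Bessel_series_def by (rule suminf_mult[OF s1])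
 also have "(\<Sum>k. \<nu> * (Bessel_coeff \<nu> (Suc k) * z ^ Suc k)) = \<nu> * (\<Sum>k. Bessel_coeff \<nu> (Suc k) * z ^ Suc k)"
  by (rule suminf_mult[OF s2])
 also have "(\<Sum>k. Bessel_coeff \<nu> (Suc k) * z ^ Suc k) = Bessel_series \<nu> z - Bessel_coeff \<nu> 0"
  unfolding Bessel_series_def using suminf_split_head[OF s(2)] \<nu> by simp
 finally show ?thesis using c0 by (simp add: algebra_simps)
qed

lemma Bessel_series_0: "Bessel_series \<nu> 0 = rGamma (\<nu> + 1)"
 unfolding Bessel_series_def using powser_zero[of "Bessel_coeff \<nu>"] by (simp add: Bessel_coeff_def)

lemma Bessel_series_pos: "\<nu> > -1 ==> z \<ge> 0 ==> Bessel_series \<nu> z > 0"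
 unfolding Bessel_series_def
 using Bessel_coeff_pos[of \<nu>]
 by (intro suminf_pos2[OF summable_Bessel_series, of _ _ 0]) (auto intro!: mult_nonneg_nonneg intro: less_imp_le)

lemma continuous_Bessel_series: "\<nu> > -1 ==> continuous_on A (Bessel_series \<nu>)"
 using DERIV_Bessel_series DERIV_isCont by (blast intro: continuous_at_imp_continuous_on)

lemma Bessel_series_measurable: "\<nu> > -1 ==> Bessel_series \<nu> \<in> borel_measurable borel"
 by (intro borel_measurable_continuous_onI continuous_Bessel_series)

text \<open>On the negative imaginary axis the alternating signs cancel and the principal argument
  is \<open>- pi / 2\<close>; a phase and a positive factor remain, and here the factor is needed in
  closed form.\<close>

lemma Bessel_J_eq_series:
 assumes \<nu>: "\<nu> > -1" and r: "r > (0::real)"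
 shows "Bessel_J (of_real \<nu>) (- \<i> * of_real r) =
  exp (- \<i> * of_real (pi / 2 * \<nu>)) * of_real ((r / 2) powr \<nu> * Bessel_series \<nu> (r\<^sup>2 / 4))"
proof -
 have term_eq: "(- 1) ^ k * rGamma (of_nat k + of_real \<nu> + 1) / fact k
     * (- \<i> * of_real r / 2) ^ (2 * k) = complex_of_real (Bessel_coeff \<nu> k * (r\<^sup>2 / 4) ^ k)" for k
 proof -
  have "(- \<i> * of_real r / 2) ^ (2 * k) = ((- \<i> * of_real r / 2)\<^sup>2 :: complex) ^ k"
   by (simp add: power_mult)
  also have "(- \<i> * of_real r / 2)\<^sup>2 = - (of_real (r\<^sup>2 / 4) :: complex)"
   by (simp add: power2_eq_square field_simps)
  also have "... ^ k = (- 1) ^ k * of_real ((r\<^sup>2 / 4) ^ k)"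
   by (subst power_minus) simp
  finally have 1: "(- \<i> * of_real r / 2 :: complex) ^ (2 * k) = (- 1) ^ k * of_real ((r\<^sup>2 / 4) ^ k)" .
  have 2: "rGamma (of_nat k + of_real \<nu> + 1 :: complex) = of_real (rGamma (real k + \<nu> + 1))"
   using rGamma_complex_of_real[of "real k + \<nu> + 1"] by simp
  have "(- 1) ^ k * rGamma (of_nat k + of_real \<nu> + 1) / fact k * (- \<i> * of_real r / 2) ^ (2 * k) =
     ((- 1 :: complex) ^ k * (- 1) ^ k) * (of_real (rGamma (real k + \<nu> + 1)) / fact k * of_real ((r\<^sup>2 / 4) ^ k))"
   unfolding 1 2 by (simp only: mult_ac times_divide_eq_right times_divide_eq_left)
  also have "(- 1 :: complex) ^ k * (- 1) ^ k = 1" by (simp flip: power_add)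
  finally show ?thesis by (simp add: Bessel_coeff_def)
 qed
 have "Ln (- \<i> * of_real r / 2) = of_real (ln (r / 2)) - \<i> * of_real (pi / 2)"
  using Ln_times_of_real[of "r/2" "-\<i>"] Ln_of_real[of "r/2"] assms by (simp add: ac_simps)
 hence "(- \<i> * of_real r / 2) powr of_real \<nu>
     = exp (of_real \<nu> * (of_real (ln (r / 2)) - \<i> * of_real (pi / 2)))"
  using assms by (simp add: powr_def)
 also have "... = exp (- \<i> * of_real (pi / 2 * \<nu>) + of_real (\<nu> * ln (r / 2)))"
  by (rule arg_cong[where f = exp]) (simp add: field_simps)
 also have "... = exp (- \<i> * of_real (pi / 2 * \<nu>)) * of_real ((r / 2) powr \<nu>)"
  unfolding exp_add exp_of_real using assms by (simp add: powr_def)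
 finally have "(- \<i> * of_real r / 2) powr of_real \<nu>
     = exp (- \<i> * of_real (pi / 2 * \<nu>)) * of_real ((r / 2) powr \<nu>)" .
 moreover have "(\<Sum>k. complex_of_real (Bessel_coeff \<nu> k * (r\<^sup>2 / 4) ^ k)) = of_real (Bessel_series \<nu> (r\<^sup>2 / 4))"
  unfolding Bessel_series_def using summable_Bessel_series[OF \<nu>] by (rule suminf_of_real[symmetric])
 ultimately show ?thesis unfolding Bessel_J_def term_eq by simp
qed

section \<open>The Neumann profile and its flux\<close>

text \<open>The coefficient of the second solution, determined by the Neumann condition: it makes
  \<open>flux\<close> vanish at \<open>y = 1\<close>.\<close>

definition neumann_const :: "real => real => real" where
 "neumann_const s r = Gamma (1 - s) * r\<^sup>2 / 4 * Bessel_series (1 - s) (r\<^sup>2 / 4) / Bessel_series (s - 1) (r\<^sup>2 / 4)"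

text \<open>For \<open>r > 0\<close> the two summands are multiples of
  \<open>y^s * I_(-s) (r * y)\<close> and \<open>y^s * I_s (r * y)\<close>, the two solutions of the
  equation; the factor \<open>Gamma (1 - s)\<close> normalises the value at 0 to 1.\<close>

definition profile :: "real => real => real => real" where
 "profile s r y = Gamma (1 - s) * Bessel_series (- s) (r\<^sup>2 * y\<^sup>2 / 4) -
  neumann_const s r * y powr (2 * s) * Bessel_series s (r\<^sup>2 * y\<^sup>2 / 4)"

text \<open>\<open>- y^a\<close> times the derivative of the profile, simplified by the recurrence
  to a form that is continuous up to \<open>y = 0\<close>, where the derivative itself may be
  singular.\<close>

definition flux :: "real => real => real => real" where
 "flux s r y = 2 * neumann_const s r * Bessel_series (s - 1) (r\<^sup>2 * y\<^sup>2 / 4) -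
  Gamma (1 - s) * r\<^sup>2 / 2 * y powr (2 - 2 * s) * Bessel_series (1 - s) (r\<^sup>2 * y\<^sup>2 / 4)"

text \<open>All phases cancel: \<open>pi / 2\<close> from the factor \<open>\<i>\<close>,
  \<open>- pi * (s - 1 / 2)\<close> from the complex power and \<open>- pi * (1 - s)\<close> from
  the quotient of the Bessel values add up to 0. Of the moduli, the powers of 2 combine to
  \<open>1 / 2\<close> and those of \<open>norm xi\<close> to its square.\<close>

lemma S_symbol_eq_flux:
 fixes xi :: "'a::euclidean_space"
 assumes s: "0 < s" "s < 1" and xi: "xi \<noteq> 0"
 shows "Re (S_symbol s xi) = flux s (norm xi) 0"
proof -
 define r where "r = norm xi"
 have r: "r > 0" using xi by (simp add: r_def)
 define FA FB where "FA = Bessel_series (1 - s) (r\<^sup>2 / 4)" and "FB = Bessel_series (s - 1) (r\<^sup>2 / 4)"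
 define A B where "A = (r / 2) powr (1 - s) * FA" and "B = (r / 2) powr (s - 1) * FB"
 have F: "FA > 0" "FB > 0" using s by (auto simp: FA_def FB_def intro!: Bessel_series_pos)
 have AB: "A > 0" "B > 0" using F r by (auto simp: A_def B_def)
 have A: "Bessel_J (of_real (1 - s)) (- \<i> * of_real (norm xi)) = exp (- \<i> * of_real (pi / 2 * (1 - s))) * of_real A"
  unfolding A_def FA_def r_def[symmetric] using s r by (intro Bessel_J_eq_series) auto
 have B: "Bessel_J (of_real (s - 1)) (- \<i> * of_real (norm xi)) = exp (- \<i> * of_real (pi / 2 * (s - 1))) * of_real B"
  unfolding B_def FB_def r_def[symmetric] using s r by (intro Bessel_J_eq_series) auto
 have e: "(1 - \<i>) / 2 = exp (of_real (ln (1 / sqrt 2)) - \<i> * of_real (pi / 4))"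
  by (simp add: exp_diff exp_of_real)
   (simp add: complex_eq_iff Re_divide Im_divide exp_minus Re_exp Im_exp
     cos_45 sin_45 field_simps power2_eq_square flip: exp_of_real)
 have "Ln ((1 - \<i>) / 2) = of_real (ln (1 / sqrt 2)) - \<i> * of_real (pi / 4)"
  unfolding e using pi_gt_zero by (intro Ln_exp; simp; linarith)
 hence c1: "c\<^sub>1 s = \<i> * exp (of_real (4 * s - 2) * (of_real (ln (1 / sqrt 2)) - \<i> * of_real (pi / 4)))
        * of_real (Gamma (1 - s) / Gamma s)"
  by (simp add: c\<^sub>1_def powr_def)
 \<comment> \<open>The modulus of the complex power in \<open>c\<^sub>1 s\<close>; it will be
   \<open>2 powr (1 - 2 * s)\<close>, as \<open>(1 - \<i>) / 2\<close> has modulus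
   \<open>1 / sqrt 2\<close>.\<close>
 define E where "E = exp ((4 * s - 2) * ln (1 / sqrt 2))"
 define D where "D = E * (Gamma (1 - s) / Gamma s) * (A / B) * r powr (2 * s)"
 have exp_i_half_pi: "exp (\<i> * of_real (pi / 2)) = \<i>"
  using cis_conv_exp[of "pi / 2"] cis_pi_half by (simp add: mult_ac)
 have "S_symbol s xi = exp (\<i> * of_real (pi / 2)) *
   exp (of_real (4 * s - 2) * (of_real (ln (1 / sqrt 2)) - \<i> * of_real (pi / 4))) *
   (exp (- \<i> * of_real (pi / 2 * (1 - s))) / exp (- \<i> * of_real (pi / 2 * (s - 1)))) *
   of_real ((Gamma (1 - s) / Gamma s) * (A / B) * r powr (2 * s))"
  unfolding S_symbol_def c1 A B exp_i_half_pi unfolding r_def[symmetric] by (simp add: mult_ac)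
 also have "... = exp (of_real ((4 * s - 2) * ln (1 / sqrt 2))) *
   of_real ((Gamma (1 - s) / Gamma s) * (A / B) * r powr (2 * s))"
  unfolding exp_add[symmetric] exp_diff[symmetric]
  by (rule arg_cong2[where f = times], rule arg_cong[where f = exp])
   (simp_all add: field_simps)
 also have "... = of_real D"
  unfolding D_def E_def exp_of_real by (simp only: of_real_mult mult.assoc)
 finally have S: "Re (S_symbol s xi) = D" by simp
 have "ln (1 / sqrt 2) = - ln 2 / 2" by (simp add: ln_div ln_sqrt)
 hence E: "E = 2 powr (1 - 2 * s)" by (simp add: E_def powr_def algebra_simps)
 have "E * (A / B) * r powr (2 * s) = r\<^sup>2 / 2 * (FA / FB)"
 proof -
  have "(r / 2) powr (1 - s) / (r / 2) powr (s - 1) = (r / 2) powr (2 - 2 * s)"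
   by (simp flip: powr_diff)
  also have "... = r powr (2 - 2 * s) * 2 powr (2 * s - 2)"
  proof -
   have m: "2 powr (2 * s - 2) = 1 / (2::real) powr (2 - 2 * s)"
    using powr_minus_divide[of 2 "2 - 2 * s"] by simp
   show ?thesis unfolding m using r by (subst powr_divide) auto
  qed
  finally have pp: "(r / 2) powr (1 - s) / (r / 2) powr (s - 1) = r powr (2 - 2 * s) * 2 powr (2 * s - 2)" .
  have "E * (A / B) * r powr (2 * s) = 2 powr (1 - 2 * s) * ((r / 2) powr (1 - s) / (r / 2) powr (s - 1)) * (FA / FB) * r powr (2 * s)"
   by (simp add: E A_def B_def)
  hence "E * (A / B) * r powr (2 * s) = (2 powr (1 - 2 * s) * 2 powr (2 * s - 2)) * (r powr (2 - 2 * s) * r powr (2 * s)) * (FA / FB)"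
   unfolding pp by (simp only: mult_ac)
  also have "2 powr (1 - 2 * s) * 2 powr (2 * s - 2) = (1/2 :: real)"
   by (simp add: powr_minus flip: powr_add)
  also have "r powr (2 - 2 * s) * r powr (2 * s) = r\<^sup>2"
   using r by (simp flip: powr_add)
  finally show ?thesis by simp
 qed
 moreover have "D = Gamma (1 - s) / Gamma s * (E * (A / B) * r powr (2 * s))"
  unfolding D_def by (simp only: mult_ac)
 ultimately have "D = Gamma (1 - s) / Gamma s * (r\<^sup>2 / 2 * (FA / FB))" by (simp only:)
 also have "... = flux s r 0"
 proof -
  have bs0: "Bessel_series (s - 1) 0 = 1 / Gamma s"
   by (simp add: Bessel_series_0 rGamma_inverse_Gamma inverse_eq_divide)
  have "flux s r 0 = 2 * (Gamma (1 - s) * r\<^sup>2 / 4 * FA / FB) * (1 / Gamma s)"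
   by (simp add: flux_def neumann_const_def bs0 FA_def[symmetric] FB_def[symmetric])
  thus ?thesis by (simp add: mult_ac)
 qed
 finally show ?thesis using S by (simp add: r_def)
qed

lemma profile_0: "s < 1 ==> 0 < s ==> profile s r 0 = 1"
proof -
 assume "s < 1" "0 < s"
 hence "0 < Gamma (1 - s)" by (intro Gamma_real_pos) simp
 hence "Gamma (1 - s) \<noteq> 0" by linarith
 thus ?thesis using \<open>0 < s\<close> by (simp add: profile_def Bessel_series_0 rGamma_inverse_Gamma)
qed

lemma flux_1: "s < 1 ==> 0 < s ==> flux s r 1 = 0"
 using Bessel_series_pos[of "s - 1" "r\<^sup>2 / 4"] by (simp add: flux_def neumann_const_def)

text \<open>The product rule for the second summand leaves
  \<open>z * Bessel_series (s + 1) z + s * Bessel_series s z\<close>, which the recurrence collapses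
  to order \<open>s - 1\<close>, the order that occurs in \<open>flux\<close>.\<close>

lemma DERIV_profile:
 assumes s: "0 < s" "s < 1" and y: "y > 0"
 shows "(profile s r has_real_derivative - (y powr (2 * s - 1) * flux s r y)) (at y)"
proof -
 define z where "z = r\<^sup>2 * y\<^sup>2 / 4"
 have dz: "((%y. r\<^sup>2 * y\<^sup>2 / 4) has_real_derivative r\<^sup>2 * y / 2) (at y)"
  by (auto intro!: derivative_eq_intros)
 have d: "((%y. Bessel_series \<nu> (r\<^sup>2 * y\<^sup>2 / 4)) has_real_derivative Bessel_series (\<nu> + 1) z * (r\<^sup>2 * y / 2)) (at y)" if "\<nu> > -1" for \<nu>
  using DERIV_chain2[OF DERIV_Bessel_series[OF that] dz] by (simp add: z_def)
 have d1: "((%y. Bessel_series (- s) (r\<^sup>2 * y\<^sup>2 / 4)) has_real_derivative Bessel_series (1 - s) z * (r\<^sup>2 * y / 2)) (at y)"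
  using d[of "- s"] s by simp
 have d2: "((%y. Bessel_series s (r\<^sup>2 * y\<^sup>2 / 4)) has_real_derivative Bessel_series (s + 1) z * (r\<^sup>2 * y / 2)) (at y)"
  using d[of s] s by simp
 have d3: "((%y. y powr (2 * s)) has_real_derivative 2 * s * y powr (2 * s - 1)) (at y)"
  using y by (auto intro!: derivative_eq_intros)
 have "(profile s r has_real_derivative (Gamma (1 - s) * (Bessel_series (1 - s) z * (r\<^sup>2 * y / 2)) -
   (neumann_const s r * (2 * s * y powr (2 * s - 1)) * Bessel_series s z + neumann_const s r * y powr (2 * s) * (Bessel_series (s + 1) z * (r\<^sup>2 * y / 2))))) (at y)"
  unfolding profile_def[abs_def]
  by (rule DERIV_cong[OF DERIV_diff[OF DERIV_cmult[OF d1] DERIV_mult[OF DERIV_cmult[OF d3] d2]]]) (simp add: z_def)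
 moreover have "y powr (2 * s) * (r\<^sup>2 * y / 2) = 2 * y powr (2 * s - 1) * z"
 proof -
  have "y powr (2 * s) = y powr (2 * s - 1) * y" using y by (simp add: powr_mult_base powr_diff)
  thus ?thesis by (simp add: z_def power2_eq_square)
 qed
 moreover have "Bessel_series (s - 1) z = z * Bessel_series (s + 1) z + s * Bessel_series s z"
  using Bessel_series_recurrence[OF s(1), of z] by simp
 moreover have "y powr (2 * s - 1) * y powr (2 - 2 * s) = y"
  using y by (simp flip: powr_add)
 ultimately show ?thesis
  by (elim DERIV_cong) (simp add: flux_def z_def[symmetric] algebra_simps)
qed

text \<open>The same collapse, now with the recurrence at order \<open>1 - s\<close>, recovers the
  series of order \<open>- s\<close> from the first summand of the profile.\<close>

lemma DERIV_flux:
 assumes s: "0 < s" "s < 1" and y: "y > 0"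
 shows "(flux s r has_real_derivative - (r\<^sup>2 * y powr (1 - 2 * s) * profile s r y)) (at y)"
proof -
 define z where "z = r\<^sup>2 * y\<^sup>2 / 4"
 have dz: "((%y. r\<^sup>2 * y\<^sup>2 / 4) has_real_derivative r\<^sup>2 * y / 2) (at y)"
  by (auto intro!: derivative_eq_intros)
 have d: "((%y. Bessel_series \<nu> (r\<^sup>2 * y\<^sup>2 / 4)) has_real_derivative Bessel_series (\<nu> + 1) z * (r\<^sup>2 * y / 2)) (at y)" if "\<nu> > -1" for \<nu>
  using DERIV_chain2[OF DERIV_Bessel_series[OF that] dz] by (simp add: z_def)
 have d1: "((%y. Bessel_series (s - 1) (r\<^sup>2 * y\<^sup>2 / 4)) has_real_derivative Bessel_series s z * (r\<^sup>2 * y / 2)) (at y)"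
  using d[of "s - 1"] s by simp
 have d2: "((%y. Bessel_series (1 - s) (r\<^sup>2 * y\<^sup>2 / 4)) has_real_derivative Bessel_series (2 - s) z * (r\<^sup>2 * y / 2)) (at y)"
  using d[of "1 - s"] s by (simp add: add.commute)
 have d3: "((%y. y powr (2 - 2 * s)) has_real_derivative (2 - 2 * s) * y powr (1 - 2 * s)) (at y)"
  using y by (auto intro!: derivative_eq_intros)
 have "(flux s r has_real_derivative (2 * neumann_const s r * (Bessel_series s z * (r\<^sup>2 * y / 2)) -
   (Gamma (1 - s) * r\<^sup>2 / 2 * ((2 - 2 * s) * y powr (1 - 2 * s)) * Bessel_series (1 - s) z +
   Gamma (1 - s) * r\<^sup>2 / 2 * y powr (2 - 2 * s) * (Bessel_series (2 - s) z * (r\<^sup>2 * y / 2))))) (at y)"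
  unfolding flux_def[abs_def]
  by (rule DERIV_cong[OF DERIV_diff[OF DERIV_cmult[OF d1] DERIV_mult[OF DERIV_cmult[OF d3] d2]]]) (simp add: z_def)
 moreover have m: "y powr (2 - 2 * s) * (r\<^sup>2 * y / 2) = 2 * y powr (1 - 2 * s) * z"
 proof -
  have "y powr (2 - 2 * s) = y powr ((1 - 2 * s) + 1)" by (simp add: algebra_simps)
  also have "... = y powr (1 - 2 * s) * y" using y by (subst powr_add) simp
  finally show ?thesis by (simp add: z_def power2_eq_square)
 qed
 moreover have
  "2 * neumann_const s r * (Bessel_series s z * (r\<^sup>2 * y / 2)) -
   (Gamma (1 - s) * r\<^sup>2 / 2 * ((2 - 2 * s) * y powr (1 - 2 * s)) * Bessel_series (1 - s) z +
   Gamma (1 - s) * r\<^sup>2 / 2 * y powr (2 - 2 * s) * (Bessel_series (2 - s) z * (r\<^sup>2 * y / 2)))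
  = - (r\<^sup>2 * y powr (1 - 2 * s) * profile s r y)"
 proof -
  define n G P Y Fs F1 F2 where "n = neumann_const s r" and "G = Gamma (1 - s)" and "P = y powr (1 - 2 * s)"
   and "Y = y powr (2 - 2 * s)" and "Fs = Bessel_series s z" and "F1 = Bessel_series (1 - s) z" and "F2 = Bessel_series (2 - s) z"
  have Fm: "Bessel_series (- s) z = z * F2 + (1 - s) * F1"
   using Bessel_series_recurrence[of "1 - s" z] s by (simp add: algebra_simps F1_def F2_def)
  have PY: "P * y powr (2 * s) = y" using y by (simp add: P_def flip: powr_add)
  have "2 * n * (Fs * (r\<^sup>2 * y / 2)) - (G * r\<^sup>2 / 2 * ((2 - 2 * s) * P) * F1 + G * r\<^sup>2 / 2 * Y * (F2 * (r\<^sup>2 * y / 2)))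
   = n * Fs * r\<^sup>2 * y - G * r\<^sup>2 / 2 * ((2 - 2 * s) * P * F1 + F2 * (Y * (r\<^sup>2 * y / 2)))"
   by (simp add: algebra_simps)
  also have "... = n * Fs * r\<^sup>2 * (P * y powr (2 * s)) - G * r\<^sup>2 / 2 * ((2 - 2 * s) * P * F1 + F2 * (2 * P * z))"
   unfolding PY m[folded Y_def P_def] ..
  also have "... = - (r\<^sup>2 * P * (G * (z * F2 + (1 - s) * F1) - n * y powr (2 * s) * Fs))"
   by (simp add: algebra_simps)
  finally show ?thesis
   unfolding profile_def z_def[symmetric] Fm by (simp only: n_def G_def P_def Y_def Fs_def F1_def F2_def)
 qed
 ultimately show ?thesis by (elim DERIV_cong) simp
qed

lemma continuous_profile_flux:
 assumes s: "0 < s" "s < 1"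
 shows "continuous_on {0..1} (profile s r)" "continuous_on {0..1} (flux s r)"
proof -
 have F: "continuous_on {0..1} (%y. Bessel_series \<nu> (r\<^sup>2 * y\<^sup>2 / 4))" if "\<nu> > -1" for \<nu>
  by (rule continuous_on_compose2[OF continuous_Bessel_series[OF that, of UNIV]]) (auto intro!: continuous_intros)
 have P: "continuous_on {0..1::real} (%y. y powr c)" if "c > 0" for c
  using that by (intro continuous_on_powr' continuous_intros) auto
 show "continuous_on {0..1} (profile s r)" "continuous_on {0..1} (flux s r)"
  unfolding profile_def[abs_def] flux_def[abs_def]
  by (intro continuous_on_diff continuous_on_mult continuous_on_const F P; use s in simp)+
qed

lemma profile_measurable[measurable]:
 assumes s: "0 < s" "s < 1" and [measurable]: "f \<in> borel_measurable M" "g \<in> borel_measurable M"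
 shows "(%x. profile s (f x) (g x)) \<in> borel_measurable M" "(%x. flux s (f x) (g x)) \<in> borel_measurable M"
proof -
 have [measurable]: "Bessel_series (- s) \<in> borel_measurable borel" "Bessel_series s \<in> borel_measurable borel"
  "Bessel_series (1 - s) \<in> borel_measurable borel" "Bessel_series (s - 1) \<in> borel_measurable borel"
  using s by (auto intro: Bessel_series_measurable)
 show "(%x. profile s (f x) (g x)) \<in> borel_measurable M" "(%x. flux s (f x) (g x)) \<in> borel_measurable M"
  unfolding profile_def flux_def neumann_const_def by measurable
qed

section \<open>A priori bounds for Neumann profiles\<close>

lemma DERIV_nonpos_decreasing_on:
 fixes f :: "real => real"
 assumes "continuous_on {0..1} f" "!!y. 0 < y ==> y < 1 ==> (f has_real_derivative f' y) (at y)"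
  "!!y. u < y ==> y < v ==> f' y \<le> 0" "0 \<le> u" "u \<le> v" "v \<le> 1"
 shows "f v \<le> f u"
proof (rule DERIV_nonpos_imp_decreasing_open[OF \<open>u \<le> v\<close>])
 show "\<exists>y. (f has_real_derivative y) (at x) \<and> y \<le> 0" if "u < x" "x < v" for x
  using assms(2)[of x] assms(3)[of x] assms(4,6) that by auto
 show "continuous_on {u..v} f" by (rule continuous_on_subset[OF assms(1)]) (use assms in auto)
qed

text \<open>The bounds follow from the first-order system and the boundary values, so the Bessel
  series are abstracted away. Derivatives are assumed inside \<open>(0, 1)\<close> only, since the
  weights may be singular at 0; continuity on \<open>{0..1}\<close> links them to the boundary
  values.\<close>

locale neumann_profile =
 fixes a r :: real and th q :: "real => real"
 assumes a: "-1 < a" "a < 1" and r: "0 \<le> r"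
  and d_th: "!!y. 0 < y ==> y < 1 ==> (th has_real_derivative - (y powr (- a) * q y)) (at y)"
  and d_q: "!!y. 0 < y ==> y < 1 ==> (q has_real_derivative - (r\<^sup>2 * y powr a * th y)) (at y)"
  and c_th: "continuous_on {0..1} th" and c_q: "continuous_on {0..1} q"
  and th_0: "th 0 = 1" and q_1: "q 1 = 0"
begin

text \<open>\<open>q * th\<close> measures the energy above height \<open>y\<close>: its derivative
  is minus the energy density, it vanishes at 1, and its value at 0 is \<open>q 0\<close>. Its
  monotonicity and sign drive all bounds of this locale.\<close>

lemma d_prod:
 assumes "0 < y" "y < 1"
 shows "((%y. q y * th y) has_real_derivative - (r\<^sup>2 * y powr a * (th y)\<^sup>2 + y powr (- a) * (q y)\<^sup>2)) (at y)"
 by (rule DERIV_cong[OF DERIV_mult[OF d_q d_th]]) (use assms in \<open>auto simp: power2_eq_square algebra_simps\<close>)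

lemma c_prod: "continuous_on {0..1} (%y. q y * th y)"
 by (intro continuous_intros c_q c_th)

lemma diss_nonneg: "0 \<le> r\<^sup>2 * y powr a * (th y)\<^sup>2 + y powr (- a) * (q y)\<^sup>2"
 by (intro add_nonneg_nonneg mult_nonneg_nonneg) auto

lemma prod_antimono: "0 \<le> u ==> u \<le> v ==> v \<le> 1 ==> q v * th v \<le> q u * th u"
 by (rule DERIV_nonpos_decreasing_on[OF c_prod d_prod]) (simp_all only: neg_le_0_iff_le diss_nonneg)

lemma prod_nonneg: "0 \<le> y ==> y \<le> 1 ==> q y * th y \<ge> 0"
 using prod_antimono[of y 1] q_1 by simp

lemma flux_0_nonneg: "q 0 \<ge> 0"
 using prod_nonneg[of 0] th_0 by simp

lemma th_sq_antimono: "0 \<le> u ==> u \<le> v ==> v \<le> 1 ==> (th v)\<^sup>2 \<le> (th u)\<^sup>2"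
proof (rule DERIV_nonpos_decreasing_on[of "%y. (th y)\<^sup>2" "%y. - 2 * (y powr (- a)) * (q y * th y)"])
 show "continuous_on {0..1} (%y. (th y)\<^sup>2)" by (intro continuous_intros c_th)
 show "((%y. (th y)\<^sup>2) has_real_derivative - 2 * (y powr (- a)) * (q y * th y)) (at y)" if "0 < y" "y < 1" for y
  using d_th[OF that] by (auto intro!: derivative_eq_intros)
 show "- 2 * (y powr (- a)) * (q y * th y) \<le> 0" if "u < y" "y < v" "0 \<le> u" "v \<le> 1" for y
  using prod_nonneg[of y] that by (auto intro!: mult_nonneg_nonneg)
qed auto

lemma q_sq_antimono: "0 \<le> u ==> u \<le> v ==> v \<le> 1 ==> (q v)\<^sup>2 \<le> (q u)\<^sup>2"
proof (rule DERIV_nonpos_decreasing_on[of "%y. (q y)\<^sup>2" "%y. - 2 * (r\<^sup>2 * y powr a) * (q y * th y)"])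
 show "continuous_on {0..1} (%y. (q y)\<^sup>2)" by (intro continuous_intros c_q)
 show "((%y. (q y)\<^sup>2) has_real_derivative - 2 * (r\<^sup>2 * y powr a) * (q y * th y)) (at y)" if "0 < y" "y < 1" for y
  using d_q[OF that] by (auto intro!: derivative_eq_intros)
 show "- 2 * (r\<^sup>2 * y powr a) * (q y * th y) \<le> 0" if "u < y" "y < v" "0 \<le> u" "v \<le> 1" for y
  using prod_nonneg[of y] that by (auto intro!: mult_nonneg_nonneg)
qed auto

lemma th_le_1: "0 \<le> y ==> y \<le> 1 ==> \<bar>th y\<bar> \<le> 1"
 using th_sq_antimono[of 0 y] th_0 by (simp add: abs_square_le_1)

lemma d_powr: "0 < y ==> ((%y. c * y powr (1 + b) / (1 + b)) has_real_derivative c * y powr b) (at y)" if "1 + b > 0"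
 using that by (auto intro!: derivative_eq_intros)

lemma c_powr: "continuous_on {0..1::real} (%y. c * y powr (1 + b) / (1 + b))" if "1 + b > 0"
proof -
 have "continuous_on {0..1::real} (%y. y powr (1 + b))"
  using that by (intro continuous_on_powr' continuous_intros) auto
 hence "continuous_on {0..1::real} (%y. (c / (1 + b)) * y powr (1 + b))"
  by (intro continuous_on_mult continuous_on_const)
 thus ?thesis by simp
qed

text \<open>\<open>q\<close> vanishes at 1 and decreases at the rate
  \<open>r\<^sup>2 * y powr a * th y\<close>, which is at most \<open>r\<^sup>2 * y powr a\<close>;
  integrating this over \<open>(0, 1)\<close> gives the constant.\<close>

lemma flux_0_le: "q 0 \<le> r\<^sup>2 / (1 + a)"
proof -
 have "- (q 1 + r\<^sup>2 * 1 powr (1 + a) / (1 + a)) \<le> - (q 0 + r\<^sup>2 * 0 powr (1 + a) / (1 + a))"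
 proof (rule DERIV_nonpos_decreasing_on[of "%y. - (q y + r\<^sup>2 * y powr (1 + a) / (1 + a))" "%y. r\<^sup>2 * y powr a * th y - r\<^sup>2 * y powr a"])
  show "continuous_on {0..1} (%y. - (q y + r\<^sup>2 * y powr (1 + a) / (1 + a)))"
   using a by (intro continuous_on_minus continuous_on_add c_q c_powr) auto
  show "((%y. - (q y + r\<^sup>2 * y powr (1 + a) / (1 + a))) has_real_derivative r\<^sup>2 * y powr a * th y - r\<^sup>2 * y powr a) (at y)" if "0 < y" "y < 1" for y
   by (rule DERIV_cong[OF DERIV_minus[OF DERIV_add[OF d_q[OF that] d_powr]]]) (use a that in auto)
  show "r\<^sup>2 * y powr a * th y - r\<^sup>2 * y powr a \<le> 0" if "0 < y" "y < 1" for y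
   using th_le_1[of y] that by (simp add: mult_left_le)
 qed auto
 thus ?thesis using a q_1 by simp
qed

lemma q_le: "0 \<le> y ==> y \<le> 1 ==> \<bar>q y\<bar> \<le> r\<^sup>2 / (1 + a)"
 using q_sq_antimono[of 0 y] flux_0_nonneg flux_0_le power2_le_iff_abs_le[of "q 0" "q y"] by simp

text \<open>By the inequality of the means the energy density is at least
  \<open>2 * r * (q y * th y)\<close>, so the product with \<open>exp (2 * r * y)\<close> is still
  decreasing.\<close>

lemma prod_decay:
 assumes y: "0 \<le> y" "y \<le> 1"
 shows "q y * th y \<le> q 0 * exp (- 2 * r * y)"
proof -
 have "exp (2 * r * y) * (q y * th y) \<le> exp (2 * r * 0) * (q 0 * th 0)"
 proof (rule DERIV_nonpos_decreasing_on[of "%y. exp (2 * r * y) * (q y * th y)"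
   "%y. exp (2 * r * y) * (2 * r * (q y * th y) - (r\<^sup>2 * y powr a * (th y)\<^sup>2 + y powr (- a) * (q y)\<^sup>2))"])
  show "continuous_on {0..1} (%y. exp (2 * r * y) * (q y * th y))" by (intro continuous_intros c_q c_th)
  have e: "((%y. exp (2 * r * y)) has_real_derivative exp (2 * r * y) * (2 * r)) (at y)" for y
   by (auto intro!: derivative_eq_intros)
  show "((%y. exp (2 * r * y) * (q y * th y)) has_real_derivative
   exp (2 * r * y) * (2 * r * (q y * th y) - (r\<^sup>2 * y powr a * (th y)\<^sup>2 + y powr (- a) * (q y)\<^sup>2))) (at y)" if "0 < y" "y < 1" for y
   by (rule DERIV_cong[OF DERIV_mult[OF e d_prod[OF that]]]) (simp add: algebra_simps)
  show "exp (2 * r * t) * (2 * r * (q t * th t) - (r\<^sup>2 * t powr a * (th t)\<^sup>2 + t powr (- a) * (q t)\<^sup>2)) \<le> 0" if "0 < t" "t < y" for t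
  proof -
   define A where "A = t powr a"
   have A: "A > 0" "t powr (- a) = 1 / A" using that by (auto simp: A_def powr_minus_divide)
   have "0 \<le> (r * A * th t - q t)\<^sup>2 / A" using A by simp
   also have "... = r\<^sup>2 * A * (th t)\<^sup>2 + 1 / A * (q t)\<^sup>2 - 2 * r * (q t * th t)"
    using A(1) by (simp add: power2_eq_square field_simps)
   finally show ?thesis unfolding A A_def[symmetric] by (simp add: mult_le_0_iff)
  qed
 qed (use y in auto)
 hence "exp (- (2 * r * y)) * (exp (2 * r * y) * (q y * th y)) \<le> exp (- (2 * r * y)) * q 0"
  using th_0 by (intro mult_left_mono) auto
 moreover have "exp (- (2 * r * y)) * (exp (2 * r * y) * (q y * th y)) = q y * th y"
  by (simp add: exp_minus)
 moreover have "exp (- (2 * r * y)) * q 0 = q 0 * exp (- 2 * r * y)" by simp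
 ultimately show ?thesis by (simp only:)
qed

text \<open>The energy between \<open>y / 2\<close> and \<open>y\<close> is at most
  \<open>q * th\<close> at \<open>y / 2\<close>, which decays exponentially. As the square of
  \<open>th\<close> decreases, this energy controls its value at \<open>y\<close>. The bound on
  \<open>q 0\<close> contributes the factor \<open>r\<^sup>2 / (1 + a)\<close>, which is then
  cancelled; hence \<open>r > 0\<close>.\<close>

lemma th_decay:
 assumes y: "0 < y" "y \<le> 1" and r0: "r > 0"
 shows "(th y)\<^sup>2 * (y powr (1 + a) - (y / 2) powr (1 + a)) \<le> exp (- r * y)"
proof -
 have "q y * th y + r\<^sup>2 * (th y)\<^sup>2 * y powr (1 + a) / (1 + a) \<le> q (y/2) * th (y/2) + r\<^sup>2 * (th y)\<^sup>2 * (y/2) powr (1 + a) / (1 + a)"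
 proof (rule DERIV_nonpos_decreasing_on[of "%t. q t * th t + r\<^sup>2 * (th y)\<^sup>2 * t powr (1 + a) / (1 + a)"
  "%t. - (r\<^sup>2 * t powr a * (th t)\<^sup>2 + t powr (- a) * (q t)\<^sup>2) + r\<^sup>2 * (th y)\<^sup>2 * t powr a"])
  show "continuous_on {0..1} (%t. q t * th t + r\<^sup>2 * (th y)\<^sup>2 * t powr (1 + a) / (1 + a))"
   using a by (intro continuous_on_add c_prod c_powr) auto
  show "((%t. q t * th t + r\<^sup>2 * (th y)\<^sup>2 * t powr (1 + a) / (1 + a)) has_real_derivative
   - (r\<^sup>2 * t powr a * (th t)\<^sup>2 + t powr (- a) * (q t)\<^sup>2) + r\<^sup>2 * (th y)\<^sup>2 * t powr a) (at t)" if "0 < t" "t < 1" for t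
   using a that by (intro DERIV_add d_prod d_powr) auto
  show "- (r\<^sup>2 * t powr a * (th t)\<^sup>2 + t powr (- a) * (q t)\<^sup>2) + r\<^sup>2 * (th y)\<^sup>2 * t powr a \<le> 0" if t: "y / 2 < t" "t < y" for t
  proof -
   have "(th y)\<^sup>2 \<le> (th t)\<^sup>2" using t y by (intro th_sq_antimono) auto
   hence "(r\<^sup>2 * t powr a) * (th y)\<^sup>2 \<le> (r\<^sup>2 * t powr a) * (th t)\<^sup>2" by (intro mult_left_mono) auto
   moreover have "t powr (- a) * (q t)\<^sup>2 \<ge> 0" by simp
   moreover have "r\<^sup>2 * (th y)\<^sup>2 * t powr a = (r\<^sup>2 * t powr a) * (th y)\<^sup>2" by simp
   ultimately show ?thesis by linarith
  qed
 qed (use y in auto)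
 hence "r\<^sup>2 * (th y)\<^sup>2 * (y powr (1 + a) - (y/2) powr (1 + a)) / (1 + a) \<le> q (y/2) * th (y/2)"
  using prod_nonneg[of y] y by (simp add: algebra_simps diff_divide_distrib)
 also have "... \<le> q 0 * exp (- r * y)" using prod_decay[of "y/2"] y by simp
 also have "... \<le> r\<^sup>2 / (1 + a) * exp (- r * y)" using flux_0_le by (intro mult_right_mono) auto
 finally have "r\<^sup>2 / (1 + a) * ((th y)\<^sup>2 * (y powr (1 + a) - (y/2) powr (1 + a))) \<le> r\<^sup>2 / (1 + a) * exp (- r * y)"
  by (simp add: mult_ac)
 thus ?thesis using r0 a by (subst (asm) mult_le_cancel_left_pos) auto
qed

text \<open>The argument of \<open>th_decay\<close> applied to the flux part of the energy density;
  here the factor \<open>r\<^sup>2\<close> stays.\<close>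

lemma q_decay:
 assumes y: "0 < y" "y \<le> 1"
 shows "(q y)\<^sup>2 * (y powr (1 - a) - (y / 2) powr (1 - a)) \<le> (1 - a) * (r\<^sup>2 / (1 + a)) * exp (- r * y)"
proof -
 have a': "1 + - a > 0" using a by simp
 have "q y * th y + (q y)\<^sup>2 * y powr (1 + - a) / (1 + - a) \<le> q (y/2) * th (y/2) + (q y)\<^sup>2 * (y/2) powr (1 + - a) / (1 + - a)"
 proof (rule DERIV_nonpos_decreasing_on[of "%t. q t * th t + (q y)\<^sup>2 * t powr (1 + - a) / (1 + - a)"
  "%t. - (r\<^sup>2 * t powr a * (th t)\<^sup>2 + t powr (- a) * (q t)\<^sup>2) + (q y)\<^sup>2 * t powr (- a)"])
  show "continuous_on {0..1} (%t. q t * th t + (q y)\<^sup>2 * t powr (1 + - a) / (1 + - a))"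
   by (intro continuous_on_add c_prod c_powr a')
  show "((%t. q t * th t + (q y)\<^sup>2 * t powr (1 + - a) / (1 + - a)) has_real_derivative
   - (r\<^sup>2 * t powr a * (th t)\<^sup>2 + t powr (- a) * (q t)\<^sup>2) + (q y)\<^sup>2 * t powr (- a)) (at t)" if "0 < t" "t < 1" for t
   using that by (intro DERIV_add d_prod d_powr a') auto
  show "- (r\<^sup>2 * t powr a * (th t)\<^sup>2 + t powr (- a) * (q t)\<^sup>2) + (q y)\<^sup>2 * t powr (- a) \<le> 0" if t: "y / 2 < t" "t < y" for t
  proof -
   have "(q y)\<^sup>2 \<le> (q t)\<^sup>2" using t y by (intro q_sq_antimono) auto
   hence "t powr (- a) * (q y)\<^sup>2 \<le> t powr (- a) * (q t)\<^sup>2" by (intro mult_left_mono) auto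
   moreover have "r\<^sup>2 * t powr a * (th t)\<^sup>2 \<ge> 0" by simp
   moreover have "(q y)\<^sup>2 * t powr (- a) = t powr (- a) * (q y)\<^sup>2" by simp
   ultimately show ?thesis by linarith
  qed
 qed (use y in auto)
 hence "(q y)\<^sup>2 * (y powr (1 - a) - (y/2) powr (1 - a)) / (1 - a) \<le> q (y/2) * th (y/2)"
  using prod_nonneg[of y] y by (simp add: algebra_simps diff_divide_distrib)
 also have "... \<le> q 0 * exp (- r * y)" using prod_decay[of "y/2"] y by simp
 also have "... \<le> r\<^sup>2 / (1 + a) * exp (- r * y)" using flux_0_le by (intro mult_right_mono) auto
 finally show ?thesis using a by (simp add: field_simps)
qed

text \<open>The density is minus the derivative of \<open>q * th\<close>, and the boundary values
  leave \<open>q 0\<close>. This is how the symbol arises as the energy of a single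
  frequency.\<close>

lemma energy:
 "(\<integral>\<^sup>+y\<in>{0<..<1}. ennreal (r\<^sup>2 * y powr a * (th y)\<^sup>2 + y powr (- a) * (q y)\<^sup>2) \<partial>lborel) = ennreal (q 0)"
proof -
 let ?f = "%y. r\<^sup>2 * y powr a * (th y)\<^sup>2 + y powr (- a) * (q y)\<^sup>2"
 have "(?f has_integral (- (q 1 * th 1) - - (q 0 * th 0))) {0..1}"
 proof (rule fundamental_theorem_of_calculus_interior)
  show "continuous_on {0..1} (%y. - (q y * th y))" by (intro continuous_intros c_q c_th)
  show "((%y. - (q y * th y)) has_vector_derivative ?f y) (at y)" if "y \<in> {0<..<1}" for y
   unfolding has_real_derivative_iff_has_vector_derivative[symmetric]
   by (rule DERIV_cong[OF DERIV_minus[OF d_prod]]) (use that in auto)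
 qed auto
 hence "(?f has_integral q 0) {0<..<1}" by (simp add: q_1 th_0 has_integral_Icc_iff_Ioo)
 thus ?thesis by (intro nn_integral_has_integral_lebesgue') (auto intro!: add_nonneg_nonneg)
qed

end

lemma neumann_profile_Bessel:
 assumes s: "0 < s" "s < 1" and r: "r \<ge> 0"
 shows "neumann_profile (1 - 2 * s) r (profile s r) (flux s r)"
proof
 show "(profile s r has_real_derivative - (y powr (- (1 - 2 * s)) * flux s r y)) (at y)" if "0 < y" "y < 1" for y
  using DERIV_profile[OF s that(1)] by simp
qed (use s r DERIV_flux continuous_profile_flux profile_0 flux_1 in auto)

section \<open>Extensions by superposition of plane waves\<close>

lemma poly_exp_bounded:
 assumes \<delta>: "\<delta> > (0::real)"
 shows "\<exists>C>0. \<forall>r\<ge>0. (1 + r) ^ j * exp (- \<delta> * r) \<le> C"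
proof (intro exI[of _ "fact j / \<delta> ^ j * exp \<delta>"] conjI allI impI)
 show "0 < fact j / \<delta> ^ j * exp \<delta>" using \<delta> by simp
 fix r :: real assume r: "0 \<le> r"
 have "(\<delta> * (1 + r)) ^ j / fact j \<le> exp (\<delta> * (1 + r))"
  using r \<delta> by (intro power_over_fact_le_exp) simp
 hence "\<delta> ^ j * (1 + r) ^ j \<le> fact j * exp (\<delta> * (1 + r))"
  by (simp add: power_mult_distrib pos_divide_le_eq mult.commute)
 hence "(1 + r) ^ j \<le> fact j * exp (\<delta> * (1 + r)) / \<delta> ^ j"
  using \<delta> by (simp add: pos_le_divide_eq mult.commute)
 hence "(1 + r) ^ j \<le> fact j / \<delta> ^ j * exp (\<delta> * (1 + r))" by simp
 hence "(1 + r) ^ j * exp (- \<delta> * r) \<le> fact j / \<delta> ^ j * exp (\<delta> * (1 + r)) * exp (- \<delta> * r)"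
  by (intro mult_right_mono) auto
 also have "... = fact j / \<delta> ^ j * exp \<delta>"
  by (simp add: mult.assoc exp_add[symmetric] algebra_simps)
 finally show "(1 + r) ^ j * exp (- \<delta> * r) \<le> fact j / \<delta> ^ j * exp \<delta>" .
qed

text \<open>A fixed integrable function of the frequency; the decay of the multipliers is recorded
  as a multiple of it, which then serves for dominated convergence and Fubini.\<close>

definition weight :: "'a::euclidean_space => real" where
 "weight xi = 1 / (1 + (norm xi)\<^sup>2) ^ DIM('a)"

lemma weight_pos: "weight xi > 0"
 unfolding weight_def by (intro divide_pos_pos zero_less_power add_pos_nonneg) auto

lemma weight_integrable: "integrable lborel (weight :: 'a::euclidean_space => real)"
 using integrable_inverse_one_plus_norm[where 'a='a] by (simp add: weight_def[abs_def])

text \<open>The exponential absorbs \<open>2 * DIM('a)\<close> further powers of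
  \<open>1 + norm xi\<close>, which dominate the denominator of \<open>weight\<close>.\<close>

lemma poly_exp_weight:
 assumes \<delta>: "\<delta> > (0::real)"
 shows "\<exists>C>0. \<forall>xi::'a::euclidean_space. (1 + norm xi) ^ m * exp (- \<delta> * norm xi) \<le> C * weight xi"
proof -
 obtain C where C: "C > 0" "!!r. r \<ge> 0 ==> (1 + r) ^ (m + 2 * DIM('a)) * exp (- \<delta> * r) \<le> C"
  using poly_exp_bounded[OF \<delta>, of "m + 2 * DIM('a)"] by blast
 have "(1 + norm xi) ^ m * exp (- \<delta> * norm xi) \<le> C * weight xi" for xi :: 'a
 proof -
  define r where "r = norm xi"
  have r: "r \<ge> 0" by (simp add: r_def)
  have "(1 + r\<^sup>2) ^ DIM('a) \<le> ((1 + r)\<^sup>2) ^ DIM('a)"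
   using r by (intro power_mono) (auto simp: power2_sum)
  also have "... = (1 + r) ^ (2 * DIM('a))" by (simp add: power_mult)
  finally have "(1 + r) ^ m * exp (- \<delta> * r) * (1 + r\<^sup>2) ^ DIM('a) \<le> (1 + r) ^ m * exp (- \<delta> * r) * (1 + r) ^ (2 * DIM('a))"
   using r by (intro mult_left_mono) auto
  also have "... = (1 + r) ^ (m + 2 * DIM('a)) * exp (- \<delta> * r)" by (simp add: power_add)
  also have "... \<le> C" by (rule C(2)[OF r])
  finally have "(1 + r) ^ m * exp (- \<delta> * r) * (1 + r\<^sup>2) ^ DIM('a) \<le> C" .
  moreover have "(1 + r\<^sup>2) ^ DIM('a) > 0" by (intro zero_less_power add_pos_nonneg) auto
  ultimately show ?thesis by (simp add: weight_def r_def[symmetric] field_simps)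
 qed
 thus ?thesis using C(1) by blast
qed

text \<open>Joint measurability in position and height, required to integrate the horizontal slices
  over the slab.\<close>

lemma ift_param_measurable:
 fixes F :: "real => 'a::euclidean_space => complex"
 assumes [measurable]: "(%p. F (fst p) (snd p)) \<in> borel_measurable (borel \<Otimes>\<^sub>M borel)"
 shows "(%p::'a \<times> real. ift (F (snd p)) (fst p)) \<in> borel_measurable borel"
proof -
 have "(%q::('a \<times> real) \<times> 'a. F (snd (fst q)) (snd q)) \<in> borel_measurable (borel \<Otimes>\<^sub>M lborel)"
  using measurable_compose[of "%q::('a \<times> real) \<times> 'a. (snd (fst q), snd q)" "borel \<Otimes>\<^sub>M lborel" "borel \<Otimes>\<^sub>M borel", OF _ assms]
  by (simp add: borel_prod[symmetric])
 hence "(%(p, xi). F (snd p) xi * exp (\<i> * of_real (fst p \<bullet> xi))) \<in> borel_measurable (borel \<Otimes>\<^sub>M (lborel::'a measure))"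
  unfolding split_beta' by (intro borel_measurable_times) (simp_all add: borel_prod[symmetric])
 thus ?thesis unfolding ift_def by (rule lborel.borel_measurable_lebesgue_integral)
qed

lemma bounded_absolutely_integrable:
 fixes f :: "'d::euclidean_space => 'e::euclidean_space"
 assumes [measurable]: "f \<in> borel_measurable borel" and K: "compact K" and b: "!!x. x \<in> K ==> norm (f x) \<le> B"
 shows "f absolutely_integrable_on K"
proof -
 have [measurable]: "K \<in> sets borel" using K by (simp add: borel_compact)
 have I: "integrable lborel (%x. indicator K x *\<^sub>R f x)"
 proof (rule Bochner_Integration.integrable_bound[OF borel_integrable_compact[OF K continuous_on_const[of _ B]]])
  show "AE x in lborel. norm (indicat_real K x *\<^sub>R f x) \<le> norm (indicat_real K x *\<^sub>R B)"
   using b by (intro AE_I2) (auto simp: indicator_def intro: order_trans[OF _ abs_ge_self])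
 qed measurable
 thus ?thesis unfolding set_integrable_def
  by (rule integrable_completion[OF borel_measurable_integrable[OF I], THEN iffD2])
qed

text \<open>A lower bound, uniform for \<open>y \<ge> \<delta>\<close>, of the factors on the left
  of \<open>th_decay\<close> and \<open>q_decay\<close>.\<close>

lemma powr_gap:
 fixes b :: real
 assumes b: "b > 0" and y: "0 < \<delta>" "\<delta> \<le> y"
 shows "\<delta> powr b * (1 - (1/2) powr b) \<le> y powr b - (y / 2) powr b" "0 < \<delta> powr b * (1 - (1/2) powr b)"
proof -
 have h: "(1/2::real) powr b < 1" using powr_less_mono2[of b "1/2" 1] b by simp
 have "(y / 2) powr b = y powr b * (1/2) powr b" using powr_mult[of y "1/2" b] y by simp
 hence "y powr b - (y / 2) powr b = y powr b * (1 - (1/2) powr b)" by (simp add: algebra_simps)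
 moreover have "\<delta> powr b \<le> y powr b" using y b by (intro powr_mono2) auto
 ultimately show "\<delta> powr b * (1 - (1/2) powr b) \<le> y powr b - (y / 2) powr b" using h by (simp add: mult_right_mono)
 show "0 < \<delta> powr b * (1 - (1/2) powr b)" using h y by simp
qed

context
 fixes s :: real
 assumes s: "0 < s" "s < 1"
begin

lemma profile_interpret: "r \<ge> 0 ==> neumann_profile (1 - 2 * s) r (profile s r) (flux s r)"
 by (rule neumann_profile_Bessel[OF s])

text \<open>Square roots of the two decay bounds, which halves the exponent. The bound is uniform
  only away from \<open>y = 0\<close>, where the profile is 1 for every \<open>r\<close>.\<close>

lemma profile_flux_decay:
 assumes \<delta>: "0 < \<delta>"
 shows "\<exists>C>0. \<forall>y r. \<delta> \<le> y --> y \<le> 1 --> 0 \<le> r -->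
  \<bar>profile s r y\<bar> \<le> C * exp (- (\<delta>/2) * r) \<and> \<bar>flux s r y\<bar> \<le> C * (1 + r) * exp (- (\<delta>/2) * r)"
proof -
 define a where "a = 1 - 2 * s"
 have a: "-1 < a" "a < 1" using s by (auto simp: a_def)
 define k1 where "k1 = \<delta> powr (1 + a) * (1 - (1/2) powr (1 + a))"
 define k2 where "k2 = \<delta> powr (1 - a) * (1 - (1/2) powr (1 - a))"
 have k: "k1 > 0" "k2 > 0" unfolding k1_def k2_def using powr_gap(2)[OF _ \<delta> order_refl] a by auto
 define C1 where "C1 = sqrt (1 / k1)"
 define C2 where "C2 = sqrt ((1 - a) / (1 + a) / k2)"
 have C12: "C1 > 0" "C2 > 0" using k a by (auto simp: C1_def C2_def)
 define C where "C = C1 + C2 + 1"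
 have C: "C > 0" using C12 by (simp add: C_def)
 have main: "\<bar>profile s r y\<bar> \<le> C * exp (- (\<delta>/2) * r) \<and> \<bar>flux s r y\<bar> \<le> C * (1 + r) * exp (- (\<delta>/2) * r)"
  if y: "\<delta> \<le> y" "y \<le> 1" and r: "0 \<le> r" for y r
 proof -
  interpret P: neumann_profile a r "profile s r" "flux s r"
   unfolding a_def by (rule profile_interpret[OF r])
  have y0: "0 < y" using \<delta> y by simp
  have E: "exp (- r * y) \<le> (exp (- (\<delta>/2) * r))\<^sup>2"
  proof -
   have "- r * y \<le> - \<delta> * r" using mult_right_mono[OF y(1) r] by (simp add: mult.commute)
   thus ?thesis by (simp add: power2_eq_square exp_add[symmetric])
  qed
  let ?E = "exp (- (\<delta>/2) * r)"
  have th: "\<bar>profile s r y\<bar> \<le> C * ?E"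
  proof (cases "r = 0")
   case True thus ?thesis using P.th_le_1[of y] y0 y C12 by (simp add: C_def)
  next
   case False
   have "(profile s r y)\<^sup>2 * k1 \<le> (profile s r y)\<^sup>2 * (y powr (1 + a) - (y / 2) powr (1 + a))"
    unfolding k1_def using powr_gap(1)[of "1 + a" \<delta> y] a \<delta> y by (intro mult_left_mono) auto
   also have "... \<le> exp (- r * y)" using P.th_decay[OF y0 y(2)] False r by simp
   also have "... \<le> ?E\<^sup>2" by (rule E)
   finally have "(profile s r y)\<^sup>2 \<le> (1 / k1) * ?E\<^sup>2" using k by (simp add: field_simps)
   also have "... = (C1 * ?E)\<^sup>2" using k by (simp add: C1_def power_mult_distrib)
   finally have "\<bar>profile s r y\<bar> \<le> C1 * ?E" using C12 by (simp add: power2_le_iff_abs_le)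
   also have "... \<le> C * ?E" using C12 by (intro mult_right_mono) (auto simp: C_def)
   finally show ?thesis .
  qed
  have "(flux s r y)\<^sup>2 * k2 \<le> (flux s r y)\<^sup>2 * (y powr (1 - a) - (y / 2) powr (1 - a))"
   unfolding k2_def using powr_gap(1)[of "1 - a" \<delta> y] a \<delta> y by (intro mult_left_mono) auto
  also have "... \<le> (1 - a) * (r\<^sup>2 / (1 + a)) * exp (- r * y)" by (rule P.q_decay[OF y0 y(2)])
  also have "... \<le> (1 - a) * (r\<^sup>2 / (1 + a)) * ?E\<^sup>2" using a E by (intro mult_left_mono) auto
  finally have "(flux s r y)\<^sup>2 \<le> (1 - a) * (r\<^sup>2 / (1 + a)) * ?E\<^sup>2 / k2"
   unfolding pos_le_divide_eq[OF k(2)] .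
  also have "... = (1 - a) / (1 + a) / k2 * (r\<^sup>2 * ?E\<^sup>2)" by simp
  also have "... = (C2 * (r * ?E))\<^sup>2" using k a by (simp add: C2_def power_mult_distrib)
  finally have "\<bar>flux s r y\<bar> \<le> C2 * (r * ?E)" using C12 r by (simp add: power2_le_iff_abs_le)
  also have "... \<le> C * ((1 + r) * ?E)" using C12 r by (intro mult_mono) (auto simp: C_def)
  finally show ?thesis using th by (simp add: mult_ac)
 qed
 show ?thesis using C main by blast
qed

section \<open>Multipliers and superposed plane waves\<close>

text \<open>The Fourier multiplier of the derivative in direction \<open>v\<close>: the imaginary
  part belongs to the horizontal component, the real part to the vertical one. For basis vectors one
  of the two is 0.\<close>

definition gmul :: "'a::euclidean_space \<times> real => real => 'a => complex" where
 "gmul v y xi = Complex (- (y powr (2 * s - 1) * flux s (norm xi) y) * snd v) ((fst v \<bullet> xi) * profile s (norm xi) y)"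

lemma gmul_decay:
 assumes \<delta>: "0 < \<delta>"
 shows "\<exists>C>0. \<forall>y xi. \<delta> \<le> y --> y \<le> 1 --> \<bar>profile s (norm xi) y\<bar> \<le> C * weight xi \<and>
  (\<forall>v\<in>Basis. norm (gmul v y (xi::'a::euclidean_space)) \<le> C * weight xi)"
proof -
 obtain C1 where C1: "C1 > 0" "!!y r. \<delta> \<le> y ==> y \<le> 1 ==> 0 \<le> r ==>
  \<bar>profile s r y\<bar> \<le> C1 * exp (- (\<delta>/2) * r) \<and> \<bar>flux s r y\<bar> \<le> C1 * (1 + r) * exp (- (\<delta>/2) * r)"
  using profile_flux_decay[OF \<delta>] by blast
 obtain C2 where C2: "C2 > 0" "!!xi::'a. (1 + norm xi) ^ 1 * exp (- (\<delta>/2) * norm xi) \<le> C2 * weight xi"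
  using poly_exp_weight[of "\<delta>/2" 1] \<delta> by (metis half_gt_zero)
 \<comment> \<open>\<open>P\<close> bounds \<open>y powr (2 * s - 1)\<close> on
   \<open>{\<delta>..1}\<close> for either sign of the exponent.\<close>
 define P where "P = 1 + \<delta> powr (2 * s - 1)"
 have P: "P \<ge> 1" by (simp add: P_def)
 define C where "C = P * C1 * C2"
 have CC: "C1 * C2 \<le> C" unfolding C_def using P C1 C2 by simp
 have C: "C > 0" using P C1 C2 by (simp add: C_def)
 have main: "\<bar>profile s (norm xi) y\<bar> \<le> C * weight xi \<and> (\<forall>v\<in>Basis. norm (gmul v y xi) \<le> C * weight xi)"
  if y: "\<delta> \<le> y" "y \<le> 1" for y and xi :: 'a
 proof -
  let ?r = "norm xi" let ?E = "exp (- (\<delta>/2) * norm xi)"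
  have b: "\<bar>profile s ?r y\<bar> \<le> C1 * ?E" "\<bar>flux s ?r y\<bar> \<le> C1 * (1 + ?r) * ?E"
   using C1(2)[OF y norm_ge_zero] by auto
  have W: "(1 + ?r) * ?E \<le> C2 * weight xi" using C2(2)[of xi] by simp
  have W': "C1 * ((1 + ?r) * ?E) \<le> C * weight xi"
  proof -
   have "C1 * ((1 + ?r) * ?E) \<le> C1 * (C2 * weight xi)" using W C1 by (intro mult_left_mono) auto
   also have "... \<le> C * weight xi" using CC weight_pos[of xi] by (simp add: mult.assoc[symmetric] mult_right_mono)
   finally show ?thesis .
  qed
  have p: "(1 + ?r) * \<bar>profile s ?r y\<bar> \<le> C * weight xi"
  proof -
   have "(1 + ?r) * \<bar>profile s ?r y\<bar> \<le> (1 + ?r) * (C1 * ?E)" using b by (intro mult_left_mono) auto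
   thus ?thesis using W' by (simp add: mult_ac)
  qed
  have "1 * \<bar>profile s ?r y\<bar> \<le> (1 + ?r) * \<bar>profile s ?r y\<bar>" by (intro mult_right_mono) auto
  hence 1: "\<bar>profile s ?r y\<bar> \<le> C * weight xi" using p by simp
  have 2: "norm (gmul v y xi) \<le> C * weight xi" if v: "v \<in> Basis" for v :: "'a \<times> real"
  proof -
   from v consider b where "b \<in> Basis" "v = (b, 0)" | "v = (0, 1)" by (auto simp: Basis_prod_def)
   thus ?thesis
   proof cases
    case 1
    have "\<bar>b \<bullet> xi\<bar> \<le> 1 + ?r" using Cauchy_Schwarz_ineq2[of b xi] 1 by simp
    hence "\<bar>b \<bullet> xi\<bar> * \<bar>profile s ?r y\<bar> \<le> (1 + ?r) * \<bar>profile s ?r y\<bar>" by (intro mult_right_mono) auto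
    thus ?thesis using p 1 by (simp add: gmul_def cmod_def abs_mult)
   next
    case 2
    have "y powr (2 * s - 1) \<le> P"
    proof (cases "2 * s - 1 \<ge> 0")
     case True
     hence "y powr (2 * s - 1) \<le> 1" using y \<delta> by (intro powr_le1) auto
     thus ?thesis using P by simp
    next
     case False
     hence "y powr (2 * s - 1) \<le> \<delta> powr (2 * s - 1)" using y \<delta> by (intro powr_mono2') auto
     thus ?thesis by (simp add: P_def)
    qed
    hence "y powr (2 * s - 1) * \<bar>flux s ?r y\<bar> \<le> P * (C1 * ((1 + ?r) * ?E))"
     using b P by (intro mult_mono) (auto simp: mult_ac)
    also have "... \<le> P * (C1 * (C2 * weight xi))" using W C1 P by (intro mult_left_mono) auto
    finally show ?thesis using 2 by (simp add: gmul_def cmod_def abs_mult C_def mult_ac)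
   qed
  qed
  show ?thesis using 1 2 by blast
 qed
 show ?thesis using C main by blast
qed

lemma gmul_measurable[measurable]:
 assumes [measurable]: "f \<in> borel_measurable M" "g \<in> borel_measurable M"
 shows "(%x. gmul v (f x) (g x)) \<in> borel_measurable M"
proof -
 note [measurable] = profile_measurable[OF s]
 have "(%x. gmul v (f x) (g x)) = (%x. of_real (- (f x powr (2 * s - 1) * flux s (norm (g x)) (f x)) * snd v)
  + \<i> * of_real ((fst v \<bullet> g x) * profile s (norm (g x)) (f x)))"
  by (simp add: gmul_def complex_eq_iff fun_eq_iff)
 thus ?thesis by simp
qed

text \<open>Taking the real part allows arbitrary amplitudes, without Hermitian symmetry, and does
  not spoil the energy bound obtained from Plancherel.\<close>

definition extn :: "('a::euclidean_space => complex) => 'a \<times> real => real" where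
 "extn c p = Re (ift (%xi. of_real (profile s (norm xi) (snd p)) * c xi) (fst p))"

definition gextn :: "('a::euclidean_space => complex) => 'a \<times> real => 'a \<times> real" where
 "gextn c p = (\<Sum>v\<in>Basis. Re (ift (%xi. gmul v (snd p) xi * c xi) (fst p)) *\<^sub>R v)"

lemma gextn_inner: "v \<in> Basis ==> gextn c p \<bullet> v = Re (ift (%xi. gmul v (snd p) xi * c xi) (fst p))"
 unfolding gextn_def by (rule inner_sum_left_Basis)

context
 fixes c :: "'a::euclidean_space => complex" and M :: real
 assumes c_meas[measurable]: "c \<in> borel_measurable borel" and c_bound: "!!xi. norm (c xi) \<le> M"
begin

lemma M_nonneg: "M \<ge> 0" using c_bound[of 0] norm_ge_zero order_trans by blast

lemma extn_measurable[measurable]: "extn c \<in> borel_measurable borel"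
proof -
 note [measurable] = profile_measurable[OF s]
 have "(%p::'a \<times> real. ift ((%y xi. of_real (profile s (norm xi) y) * c xi) (snd p)) (fst p)) \<in> borel_measurable borel"
  by (rule ift_param_measurable) measurable
 thus ?thesis unfolding extn_def[abs_def] by measurable
qed

lemma gextn_inner_measurable: "v \<in> Basis ==> (%p. gextn c p \<bullet> v) \<in> borel_measurable borel"
proof -
 assume v: "v \<in> Basis"
 have "(%p::'a \<times> real. ift ((%y xi. gmul v y xi * c xi) (snd p)) (fst p)) \<in> borel_measurable borel"
  by (rule ift_param_measurable) measurable
 thus ?thesis unfolding gextn_inner[OF v] by measurable
qed

lemma gextn_measurable[measurable]: "gextn c \<in> borel_measurable borel"
 using gextn_inner_measurable by (subst borel_measurable_euclidean_space) auto

lemma integrable_multiplier: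
 assumes y: "0 < y" "y < 1"
 shows "integrable lborel (%xi::'a. of_real (profile s (norm xi) y) * c xi)"
  "v \<in> Basis ==> integrable lborel (%xi::'a. gmul v y xi * c xi)"
proof -
 note [measurable] = profile_measurable[OF s]
 obtain C where C: "C > 0" "!!xi::'a. \<bar>profile s (norm xi) y\<bar> \<le> C * weight xi"
  "!!xi::'a. !!v. v \<in> Basis ==> norm (gmul v y xi) \<le> C * weight xi"
  using gmul_decay[OF y(1), where 'a='a] y by (meson less_imp_le order_refl)
 have i: "integrable lborel (%xi::'a. C * weight xi * M)"
  by (intro integrable_mult_left integrable_mult_right weight_integrable)
 have n: "0 \<le> C * weight xi" for xi :: 'a using C(1) weight_pos[of xi] by simp
 show "integrable lborel (%xi::'a. of_real (profile s (norm xi) y) * c xi)"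
 proof (rule Bochner_Integration.integrable_bound[OF i])
  show "AE xi in lborel. norm (of_real (profile s (norm xi) y) * c xi) \<le> norm (C * weight xi * M)"
  proof (rule AE_I2)
   fix xi :: 'a
   have "norm (of_real (profile s (norm xi) y) * c xi) \<le> C * weight xi * M"
    unfolding norm_mult using C(2)[of xi] c_bound[of xi] n[of xi] by (intro mult_mono) auto
   also have "... \<le> norm (C * weight xi * M)" by simp
   finally show "norm (of_real (profile s (norm xi) y) * c xi) \<le> norm (C * weight xi * M)" .
  qed
 qed measurable
 show "integrable lborel (%xi::'a. gmul v y xi * c xi)" if v: "v \<in> Basis"
 proof (rule Bochner_Integration.integrable_bound[OF i])
  show "AE xi in lborel. norm (gmul v y xi * c xi) \<le> norm (C * weight xi * M)"
  proof (rule AE_I2)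
   fix xi :: 'a
   have "norm (gmul v y xi * c xi) \<le> C * weight xi * M"
    unfolding norm_mult using C(3)[OF v, of xi] c_bound[of xi] n[of xi] by (intro mult_mono) auto
   also have "... \<le> norm (C * weight xi * M)" by simp
   finally show "norm (gmul v y xi * c xi) \<le> norm (C * weight xi * M)" .
  qed
 qed measurable
qed

definition wave :: "'a => 'a \<times> real => real" where
 "wave xi p = Re (of_real (profile s (norm xi) (snd p)) * c xi * exp (\<i> * of_real (fst p \<bullet> xi)))"

definition dwave :: "'a => 'a \<times> real => 'a \<times> real => real" where
 "dwave xi p v = Re (gmul v (snd p) xi * c xi * exp (\<i> * of_real (fst p \<bullet> xi)))"

lemma wave_has_derivative:
 assumes p: "p \<in> slab"
 shows "(wave xi has_derivative dwave xi p) (at p)"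
proof -
 have y: "0 < snd p" using p by (auto simp: slab_def)
 have 1: "((%p::'a \<times> real. profile s (norm xi) (snd p)) has_derivative (%v. - (snd p powr (2 * s - 1) * flux s (norm xi) (snd p)) * snd v)) (at p)"
  by (rule has_derivative_compose[where f=snd and g="profile s (norm xi)", OF _ DERIV_profile[OF s y, unfolded has_field_derivative_def]])
   (auto intro!: derivative_eq_intros)
 have 2: "((%p::'a \<times> real. Re (c xi) * cos (fst p \<bullet> xi) - Im (c xi) * sin (fst p \<bullet> xi)) has_derivative
   (%v. - Re (c xi) * sin (fst p \<bullet> xi) * (fst v \<bullet> xi) - Im (c xi) * cos (fst p \<bullet> xi) * (fst v \<bullet> xi))) (at p)"
  by (auto intro!: derivative_eq_intros simp: algebra_simps)
 have w: "wave xi = (%p. profile s (norm xi) (snd p) * (Re (c xi) * cos (fst p \<bullet> xi) - Im (c xi) * sin (fst p \<bullet> xi)))"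
  by (simp add: wave_def fun_eq_iff cis_conv_exp[symmetric] algebra_simps)
 have d: "dwave xi p = (%v. profile s (norm xi) (snd p) * (- Re (c xi) * sin (fst p \<bullet> xi) * (fst v \<bullet> xi) - Im (c xi) * cos (fst p \<bullet> xi) * (fst v \<bullet> xi))
  + (- (snd p powr (2 * s - 1) * flux s (norm xi) (snd p)) * snd v) * (Re (c xi) * cos (fst p \<bullet> xi) - Im (c xi) * sin (fst p \<bullet> xi)))"
  by (simp add: dwave_def gmul_def fun_eq_iff cis_conv_exp[symmetric] algebra_simps)
 show ?thesis unfolding w d by (rule has_derivative_mult[OF 1 2])
qed

lemma dwave_continuous: "continuous_on slab (%p. dwave xi p v)"
proof -
 have c1: "continuous_on slab (%p::'a\<times>real. profile s (norm xi) (snd p))" "continuous_on slab (%p::'a\<times>real. flux s (norm xi) (snd p))"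
  by (rule continuous_on_compose2[OF continuous_profile_flux(1)[OF s]] continuous_on_compose2[OF continuous_profile_flux(2)[OF s]];
    auto intro!: continuous_intros simp: slab_def)+
 have c2: "continuous_on slab (%p::'a\<times>real. snd p powr (2 * s - 1))"
  by (intro continuous_intros) (auto simp: slab_def)
 have d: "(%p. dwave xi p v) = (%p. profile s (norm xi) (snd p) * (- Re (c xi) * sin (fst p \<bullet> xi) * (fst v \<bullet> xi) - Im (c xi) * cos (fst p \<bullet> xi) * (fst v \<bullet> xi))
  + (- (snd p powr (2 * s - 1) * flux s (norm xi) (snd p)) * snd v) * (Re (c xi) * cos (fst p \<bullet> xi) - Im (c xi) * sin (fst p \<bullet> xi)))"
  by (simp add: dwave_def gmul_def fun_eq_iff cis_conv_exp[symmetric] algebra_simps)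
 show ?thesis unfolding d by (intro continuous_intros c1 c2)
qed

lemma wave_measurable:
 "(%(p, xi). wave xi p) \<in> borel_measurable (lborel \<Otimes>\<^sub>M lborel)"
 "(%(p, xi). dwave xi p v) \<in> borel_measurable (lborel \<Otimes>\<^sub>M lborel)"
proof -
 note [measurable] = profile_measurable[OF s]
 have [measurable]: "fst \<in> borel_measurable (borel :: ('a \<times> real) measure)" "snd \<in> borel_measurable (borel :: ('a \<times> real) measure)"
  by (intro borel_measurable_continuous_onI continuous_intros)+
 show "(%(p, xi). wave xi p) \<in> borel_measurable (lborel \<Otimes>\<^sub>M lborel)"
  "(%(p, xi). dwave xi p v) \<in> borel_measurable (lborel \<Otimes>\<^sub>M lborel)"
  unfolding wave_def dwave_def by measurable
qed

lemma extn_eq_wave: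
 assumes "0 < snd p" "snd p < 1"
 shows "extn c p = (LINT xi|lborel. wave xi p)" "v \<in> Basis ==> gextn c p \<bullet> v = (LINT xi|lborel. dwave xi p v)"
proof -
 have i: "integrable lborel (%xi. f xi * exp (\<i> * of_real (x \<bullet> xi)))" if "integrable lborel f" for f and x :: 'a
  by (rule Bochner_Integration.integrable_bound[OF integrable_norm[OF that]])
   (use borel_measurable_integrable[OF that] in \<open>auto simp: norm_mult norm_exp_ii\<close>)
 show "extn c p = (LINT xi|lborel. wave xi p)"
  unfolding extn_def ift_def wave_def by (rule integral_Re[symmetric, OF i[OF integrable_multiplier(1)[OF assms]]])
 show "gextn c p \<bullet> v = (LINT xi|lborel. dwave xi p v)" if v: "v \<in> Basis"
  unfolding gextn_inner[OF v] ift_def dwave_def by (rule integral_Re[symmetric, OF i[OF integrable_multiplier(2)[OF assms v]]])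
qed

lemma compact_slab_bounds:
 assumes K: "compact K" "K \<subseteq> (slab :: ('a \<times> real) set)"
 shows "\<exists>C>0. \<forall>p\<in>K. \<forall>xi. \<bar>wave xi p\<bar> \<le> C * weight xi \<and> (\<forall>v\<in>Basis. \<bar>dwave xi p v\<bar> \<le> C * weight xi)"
proof -
 \<comment> \<open>A compact subset of the slab stays away from \<open>y = 0\<close>, where the
   decay in the frequency is lost.\<close>
 have "\<exists>\<delta>>0. \<forall>p\<in>K. \<delta> \<le> snd p"
 proof (cases "K = {}")
  case False
  obtain p0 where p0: "p0 \<in> K" "\<forall>p\<in>K. snd p0 \<le> snd p"
   using continuous_attains_inf[OF K(1) False continuous_on_snd[OF continuous_on_id]] by blast
  have "0 < snd p0" using p0 K by (auto simp: slab_def)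
  thus ?thesis using p0 by blast
 qed (auto intro: exI[of _ 1])
 then obtain \<delta> where \<delta>: "\<delta> > 0" "\<forall>p\<in>K. \<delta> \<le> snd p" by blast
 obtain C where C: "C > 0" "!!y xi::'a. \<delta> \<le> y ==> y \<le> 1 ==> \<bar>profile s (norm xi) y\<bar> \<le> C * weight xi \<and>
  (\<forall>v\<in>Basis. norm (gmul v y xi) \<le> C * weight xi)"
  using gmul_decay[OF \<delta>(1), where 'a='a] by blast
 have "\<bar>wave xi p\<bar> \<le> (C * (M + 1)) * weight xi \<and> (\<forall>v\<in>Basis. \<bar>dwave xi p v\<bar> \<le> (C * (M + 1)) * weight xi)" if p: "p \<in> K" for p xi
 proof -
  have y: "\<delta> \<le> snd p" "snd p \<le> 1" using p \<delta> K by (auto simp: slab_def)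
  have "norm z * norm (c xi) \<le> (C * weight xi) * (M + 1)" if "norm z \<le> C * weight xi" for z :: complex
   using that c_bound[of xi] C(1) weight_pos[of xi] M_nonneg by (intro mult_mono) auto
  hence *: "\<bar>Re (z * c xi * exp (\<i> * of_real (fst p \<bullet> xi)))\<bar> \<le> (C * weight xi) * (M + 1)" if "norm z \<le> C * weight xi" for z
   using that abs_Re_le_cmod[of "z * c xi * exp (\<i> * of_real (fst p \<bullet> xi))"] by (fastforce simp: norm_mult norm_exp_ii)
  show ?thesis
   using *[of "of_real (profile s (norm xi) (snd p))"] *[of "gmul _ (snd p) xi"] C(2)[OF y, of xi]
   unfolding wave_def dwave_def by (simp add: mult_ac)
 qed
 moreover have "C * (M + 1) > 0" using C M_nonneg by simp
 ultimately show ?thesis by blast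
qed

text \<open>For each frequency the wave is differentiable in the classical sense and
  \<open>classical_ibp\<close> applies. Fubini exchanges the frequency integral with the integral
  against the test function, since on its compact support all waves are dominated by a multiple of
  \<open>weight\<close>.\<close>

lemma extn_has_weak_gradient_slab: "has_weak_gradient slab (extn c) (gextn c)"
 unfolding has_weak_gradient_def
proof (intro conjI allI impI ballI)
 have bd: "\<exists>B. \<forall>p\<in>K. \<bar>extn c p\<bar> \<le> B \<and> (\<forall>v\<in>Basis. \<bar>gextn c p \<bullet> v\<bar> \<le> B)" if K: "compact K" "K \<subseteq> slab" for K
 proof -
  obtain C where C: "C > 0" "\<forall>p\<in>K. \<forall>xi. \<bar>wave xi p\<bar> \<le> C * weight xi \<and> (\<forall>v\<in>Basis. \<bar>dwave xi p v\<bar> \<le> C * weight xi)"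
   using compact_slab_bounds[OF K] by blast
  have i: "integrable lborel (%xi::'a. C * weight xi)" by (intro integrable_mult_right weight_integrable)
  \<comment> \<open>If \<open>f\<close> is not integrable, its integral is 0 by convention and the
    bound holds trivially; so measurability of \<open>f\<close> need not be tracked.\<close>
  have le: "\<bar>LINT xi|lborel. f xi\<bar> \<le> (LINT xi|lborel. C * weight (xi::'a))" if "!!xi. \<bar>f xi\<bar> \<le> C * weight xi" for f :: "'a => real"
  proof (cases "integrable lborel f")
   case True
   have "norm (LINT xi|lborel. f xi) \<le> (LINT xi|lborel. C * weight (xi::'a))"
    by (rule Bochner_Integration.integral_norm_bound_integral[OF True i]) (use that in simp)
   thus ?thesis by simp
  next
   case False
   have "0 \<le> (LINT xi|lborel. C * weight (xi::'a))"
    using C(1) weight_pos by (intro integral_nonneg_AE AE_I2 mult_nonneg_nonneg) (auto intro: less_imp_le)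
   thus ?thesis by (simp add: not_integrable_integral_eq[OF False])
  qed
  show ?thesis
  proof (intro exI ballI conjI)
   fix p assume p: "p \<in> K"
   have y: "0 < snd p" "snd p < 1" using p K by (auto simp: slab_def)
   show "\<bar>extn c p\<bar> \<le> (LINT xi|lborel. C * weight (xi::'a))" unfolding extn_eq_wave(1)[OF y] using C(2) p by (intro le) auto
   fix v :: "'a \<times> real" assume v: "v \<in> Basis"
   show "\<bar>gextn c p \<bullet> v\<bar> \<le> (LINT xi|lborel. C * weight (xi::'a))" unfolding extn_eq_wave(2)[OF y v] using C(2) p v by (intro le) auto
  qed
 qed
 show "locally_integrable slab (extn c)"
  unfolding locally_integrable_def
 proof (intro allI impI, elim conjE)
  fix K :: "('a \<times> real) set" assume K: "compact K" "K \<subseteq> slab"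
  obtain B where "\<forall>p\<in>K. \<bar>extn c p\<bar> \<le> B" using bd[OF K] by blast
  thus "extn c absolutely_integrable_on K" by (intro bounded_absolutely_integrable[OF extn_measurable K(1), of B]) auto
 qed
 show "locally_integrable slab (gextn c)"
  unfolding locally_integrable_def
 proof (intro allI impI, elim conjE)
  fix K :: "('a \<times> real) set" assume K: "compact K" "K \<subseteq> slab"
  obtain B where B: "\<forall>p\<in>K. \<forall>v\<in>Basis. \<bar>gextn c p \<bullet> v\<bar> \<le> B" using bd[OF K] by blast
  show "gextn c absolutely_integrable_on K"
  proof (rule absolutely_integrable_componentwise)
   fix v :: "'a \<times> real" assume v: "v \<in> Basis"
   show "(%p. gextn c p \<bullet> v) absolutely_integrable_on K"
    using B v by (intro bounded_absolutely_integrable[OF gextn_inner_measurable[OF v] K(1), of B]) auto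
  qed
 qed
 fix \<phi> :: "'a \<times> real => real" and v :: "'a \<times> real" assume t: "test_function slab \<phi>" and v: "v \<in> Basis"
 from test_function_bounds[OF t] obtain K B where K: "smooth \<phi>" "compact K" "K \<subseteq> slab"
  "\<forall>x. x \<notin> K --> \<phi> x = 0 \<and> (\<forall>b. frechet_derivative \<phi> (at x) b = 0)"
  "\<forall>x. \<bar>\<phi> x\<bar> \<le> B \<and> (\<forall>b\<in>Basis. \<bar>frechet_derivative \<phi> (at x) b\<bar> \<le> B)"
  by (elim exE conjE)
 obtain C where C: "C > 0" "\<forall>p\<in>K. \<forall>xi. \<bar>wave xi p\<bar> \<le> C * weight xi \<and> (\<forall>v\<in>Basis. \<bar>dwave xi p v\<bar> \<le> C * weight xi)"
  using compact_slab_bounds[OF K(2,3)] by blast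
 have Kb[measurable]: "K \<in> sets borel" using K(2) by (simp add: borel_compact)
 have iK: "integrable lborel (%p. indicator K p *\<^sub>R B)"
  by (rule borel_integrable_compact[OF K(2) continuous_on_const])
 have iW: "integrable lborel (%xi::'a. C * weight xi)" by (intro integrable_mult_right weight_integrable)
 have toK: "(LINT p:slab|lebesgue. f p * \<psi> p) = (LINT p|lborel. f p * \<psi> p)"
  if "f \<in> borel_measurable borel" "\<psi> \<in> borel_measurable borel" "\<forall>p. p \<notin> K --> \<psi> p = 0" for f \<psi> :: "'a \<times> real => real"
 proof -
  have "(LINT p:slab|lebesgue. f p * \<psi> p) = (LINT p|lebesgue. f p * \<psi> p)"
   unfolding set_lebesgue_integral_def
  proof (intro Bochner_Integration.integral_cong refl)
   fix p show "indicat_real slab p *\<^sub>R (f p * \<psi> p) = f p * \<psi> p"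
   proof (cases "p \<in> slab")
    case False
    hence "p \<notin> K" using K(3) by blast
    thus ?thesis using that(3)[rule_format, of p] by simp
   qed simp
  qed
  also have "... = (LINT p|lborel. f p * \<psi> p)"
   using borel_measurable_times[OF that(1,2)] by (intro integral_completion) simp
  finally show ?thesis .
 qed
 have key: "(LINT p|lborel. (LINT xi|lborel. F xi p) * \<psi> p) = (LINT xi|lborel. LINT p|lborel. F xi p * \<psi> p)"
  if Fm: "(%(p, xi). F xi p) \<in> borel_measurable (lborel \<Otimes>\<^sub>M lborel)" and \<psi>: "\<psi> \<in> borel_measurable borel"
   and z: "\<forall>p. p \<notin> K --> \<psi> p = 0" and b: "\<forall>p. \<bar>\<psi> p\<bar> \<le> B"
   and FC: "\<forall>p\<in>K. \<forall>xi. \<bar>F xi p\<bar> \<le> C * weight xi" for F :: "'a => 'a \<times> real => real" and \<psi>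
 proof -
  have "(LINT p|lborel. (LINT xi|lborel. F xi p) * \<psi> p) = (LINT p|lborel. LINT xi|lborel. F xi p * \<psi> p)"
   by simp
  also have "... = (LINT xi|lborel. LINT p|lborel. F xi p * \<psi> p)"
  proof (rule lborel_pair.Fubini_integral[symmetric], rule lborel_pair.integrable_tensor_bound[OF iK iW])
   have "(%x::('a \<times> real) \<times> 'a. \<psi> (fst x)) \<in> borel_measurable (lborel \<Otimes>\<^sub>M lborel)"
    using \<psi> by measurable
   thus "(%(p, xi). F xi p * \<psi> p) \<in> borel_measurable (lborel \<Otimes>\<^sub>M lborel)"
    using Fm unfolding split_beta' by (intro borel_measurable_times)
   fix p xi
   have "\<bar>F xi p * \<psi> p\<bar> \<le> (C * weight xi) * B" if "p \<in> K"
    unfolding abs_mult using that FC b[rule_format, of p] C(1) weight_pos[of xi] by (intro mult_mono) auto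
   thus "norm (case (p, xi) of (p, xi) => F xi p * \<psi> p) \<le> (indicator K p *\<^sub>R B) * (C * weight xi)"
    using z[rule_format, of p] by (cases "p \<in> K") (simp_all add: mult_ac)
  qed
  finally show ?thesis .
 qed
 define d where "d p = frechet_derivative \<phi> (at p) v" for p
 have dm: "d \<in> borel_measurable borel" "\<phi> \<in> borel_measurable borel"
  unfolding d_def using K(1) v by (auto intro!: borel_measurable_continuous_onI smooth_continuous smooth_partial)
 have dz: "\<forall>p. p \<notin> K --> d p = 0" "\<forall>p. p \<notin> K --> \<phi> p = 0" using K(4) unfolding d_def by blast+
 have db: "\<forall>p. \<bar>d p\<bar> \<le> B" "\<forall>p. \<bar>\<phi> p\<bar> \<le> B" using K(5)[rule_format] v unfolding d_def by blast+
 have wm: "wave xi \<in> borel_measurable borel" "(%p. dwave xi p v) \<in> borel_measurable borel" for xi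
  using measurable_compose[OF measurable_Pair2'[of xi lborel "lborel :: ('a \<times> real) measure"] wave_measurable(1)]
   measurable_compose[OF measurable_Pair2'[of xi lborel "lborel :: ('a \<times> real) measure"] wave_measurable(2)] by simp_all
 have cut: "(LINT p|lborel. f p * \<psi> p) = (LINT p|lborel. g p * \<psi> p)"
  if "\<forall>p\<in>slab. f p = g p" "\<forall>p. p \<notin> K --> \<psi> p = 0" for f g \<psi> :: "'a \<times> real => real"
 proof (intro Bochner_Integration.integral_cong refl)
  fix p show "f p * \<psi> p = g p * \<psi> p"
  proof (cases "p \<in> K")
   case True
   hence "p \<in> slab" using K(3) by blast
   thus ?thesis using that(1) by simp
  next
   case False
   thus ?thesis using that(2)[rule_format, of p] by simp
  qed
 qed
 have sl: "\<forall>p\<in>slab. extn c p = (LINT xi|lborel. wave xi p)" "\<forall>p\<in>slab. gextn c p \<bullet> v = (LINT xi|lborel. dwave xi p v)"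
  using extn_eq_wave v by (auto simp: slab_def)
 have "(LINT p:slab|lebesgue. extn c p * d p) = (LINT p|lborel. (LINT xi|lborel. wave xi p) * d p)"
  unfolding toK[OF extn_measurable dm(1) dz(1)] by (rule cut[OF sl(1) dz(1)])
 also have "... = (LINT xi|lborel. LINT p|lborel. wave xi p * d p)"
  by (rule key[OF wave_measurable(1) dm(1) dz(1) db(1)]) (use C in blast)
 also have "... = (LINT xi|lborel. - (LINT p|lborel. dwave xi p v * \<phi> p))"
 proof (intro Bochner_Integration.integral_cong refl)
  fix xi :: 'a
  have "(LINT p:slab|lebesgue. wave xi p * d p) = - (LINT p:slab|lebesgue. dwave xi p v * \<phi> p)"
   unfolding d_def by (rule classical_ibp[OF open_slab t v wave_has_derivative dwave_continuous])
  thus "(LINT p|lborel. wave xi p * d p) = - (LINT p|lborel. dwave xi p v * \<phi> p)"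
   unfolding toK[OF wm(1) dm(1) dz(1)] toK[OF wm(2) dm(2) dz(2)] .
 qed
 also have "... = - (LINT xi|lborel. LINT p|lborel. dwave xi p v * \<phi> p)" by simp
 also have "(LINT xi|lborel. LINT p|lborel. dwave xi p v * \<phi> p) = (LINT p|lborel. (LINT xi|lborel. dwave xi p v) * \<phi> p)"
  by (rule key[OF wave_measurable(2) dm(2) dz(2) db(2), symmetric]) (use C v in blast)
 also have "... = (LINT p:slab|lebesgue. (gextn c p \<bullet> v) * \<phi> p)"
  unfolding toK[OF gextn_inner_measurable[OF v] dm(2) dz(2)] by (rule cut[OF sl(2) dz(2), symmetric])
 finally show "(LINT p:slab|lebesgue. extn c p * frechet_derivative \<phi> (at p) v) = - (LINT p:slab|lebesgue. (gextn c p \<bullet> v) * \<phi> p)"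
  unfolding d_def .
qed

end

end

section \<open>Energy bounds by Plancherel\<close>

text \<open>Plancherel in \<open>x\<close> at each fixed height, then an exchange of the integrals
  over height and frequency; passing to the real part only decreases the left-hand side.\<close>

lemma slab_Plancherel:
 fixes m :: "real => 'a::euclidean_space => complex" and g :: "real => real"
 assumes m[measurable]: "(%p. m (fst p) (snd p)) \<in> borel_measurable (borel \<Otimes>\<^sub>M borel)"
  and g[measurable]: "g \<in> borel_measurable borel" and g0: "!!y. 0 \<le> g y"
  and i: "!!y. 0 < y ==> y < 1 ==> integrable lborel (m y)"
 shows "(\<integral>\<^sup>+p\<in>slab. ennreal (g (snd p) * (Re (ift (m (snd p)) (fst p)))\<^sup>2) \<partial>lborel)
  \<le> ennreal ((2 * pi) ^ DIM('a)) * (\<integral>\<^sup>+xi. (\<integral>\<^sup>+y\<in>{0<..<1}. ennreal (g y * (norm (m y xi))\<^sup>2) \<partial>lborel) \<partial>lborel)"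
proof -
 define h where "h p = ennreal (g (snd p) * (Re (ift (m (snd p)) (fst p)))\<^sup>2) * indicator slab p" for p :: "'a \<times> real"
 have [measurable]: "snd \<in> borel_measurable (borel :: ('a \<times> real) measure)"
  by (intro borel_measurable_continuous_onI continuous_intros)
 have [measurable]: "(%p::'a \<times> real. ift (m (snd p)) (fst p)) \<in> borel_measurable borel"
  by (rule ift_param_measurable[OF m])
 have [measurable]: "slab \<in> sets (borel :: ('a \<times> real) measure)" by (rule borel_open[OF open_slab])
 have "h \<in> borel_measurable borel" unfolding h_def by measurable
 hence hm: "h \<in> borel_measurable (lborel \<Otimes>\<^sub>M lborel)" by (simp add: lborel_prod)
 have pair: "(%q. m (fst q) (snd q)) \<in> borel_measurable (lborel \<Otimes>\<^sub>M lborel)" using m by (simp add: borel_prod)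
 have m2[measurable]: "m y \<in> borel_measurable borel" for y
  using measurable_compose[OF measurable_Pair1'[of y "borel :: real measure" borel] m] by simp
 have gm[measurable]: "(%q::real \<times> 'a. ennreal (g (fst q) * (norm (m (fst q) (snd q)))\<^sup>2) * indicator {0<..<1} (fst q)) \<in> borel_measurable (lborel \<Otimes>\<^sub>M lborel)"
 proof -
  have "(%q::real \<times> 'a. m (fst q) (snd q)) \<in> borel_measurable (lborel \<Otimes>\<^sub>M lborel)" by (rule pair)
  thus ?thesis by measurable
 qed
 have "(\<integral>\<^sup>+p\<in>slab. ennreal (g (snd p) * (Re (ift (m (snd p)) (fst p)))\<^sup>2) \<partial>lborel) = (\<integral>\<^sup>+p. h p \<partial>(lborel \<Otimes>\<^sub>M lborel))"
  by (simp add: h_def lborel_prod)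
 also have "... = (\<integral>\<^sup>+y. \<integral>\<^sup>+x. h (x, y) \<partial>lborel \<partial>lborel)"
  by (rule lborel_pair.nn_integral_snd[OF hm, symmetric])
 also have "... \<le> (\<integral>\<^sup>+y. \<integral>\<^sup>+xi. ennreal ((2 * pi) ^ DIM('a)) * (ennreal (g y * (norm (m y xi))\<^sup>2) * indicator {0<..<1} y) \<partial>lborel \<partial>lborel)"
 proof (rule nn_integral_mono)
  fix y :: real
  show "(\<integral>\<^sup>+x. h (x, y) \<partial>lborel) \<le> (\<integral>\<^sup>+xi. ennreal ((2 * pi) ^ DIM('a)) * (ennreal (g y * (norm (m y xi))\<^sup>2) * indicator {0<..<1} y) \<partial>lborel)"
  proof (cases "y \<in> {0<..<1}")
   case False
   thus ?thesis by (simp add: h_def slab_def)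
  next
   case True
   have "(\<integral>\<^sup>+x. h (x, y) \<partial>lborel) \<le> (\<integral>\<^sup>+x. ennreal (g y) * ennreal ((norm (ift (m y) x))\<^sup>2) \<partial>lborel)"
   proof (intro nn_integral_mono)
    fix x :: 'a
    have "(Re (ift (m y) x))\<^sup>2 \<le> (norm (ift (m y) x))\<^sup>2" using abs_Re_le_cmod[of "ift (m y) x"] by (simp add: abs_le_square_iff[symmetric])
    hence "g y * (Re (ift (m y) x))\<^sup>2 \<le> g y * (norm (ift (m y) x))\<^sup>2" using g0 by (intro mult_left_mono)
    thus "h (x, y) \<le> ennreal (g y) * ennreal ((norm (ift (m y) x))\<^sup>2)"
     using True g0 by (simp add: h_def slab_def ennreal_mult[symmetric] ennreal_leI)
   qed
   also have "... = ennreal (g y) * (\<integral>\<^sup>+x. ennreal ((norm (ift (m y) x))\<^sup>2) \<partial>lborel)"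
    by (rule nn_integral_cmult) measurable
   also have "... \<le> ennreal (g y) * (ennreal ((2 * pi) ^ DIM('a)) * (\<integral>\<^sup>+xi. ennreal ((norm (m y xi))\<^sup>2) \<partial>lborel))"
    using True by (intro mult_left_mono Plancherel_le i) auto
   also have "... = ennreal ((2 * pi) ^ DIM('a)) * (ennreal (g y) * (\<integral>\<^sup>+xi. ennreal ((norm (m y xi))\<^sup>2) \<partial>lborel))"
    by (simp only: mult_ac)
   also have "... = ennreal ((2 * pi) ^ DIM('a)) * (\<integral>\<^sup>+xi. ennreal (g y) * ennreal ((norm (m y xi))\<^sup>2) \<partial>lborel)"
    by (subst nn_integral_cmult) measurable
   also have "... = (\<integral>\<^sup>+xi. ennreal ((2 * pi) ^ DIM('a)) * (ennreal (g y) * ennreal ((norm (m y xi))\<^sup>2)) \<partial>lborel)"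
    by (rule nn_integral_cmult[symmetric]) measurable
   finally show ?thesis using True g0 by (simp add: ennreal_mult)
  qed
 qed
 also have "... = (\<integral>\<^sup>+xi. \<integral>\<^sup>+y. ennreal ((2 * pi) ^ DIM('a)) * (ennreal (g y * (norm (m y xi))\<^sup>2) * indicator {0<..<1} y) \<partial>lborel \<partial>lborel)"
  by (rule lborel_pair.Fubini'[symmetric], unfold split_beta', intro borel_measurable_times_ennreal gm) measurable
 also have "... = (\<integral>\<^sup>+xi. ennreal ((2 * pi) ^ DIM('a)) * (\<integral>\<^sup>+y. ennreal (g y * (norm (m y xi))\<^sup>2) * indicator {0<..<1} y \<partial>lborel) \<partial>lborel)"
 proof (intro nn_integral_cong)
  fix xi :: 'a
  have "(%y. m y xi) \<in> borel_measurable borel"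
   using measurable_compose[OF measurable_Pair2'[of xi "borel :: 'a measure" "borel :: real measure"] m] by simp
  note [measurable] = this
  show "(\<integral>\<^sup>+y. ennreal ((2 * pi) ^ DIM('a)) * (ennreal (g y * (norm (m y xi))\<^sup>2) * indicator {0<..<1} y) \<partial>lborel)
   = ennreal ((2 * pi) ^ DIM('a)) * (\<integral>\<^sup>+y. ennreal (g y * (norm (m y xi))\<^sup>2) * indicator {0<..<1} y \<partial>lborel)"
   by (rule nn_integral_cmult) measurable
 qed
 also have "... = ennreal ((2 * pi) ^ DIM('a)) * (\<integral>\<^sup>+xi. (\<integral>\<^sup>+y. ennreal (g y * (norm (m y xi))\<^sup>2) * indicator {0<..<1} y \<partial>lborel) \<partial>lborel)"
 proof (rule nn_integral_cmult)
  have "(%q::'a \<times> real. ennreal (g (snd q) * (norm (m (snd q) (fst q)))\<^sup>2) * indicator {0<..<1} (snd q)) \<in> borel_measurable (lborel \<Otimes>\<^sub>M lborel)"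
   using measurable_compose[OF measurable_pair_swap' gm] by (simp add: split_beta')
  thus "(%xi. \<integral>\<^sup>+y. ennreal (g y * (norm (m y xi))\<^sup>2) * indicator {0<..<1} y \<partial>lborel) \<in> borel_measurable lborel"
   by (intro lborel.borel_measurable_nn_integral) (simp add: split_beta')
 qed
 finally show ?thesis .
qed

lemma nn_integral_powr_unit:
 assumes a: "a > -1"
 shows "(\<integral>\<^sup>+y\<in>{0<..<1}. ennreal (y powr a) \<partial>lborel) = ennreal (1 / (1 + a))"
proof -
 have "((%x. x powr a) has_integral (1 powr (a + 1) / (a + 1))) {0..1::real}"
  using has_integral_powr_from_0[OF a, of 1] by simp
 hence "((%x. x powr a) has_integral (1 / (1 + a))) {0<..<1::real}"
  by (simp add: has_integral_Icc_iff_Ioo add.commute)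
 thus ?thesis by (intro nn_integral_has_integral_lebesgue') auto
qed

context
 fixes s :: real
 assumes s: "0 < s" "s < 1"
begin

lemma flux_0_bounds: "r \<ge> 0 ==> 0 \<le> flux s r 0" "r \<ge> 0 ==> flux s r 0 \<le> r\<^sup>2 / (2 - 2 * s)"
proof -
 assume r: "r \<ge> 0"
 interpret P: neumann_profile "1 - 2 * s" r "profile s r" "flux s r" by (rule neumann_profile_Bessel[OF s r])
 show "0 \<le> flux s r 0" "flux s r 0 \<le> r\<^sup>2 / (2 - 2 * s)" using P.flux_0_nonneg P.flux_0_le by auto
qed

lemma flux_0_measurable[measurable]: "(%xi::'a::euclidean_space. flux s (norm xi) 0) \<in> borel_measurable borel"
 using profile_measurable(2)[OF s, of norm borel "%_. 0"] by simp

lemma extn_sq_bound: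
 fixes c :: "'a::euclidean_space => complex"
 assumes c[measurable]: "c \<in> borel_measurable borel" and cM: "!!xi. norm (c xi) \<le> M"
 shows "(\<integral>\<^sup>+p\<in>slab. ennreal (snd p powr (1 - 2 * s) * (extn s c p)\<^sup>2) \<partial>lborel)
  \<le> ennreal ((2 * pi) ^ DIM('a)) * (\<integral>\<^sup>+xi. ennreal (1 / (2 - 2 * s) * (norm (c xi))\<^sup>2) \<partial>lborel)"
proof -
 note [measurable] = profile_measurable[OF s]
 have "(\<integral>\<^sup>+p\<in>slab. ennreal (snd p powr (1 - 2 * s) * (extn s c p)\<^sup>2) \<partial>lborel)
  \<le> ennreal ((2 * pi) ^ DIM('a)) * (\<integral>\<^sup>+xi. (\<integral>\<^sup>+y\<in>{0<..<1}. ennreal (y powr (1 - 2 * s) * (norm (of_real (profile s (norm xi) y) * c xi))\<^sup>2) \<partial>lborel) \<partial>lborel)"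
  unfolding extn_def[OF s]
 proof (rule slab_Plancherel[where m="%y xi. of_real (profile s (norm xi) y) * c xi" and g="%y. y powr (1 - 2 * s)"])
  show "(%p. of_real (profile s (norm (snd p)) (fst p)) * c (snd p)) \<in> borel_measurable (borel \<Otimes>\<^sub>M borel)"
   by measurable
  show "(%y. y powr (1 - 2 * s)) \<in> borel_measurable borel" by measurable
  show "integrable lborel (%xi. of_real (profile s (norm xi) y) * c xi)" if "0 < y" "y < 1" for y
   by (rule integrable_multiplier(1)[OF s c cM that])
 qed simp
 also have "... \<le> ennreal ((2 * pi) ^ DIM('a)) * (\<integral>\<^sup>+xi. ennreal (1 / (2 - 2 * s) * (norm (c xi))\<^sup>2) \<partial>lborel)"
 proof (intro mult_left_mono nn_integral_mono)
  fix xi :: 'a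
  interpret P: neumann_profile "1 - 2 * s" "norm xi" "profile s (norm xi)" "flux s (norm xi)"
   by (rule neumann_profile_Bessel[OF s norm_ge_zero])
  have "(\<integral>\<^sup>+y\<in>{0<..<1}. ennreal (y powr (1 - 2 * s) * (norm (of_real (profile s (norm xi) y) * c xi))\<^sup>2) \<partial>lborel)
   \<le> (\<integral>\<^sup>+y. ennreal ((norm (c xi))\<^sup>2) * (ennreal (y powr (1 - 2 * s)) * indicator {0<..<1} y) \<partial>lborel)"
  proof (intro nn_integral_mono)
   fix y :: real
   show "ennreal (y powr (1 - 2 * s) * (norm (of_real (profile s (norm xi) y) * c xi))\<^sup>2) * indicator {0<..<1} y
    \<le> ennreal ((norm (c xi))\<^sup>2) * (ennreal (y powr (1 - 2 * s)) * indicator {0<..<1} y)"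
   proof (cases "y \<in> {0<..<1}")
    case True
    hence "(profile s (norm xi) y)\<^sup>2 \<le> 1" using P.th_le_1[of y] by (simp add: abs_square_le_1)
    hence "y powr (1 - 2 * s) * ((profile s (norm xi) y)\<^sup>2 * (norm (c xi))\<^sup>2) \<le> y powr (1 - 2 * s) * (1 * (norm (c xi))\<^sup>2)"
     by (intro mult_left_mono mult_right_mono) auto
    thus ?thesis using True by (simp add: norm_mult power_mult_distrib ennreal_mult[symmetric] ennreal_leI mult.commute)
   qed simp
  qed
  also have "... = ennreal ((norm (c xi))\<^sup>2) * ennreal (1 / (2 - 2 * s))"
   using nn_integral_powr_unit[of "1 - 2 * s"] s by (subst nn_integral_cmult) auto
  finally show "(\<integral>\<^sup>+y\<in>{0<..<1}. ennreal (y powr (1 - 2 * s) * (norm (of_real (profile s (norm xi) y) * c xi))\<^sup>2) \<partial>lborel)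
   \<le> ennreal (1 / (2 - 2 * s) * (norm (c xi))\<^sup>2)" using s by (simp add: ennreal_mult[symmetric] mult.commute)
 qed simp
 finally show ?thesis .
qed

text \<open>The horizontal components sum up to the square of \<open>norm xi\<close>, and the weight
  turns the squared power in the vertical one into \<open>y^(-a)\<close>: what appears is the energy
  density of the profile.\<close>

lemma sum_gmul_sq:
 assumes y: "0 < y" "y < 1"
 shows "(\<Sum>v\<in>Basis. y powr (1 - 2 * s) * (norm (gmul s v y (xi::'a::euclidean_space) * z))\<^sup>2) =
  (norm z)\<^sup>2 * ((norm xi)\<^sup>2 * y powr (1 - 2 * s) * (profile s (norm xi) y)\<^sup>2 + y powr (- (1 - 2 * s)) * (flux s (norm xi) y)\<^sup>2)"
proof -
 have sq: "(norm (gmul s v y xi))\<^sup>2 = (y powr (2 * s - 1) * flux s (norm xi) y * snd v)\<^sup>2 + ((fst v \<bullet> xi) * profile s (norm xi) y)\<^sup>2" for v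
  unfolding gmul_def[OF s] cmod_power2 by simp
 have pw: "y powr (1 - 2 * s) * (y powr (2 * s - 1))\<^sup>2 = y powr (- (1 - 2 * s))"
  using y by (simp add: power2_eq_square powr_add[symmetric])
 have split: "(\<Sum>v\<in>(Basis :: ('a \<times> real) set). f v) = (\<Sum>b\<in>Basis. f (b, 0)) + f (0, 1)" for f :: "'a \<times> real => real"
  unfolding Basis_prod_def by (subst sum.union_disjoint) (auto simp: sum.reindex inj_on_def)
 have "(\<Sum>v\<in>(Basis :: ('a \<times> real) set). (norm (gmul s v y xi))\<^sup>2) = (norm xi)\<^sup>2 * (profile s (norm xi) y)\<^sup>2 + (y powr (2 * s - 1))\<^sup>2 * (flux s (norm xi) y)\<^sup>2"
  unfolding split sq norm_sq_sum_Basis[of xi] by (simp add: power_mult_distrib sum_distrib_right inner_commute)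
 hence "(\<Sum>v\<in>Basis. y powr (1 - 2 * s) * (norm (gmul s v y xi * z))\<^sup>2) =
  y powr (1 - 2 * s) * (norm z)\<^sup>2 * ((norm xi)\<^sup>2 * (profile s (norm xi) y)\<^sup>2 + (y powr (2 * s - 1))\<^sup>2 * (flux s (norm xi) y)\<^sup>2)"
  by (simp add: norm_mult power_mult_distrib sum_distrib_left[symmetric] sum_distrib_right[symmetric] mult_ac)
 also have "... = (norm z)\<^sup>2 * ((norm xi)\<^sup>2 * y powr (1 - 2 * s) * (profile s (norm xi) y)\<^sup>2 + (y powr (1 - 2 * s) * (y powr (2 * s - 1))\<^sup>2) * (flux s (norm xi) y)\<^sup>2)"
  by (simp add: algebra_simps)
 finally show ?thesis unfolding pw .
qed

text \<open>After Plancherel the integrand at a fixed frequency is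
  \<open>(norm (c xi))\<^sup>2\<close> times the energy density of the profile, and its vertical
  integral is the flux at 0.\<close>

lemma gextn_energy_bound:
 fixes c :: "'a::euclidean_space => complex"
 assumes c[measurable]: "c \<in> borel_measurable borel" and cM: "!!xi. norm (c xi) \<le> M"
 shows "(\<integral>\<^sup>+p\<in>slab. ennreal (snd p powr (1 - 2 * s) * (norm (gextn s c p))\<^sup>2) \<partial>lborel)
  \<le> ennreal ((2 * pi) ^ DIM('a)) * (\<integral>\<^sup>+xi. ennreal (flux s (norm xi) 0 * (norm (c xi))\<^sup>2) \<partial>lborel)"
proof -
 note [measurable] = gmul_measurable[OF s]
 define a where "a = 1 - 2 * s"
 have [measurable]: "snd \<in> borel_measurable (borel :: ('a \<times> real) measure)"
  by (intro borel_measurable_continuous_onI continuous_intros)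
 have [measurable]: "slab \<in> sets (borel :: ('a \<times> real) measure)" by (rule borel_open[OF open_slab])
 have gm: "(%p. gextn s c p \<bullet> v) \<in> borel_measurable borel" if "v \<in> Basis" for v
  by (rule gextn_inner_measurable[OF s c cM that])
 have mm[measurable]: "(%q. gmul s v (fst q) (snd q) * c (snd q)) \<in> borel_measurable (borel \<Otimes>\<^sub>M borel)" for v by measurable
 let ?I = "%v y xi. ennreal (y powr a * (norm (gmul s v y xi * c xi))\<^sup>2) * indicator {0<..<1::real} y"
 have Im: "(%q. ?I v (snd q) (fst q)) \<in> borel_measurable (lborel \<Otimes>\<^sub>M lborel)" for v
  by measurable
 have Im2: "(%y. ?I v y xi) \<in> borel_measurable lborel" for v xi by measurable
 have "(\<integral>\<^sup>+p\<in>slab. ennreal (snd p powr a * (norm (gextn s c p))\<^sup>2) \<partial>lborel)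
  = (\<integral>\<^sup>+p. (\<Sum>v\<in>Basis. ennreal (snd p powr a * (gextn s c p \<bullet> v)\<^sup>2) * indicator slab p) \<partial>lborel)"
 proof (intro nn_integral_cong)
  fix p :: "'a \<times> real"
  have e: "ennreal (snd p powr a * (norm (gextn s c p))\<^sup>2) = (\<Sum>v\<in>Basis. ennreal (snd p powr a * (gextn s c p \<bullet> v)\<^sup>2))"
   unfolding norm_sq_sum_Basis sum_distrib_left by (rule sum_ennreal[symmetric]) simp
  show "ennreal (snd p powr a * (norm (gextn s c p))\<^sup>2) * indicator slab p = (\<Sum>v\<in>Basis. ennreal (snd p powr a * (gextn s c p \<bullet> v)\<^sup>2) * indicator slab p)"
   unfolding e by (rule sum_distrib_right)
 qed
 also have "... = (\<Sum>v\<in>Basis. \<integral>\<^sup>+p. ennreal (snd p powr a * (gextn s c p \<bullet> v)\<^sup>2) * indicator slab p \<partial>lborel)"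
 proof (rule nn_integral_sum)
  fix v :: "'a \<times> real" assume v: "v \<in> Basis"
  note [measurable] = gm[OF v]
  show "(%p. ennreal (snd p powr a * (gextn s c p \<bullet> v)\<^sup>2) * indicator slab p) \<in> borel_measurable lborel" by measurable
 qed
 also have "... \<le> (\<Sum>v\<in>(Basis :: ('a \<times> real) set). ennreal ((2 * pi) ^ DIM('a)) * (\<integral>\<^sup>+xi. (\<integral>\<^sup>+y. ?I v y xi \<partial>lborel) \<partial>lborel))"
 proof (rule sum_mono)
  fix v :: "'a \<times> real" assume v: "v \<in> Basis"
  show "(\<integral>\<^sup>+p. ennreal (snd p powr a * (gextn s c p \<bullet> v)\<^sup>2) * indicator slab p \<partial>lborel)
   \<le> ennreal ((2 * pi) ^ DIM('a)) * (\<integral>\<^sup>+xi. (\<integral>\<^sup>+y. ?I v y xi \<partial>lborel) \<partial>lborel)"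
   unfolding gextn_inner[OF s v]
  proof (rule slab_Plancherel[where m="%y xi. gmul s v y xi * c xi" and g="%y. y powr a"])
   show "(%y::real. y powr a) \<in> borel_measurable borel" by measurable
   show "integrable lborel (%xi. gmul s v y xi * c xi)" if "0 < y" "y < 1" for y
    by (rule integrable_multiplier(2)[OF s c cM that v])
  qed (simp_all only: mm powr_ge_zero)
 qed
 also have "... = ennreal ((2 * pi) ^ DIM('a)) * (\<Sum>v\<in>(Basis :: ('a \<times> real) set). \<integral>\<^sup>+xi. (\<integral>\<^sup>+y. ?I v y xi \<partial>lborel) \<partial>lborel)"
  by (simp add: sum_distrib_left)
 also have "(\<Sum>v\<in>(Basis :: ('a \<times> real) set). \<integral>\<^sup>+xi. (\<integral>\<^sup>+y. ?I v y xi \<partial>lborel) \<partial>lborel) = (\<integral>\<^sup>+xi. (\<Sum>v\<in>(Basis :: ('a \<times> real) set). \<integral>\<^sup>+y. ?I v y xi \<partial>lborel) \<partial>lborel)"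
 proof (rule nn_integral_sum[symmetric])
  fix v :: "'a \<times> real"
  show "(%xi. \<integral>\<^sup>+y. ?I v y xi \<partial>lborel) \<in> borel_measurable lborel"
   using Im[of v] by (intro lborel.borel_measurable_nn_integral) (simp add: split_beta')
 qed
 also have "... = (\<integral>\<^sup>+xi. ennreal (flux s (norm xi) 0 * (norm (c xi))\<^sup>2) \<partial>lborel)"
 proof (intro nn_integral_cong)
  fix xi :: 'a
  interpret P: neumann_profile a "norm xi" "profile s (norm xi)" "flux s (norm xi)"
   unfolding a_def by (rule neumann_profile_Bessel[OF s norm_ge_zero])
  have "(\<Sum>v\<in>(Basis :: ('a \<times> real) set). \<integral>\<^sup>+y. ?I v y xi \<partial>lborel) = (\<integral>\<^sup>+y. (\<Sum>v\<in>(Basis :: ('a \<times> real) set). ?I v y xi) \<partial>lborel)"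
   by (rule nn_integral_sum[symmetric]) (rule Im2)
  also have "... = (\<integral>\<^sup>+y. ennreal ((norm (c xi))\<^sup>2) * (ennreal ((norm xi)\<^sup>2 * y powr a * (profile s (norm xi) y)\<^sup>2 + y powr (- a) * (flux s (norm xi) y)\<^sup>2) * indicator {0<..<1} y) \<partial>lborel)"
  proof (intro nn_integral_cong)
   fix y :: real
   show "(\<Sum>v\<in>(Basis :: ('a \<times> real) set). ?I v y xi) = ennreal ((norm (c xi))\<^sup>2) * (ennreal ((norm xi)\<^sup>2 * y powr a * (profile s (norm xi) y)\<^sup>2 + y powr (- a) * (flux s (norm xi) y)\<^sup>2) * indicator {0<..<1} y)"
   proof (cases "y \<in> {0<..<1}")
    case True
    have "(\<Sum>v\<in>(Basis :: ('a \<times> real) set). ?I v y xi) = ennreal (\<Sum>v\<in>(Basis :: ('a \<times> real) set). y powr a * (norm (gmul s v y xi * c xi))\<^sup>2)"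
     using True by (simp add: sum_ennreal)
    also have "... = ennreal ((norm (c xi))\<^sup>2 * ((norm xi)\<^sup>2 * y powr a * (profile s (norm xi) y)\<^sup>2 + y powr (- a) * (flux s (norm xi) y)\<^sup>2))"
     unfolding a_def using True by (subst sum_gmul_sq) auto
    also have "... = ennreal ((norm (c xi))\<^sup>2) * ennreal ((norm xi)\<^sup>2 * y powr a * (profile s (norm xi) y)\<^sup>2 + y powr (- a) * (flux s (norm xi) y)\<^sup>2)"
     by (rule ennreal_mult) (simp, rule P.diss_nonneg)
    finally show ?thesis using True by simp
   qed simp
  qed
  also have "... = ennreal ((norm (c xi))\<^sup>2) * ennreal (flux s (norm xi) 0)"
  proof -
   note [measurable] = profile_measurable[OF s]
   show ?thesis unfolding P.energy[symmetric] by (rule nn_integral_cmult) measurable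
  qed
  also have "... = ennreal (flux s (norm xi) 0 * (norm (c xi))\<^sup>2)"
   using P.flux_0_nonneg by (simp add: ennreal_mult[symmetric] mult.commute)
  finally show "(\<Sum>v\<in>(Basis :: ('a \<times> real) set). \<integral>\<^sup>+y. ?I v y xi \<partial>lborel) = ennreal (flux s (norm xi) 0 * (norm (c xi))\<^sup>2)" .
 qed
 finally show ?thesis unfolding a_def .
qed

lemma ift_diff:
 assumes "integrable lborel f" "integrable lborel g"
 shows "ift (%xi. f xi - g xi) x = ift f x - ift g (x::'a::euclidean_space)"
proof -
 have i: "integrable lborel (%xi. f xi * exp (\<i> * of_real (x \<bullet> xi)))" if "integrable lborel f" for f
  by (rule Bochner_Integration.integrable_bound[OF integrable_norm[OF that]])
   (use borel_measurable_integrable[OF that] in \<open>auto simp: norm_mult norm_exp_ii\<close>)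
 show ?thesis unfolding ift_def left_diff_distrib by (rule Bochner_Integration.integral_diff[OF i i]; fact)
qed

lemma extn_diff:
 fixes c d :: "'a::euclidean_space => complex"
 assumes c: "c \<in> borel_measurable borel" "!!xi. norm (c xi) \<le> M" and d: "d \<in> borel_measurable borel" "!!xi. norm (d xi) \<le> M"
  and p: "p \<in> slab"
 shows "extn s (%xi. c xi - d xi) p = extn s c p - extn s d p"
  "gextn s (%xi. c xi - d xi) p = gextn s c p - gextn s d p"
proof -
 have y: "0 < snd p" "snd p < 1" using p by (auto simp: slab_def)
 show "extn s (%xi. c xi - d xi) p = extn s c p - extn s d p"
  unfolding extn_def[OF s] right_diff_distrib
  using ift_diff[OF integrable_multiplier(1)[OF s c y] integrable_multiplier(1)[OF s d y]] by simp
 show "gextn s (%xi. c xi - d xi) p = gextn s c p - gextn s d p"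
 proof (rule euclidean_eqI)
  fix v :: "'a \<times> real" assume v: "v \<in> Basis"
  show "gextn s (%xi. c xi - d xi) p \<bullet> v = (gextn s c p - gextn s d p) \<bullet> v"
   unfolding inner_diff_left gextn_inner[OF s v] right_diff_distrib
   using ift_diff[OF integrable_multiplier(2)[OF s c y v] integrable_multiplier(2)[OF s d y v]] by simp
 qed
qed

text \<open>The profiles are bounded by 1 but do not decay in the frequency at \<open>y = 0\<close>,
  so the dominating function is the amplitude itself; hence integrability of
  \<open>c\<close>.\<close>

lemma extn_continuous:
 fixes c :: "'a::euclidean_space => complex"
 assumes c: "integrable lborel c"
 shows "continuous_on (UNIV \<times> {0..1}) (extn s c)"
proof (rule continuous_on_sequentiallyI)
 fix P :: "nat => 'a \<times> real" and p
 assume P: "\<forall>n. P n \<in> UNIV \<times> {0..1}" "p \<in> UNIV \<times> {0..1}" "P \<longlonglongrightarrow> p"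
 note [measurable] = profile_measurable[OF s]
 have [measurable]: "c \<in> borel_measurable borel" using borel_measurable_integrable[OF c] by simp
 let ?f = "%p xi. of_real (profile s (norm xi) (snd p)) * c xi * exp (\<i> * of_real (fst p \<bullet> xi))"
 have "(%n. LINT xi|lborel. ?f (P n) xi) \<longlonglongrightarrow> (LINT xi|lborel. ?f p xi)"
 proof (rule integral_dominated_convergence[where w="%xi. norm (c xi)"])
  show "integrable lborel (%xi. norm (c xi))" using c by (rule integrable_norm)
  show "AE xi in lborel. (%n. ?f (P n) xi) \<longlonglongrightarrow> ?f p xi"
  proof (rule AE_I2)
   fix xi :: 'a
   have "continuous_on (UNIV \<times> {0..1}) (%p::'a \<times> real. profile s (norm xi) (snd p))"
    by (rule continuous_on_compose2[OF continuous_profile_flux(1)[OF s]]) (auto intro!: continuous_intros)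
   hence "continuous_on (UNIV \<times> {0..1}) (%p. ?f p xi)" by (intro continuous_intros)
   thus "(%n. ?f (P n) xi) \<longlonglongrightarrow> ?f p xi"
    using P unfolding continuous_on_sequentially o_def by blast
  qed
  show "AE xi in lborel. norm (?f (P n) xi) \<le> norm (c xi)" for n
  proof (rule AE_I2)
   fix xi :: 'a
   interpret Q: neumann_profile "1 - 2 * s" "norm xi" "profile s (norm xi)" "flux s (norm xi)"
    by (rule neumann_profile_Bessel[OF s norm_ge_zero])
   have "snd (P n) \<in> {0..1}" using P(1) by (metis mem_Times_iff)
   thus "norm (?f (P n) xi) \<le> norm (c xi)" using Q.th_le_1[of "snd (P n)"] by (simp add: norm_mult norm_exp_ii mult_left_le_one_le)
  qed
 qed measurable
 thus "(%n. extn s c (P n)) \<longlonglongrightarrow> extn s c p"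
  unfolding extn_def[OF s] ift_def by (rule tendsto_Re)
qed

lemma extn_0: "extn s c (x, 0) = Re (ift c x)"
 unfolding extn_def[OF s] using s by (simp add: profile_0)

end

section \<open>The competitor\<close>

lemma fourier_eq_ift: "fourier u xi = ift (%x. of_real (u x)) (- xi)"
 unfolding fourier_def ift_def by (simp add: inner_commute)

lemma fourier_measurable:
 fixes u :: "'a::euclidean_space => real"
 assumes "integrable lborel u" shows "fourier u \<in> borel_measurable borel"
proof -
 have [measurable]: "u \<in> borel_measurable borel" using borel_measurable_integrable[OF assms] by simp
 show ?thesis unfolding fourier_eq_ift[abs_def] by measurable
qed

lemma fourier_bound: "norm (fourier u xi) \<le> (LINT x|lborel. \<bar>u x\<bar>)"
 unfolding fourier_eq_ift using ift_bound[of "%x. of_real (u x)" "- xi"] by simp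

text \<open>A bounded integrable \<open>u\<close> is square integrable, and \<open>fourier u\<close>
  is a reflected inverse transform. This controls the zero-order part of the norm of the
  competitor.\<close>

lemma fourier_L2:
 fixes u :: "'a::euclidean_space => real"
 assumes u: "integrable lborel u" and B: "!!x. \<bar>u x\<bar> \<le> B"
 shows "(\<integral>\<^sup>+xi. ennreal ((norm (fourier u xi))\<^sup>2) \<partial>lborel) < \<infinity>"
proof -
 have um[measurable]: "u \<in> borel_measurable borel" using borel_measurable_integrable[OF u] by simp
 let ?f = "%x. complex_of_real (u x)"
 have i: "integrable lborel ?f" using u by (rule integrable_of_real)
 have "(\<integral>\<^sup>+xi. ennreal ((norm (fourier u xi))\<^sup>2) \<partial>lborel) = (\<integral>\<^sup>+xi. ennreal ((norm (ift ?f (0 - xi)))\<^sup>2) \<partial>lborel)"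
  unfolding fourier_eq_ift by simp
 also have "... = (\<integral>\<^sup>+xi. ennreal ((norm (ift ?f xi))\<^sup>2) \<partial>lborel)"
  by (rule lborel_integral_reflect_translate[where g="%xi. ennreal ((norm (ift ?f xi))\<^sup>2)"]) measurable
 also have "... \<le> ennreal ((2 * pi) ^ DIM('a)) * (\<integral>\<^sup>+x. ennreal ((norm (?f x))\<^sup>2) \<partial>lborel)"
  by (rule Plancherel_le[OF i])
 also have "... < \<infinity>"
 proof -
  have "integrable lborel (%x. (u x)\<^sup>2)"
  proof (rule Bochner_Integration.integrable_bound[OF integrable_mult_right[OF integrable_abs[OF u], of B]])
   show "AE x in lborel. norm ((u x)\<^sup>2) \<le> norm (B * \<bar>u x\<bar>)"
   proof (rule AE_I2)
    fix x
    have "\<bar>u x\<bar> * \<bar>u x\<bar> \<le> B * \<bar>u x\<bar>" using B[of x] by (intro mult_right_mono) auto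
    thus "norm ((u x)\<^sup>2) \<le> norm (B * \<bar>u x\<bar>)" using B[of x] by (simp add: power2_eq_square abs_mult)
   qed
  qed measurable
  hence "(\<integral>\<^sup>+x. ennreal ((u x)\<^sup>2) \<partial>lborel) < \<infinity>" by (subst nn_integral_eq_integral) auto
  thus ?thesis by (simp add: ennreal_mult_less_top)
 qed
 finally show ?thesis .
qed

section \<open>Gaussian regularisation of the boundary values\<close>

text \<open>The Gaussian makes Fubini applicable to the iterated integral, whose inner part is then
  the transform of a Gaussian: damping in the frequency is a convolution of \<open>u\<close> with
  \<open>gauss_kernel\<close>.\<close>

lemma ift_fourier_gauss:
 fixes u :: "'a::euclidean_space => real"
 assumes u: "integrable lborel u" and e: "eps > 0"
 shows "ift (%xi. fourier u xi * of_real (exp (- eps * (norm xi)\<^sup>2))) x = of_real (LINT z|lborel. u z * gauss_kernel eps (x - z))"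
proof -
 have um[measurable]: "u \<in> borel_measurable borel" using borel_measurable_integrable[OF u] by simp
 let ?g = "%xi::'a. exp (- eps * (norm xi)\<^sup>2)"
 let ?F = "%xi z. complex_of_real (?g xi) * exp (\<i> * of_real (x \<bullet> xi)) * (of_real (u z) * exp (- \<i> * of_real (z \<bullet> xi)))"
 have "ift (%xi. fourier u xi * of_real (?g xi)) x = (LINT xi|lborel. LINT z|lborel. ?F xi z)"
  unfolding ift_def fourier_def integral_mult_right_zero by (simp add: mult_ac)
 also have "... = (LINT z|lborel. LINT xi|lborel. ?F xi z)"
 proof (rule lborel_pair.Fubini_integral[symmetric], rule lborel_pair.integrable_tensor_bound[OF gauss_integrable[OF e] integrable_abs[OF u]])
  show "norm (case (xi, z) of (xi, z) => ?F xi z) \<le> ?g xi * \<bar>u z\<bar>" for xi z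
   by (simp add: norm_mult norm_exp_ii)
 qed measurable
 also have "... = (LINT z|lborel. of_real (u z) * of_real (gauss_kernel eps (x - z)))"
 proof (intro Bochner_Integration.integral_cong refl)
  fix z :: 'a
  have "?F xi z = of_real (u z) * (of_real (?g xi) * exp (\<i> * of_real (xi \<bullet> (x - z))))" for xi
  proof -
   have "exp (\<i> * of_real (xi \<bullet> (x - z))) = exp (\<i> * of_real (x \<bullet> xi)) * exp (- \<i> * of_real (z \<bullet> xi))"
    by (simp add: exp_add[symmetric] inner_diff_right algebra_simps inner_commute)
   thus ?thesis by (simp add: mult_ac)
  qed
  hence "(LINT xi|lborel. ?F xi z) = of_real (u z) * (LINT xi|lborel. of_real (?g xi) * exp (\<i> * of_real (xi \<bullet> (x - z))))"
   by (simp only: integral_mult_right_zero)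
  thus "(LINT xi|lborel. ?F xi z) = of_real (u z) * of_real (gauss_kernel eps (x - z))"
   unfolding gauss_FT[OF e] .
 qed
 also have "... = of_real (LINT z|lborel. u z * gauss_kernel eps (x - z))"
  unfolding of_real_mult[symmetric] by (rule integral_complex_of_real)
 finally show ?thesis .
qed

lemma lborel_integral_affine:
 fixes f :: "'a::euclidean_space => real"
 assumes f[measurable]: "f \<in> borel_measurable borel" and c: "c \<noteq> 0"
 shows "(LINT z|lborel. f z) = \<bar>c\<bar> ^ DIM('a) * (LINT t|lborel. f (x + c *\<^sub>R t))"
proof -
 have "(LINT z|lborel. f z) = (LINT z|density (distr lborel borel (%t. x + c *\<^sub>R t)) (%_. \<bar>c\<bar> ^ DIM('a)). f z)"
  using lborel_affine[OF c, of x] by metis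
 also have "... = (LINT z|distr lborel borel (%t. x + c *\<^sub>R t). \<bar>c\<bar> ^ DIM('a) *\<^sub>R f z)"
  by (rule integral_density) auto
 also have "... = (LINT t|lborel. \<bar>c\<bar> ^ DIM('a) *\<^sub>R f (x + c *\<^sub>R t))"
  by (rule integral_distr) measurable
 finally show ?thesis by simp
qed

text \<open>The substitution \<open>z = x + (2 * sqrt eps) *\<^sub>R t\<close> moves
  \<open>eps\<close> from the kernel into the argument of \<open>u\<close>, so that bounds and
  limits follow with one fixed Gaussian.\<close>

lemma gauss_convolution_eq:
 fixes u :: "'a::euclidean_space => real"
 assumes um[measurable]: "u \<in> borel_measurable borel" and e: "eps > 0"
 shows "(LINT z|lborel. u z * gauss_kernel eps (x - z)) =
  (2 * sqrt pi) ^ DIM('a) * (LINT t|lborel. u (x + (2 * sqrt eps) *\<^sub>R t) * exp (- 1 * (norm t)\<^sup>2))"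
proof -
 define c where "c = 2 * sqrt eps"
 have c: "c > 0" using e by (simp add: c_def)
 have g: "gauss_kernel eps (x - (x + c *\<^sub>R t)) = sqrt (pi / eps) ^ DIM('a) * exp (- 1 * (norm t)\<^sup>2)" for t
  using e by (simp add: gauss_kernel_def c_def power_mult_distrib)
 have "(LINT z|lborel. u z * gauss_kernel eps (x - z)) = \<bar>c\<bar> ^ DIM('a) * (LINT t|lborel. u (x + c *\<^sub>R t) * gauss_kernel eps (x - (x + c *\<^sub>R t)))"
  using c by (intro lborel_integral_affine) auto
 also have "(LINT t|lborel. u (x + c *\<^sub>R t) * gauss_kernel eps (x - (x + c *\<^sub>R t))) = (LINT t|lborel. sqrt (pi / eps) ^ DIM('a) * (u (x + c *\<^sub>R t) * exp (- 1 * (norm t)\<^sup>2)))"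
  unfolding g by (simp add: mult_ac)
 also have "... = sqrt (pi / eps) ^ DIM('a) * (LINT t|lborel. u (x + c *\<^sub>R t) * exp (- 1 * (norm t)\<^sup>2))"
  by (rule integral_mult_right_zero)
 also have "\<bar>c\<bar> ^ DIM('a) * (sqrt (pi / eps) ^ DIM('a) * (LINT t|lborel. u (x + c *\<^sub>R t) * exp (- 1 * (norm t)\<^sup>2)))
  = (c * sqrt (pi / eps)) ^ DIM('a) * (LINT t|lborel. u (x + c *\<^sub>R t) * exp (- 1 * (norm t)\<^sup>2))"
  using c by (simp add: power_mult_distrib)
 also have "c * sqrt (pi / eps) = 2 * sqrt pi" using e by (simp add: c_def real_sqrt_divide)
 finally show ?thesis unfolding c_def .
qed

lemma sqrt_pi_power: "(2 * sqrt pi) ^ n * sqrt pi ^ n = (2 * pi) ^ n"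
proof -
 have "2 * sqrt pi * sqrt pi = 2 * pi" by (simp add: mult.assoc)
 thus ?thesis by (simp only: power_mult_distrib[symmetric])
qed

lemma gauss_convolution_bound:
 fixes u :: "'a::euclidean_space => real"
 assumes um[measurable]: "u \<in> borel_measurable borel" and B: "!!x. \<bar>u x\<bar> \<le> B" and e: "eps > 0"
 shows "\<bar>LINT z|lborel. u z * gauss_kernel eps (x - z)\<bar> \<le> (2 * pi) ^ DIM('a) * B"
proof -
 have i1: "integrable lborel (%t::'a. B * exp (- 1 * (norm t)\<^sup>2))"
  by (intro integrable_mult_right gauss_integrable) simp
 have b: "norm (u (x + (2 * sqrt eps) *\<^sub>R t) * exp (- 1 * (norm t)\<^sup>2)) \<le> B * exp (- 1 * (norm t)\<^sup>2)" for t
  using B by (simp add: abs_mult mult_right_mono)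
 have i2: "integrable lborel (%t. u (x + (2 * sqrt eps) *\<^sub>R t) * exp (- 1 * (norm t)\<^sup>2))"
  by (rule Bochner_Integration.integrable_bound[OF i1]) (measurable, intro AE_I2 order_trans[OF b], simp)
 have "norm (LINT t|lborel. u (x + (2 * sqrt eps) *\<^sub>R t) * exp (- 1 * (norm t)\<^sup>2)) \<le> (LINT t|lborel. B * exp (- 1 * (norm (t::'a))\<^sup>2))"
  by (rule Bochner_Integration.integral_norm_bound_integral[OF i2 i1 b])
 also have "... = B * sqrt pi ^ DIM('a)"
  using gauss_integral[of 1, where 'a='a] by simp
 finally have "\<bar>LINT z|lborel. u z * gauss_kernel eps (x - z)\<bar> \<le> (2 * sqrt pi) ^ DIM('a) * (B * sqrt pi ^ DIM('a))"
  unfolding gauss_convolution_eq[OF um e] abs_mult by (intro mult_mono) auto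
 also have "... = (2 * pi) ^ DIM('a) * B" unfolding sqrt_pi_power[symmetric] by (simp add: mult_ac)
 finally show ?thesis .
qed

lemma gauss_convolution_tendsto:
 fixes u :: "'a::euclidean_space => real"
 assumes uc: "continuous_on UNIV u" and B: "!!x. \<bar>u x\<bar> \<le> B"
 shows "(%k. LINT z|lborel. u z * gauss_kernel (1 / real (Suc k)) (x - z)) \<longlonglongrightarrow> (2 * pi) ^ DIM('a) * u x"
proof -
 have um[measurable]: "u \<in> borel_measurable borel" using uc by (rule borel_measurable_continuous_onI)
 have "(%k. LINT t|lborel. u (x + (2 * sqrt (1 / real (Suc k))) *\<^sub>R t) * exp (- 1 * (norm t)\<^sup>2)) \<longlonglongrightarrow> (LINT t|lborel. u x * exp (- 1 * (norm (t::'a))\<^sup>2))"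
 proof (rule integral_dominated_convergence[where w="%t. B * exp (- 1 * (norm t)\<^sup>2)"])
  show "integrable lborel (%t::'a. B * exp (- 1 * (norm t)\<^sup>2))"
   by (intro integrable_mult_right gauss_integrable) simp
  show "AE t in lborel. (%k. u (x + (2 * sqrt (1 / real (Suc k))) *\<^sub>R t) * exp (- 1 * (norm t)\<^sup>2)) \<longlonglongrightarrow> u x * exp (- 1 * (norm t)\<^sup>2)"
  proof (rule AE_I2)
   fix t :: 'a
   have "(%k. x + (2 * sqrt (1 / real (Suc k))) *\<^sub>R t) \<longlonglongrightarrow> x + (2 * sqrt 0) *\<^sub>R t"
    by (intro tendsto_intros lim_1_over_n[THEN LIMSEQ_Suc])
   hence "(%k. u (x + (2 * sqrt (1 / real (Suc k))) *\<^sub>R t)) \<longlonglongrightarrow> u (x + (2 * sqrt 0) *\<^sub>R t)"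
    using uc by (intro continuous_on_tendsto_compose[OF uc]) auto
   thus "(%k. u (x + (2 * sqrt (1 / real (Suc k))) *\<^sub>R t) * exp (- 1 * (norm t)\<^sup>2)) \<longlonglongrightarrow> u x * exp (- 1 * (norm t)\<^sup>2)"
    by (intro tendsto_mult) auto
  qed
  show "AE t in lborel. norm (u (x + (2 * sqrt (1 / real (Suc k))) *\<^sub>R t) * exp (- 1 * (norm t)\<^sup>2)) \<le> B * exp (- 1 * (norm t)\<^sup>2)" for k
   using B by (intro AE_I2) (simp add: abs_mult mult_right_mono)
 qed measurable
 hence "(%k. (2 * sqrt pi) ^ DIM('a) * (LINT t|lborel. u (x + (2 * sqrt (1 / real (Suc k))) *\<^sub>R t) * exp (- 1 * (norm t)\<^sup>2)))
  \<longlonglongrightarrow> (2 * sqrt pi) ^ DIM('a) * (LINT t|lborel. u x * exp (- 1 * (norm (t::'a))\<^sup>2))"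
  by (intro tendsto_mult tendsto_const)
 moreover have "(2 * sqrt pi) ^ DIM('a) * (LINT t|lborel. u x * exp (- 1 * (norm (t::'a))\<^sup>2)) = (2 * pi) ^ DIM('a) * u x"
  using gauss_integral[of 1, where 'a='a] unfolding sqrt_pi_power[symmetric] by simp
 moreover have "(LINT z|lborel. u z * gauss_kernel (1 / real (Suc k)) (x - z)) =
  (2 * sqrt pi) ^ DIM('a) * (LINT t|lborel. u (x + (2 * sqrt (1 / real (Suc k))) *\<^sub>R t) * exp (- 1 * (norm t)\<^sup>2))" for k
  by (rule gauss_convolution_eq[OF um]) simp
 ultimately show ?thesis by (simp only:)
qed

lemma set_nn_integral_lebesgue_eq_lborel:
 assumes "!!p. p \<in> \<Omega> ==> f p = g p"
 shows "(\<integral>\<^sup>+p\<in>\<Omega>. f p \<partial>lebesgue) = (\<integral>\<^sup>+p\<in>\<Omega>. g p \<partial>lborel)"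
 unfolding nn_integral_completion using assms by (intro nn_integral_cong) (auto simp: indicator_def)

context
 fixes s :: real
 assumes s: "0 < s" "s < 1"
begin

text \<open>Formulated for any \<open>w\<close> that agrees with an extension on
  \<open>\<Omega>\<close>, so that it also covers the difference of two extensions. The term
  \<open>1 / (2 - 2 * s)\<close> is the integral of \<open>y^a\<close> over \<open>(0, 1)\<close>
  and stems from the zero-order part.\<close>

lemma H1_sqnorm_extn_le:
 fixes c :: "'a::euclidean_space => complex"
 assumes c[measurable]: "c \<in> borel_measurable borel" and cM: "!!xi. norm (c xi) \<le> M"
  and \<Omega>: "open \<Omega>" "\<Omega> \<subseteq> slab" and g: "has_weak_gradient \<Omega> w g"
  and eq: "!!p. p \<in> \<Omega> ==> w p = extn s c p" "!!p. p \<in> \<Omega> ==> g p = gextn s c p"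
 shows "H1_sqnorm (1 - 2 * s) \<Omega> w \<le> ennreal ((2 * pi) ^ DIM('a)) *
  (\<integral>\<^sup>+xi. ennreal ((flux s (norm xi) 0 + 1 / (2 - 2 * s)) * (norm (c xi))\<^sup>2) \<partial>lborel)"
proof -
 note [measurable] = extn_measurable[OF s c cM] gextn_measurable[OF s c cM] flux_0_measurable[OF s]
 have [measurable]: "snd \<in> borel_measurable (borel :: ('a \<times> real) measure)"
  by (intro borel_measurable_continuous_onI continuous_intros)
 have [measurable]: "slab \<in> sets (borel :: ('a \<times> real) measure)" by (rule borel_open[OF open_slab])
 define a where "a = 1 - 2 * s"
 have "H1_sqnorm a \<Omega> w = (\<integral>\<^sup>+p\<in>\<Omega>. ennreal (snd p powr a * ((extn s c p)\<^sup>2 + (norm (gextn s c p))\<^sup>2)) \<partial>lborel)"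
  unfolding H1_sqnorm_eq[OF \<Omega>(1) g] using eq by (intro set_nn_integral_lebesgue_eq_lborel) simp
 also have "... \<le> (\<integral>\<^sup>+p. ennreal (snd p powr a * (extn s c p)\<^sup>2) * indicator slab p + ennreal (snd p powr a * (norm (gextn s c p))\<^sup>2) * indicator slab p \<partial>lborel)"
 proof (rule nn_integral_mono)
  fix p :: "'a \<times> real"
  show "ennreal (snd p powr a * ((extn s c p)\<^sup>2 + (norm (gextn s c p))\<^sup>2)) * indicator \<Omega> p
   \<le> ennreal (snd p powr a * (extn s c p)\<^sup>2) * indicator slab p + ennreal (snd p powr a * (norm (gextn s c p))\<^sup>2) * indicator slab p"
  proof (cases "p \<in> \<Omega>")
   case True
   hence "p \<in> slab" using \<Omega> by blast
   thus ?thesis using True by (simp add: distrib_left)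
  qed simp
 qed
 also have "... = (\<integral>\<^sup>+p\<in>slab. ennreal (snd p powr a * (extn s c p)\<^sup>2) \<partial>lborel) + (\<integral>\<^sup>+p\<in>slab. ennreal (snd p powr a * (norm (gextn s c p))\<^sup>2) \<partial>lborel)"
  by (rule nn_integral_add) measurable
 also have "... \<le> ennreal ((2 * pi) ^ DIM('a)) * (\<integral>\<^sup>+xi. ennreal (1 / (2 - 2 * s) * (norm (c xi))\<^sup>2) \<partial>lborel)
  + ennreal ((2 * pi) ^ DIM('a)) * (\<integral>\<^sup>+xi. ennreal (flux s (norm xi) 0 * (norm (c xi))\<^sup>2) \<partial>lborel)"
  unfolding a_def by (intro add_mono extn_sq_bound[OF s c cM] gextn_energy_bound[OF s c cM])
 also have "... = ennreal ((2 * pi) ^ DIM('a)) * (\<integral>\<^sup>+xi. ennreal (1 / (2 - 2 * s) * (norm (c xi))\<^sup>2) + ennreal (flux s (norm xi) 0 * (norm (c xi))\<^sup>2) \<partial>lborel)"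
  by (subst nn_integral_add) (measurable, simp add: distrib_left)
 also have "(\<integral>\<^sup>+xi. ennreal (1 / (2 - 2 * s) * (norm (c xi))\<^sup>2) + ennreal (flux s (norm xi) 0 * (norm (c xi))\<^sup>2) \<partial>lborel)
  = (\<integral>\<^sup>+xi. ennreal ((flux s (norm xi) 0 + 1 / (2 - 2 * s)) * (norm (c xi))\<^sup>2) \<partial>lborel)"
 proof (intro nn_integral_cong)
  fix xi :: 'a
  have "ennreal (1 / (2 - 2 * s) * (norm (c xi))\<^sup>2) + ennreal (flux s (norm xi) 0 * (norm (c xi))\<^sup>2)
   = ennreal (1 / (2 - 2 * s) * (norm (c xi))\<^sup>2 + flux s (norm xi) 0 * (norm (c xi))\<^sup>2)"
   using s flux_0_bounds(1)[OF s norm_ge_zero, of xi] by (intro ennreal_plus[symmetric]) auto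
  thus "ennreal (1 / (2 - 2 * s) * (norm (c xi))\<^sup>2) + ennreal (flux s (norm xi) 0 * (norm (c xi))\<^sup>2) = ennreal ((flux s (norm xi) 0 + 1 / (2 - 2 * s)) * (norm (c xi))\<^sup>2)"
   by (simp only: distrib_right add.commute)
 qed
 finally show ?thesis unfolding a_def .
qed

lemma competitor:
 fixes u :: "'a::euclidean_space => real"
 assumes uc: "continuous_on UNIV u" and uB: "!!x. \<bar>u x\<bar> \<le> B" and ui: "integrable lborel u"
  and Q: "(\<integral>\<^sup>+xi. ennreal (flux s (norm xi) 0 * (norm (fourier u xi))\<^sup>2) \<partial>lborel) < \<infinity>"
 shows "\<exists>w\<in>H_class (1 - 2 * s) u. E_K (1 - 2 * s) w \<le> ennreal (1 / (2 * (2 * pi) ^ DIM('a))) *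
  (\<integral>\<^sup>+xi. ennreal (flux s (norm xi) 0 * (norm (fourier u xi))\<^sup>2) \<partial>lborel)"
proof -
 note [measurable] = flux_0_measurable[OF s] fourier_measurable[OF ui]
 define a where "a = 1 - 2 * s"
 define N where "N = (2 * pi) ^ DIM('a)"
 have N: "N > 0" by (simp add: N_def)
 define c where "c xi = fourier u xi / of_real N" for xi
 define e where "e k xi = exp (- (1 / real (Suc k)) * (norm (xi::'a))\<^sup>2)" for k xi
 define ck where "ck k xi = c xi * of_real (e k xi)" for k xi
 define L where "L = (LINT x|lborel. \<bar>u x\<bar>) / N"
 have e01: "0 \<le> e k xi" "e k xi \<le> 1" for k xi by (auto simp: e_def)
 have cm[measurable]: "c \<in> borel_measurable borel" unfolding c_def[abs_def] by measurable
 have em[measurable]: "e k \<in> borel_measurable borel" for k unfolding e_def[abs_def] by measurable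
 have ckm[measurable]: "ck k \<in> borel_measurable borel" for k unfolding ck_def[abs_def] by measurable
 have cL: "norm (c xi) \<le> L" for xi
  using fourier_bound[of u xi] N by (simp add: c_def L_def norm_divide divide_right_mono)
 have ckc: "norm (ck k xi) \<le> norm (c xi)" for k xi
  using e01[of k xi] by (simp add: ck_def norm_mult mult_left_le)
 have ckL: "norm (ck k xi) \<le> L" for k xi using ckc cL order_trans by blast
 let ?W = "%xi::'a. flux s (norm xi) 0 + 1 / (2 - 2 * s)"
 have W0: "?W xi \<ge> 0" for xi using s flux_0_bounds(1)[OF s norm_ge_zero, of xi] by simp
 \<comment> \<open>Finiteness of the right-hand side handles the gradient, \<open>fourier_L2\<close>
   the zero-order part; the same integrand later dominates the convergence in the \<open>H1\<close>
   norm.\<close>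
 have fin: "(\<integral>\<^sup>+xi. ennreal (?W xi * (norm (c xi))\<^sup>2) \<partial>lborel) < \<infinity>"
 proof -
  have "(\<integral>\<^sup>+xi. ennreal (?W xi * (norm (c xi))\<^sup>2) \<partial>lborel) = (\<integral>\<^sup>+xi. ennreal (1 / N\<^sup>2) * ennreal (flux s (norm xi) 0 * (norm (fourier u xi))\<^sup>2) + ennreal (1 / (2 - 2 * s) / N\<^sup>2) * ennreal ((norm (fourier u xi))\<^sup>2) \<partial>lborel)"
  proof (intro nn_integral_cong)
   fix xi :: 'a
   have "?W xi * (norm (c xi))\<^sup>2 = 1 / N\<^sup>2 * (flux s (norm xi) 0 * (norm (fourier u xi))\<^sup>2) + (1 / (2 - 2 * s) / N\<^sup>2) * (norm (fourier u xi))\<^sup>2"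
    using N s by (simp add: c_def norm_divide power_divide distrib_right add_divide_distrib)
   also have "ennreal ... = ennreal (1 / N\<^sup>2 * (flux s (norm xi) 0 * (norm (fourier u xi))\<^sup>2)) + ennreal ((1 / (2 - 2 * s) / N\<^sup>2) * (norm (fourier u xi))\<^sup>2)"
    using s flux_0_bounds(1)[OF s norm_ge_zero, of xi] by (intro ennreal_plus) auto
   also have "ennreal (1 / N\<^sup>2 * (flux s (norm xi) 0 * (norm (fourier u xi))\<^sup>2)) = ennreal (1 / N\<^sup>2) * ennreal (flux s (norm xi) 0 * (norm (fourier u xi))\<^sup>2)"
    using flux_0_bounds(1)[OF s norm_ge_zero, of xi] by (intro ennreal_mult) auto
   also have "ennreal ((1 / (2 - 2 * s) / N\<^sup>2) * (norm (fourier u xi))\<^sup>2) = ennreal (1 / (2 - 2 * s) / N\<^sup>2) * ennreal ((norm (fourier u xi))\<^sup>2)"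
    using s by (intro ennreal_mult) auto
   finally show "ennreal (?W xi * (norm (c xi))\<^sup>2) = ennreal (1 / N\<^sup>2) * ennreal (flux s (norm xi) 0 * (norm (fourier u xi))\<^sup>2) + ennreal (1 / (2 - 2 * s) / N\<^sup>2) * ennreal ((norm (fourier u xi))\<^sup>2)" .
  qed
  also have "... = ennreal (1 / N\<^sup>2) * (\<integral>\<^sup>+xi. ennreal (flux s (norm xi) 0 * (norm (fourier u xi))\<^sup>2) \<partial>lborel) + ennreal (1 / (2 - 2 * s) / N\<^sup>2) * (\<integral>\<^sup>+xi. ennreal ((norm (fourier u xi))\<^sup>2) \<partial>lborel)"
   by (subst nn_integral_add) (measurable, simp add: nn_integral_cmult)
  also have "... < \<infinity>"
   using Q fourier_L2[OF ui uB] by (simp add: ennreal_mult_less_top)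
  finally show ?thesis .
 qed
 define w where "w = extn s c"
 have wg: "has_weak_gradient slab w (gextn s c)" unfolding w_def by (rule extn_has_weak_gradient_slab[OF s cm cL])
 have kg: "has_weak_gradient slab (extn s (ck k)) (gextn s (ck k))" for k by (rule extn_has_weak_gradient_slab[OF s ckm ckL])
 have op: "open (ball x R \<times> {0<..<1} :: ('a \<times> real) set)" for x R by (intro open_Times) auto
 have sub: "ball x R \<times> {0<..<1} \<subseteq> (slab :: ('a \<times> real) set)" for x R by (auto simp: slab_def)
 have H1: "w \<in> H1 a (ball x R \<times> {0<..<1})" for x R
 proof -
  have g: "has_weak_gradient (ball x R \<times> {0<..<1}) w (gextn s c)" by (rule has_weak_gradient_mono[OF wg sub])
  have "H1_sqnorm a (ball x R \<times> {0<..<1}) w \<le> ennreal N * (\<integral>\<^sup>+xi. ennreal (?W xi * (norm (c xi))\<^sup>2) \<partial>lborel)"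
   unfolding a_def N_def by (rule H1_sqnorm_extn_le[OF cm cL op sub g]) (simp_all add: w_def)
  also have "... < \<infinity>" using fin by (simp add: ennreal_mult_less_top)
  finally show ?thesis using g by (auto simp: H1_def)
 qed
 have H1k: "extn s (ck k) \<in> H1 a (ball x R \<times> {0<..<1})" for x R k
 proof -
  have g: "has_weak_gradient (ball x R \<times> {0<..<1}) (extn s (ck k)) (gextn s (ck k))" by (rule has_weak_gradient_mono[OF kg sub])
  have "H1_sqnorm a (ball x R \<times> {0<..<1}) (extn s (ck k)) \<le> ennreal N * (\<integral>\<^sup>+xi. ennreal (?W xi * (norm (ck k xi))\<^sup>2) \<partial>lborel)"
   unfolding a_def N_def by (rule H1_sqnorm_extn_le[OF ckm ckL op sub g]) simp_all
  also have "... \<le> ennreal N * (\<integral>\<^sup>+xi. ennreal (?W xi * (norm (c xi))\<^sup>2) \<partial>lborel)"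
   using ckc W0 by (intro mult_left_mono nn_integral_mono ennreal_leI power_mono) auto
  also have "... < \<infinity>" using fin by (simp add: ennreal_mult_less_top)
  finally show ?thesis using g by (auto simp: H1_def)
 qed
 have conv1: "(%k. H1_sqnorm a (ball x R \<times> {0<..<1}) (%p. extn s (ck k) p - w p)) \<longlonglongrightarrow> 0" for x R
 proof -
  let ?d = "%k xi. ck k xi - c xi"
  have le: "H1_sqnorm a (ball x R \<times> {0<..<1}) (%p. extn s (ck k) p - w p) \<le> ennreal N * (\<integral>\<^sup>+xi. ennreal (?W xi * (norm (?d k xi))\<^sup>2) \<partial>lborel)" for k
  proof -
   have g: "has_weak_gradient (ball x R \<times> {0<..<1}) (%p. extn s (ck k) p - w p) (%p. gextn s (ck k) p - gextn s c p)"
    by (rule has_weak_gradient_mono[OF has_weak_gradient_diff[OF kg wg] sub])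
   have dM: "norm (?d k xi) \<le> L + L" for xi
    using norm_triangle_ineq4[of "ck k xi" "c xi"] ckL[of k xi] cL[of xi] by linarith
   show ?thesis unfolding a_def N_def
   proof (rule H1_sqnorm_extn_le[OF _ dM op sub g])
    show "?d k \<in> borel_measurable borel" by measurable
    fix p :: "'a \<times> real" assume "p \<in> ball x R \<times> {0<..<1}"
    hence p: "p \<in> slab" using sub by blast
    show "extn s (ck k) p - w p = extn s (?d k) p" "gextn s (ck k) p - gextn s c p = gextn s (?d k) p"
     unfolding w_def using extn_diff[OF s ckm ckL cm cL p] by simp_all
   qed
  qed
  have "(%k. \<integral>\<^sup>+xi. ennreal (?W xi * (norm (?d k xi))\<^sup>2) \<partial>lborel) \<longlonglongrightarrow> (\<integral>\<^sup>+xi. 0 \<partial>(lborel :: 'a measure))"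
  proof (rule nn_integral_dominated_convergence[where w="%xi. ennreal (?W xi * (norm (c xi))\<^sup>2)"])
   show "(\<integral>\<^sup>+xi. ennreal (?W xi * (norm (c xi))\<^sup>2) \<partial>lborel) < \<infinity>" by (rule fin)
   show "AE xi in lborel. (%k. ennreal (?W xi * (norm (?d k xi))\<^sup>2)) \<longlonglongrightarrow> 0"
   proof (rule AE_I2)
    fix xi :: 'a
    have "(%k. e k xi) \<longlonglongrightarrow> exp (- 0 * (norm xi)\<^sup>2)"
     unfolding e_def by (intro tendsto_intros lim_1_over_n[THEN LIMSEQ_Suc])
    hence "(%k. ?W xi * (norm (c xi * of_real (e k xi) - c xi))\<^sup>2) \<longlonglongrightarrow> ?W xi * (norm (c xi * of_real (exp (- 0 * (norm xi)\<^sup>2)) - c xi))\<^sup>2"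
     by (intro tendsto_intros)
    hence "(%k. ennreal (?W xi * (norm (?d k xi))\<^sup>2)) \<longlonglongrightarrow> ennreal 0"
     unfolding ck_def by (intro tendsto_ennrealI) simp
    thus "(%k. ennreal (?W xi * (norm (?d k xi))\<^sup>2)) \<longlonglongrightarrow> 0" by simp
   qed
   show "AE xi in lborel. ennreal (?W xi * (norm (?d k xi))\<^sup>2) \<le> ennreal (?W xi * (norm (c xi))\<^sup>2)" for k
   proof (rule AE_I2)
    fix xi :: 'a
    have "?d k xi = c xi * of_real (e k xi - 1)" by (simp add: ck_def algebra_simps)
    hence "norm (?d k xi) = norm (c xi) * \<bar>e k xi - 1\<bar>" by (simp only: norm_mult norm_of_real)
    also have "... \<le> norm (c xi) * 1" using e01[of k xi] by (intro mult_left_mono) auto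
    finally show "ennreal (?W xi * (norm (?d k xi))\<^sup>2) \<le> ennreal (?W xi * (norm (c xi))\<^sup>2)"
     using W0[of xi] by (intro ennreal_leI mult_left_mono power_mono) auto
   qed
  qed measurable
  hence "(%k. ennreal N * (\<integral>\<^sup>+xi. ennreal (?W xi * (norm (?d k xi))\<^sup>2) \<partial>lborel)) \<longlonglongrightarrow> ennreal N * 0"
   by (intro ennreal_tendsto_cmult) auto
  hence lim: "(%k. ennreal N * (\<integral>\<^sup>+xi. ennreal (?W xi * (norm (?d k xi))\<^sup>2) \<partial>lborel)) \<longlonglongrightarrow> 0" by simp
  show ?thesis by (rule tendsto_sandwich[OF _ _ tendsto_const lim]) (use le in auto)
 qed
 have B0: "B \<ge> 0" using uB[of 0] by linarith
 have cki: "integrable lborel (ck k)" for k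
 proof (rule Bochner_Integration.integrable_bound[OF integrable_mult_right[OF gauss_integrable[of "1 / real (Suc k)"], of L]])
  show "AE xi in lborel. norm (ck k xi) \<le> norm (L * exp (- (1 / real (Suc k)) * (norm xi)\<^sup>2))"
  proof (rule AE_I2)
   fix xi :: 'a
   have "norm (ck k xi) \<le> L * e k xi" using cL[of xi] e01[of k xi] by (simp add: ck_def norm_mult mult_right_mono)
   thus "norm (ck k xi) \<le> norm (L * exp (- (1 / real (Suc k)) * (norm xi)\<^sup>2))" unfolding e_def by simp
  qed
 qed auto
 \<comment> \<open>At \<open>y = 0\<close> the profile is 1, so the approximants restrict to
   Gaussian means of \<open>u\<close>.\<close>
 have tr: "extn s (ck k) (x, 0) = (LINT z|lborel. u z * gauss_kernel (1 / real (Suc k)) (x - z)) / N" for k x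
 proof -
  have "ift (ck k) x = ift (%xi. fourier u xi * of_real (exp (- (1 / real (Suc k)) * (norm xi)\<^sup>2))) x / of_real N"
   unfolding ift_def ck_def c_def e_def by (subst integral_divide_zero[symmetric]) (simp add: mult_ac)
  also have "... = of_real ((LINT z|lborel. u z * gauss_kernel (1 / real (Suc k)) (x - z)) / N)"
   by (subst ift_fourier_gauss[OF ui]) auto
  finally show ?thesis unfolding extn_0[OF s] by simp
 qed
 have um[measurable]: "u \<in> borel_measurable borel" using uc by (rule borel_measurable_continuous_onI)
 have conv2: "(%k. \<integral>\<^sup>+x\<in>ball x0 R. ennreal ((extn s (ck k) (x, 0) - u x)\<^sup>2) \<partial>lebesgue) \<longlonglongrightarrow> 0" for x0 R
 proof -
  define E where "E k x = extn s (ck k) (x, 0)" for k x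
  have [measurable]: "E k \<in> borel_measurable borel" for k
   unfolding E_def extn_0[OF s] by measurable
  have trE: "E k x = (LINT z|lborel. u z * gauss_kernel (1 / real (Suc k)) (x - z)) / N" for k x
   unfolding E_def by (rule tr)
  have [measurable]: "ball x0 R \<in> sets borel" by simp
  \<comment> \<open>Gaussian means of \<open>u\<close> are again bounded by \<open>B\<close>, so the
    squared error is at most \<open>(B + B)\<^sup>2\<close>, which is integrable on a ball.\<close>
  have "(%k. \<integral>\<^sup>+x. ennreal ((E k x - u x)\<^sup>2) * indicator (ball x0 R) x \<partial>lborel) \<longlonglongrightarrow> (\<integral>\<^sup>+x. 0 \<partial>(lborel :: 'a measure))"
  proof (rule nn_integral_dominated_convergence[where w="%x. ennreal ((B + B)\<^sup>2) * indicator (ball x0 R) x"])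
   have "emeasure lborel (ball x0 R) < \<infinity>" using emeasure_bounded_finite[OF bounded_ball] by simp
   thus "(\<integral>\<^sup>+x. ennreal ((B + B)\<^sup>2) * indicator (ball x0 R) x \<partial>lborel) < \<infinity>"
    by (subst nn_integral_cmult_indicator) (auto simp: ennreal_mult_less_top)
   show "AE x in lborel. (%k. ennreal ((E k x - u x)\<^sup>2) * indicator (ball x0 R) x) \<longlonglongrightarrow> 0"
   proof (rule AE_I2)
    fix x :: 'a
    have "(%k. ((LINT z|lborel. u z * gauss_kernel (1 / real (Suc k)) (x - z)) / N - u x)\<^sup>2) \<longlonglongrightarrow> (N * u x / N - u x)\<^sup>2"
     using gauss_convolution_tendsto[OF uc uB, of x] N unfolding N_def by (intro tendsto_intros) auto
    hence "(%k. ennreal ((E k x - u x)\<^sup>2)) \<longlonglongrightarrow> ennreal 0"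
     unfolding trE using N by (intro tendsto_ennrealI) simp
    thus "(%k. ennreal ((E k x - u x)\<^sup>2) * indicator (ball x0 R) x) \<longlonglongrightarrow> 0"
     by (cases "x \<in> ball x0 R") auto
   qed
   show "AE x in lborel. ennreal ((E k x - u x)\<^sup>2) * indicator (ball x0 R) x \<le> ennreal ((B + B)\<^sup>2) * indicator (ball x0 R) x" for k
   proof (rule AE_I2)
    fix x :: 'a
    have "\<bar>LINT z|lborel. u z * gauss_kernel (1 / real (Suc k)) (x - z)\<bar> \<le> N * B"
     unfolding N_def by (rule gauss_convolution_bound[OF um uB]) simp
    hence "\<bar>LINT z|lborel. u z * gauss_kernel (1 / real (Suc k)) (x - z)\<bar> / N \<le> N * B / N"
     using N by (intro divide_right_mono) auto
    hence "\<bar>E k x\<bar> \<le> N * B / N"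
     unfolding trE abs_divide using N by (simp only: abs_of_pos)
    hence "\<bar>E k x - u x\<bar> \<le> B + B" using uB[of x] N by simp
    hence "(E k x - u x)\<^sup>2 \<le> (B + B)\<^sup>2" using B0 power2_le_iff_abs_le[of "B + B"] by (simp only: add_nonneg_nonneg)
    thus "ennreal ((E k x - u x)\<^sup>2) * indicator (ball x0 R) x \<le> ennreal ((B + B)\<^sup>2) * indicator (ball x0 R) x"
     by (intro mult_right_mono ennreal_leI) auto
   qed
  qed measurable
  thus ?thesis unfolding E_def by (simp add: nn_integral_completion)
 qed
 have "w \<in> H_class a u"
  unfolding H_class_def
 proof (intro CollectI conjI allI impI)
  show "w \<in> H1_loc a" unfolding H1_loc_def using H1 by blast
  fix x0 :: 'a and R :: real assume R: "R > 0"
  show "has_trace a (ball x0 R) w u"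
   unfolding has_trace_def
  proof (intro conjI exI[of _ "%k. extn s (ck k)"] allI)
   show "u \<in> borel_measurable (lebesgue_on (ball x0 R))"
    by (intro measurable_restrict_space1 measurable_completion) simp
   show "extn s (ck k) \<in> H1 a (ball x0 R \<times> {0<..<1})" for k by (rule H1k)
   show "continuous_on (closure (ball x0 R \<times> {0<..<1})) (extn s (ck k))" for k
   proof (rule continuous_on_subset[OF extn_continuous[OF s cki]])
    have "closure (ball x0 R \<times> {0<..<1}) = closure (ball x0 R) \<times> closure {0<..<1::real}" by (rule closure_Times)
    thus "closure (ball x0 R \<times> {0<..<1}) \<subseteq> UNIV \<times> {0..1::real}" by auto
   qed
  qed (use conv1 conv2 in auto)
 qed
 moreover have "E_K a w \<le> ennreal (1 / (2 * N)) * (\<integral>\<^sup>+xi. ennreal (flux s (norm xi) 0 * (norm (fourier u xi))\<^sup>2) \<partial>lborel)"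
 proof -
  have "E_K a w = 1 / 2 * (\<integral>\<^sup>+p\<in>slab. ennreal (snd p powr a * (norm (gextn s c p))\<^sup>2) \<partial>lborel)"
   unfolding E_K_eq[OF wg] by (simp add: nn_integral_completion)
  also have "... \<le> 1 / 2 * (ennreal N * (\<integral>\<^sup>+xi. ennreal (flux s (norm xi) 0 * (norm (c xi))\<^sup>2) \<partial>lborel))"
   unfolding a_def N_def by (intro mult_left_mono gextn_energy_bound[OF s cm cL]) simp
  also have "(\<integral>\<^sup>+xi. ennreal (flux s (norm xi) 0 * (norm (c xi))\<^sup>2) \<partial>lborel) = (\<integral>\<^sup>+xi. ennreal (1 / N\<^sup>2) * ennreal (flux s (norm xi) 0 * (norm (fourier u xi))\<^sup>2) \<partial>lborel)"
  proof (intro nn_integral_cong)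
   fix xi :: 'a
   have "flux s (norm xi) 0 * (norm (c xi))\<^sup>2 = 1 / N\<^sup>2 * (flux s (norm xi) 0 * (norm (fourier u xi))\<^sup>2)"
    using N by (simp add: c_def norm_divide power_divide)
   thus "ennreal (flux s (norm xi) 0 * (norm (c xi))\<^sup>2) = ennreal (1 / N\<^sup>2) * ennreal (flux s (norm xi) 0 * (norm (fourier u xi))\<^sup>2)"
    using flux_0_bounds(1)[OF s norm_ge_zero, of xi] by (simp only: ennreal_mult[symmetric] zero_le_power2 divide_nonneg_nonneg mult_nonneg_nonneg zero_le_one)
  qed
  also have "... = ennreal (1 / N\<^sup>2) * (\<integral>\<^sup>+xi. ennreal (flux s (norm xi) 0 * (norm (fourier u xi))\<^sup>2) \<partial>lborel)"
   by (rule nn_integral_cmult) measurable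
  \<comment> \<open>The factor \<open>N\<close> comes from Plancherel and
    \<open>1 / N\<^sup>2\<close> from the squared amplitude; together with \<open>1 / 2\<close> they
    leave the constant of the statement.\<close>
  also have "1 / 2 * (ennreal N * (ennreal (1 / N\<^sup>2) * X)) = ennreal (1 / (2 * N)) * X" for X
  proof -
   have "ennreal (1/2) * (ennreal N * ennreal (1 / N\<^sup>2)) = ennreal (1/2 * (N * (1 / N\<^sup>2)))"
    using N by (subst ennreal_mult[symmetric]; (subst ennreal_mult[symmetric])?; simp)
   also have "1/2 * (N * (1 / N\<^sup>2)) = 1 / (2 * N)" using N by (simp add: power2_eq_square)
   finally show ?thesis unfolding ennreal_half by (simp only: mult.assoc[symmetric])
  qed
  finally show ?thesis .
 qed
 ultimately show ?thesis unfolding a_def N_def by blast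
qed

end

section \<open>Cutoffs in the vertical variable\<close>

text \<open>The support fills \<open>(0, 1)\<close> and the parameter of the exponent tends to 0, so
  the cutoffs converge to 1 inside. The offset 3 keeps the left end below \<open>1 / 2\<close>
  already for \<open>k = 0\<close>.\<close>

definition cutoff :: "nat => real => real" where
 "cutoff k = bump (1 / real (Suc k)) (1 / real (k + 3)) (1 - 1 / real (k + 3))"

text \<open>The derivative of \<open>cutoff k\<close> in closed form: for a constant numerator only
  the contribution of the exponent survives, with a pole of order 2.\<close>

definition dcutoff :: "nat => real => real" where
 "dcutoff k = (let e = 1 / real (Suc k); \<alpha> = 1 / real (k + 3); \<beta> = 1 - 1 / real (k + 3) in
  wbump e \<alpha> \<beta> 2 (%y. e * ((\<beta> - y)\<^sup>2 - (y - \<alpha>)\<^sup>2)))"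

lemma cutoff_range: "0 \<le> cutoff k y" "cutoff k y \<le> 1"
 unfolding cutoff_def by (auto intro!: bump_bounds simp: add_pos_nonneg)

lemma cutoff_ends: "0 < 1 / real (k + 3)" "1 / real (k + 3) < 1/2"
 by (auto simp: field_simps)

lemma cutoff_eq_0: "y \<notin> {1 / real (k + 3)..1 - 1 / real (k + 3)} ==> cutoff k y = 0"
 by (auto simp: cutoff_def bump_def)

lemma DERIV_cutoff: "(cutoff k has_real_derivative dcutoff k y) (at y)"
proof -
 have e: "1 / real (Suc k) > 0" by simp
 define e \<alpha> \<beta> where "e = 1 / real (Suc k)" and "\<alpha> = 1 / real (k + 3)" and "\<beta> = 1 - 1 / real (k + 3)"
 have W: "(wbump e \<alpha> \<beta> 0 (%_. 1) has_real_derivative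
  (wbump e \<alpha> \<beta> 0 (%_. 0) y + (wbump e \<alpha> \<beta> (Suc 0) (%y. - real 0 * ((\<beta> - y) - (y - \<alpha>)) * 1) y
   + wbump e \<alpha> \<beta> (0 + 2) (%y. e * ((\<beta> - y)\<^sup>2 - (y - \<alpha>)\<^sup>2) * 1) y))) (at y)"
  by (rule wbump_DERIV[where J=UNIV]) (auto simp: e_def)
 have 1: "wbump e \<alpha> \<beta> 0 (%_. 1) = cutoff k"
  by (simp add: wbump_def cutoff_def e_def \<alpha>_def \<beta>_def fun_eq_iff)
 have 2: "wbump e \<alpha> \<beta> 0 (%_. 0) y = 0" "wbump e \<alpha> \<beta> (Suc 0) (%y. - real 0 * ((\<beta> - y) - (y - \<alpha>)) * 1) y = 0"
  by (simp_all add: wbump_def)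
 have 3: "wbump e \<alpha> \<beta> (0 + 2) (%y. e * ((\<beta> - y)\<^sup>2 - (y - \<alpha>)\<^sup>2) * 1) y = dcutoff k y"
  unfolding dcutoff_def Let_def e_def \<alpha>_def \<beta>_def by (simp only: add_0 mult_1_right)
 show ?thesis using W unfolding 1 2 3 by simp
qed

lemma dcutoff_continuous: "continuous_on A (dcutoff k)"
proof -
 have "continuous_on UNIV (dcutoff k)"
  unfolding dcutoff_def Let_def by (rule wbump_continuous[where J=UNIV]) (auto intro!: continuous_intros)
 thus ?thesis using continuous_on_subset by blast
qed

lemma cutoff_continuous: "continuous_on A (cutoff k)"
 using DERIV_cutoff DERIV_isCont by (blast intro: continuous_at_imp_continuous_on)

lemma dcutoff_eq_0: "y \<notin> {1 / real (k + 3)<..<1 - 1 / real (k + 3)} ==> dcutoff k y = 0"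
 by (auto simp: dcutoff_def Let_def wbump_def bump_def)

text \<open>By the symmetry of the ends about \<open>1 / 2\<close> the numerator is a nonnegative
  multiple of \<open>1 - 2 * y\<close>. The cutoff thus rises and then falls, which bounds the
  \<open>L1\<close> norm of its derivative independently of \<open>k\<close>.\<close>

lemma dcutoff_sign: "y \<le> 1/2 ==> dcutoff k y \<ge> 0" "y \<ge> 1/2 ==> dcutoff k y \<le> 0"
proof -
 define e \<alpha> \<beta> where "e = 1 / real (Suc k)" and "\<alpha> = 1 / real (k + 3)" and "\<beta> = 1 - 1 / real (k + 3)"
 have b: "\<beta> = 1 - \<alpha>" by (simp only: \<alpha>_def \<beta>_def)
 have f: "e * ((\<beta> - y)\<^sup>2 - (y - \<alpha>)\<^sup>2) = (e * (\<beta> - \<alpha>)) * (1 - 2 * y)"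
  unfolding b by (simp add: power2_eq_square algebra_simps)
 have p: "e * (\<beta> - \<alpha>) \<ge> 0" using cutoff_ends[of k] by (simp add: e_def \<alpha>_def \<beta>_def)
 define D where "D = bump e \<alpha> \<beta> y / ((y - \<alpha>) * (\<beta> - y)) ^ 2"
 have D: "D \<ge> 0" unfolding D_def using bump_bounds(1)[of e \<alpha> \<beta> y] by (auto simp: e_def)
 have d: "dcutoff k y = (e * (\<beta> - \<alpha>)) * (1 - 2 * y) * D"
  unfolding dcutoff_def Let_def wbump_def e_def[symmetric] \<alpha>_def[symmetric] b[symmetric] f D_def by simp
 show "dcutoff k y \<ge> 0" if "y \<le> 1/2"
  unfolding d by (rule mult_nonneg_nonneg[OF mult_nonneg_nonneg[OF p] D]) (use that in simp)
 show "dcutoff k y \<le> 0" if "y \<ge> 1/2"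
  unfolding d by (rule mult_nonpos_nonneg[OF mult_nonneg_nonpos[OF p] D]) (use that in simp)
qed

lemma cutoff_tendsto:
 assumes y: "0 < y" "y < 1"
 shows "(%k. cutoff k y) \<longlonglongrightarrow> 1"
proof -
 have l: "(%k. 1 / real (Suc k)) \<longlonglongrightarrow> 0" by (rule lim_1_over_n[THEN LIMSEQ_Suc])
 have l3: "(%k. 1 / real (k + 3)) \<longlonglongrightarrow> 0" by real_asymp
 have "(%k. exp (- (1 / real (Suc k)) / (y - 1 / real (k + 3)) - (1 / real (Suc k)) / (1 - 1 / real (k + 3) - y))) \<longlonglongrightarrow> exp (- 0 / (y - 0) - 0 / (1 - 0 - y))"
  using y by (intro tendsto_intros l l3) auto
 hence lim: "(%k. exp (- (1 / real (Suc k)) / (y - 1 / real (k + 3)) - (1 / real (Suc k)) / (1 - 1 / real (k + 3) - y))) \<longlonglongrightarrow> 1" by simp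
 have "eventually (%k. 1 / real (k + 3) < y) sequentially" "eventually (%k. 1 / real (k + 3) < 1 - y) sequentially"
  using order_tendstoD(2)[OF l3] y by auto
 hence "eventually (%k. exp (- (1 / real (Suc k)) / (y - 1 / real (k + 3)) - (1 / real (Suc k)) / (1 - 1 / real (k + 3) - y)) = cutoff k y) sequentially"
  by eventually_elim (simp add: cutoff_def bump_def)
 thus ?thesis by (rule Lim_transform_eventually[OF lim])
qed

lemma set_LINT_eq_integral:
 fixes f :: "real => real"
 assumes "continuous_on {a..b} f"
 shows "set_integrable lborel {a..b} f" "(LINT y:{a..b}|lborel. f y) = integral {a..b} f"
proof -
 show i: "set_integrable lborel {a..b} f" unfolding set_integrable_def by (rule borel_integrable_compact[OF compact_Icc assms])
 show "(LINT y:{a..b}|lborel. f y) = integral {a..b} f" by (rule set_borel_integral_eq_integral(2)[OF i])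
qed

lemma integral_abs_dcutoff: "(LINT y:{0..1}|lborel. \<bar>dcutoff k y\<bar>) \<le> 2"
proof -
 have 1: "(dcutoff k has_integral (cutoff k (1/2) - cutoff k 0)) {0..1/2}" "(dcutoff k has_integral (cutoff k 1 - cutoff k (1/2))) {1/2..1}"
  by (auto intro!: fundamental_theorem_of_calculus DERIV_subset[OF DERIV_cutoff]
    simp: has_real_derivative_iff_has_vector_derivative[symmetric])
 have "((%y. \<bar>dcutoff k y\<bar>) has_integral (cutoff k (1/2) - cutoff k 0)) {0..1/2}"
  by (rule has_integral_eq[OF _ 1(1)]) (use dcutoff_sign(1) in auto)
 moreover have "((%y. \<bar>dcutoff k y\<bar>) has_integral (- (cutoff k 1 - cutoff k (1/2)))) {1/2..1}"
  by (rule has_integral_eq[OF _ has_integral_neg[OF 1(2)]]) (use dcutoff_sign(2)[of _ k] in auto)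
 ultimately have "((%y. \<bar>dcutoff k y\<bar>) has_integral (cutoff k (1/2) - cutoff k 0 + - (cutoff k 1 - cutoff k (1/2)))) {0..1}"
  by (intro has_integral_combine[of 0 "1/2"]) auto
 hence "integral {0..1} (%y. \<bar>dcutoff k y\<bar>) = cutoff k (1/2) - cutoff k 0 + - (cutoff k 1 - cutoff k (1/2))"
  by (rule integral_unique)
 also have "... \<le> 2" using cutoff_range[of k "1/2"] cutoff_range[of k 0] cutoff_range[of k 1] by linarith
 finally show ?thesis
  by (subst set_LINT_eq_integral(2)) (auto intro!: continuous_intros dcutoff_continuous)
qed

lemma dcutoff_integral_bound:
 assumes c: "continuous_on {0..1} \<Psi>" and b: "!!y. y \<in> {0..1} ==> \<bar>\<Psi> y\<bar> \<le> M"
 shows "\<bar>LINT y:{0..1}|lborel. dcutoff k y * \<Psi> y\<bar> \<le> 2 * M"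
proof -
 have M: "M \<ge> 0" using b[of 0] by simp
 have "norm (LINT y|lborel. indicator {0..1} y *\<^sub>R (dcutoff k y * \<Psi> y)) \<le> (LINT y|lborel. indicator {0..1} y *\<^sub>R (\<bar>dcutoff k y\<bar> * M))"
 proof (rule Bochner_Integration.integral_norm_bound_integral)
  show "integrable lborel (%y. indicat_real {0..1} y *\<^sub>R (dcutoff k y * \<Psi> y))" "integrable lborel (%y. indicat_real {0..1} y *\<^sub>R (\<bar>dcutoff k y\<bar> * M))"
   by (intro borel_integrable_compact compact_Icc continuous_intros dcutoff_continuous c)+
  show "norm (indicat_real {0..1} y *\<^sub>R (dcutoff k y * \<Psi> y)) \<le> indicat_real {0..1} y *\<^sub>R (\<bar>dcutoff k y\<bar> * M)" for y
   using b[of y] by (cases "y \<in> {0..1}") (simp_all add: abs_mult mult_left_mono)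
 qed
 also have "... = (LINT y:{0..1}|lborel. \<bar>dcutoff k y\<bar>) * M"
  unfolding set_lebesgue_integral_def by (simp add: mult.assoc[symmetric])
 also have "... \<le> 2 * M" using integral_abs_dcutoff M by (intro mult_right_mono) auto
 finally show ?thesis unfolding set_lebesgue_integral_def by simp
qed

text \<open>The derivatives converge weakly to the point mass at 0 minus the point mass at 1. For
  polynomials this is integration by parts; Weierstrass approximation and the uniform
  \<open>L1\<close> bound extend it to continuous functions.\<close>

lemma dcutoff_integral_tendsto:
 assumes c: "continuous_on {0..1} \<Psi>"
 shows "(%k. LINT y:{0..1}|lborel. dcutoff k y * \<Psi> y) \<longlonglongrightarrow> \<Psi> 0 - \<Psi> 1"
proof (rule LIMSEQ_I)
 fix \<eta> :: real assume \<eta>: "\<eta> > 0"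
 \<comment> \<open>An approximation error of \<open>\<eta> / 8\<close> costs twice that in the
   integral and once at each end point, in total \<open>\<eta> / 2\<close>; another
   \<open>\<eta> / 4\<close> is left for the polynomial.\<close>
 obtain p where p: "real_polynomial_function p" "!!y. y \<in> {0..1} ==> \<bar>\<Psi> y - p y\<bar> < \<eta> / 8"
  using Stone_Weierstrass_real_polynomial_function[OF compact_Icc c, of "\<eta>/8"] \<eta> by auto
 obtain p' where p': "real_polynomial_function p'" "!!x. (p has_real_derivative p' x) (at x)"
  using has_real_derivative_polynomial_function[OF p(1)] by blast
 have cp: "continuous_on A p" for A using p'(2) DERIV_isCont by (blast intro: continuous_at_imp_continuous_on)
 have cp': "continuous_on A p'" for A
  using has_real_derivative_polynomial_function[OF p'(1)] DERIV_isCont by (metis continuous_at_imp_continuous_on)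
 \<comment> \<open>No boundary terms appear, because every cutoff vanishes at 0 and at 1.\<close>
 have ibp: "(LINT y:{0..1}|lborel. dcutoff k y * p y) = - (LINT y:{0..1}|lborel. cutoff k y * p' y)" for k
 proof -
  have "((%y. dcutoff k y * p y + p' y * cutoff k y) has_integral (cutoff k 1 * p 1 - cutoff k 0 * p 0)) {0..1}"
   by (rule fundamental_theorem_of_calculus)
    (auto intro!: DERIV_subset[OF DERIV_mult[OF DERIV_cutoff p'(2)]] simp: has_real_derivative_iff_has_vector_derivative[symmetric])
  moreover have "cutoff k 1 = 0" "cutoff k 0 = 0" using cutoff_ends[of k] by (auto intro!: cutoff_eq_0)
  ultimately have "((%y. dcutoff k y * p y + p' y * cutoff k y) has_integral 0) {0..1}" by simp
  hence 0: "integral {0..1} (%y. dcutoff k y * p y + p' y * cutoff k y) = 0" by (rule integral_unique)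
  have i: "(%y. dcutoff k y * p y) integrable_on {0..1}" "(%y. p' y * cutoff k y) integrable_on {0..1}"
   by (auto intro!: integrable_continuous_interval continuous_intros dcutoff_continuous cutoff_continuous cp cp')
  have "integral {0..1} (%y. dcutoff k y * p y) = - integral {0..1} (%y. p' y * cutoff k y)"
   using 0 Henstock_Kurzweil_Integration.integral_add[OF i] by simp
  also have "(%y. p' y * cutoff k y) = (%y. cutoff k y * p' y)" by (simp add: mult.commute)
  finally show ?thesis
   using set_LINT_eq_integral(2)[of 0 1 "%y. dcutoff k y * p y"] set_LINT_eq_integral(2)[of 0 1 "%y. cutoff k y * p' y"]
   by (simp add: continuous_on_mult dcutoff_continuous cutoff_continuous cp cp')
 qed
 have "(%k. LINT y|lborel. indicator {0..1} y *\<^sub>R (cutoff k y * p' y)) \<longlonglongrightarrow> (LINT y|lborel. indicator {0..1} y *\<^sub>R (p' y))"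
 proof (rule integral_dominated_convergence[where w="%y. indicator {0..1} y *\<^sub>R \<bar>p' y\<bar>"])
  have [measurable]: "p' \<in> borel_measurable borel" "cutoff k \<in> borel_measurable borel" for k
   using cp' cutoff_continuous by (auto intro: borel_measurable_continuous_onI)
  show "(%y. indicat_real {0..1} y *\<^sub>R p' y) \<in> borel_measurable lborel" by measurable
  show "(%y. indicat_real {0..1} y *\<^sub>R (cutoff k y * p' y)) \<in> borel_measurable lborel" for k by measurable
  show "integrable lborel (%y. indicat_real {0..1} y *\<^sub>R \<bar>p' y\<bar>)"
   by (intro borel_integrable_compact compact_Icc continuous_intros cp')
  have "AE y in lborel. y \<noteq> (0::real)" "AE y in lborel. y \<noteq> (1::real)" by (rule AE_lborel_singleton)+
  thus "AE y in lborel. (%k. indicat_real {0..1} y *\<^sub>R (cutoff k y * p' y)) \<longlonglongrightarrow> indicat_real {0..1} y *\<^sub>R p' y"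
  proof eventually_elim
   case (elim y)
   show ?case
   proof (cases "y \<in> {0..1}")
    case True
    hence "(%k. cutoff k y * p' y) \<longlonglongrightarrow> 1 * p' y" using elim by (intro tendsto_mult cutoff_tendsto) auto
    thus ?thesis using True by simp
   qed simp
  qed
  show "AE y in lborel. norm (indicat_real {0..1} y *\<^sub>R (cutoff k y * p' y)) \<le> indicat_real {0..1} y *\<^sub>R \<bar>p' y\<bar>" for k
   using cutoff_range[of k] by (intro AE_I2) (auto simp: abs_mult indicator_def mult_left_le_one_le)
 qed
 hence "(%k. - (LINT y:{0..1}|lborel. cutoff k y * p' y)) \<longlonglongrightarrow> - (LINT y:{0..1}|lborel. p' y)"
  unfolding set_lebesgue_integral_def by (rule tendsto_minus)
 moreover have "(LINT y:{0..1}|lborel. p' y) = p 1 - p 0"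
 proof -
  have "(p' has_integral (p 1 - p 0)) {0..1}"
   by (rule fundamental_theorem_of_calculus)
    (auto intro!: DERIV_subset[OF p'(2)] simp: has_real_derivative_iff_has_vector_derivative[symmetric])
  thus ?thesis using set_LINT_eq_integral(2)[OF cp', of 0 1] by (simp add: integral_unique)
 qed
 ultimately have "(%k. LINT y:{0..1}|lborel. dcutoff k y * p y) \<longlonglongrightarrow> p 0 - p 1" unfolding ibp by simp
 from LIMSEQ_D[OF this, of "\<eta>/4"] \<eta> obtain N where N: "!!k. k \<ge> N ==> \<bar>(LINT y:{0..1}|lborel. dcutoff k y * p y) - (p 0 - p 1)\<bar> < \<eta> / 4"
  by auto
 show "\<exists>N. \<forall>k\<ge>N. norm ((LINT y:{0..1}|lborel. dcutoff k y * \<Psi> y) - (\<Psi> 0 - \<Psi> 1)) < \<eta>"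
 proof (intro exI allI impI)
  fix k assume k: "N \<le> k"
  have "(LINT y:{0..1}|lborel. dcutoff k y * \<Psi> y) - (LINT y:{0..1}|lborel. dcutoff k y * p y) = (LINT y:{0..1}|lborel. dcutoff k y * (\<Psi> y - p y))"
   unfolding right_diff_distrib
   by (intro set_integral_diff(2)[symmetric] set_LINT_eq_integral(1) continuous_intros dcutoff_continuous c cp)
  moreover have "\<bar>LINT y:{0..1}|lborel. dcutoff k y * (\<Psi> y - p y)\<bar> \<le> 2 * (\<eta> / 8)"
   using p(2) by (intro dcutoff_integral_bound continuous_intros c cp) (auto intro: less_imp_le)
  moreover have "\<bar>\<Psi> 0 - p 0\<bar> < \<eta> / 8" "\<bar>\<Psi> 1 - p 1\<bar> < \<eta> / 8" using p(2) by auto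
  ultimately show "norm ((LINT y:{0..1}|lborel. dcutoff k y * \<Psi> y) - (\<Psi> 0 - \<Psi> 1)) < \<eta>"
   using N[OF k] \<eta> unfolding real_norm_def by linarith
 qed
qed

section \<open>Integrability and testing on cylinders\<close>

definition cyl :: "real => ('a::euclidean_space \<times> real) set" where
 "cyl R = ball 0 R \<times> {0<..<1}"

lemma cyl_open: "open (cyl R)" and cyl_slab: "cyl R \<subseteq> slab"
 unfolding cyl_def slab_def by (auto intro: open_Times)

lemma cyl_borel[measurable]: "cyl R \<in> sets borel"
 by (rule borel_open[OF cyl_open])

lemma borel_lebesgue: "f \<in> borel_measurable borel ==> f \<in> borel_measurable lebesgue"
 by (simp add: measurable_completion)

lemma snd_measurable[measurable]: "snd \<in> borel_measurable (borel :: ('a::euclidean_space \<times> real) measure)"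
 and fst_measurable[measurable]: "fst \<in> borel_measurable (borel :: ('a::euclidean_space \<times> real) measure)"
 by (intro borel_measurable_continuous_onI continuous_intros)+

lemma cyl_powr_nn_integral:
 assumes b: "b > -1"
 shows "(\<integral>\<^sup>+p\<in>(cyl R :: ('a::euclidean_space \<times> real) set). ennreal (snd p powr b) \<partial>lebesgue) < \<infinity>"
proof -
 have "(\<integral>\<^sup>+p\<in>(cyl R :: ('a \<times> real) set). ennreal (snd p powr b) \<partial>lebesgue)
  = (\<integral>\<^sup>+p. indicator (ball 0 R) (fst p) * (ennreal (snd p powr b) * indicator {0<..<1} (snd p)) \<partial>(lborel \<Otimes>\<^sub>M lborel :: ('a \<times> real) measure))"
  unfolding nn_integral_completion lborel_prod by (intro nn_integral_cong) (auto simp: cyl_def indicator_def)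
 also have "... = (\<integral>\<^sup>+x. \<integral>\<^sup>+y. indicator (ball 0 R) x * (ennreal (y powr b) * indicator {0<..<1} y) \<partial>lborel \<partial>(lborel :: 'a measure))"
 proof -
  have "ball (0::'a) R \<in> sets borel" by simp
  note [measurable] = this
  have m: "(%p::'a \<times> real. indicator (ball 0 R) (fst p) * (ennreal (snd p powr b) * indicator {0<..<1} (snd p))) \<in> borel_measurable borel"
   by measurable
  show ?thesis by (subst lborel.nn_integral_fst[symmetric]) (use m in \<open>simp_all add: lborel_prod\<close>)
 qed
 also have "... = (\<integral>\<^sup>+x. indicator (ball 0 R) x * ennreal (1 / (1 + b)) \<partial>(lborel :: 'a measure))"
  by (subst nn_integral_cmult) (auto simp: nn_integral_powr_unit[OF b])
 also have "... = emeasure lborel (ball (0::'a) R) * ennreal (1 / (1 + b))"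
  by (subst nn_integral_multc) (auto intro!: borel_measurable_indicator)
 also have "... < \<infinity>" using emeasure_bounded_finite[OF bounded_ball, of "0::'a" R] by (simp add: ennreal_mult_less_top)
 finally show ?thesis .
qed

lemma set_integrableI_nn:
 fixes D :: "'a::euclidean_space => real"
 assumes m: "(%p. indicator \<Omega> p *\<^sub>R D p) \<in> borel_measurable lebesgue" and D: "!!p. D p \<ge> 0"
  and f: "(\<integral>\<^sup>+p\<in>\<Omega>. ennreal (D p) \<partial>lebesgue) < \<infinity>"
 shows "set_integrable lebesgue \<Omega> D"
 unfolding set_integrable_def
proof (rule integrableI_nonneg[OF m])
 show "AE p in lebesgue. 0 \<le> indicat_real \<Omega> p *\<^sub>R D p" using D by auto
 have "(\<integral>\<^sup>+p. ennreal (indicat_real \<Omega> p *\<^sub>R D p) \<partial>lebesgue) = (\<integral>\<^sup>+p\<in>\<Omega>. ennreal (D p) \<partial>lebesgue)"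
  by (intro nn_integral_cong) (auto simp: indicator_def)
 thus "(\<integral>\<^sup>+p. ennreal (indicat_real \<Omega> p *\<^sub>R D p) \<partial>lebesgue) < \<infinity>" using f by simp
qed

lemma cyl_powr_integrable:
 assumes b: "b > -1"
 shows "set_integrable lebesgue (cyl R :: ('a::euclidean_space \<times> real) set) (%p. snd p powr b)"
 by (rule set_integrableI_nn[OF _ _ cyl_powr_nn_integral[OF b]]) (auto intro!: borel_lebesgue)

lemma set_integrable_dominated:
 fixes w H D :: "'a::euclidean_space => real"
 assumes w: "(%p. indicator \<Omega> p *\<^sub>R w p) \<in> borel_measurable lebesgue" and H: "H \<in> borel_measurable lebesgue"
  and D: "set_integrable lebesgue \<Omega> D" and b: "!!p. p \<in> \<Omega> ==> \<bar>w p * H p\<bar> \<le> D p"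
 shows "set_integrable lebesgue \<Omega> (%p. w p * H p)"
 unfolding set_integrable_def
proof (rule Bochner_Integration.integrable_bound[OF D[unfolded set_integrable_def]])
 have "(%p. indicator \<Omega> p *\<^sub>R (w p * H p)) = (%p. (indicator \<Omega> p *\<^sub>R w p) * H p)" by (simp add: mult.assoc)
 thus "(%p. indicator \<Omega> p *\<^sub>R (w p * H p)) \<in> borel_measurable lebesgue" using borel_measurable_times[OF w H] by (simp add: mult.assoc)
 show "AE p in lebesgue. norm (indicat_real \<Omega> p *\<^sub>R (w p * H p)) \<le> norm (indicat_real \<Omega> p *\<^sub>R D p)"
  using b by (intro AE_I2) (auto simp: indicator_def intro: order_trans[OF _ abs_ge_self])
qed

lemma cutoff_set_integral_tendsto:
 fixes F :: "'a::euclidean_space \<times> real => real"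
 assumes F: "set_integrable lebesgue \<Omega> F" and \<Omega>: "\<Omega> \<subseteq> slab"
 shows "(%k. LINT p:\<Omega>|lebesgue. F p * cutoff k (snd p)) \<longlonglongrightarrow> (LINT p:\<Omega>|lebesgue. F p)"
 unfolding set_lebesgue_integral_def
proof (rule integral_dominated_convergence[where w="%p. \<bar>indicator \<Omega> p *\<^sub>R F p\<bar>"])
 note I = F[unfolded set_integrable_def]
 have cm: "(%p::'a \<times> real. cutoff k (snd p)) \<in> borel_measurable lebesgue" for k
  by (intro borel_lebesgue borel_measurable_continuous_onI continuous_on_compose2[OF cutoff_continuous[of UNIV]] continuous_intros) auto
 show "(%p. indicat_real \<Omega> p *\<^sub>R F p) \<in> borel_measurable lebesgue" using I by (rule borel_measurable_integrable)
 show "(%p. indicat_real \<Omega> p *\<^sub>R (F p * cutoff k (snd p))) \<in> borel_measurable lebesgue" for k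
  using borel_measurable_times[OF borel_measurable_integrable[OF I] cm[of k]] by (simp add: mult.assoc)
 show "integrable lebesgue (%p. \<bar>indicator \<Omega> p *\<^sub>R F p\<bar>)" using I by (rule integrable_abs)
 show "AE p in lebesgue. (%k. indicat_real \<Omega> p *\<^sub>R (F p * cutoff k (snd p))) \<longlonglongrightarrow> indicat_real \<Omega> p *\<^sub>R F p"
 proof (rule AE_I2)
  fix p
  show "(%k. indicat_real \<Omega> p *\<^sub>R (F p * cutoff k (snd p))) \<longlonglongrightarrow> indicat_real \<Omega> p *\<^sub>R F p"
  proof (cases "p \<in> \<Omega>")
   case True
   hence "p \<in> slab" using \<Omega> by blast
   hence "0 < snd p" "snd p < 1" by (auto simp: slab_def)
   hence "(%k. F p * cutoff k (snd p)) \<longlonglongrightarrow> F p * 1" by (intro tendsto_mult tendsto_const cutoff_tendsto)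
   thus ?thesis using True by simp
  qed simp
 qed
 show "AE p in lebesgue. norm (indicat_real \<Omega> p *\<^sub>R (F p * cutoff k (snd p))) \<le> \<bar>indicat_real \<Omega> p *\<^sub>R F p\<bar>" for k
  using cutoff_range by (intro AE_I2) (auto simp: abs_mult indicator_def mult_left_le)
qed

text \<open>The test function is \<open>h x * (f y * cutoff k y)\<close>. Since the cutoff has
  compact support in \<open>(0, 1)\<close>, it suffices that \<open>f\<close> is smooth there; in
  the horizontal direction the cutoff is not differentiated.\<close>

lemma weak_ibp_tensor:
 fixes h :: "'a::euclidean_space => real" and w :: "'a \<times> real => real"
 assumes g: "has_weak_gradient (cyl R) w g" and h: "test_function (ball 0 R) h"
  and f: "!!k. C_k_on k {0<..<1} f" and f': "!!y. 0 < y ==> y < 1 ==> (f has_real_derivative f' y) (at y)"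
 shows "(LINT p:cyl R|lebesgue. w p * (h (fst p) * (f' (snd p) * cutoff k (snd p) + dcutoff k (snd p) * f (snd p)))) =
  - (LINT p:cyl R|lebesgue. (g p \<bullet> (0, 1)) * (h (fst p) * (f (snd p) * cutoff k (snd p))))"
  and "b \<in> Basis ==> (LINT p:cyl R|lebesgue. w p * (frechet_derivative h (at (fst p)) b * (f (snd p) * cutoff k (snd p)))) =
  - (LINT p:cyl R|lebesgue. (g p \<bullet> (b, 0)) * (h (fst p) * (f (snd p) * cutoff k (snd p))))"
proof -
 define \<alpha> where "\<alpha> = 1 / real (k + 3)"
 have al: "0 < \<alpha>" "\<alpha> < 1/2" unfolding \<alpha>_def by (rule cutoff_ends)+
 define \<kappa> where "\<kappa> y = f y * cutoff k y" for y
 have sk: "smooth \<kappa>"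
  unfolding \<kappa>_def cutoff_def \<alpha>_def[symmetric]
  by (rule smooth_times_bump[OF _ _ f]) (use al in auto)
 have z: "\<kappa> y = 0" if "y \<notin> {\<alpha>..1 - \<alpha>}" for y using cutoff_eq_0[of y k] that by (simp add: \<kappa>_def \<alpha>_def)
 have sh: "smooth h" using h by (simp add: test_function_def)
 have t: "test_function (cyl R) (%p. h (fst p) * \<kappa> (snd p))"
  unfolding cyl_def by (rule test_function_tensor[OF h sk z]) (use al in auto)
 have d: "(\<kappa> has_real_derivative (f' y * cutoff k y + dcutoff k y * f y)) (at y)" if "0 < y" "y < 1" for y
  unfolding \<kappa>_def[abs_def] by (rule DERIV_mult[OF f'[OF that] DERIV_cutoff])
 have fd: "frechet_derivative (%p. h (fst p) * \<kappa> (snd p)) (at p) v =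
  frechet_derivative h (at (fst p)) (fst v) * \<kappa> (snd p) + h (fst p) * ((f' (snd p) * cutoff k (snd p) + dcutoff k (snd p) * f (snd p)) * snd v)"
  if "p \<in> cyl R" for p v
  by (rule frechet_derivative_tensor[OF sh d]) (use that in \<open>auto simp: cyl_def\<close>)
 have l0: "frechet_derivative h (at x) 0 = 0" for x
  using linear_0[OF has_derivative_linear[OF smooth_has_derivative[OF sh, of x]]] .
 have b1: "(0::'a, 1::real) \<in> Basis" by (auto simp: Basis_prod_def)
 have "(LINT p:cyl R|lebesgue. w p * (h (fst p) * (f' (snd p) * cutoff k (snd p) + dcutoff k (snd p) * f (snd p)))) =
  (LINT p:cyl R|lebesgue. w p * frechet_derivative (%p. h (fst p) * \<kappa> (snd p)) (at p) (0, 1))"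
  by (rule set_lebesgue_integral_cong) (auto simp: fd l0)
 also have "... = - (LINT p:cyl R|lebesgue. (g p \<bullet> (0, 1)) * (h (fst p) * \<kappa> (snd p)))"
  by (rule has_weak_gradient_ibp[OF g t b1])
 finally show "(LINT p:cyl R|lebesgue. w p * (h (fst p) * (f' (snd p) * cutoff k (snd p) + dcutoff k (snd p) * f (snd p)))) =
  - (LINT p:cyl R|lebesgue. (g p \<bullet> (0, 1)) * (h (fst p) * (f (snd p) * cutoff k (snd p))))" unfolding \<kappa>_def .
 assume b: "b \<in> Basis"
 hence b0: "(b, 0::real) \<in> Basis" by (auto simp: Basis_prod_def)
 have "(LINT p:cyl R|lebesgue. w p * (frechet_derivative h (at (fst p)) b * \<kappa> (snd p))) =
  (LINT p:cyl R|lebesgue. w p * frechet_derivative (%p. h (fst p) * \<kappa> (snd p)) (at p) (b, 0))"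
  by (rule set_lebesgue_integral_cong) (auto simp: fd)
 also have "... = - (LINT p:cyl R|lebesgue. (g p \<bullet> (b, 0)) * (h (fst p) * \<kappa> (snd p)))"
  by (rule has_weak_gradient_ibp[OF g t b0])
 finally show "(LINT p:cyl R|lebesgue. w p * (frechet_derivative h (at (fst p)) b * (f (snd p) * cutoff k (snd p)))) =
  - (LINT p:cyl R|lebesgue. (g p \<bullet> (b, 0)) * (h (fst p) * (f (snd p) * cutoff k (snd p))))" unfolding \<kappa>_def .
qed

section \<open>The trace identity\<close>

lemma L2_imp_L1_tendsto:
 fixes f :: "nat => 'a => ennreal"
 assumes m: "!!k. f k \<in> borel_measurable M" "g \<in> borel_measurable M"
  and f: "(%k. \<integral>\<^sup>+x. (f k x)\<^sup>2 \<partial>M) \<longlonglongrightarrow> 0" and g: "(\<integral>\<^sup>+x. (g x)\<^sup>2 \<partial>M) < \<infinity>"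
 shows "(%k. \<integral>\<^sup>+x. f k x * g x \<partial>M) \<longlonglongrightarrow> 0"
proof (rule order_tendstoI)
 fix b :: ennreal assume b: "0 < b"
 have "(%k. (\<integral>\<^sup>+x. (g x)\<^sup>2 \<partial>M) * (\<integral>\<^sup>+x. (f k x)\<^sup>2 \<partial>M)) \<longlonglongrightarrow> (\<integral>\<^sup>+x. (g x)\<^sup>2 \<partial>M) * 0"
  using g by (intro ennreal_tendsto_cmult f) auto
 hence "(%k. (\<integral>\<^sup>+x. (g x)\<^sup>2 \<partial>M) * (\<integral>\<^sup>+x. (f k x)\<^sup>2 \<partial>M)) \<longlonglongrightarrow> 0" by simp
 moreover have "0 < b\<^sup>2" using b by (simp add: power2_eq_square ennreal_zero_less_mult_iff)
 ultimately have "eventually (%k. (\<integral>\<^sup>+x. (g x)\<^sup>2 \<partial>M) * (\<integral>\<^sup>+x. (f k x)\<^sup>2 \<partial>M) < b\<^sup>2) sequentially"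
  by (rule order_tendstoD(2))
 thus "eventually (%k. (\<integral>\<^sup>+x. f k x * g x \<partial>M) < b) sequentially"
 proof (rule eventually_mono)
  fix k assume k: "(\<integral>\<^sup>+x. (g x)\<^sup>2 \<partial>M) * (\<integral>\<^sup>+x. (f k x)\<^sup>2 \<partial>M) < b\<^sup>2"
  have "(\<integral>\<^sup>+x. f k x * g x \<partial>M)\<^sup>2 \<le> (\<integral>\<^sup>+x. (f k x)\<^sup>2 \<partial>M) * (\<integral>\<^sup>+x. (g x)\<^sup>2 \<partial>M)"
   by (rule Cauchy_Schwarz_nn_integral[OF m])
  hence lt: "(\<integral>\<^sup>+x. f k x * g x \<partial>M)\<^sup>2 < b\<^sup>2" using k by (simp add: mult.commute)
  show "(\<integral>\<^sup>+x. f k x * g x \<partial>M) < b"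
  proof (rule ccontr)
   assume "\<not> (\<integral>\<^sup>+x. f k x * g x \<partial>M) < b"
   hence "b\<^sup>2 \<le> (\<integral>\<^sup>+x. f k x * g x \<partial>M)\<^sup>2" by (intro power_mono) auto
   thus False using lt by simp
  qed
 qed
qed simp

lemma set_integral_tendsto_L1:
 fixes F :: "nat => 'a => real"
 assumes i: "!!k. set_integrable M \<Omega> (F k)" "set_integrable M \<Omega> G"
  and b: "!!k p. p \<in> \<Omega> ==> \<bar>F k p - G p\<bar> \<le> C * d k p" and C: "C \<ge> 0" and d0: "!!k p. d k p \<ge> 0"
  and dm: "!!k. (%p. ennreal (d k p) * indicator \<Omega> p) \<in> borel_measurable M"
  and d: "(%k. \<integral>\<^sup>+p\<in>\<Omega>. ennreal (d k p) \<partial>M) \<longlonglongrightarrow> 0"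
 shows "(%k. LINT p:\<Omega>|M. F k p) \<longlonglongrightarrow> (LINT p:\<Omega>|M. G p)"
proof -
 have le: "ennreal \<bar>(LINT p:\<Omega>|M. F k p) - (LINT p:\<Omega>|M. G p)\<bar> \<le> ennreal C * (\<integral>\<^sup>+p\<in>\<Omega>. ennreal (d k p) \<partial>M)" for k
 proof -
  have D: "set_integrable M \<Omega> (%p. F k p - G p)" by (intro set_integral_diff(1) i)
  have "ennreal \<bar>(LINT p:\<Omega>|M. F k p) - (LINT p:\<Omega>|M. G p)\<bar> = ennreal (norm (LINT p|M. indicator \<Omega> p *\<^sub>R (F k p - G p)))"
   using set_integral_diff(2)[OF i(1)[of k] i(2)] unfolding set_lebesgue_integral_def by simp
  also have "... \<le> (\<integral>\<^sup>+p. ennreal (norm (indicator \<Omega> p *\<^sub>R (F k p - G p))) \<partial>M)"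
   using D unfolding set_integrable_def by (rule integral_norm_bound_ennreal)
  also have "... \<le> (\<integral>\<^sup>+p. ennreal C * (ennreal (d k p) * indicator \<Omega> p) \<partial>M)"
  proof (rule nn_integral_mono)
   fix p
   show "ennreal (norm (indicat_real \<Omega> p *\<^sub>R (F k p - G p))) \<le> ennreal C * (ennreal (d k p) * indicator \<Omega> p)"
    using b[of p k] C d0[of k p] by (cases "p \<in> \<Omega>") (simp_all add: ennreal_mult[symmetric] ennreal_leI)
  qed
  also have "... = ennreal C * (\<integral>\<^sup>+p\<in>\<Omega>. ennreal (d k p) \<partial>M)" by (rule nn_integral_cmult[OF dm])
  finally show ?thesis .
 qed
 have "(%k. ennreal C * (\<integral>\<^sup>+p\<in>\<Omega>. ennreal (d k p) \<partial>M)) \<longlonglongrightarrow> ennreal C * 0"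
  by (intro ennreal_tendsto_cmult d) auto
 hence "(%k. ennreal C * (\<integral>\<^sup>+p\<in>\<Omega>. ennreal (d k p) \<partial>M)) \<longlonglongrightarrow> 0" by simp
 hence "(%k. ennreal \<bar>(LINT p:\<Omega>|M. F k p) - (LINT p:\<Omega>|M. G p)\<bar>) \<longlonglongrightarrow> 0"
  by (rule tendsto_sandwich[OF _ _ tendsto_const, rotated 2]) (use le in auto)
 hence "(%k. ennreal \<bar>(LINT p:\<Omega>|M. F k p) - (LINT p:\<Omega>|M. G p)\<bar>) \<longlonglongrightarrow> ennreal 0" by simp
 hence "(%k. \<bar>(LINT p:\<Omega>|M. F k p) - (LINT p:\<Omega>|M. G p)\<bar>) \<longlonglongrightarrow> 0"
  by (subst (asm) tendsto_ennreal_iff) auto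
 thus ?thesis by (simp add: tendsto_rabs_zero_iff LIM_zero_iff)
qed

text \<open>With \<open>A = y^a\<close>, both
  \<open>2 * \<bar>v\<bar> \<le> A * v\<^sup>2 + 1 / A\<close> and
  \<open>2 * A * \<bar>v\<bar> \<le> A * v\<^sup>2 + A\<close> hold, and \<open>y^a\<close> and
  \<open>y^(-a)\<close> are integrable as \<open>-1 < a < 1\<close>. The weight
  \<open>1 + y^a\<close> serves both kinds of factors that occur below: bounded fluxes, and
  \<open>y^a\<close> times bounded profiles.\<close>

lemma weighted_L2_integrable:
 fixes v :: "'a::euclidean_space \<times> real => real"
 assumes a: "-1 < a" "a < 1" and vm: "(%p. indicator (cyl R) p *\<^sub>R v p) \<in> borel_measurable lebesgue"
  and f: "(\<integral>\<^sup>+p\<in>cyl R. ennreal (snd p powr a * (v p)\<^sup>2) \<partial>lebesgue) < \<infinity>"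
 shows "set_integrable lebesgue (cyl R) (%p. (1 + snd p powr a) * \<bar>v p\<bar>)"
proof -
 have wm: "(%p::'a \<times> real. snd p powr b) \<in> borel_measurable lebesgue" for b
  by (intro borel_lebesgue) measurable
 have "(%p. snd p powr a * (indicator (cyl R) p *\<^sub>R v p)\<^sup>2) \<in> borel_measurable lebesgue"
  by (intro borel_measurable_times borel_measurable_power wm vm)
 also have "(%p. snd p powr a * (indicator (cyl R) p *\<^sub>R v p)\<^sup>2) = (%p. indicator (cyl R) p *\<^sub>R (snd p powr a * (v p)\<^sup>2))"
  by (auto simp: indicator_def)
 finally have i1: "set_integrable lebesgue (cyl R) (%p. snd p powr a * (v p)\<^sup>2)"
  by (rule set_integrableI_nn[OF _ _ f]) simp
 have i: "set_integrable lebesgue (cyl R) (%p. snd p powr a * (v p)\<^sup>2 + (snd p powr (- a) + snd p powr a))"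
  by (intro set_integral_add(1) i1 cyl_powr_integrable) (use a in auto)
 have m2: "(%p. indicator (cyl R) p *\<^sub>R \<bar>v p\<bar>) \<in> borel_measurable lebesgue"
 proof -
  have "(%p. indicator (cyl R) p *\<^sub>R \<bar>v p\<bar>) = (%p. \<bar>indicator (cyl R) p *\<^sub>R v p\<bar>)" by (auto simp: indicator_def)
  thus ?thesis using borel_measurable_abs[OF vm] by simp
 qed
 have "set_integrable lebesgue (cyl R) (%p. \<bar>v p\<bar> * (1 + snd p powr a))"
 proof (rule set_integrable_dominated[OF m2 _ i])
  show "(%p::'a \<times> real. 1 + snd p powr a) \<in> borel_measurable lebesgue" using wm by auto
  fix p :: "'a \<times> real" assume "p \<in> cyl R"
  hence y: "0 < snd p" by (auto simp: cyl_def)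
  define A where "A = snd p powr a"
  have A: "A > 0" "snd p powr (- a) = 1 / A" using y by (auto simp: A_def powr_minus_divide)
  have "0 \<le> (A * \<bar>v p\<bar> - 1)\<^sup>2 / A" using A by simp
  also have "... = A * (v p)\<^sup>2 - 2 * \<bar>v p\<bar> + 1 / A" using A(1) by (simp add: power2_eq_square field_simps)
  finally have 1: "2 * \<bar>v p\<bar> \<le> A * (v p)\<^sup>2 + 1 / A" by simp
  have "0 \<le> A * (\<bar>v p\<bar> - 1)\<^sup>2" using A by simp
  hence 2: "2 * (A * \<bar>v p\<bar>) \<le> A * (v p)\<^sup>2 + A" by (simp add: power2_eq_square algebra_simps)
  have 3: "1 / A \<ge> 0" using A by simp
  have "\<bar>\<bar>v p\<bar> * (1 + A)\<bar> = \<bar>v p\<bar> + A * \<bar>v p\<bar>" using A by (simp add: abs_mult algebra_simps)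
  also have "... \<le> A * (v p)\<^sup>2 + (1 / A + A)" using 1 2 3 A by linarith
  finally show "\<bar>\<bar>v p\<bar> * (1 + snd p powr a)\<bar> \<le> snd p powr a * (v p)\<^sup>2 + (snd p powr (- a) + snd p powr a)"
   unfolding A(2) A_def[symmetric] .
 qed
 thus ?thesis by (simp only: mult.commute)
qed

text \<open>Membership in \<open>H1\<close> with an explicit gradient in place of the chosen
  one.\<close>

definition finite_H1 :: "real => real => ('a::euclidean_space \<times> real => real) => ('a \<times> real => 'a \<times> real) => bool" where
 "finite_H1 a R w g \<longleftrightarrow> has_weak_gradient (cyl R) w g \<and>
  (\<integral>\<^sup>+p\<in>cyl R. ennreal (snd p powr a * ((w p)\<^sup>2 + (norm (g p))\<^sup>2)) \<partial>lebesgue) < \<infinity>"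

lemma finite_H1_measurable:
 assumes "finite_H1 a R w g"
 shows "(%p. indicator (cyl R) p *\<^sub>R w p) \<in> borel_measurable lebesgue"
  "(%p. indicator (cyl R) p *\<^sub>R g p) \<in> borel_measurable lebesgue"
  "(%p. indicator (cyl R) p *\<^sub>R (g p \<bullet> v)) \<in> borel_measurable lebesgue"
proof -
 show "(%p. indicator (cyl R) p *\<^sub>R w p) \<in> borel_measurable lebesgue"
  and gm: "(%p. indicator (cyl R) p *\<^sub>R g p) \<in> borel_measurable lebesgue"
  using assms locally_integrable_measurable[OF cyl_open] unfolding finite_H1_def has_weak_gradient_def by blast+
 have "(%p. indicator (cyl R) p *\<^sub>R (g p \<bullet> v)) = (%p. (indicator (cyl R) p *\<^sub>R g p) \<bullet> v)" by simp
 thus "(%p. indicator (cyl R) p *\<^sub>R (g p \<bullet> v)) \<in> borel_measurable lebesgue"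
  using measurable_compose[OF gm, of "%x. x \<bullet> v" borel] by (simp add: borel_measurable_continuous_onI continuous_intros)
qed

lemma finite_H1_integrable:
 fixes w :: "'a::euclidean_space \<times> real => real" and g :: "'a \<times> real => 'a \<times> real"
 assumes a: "-1 < a" "a < 1" and f: "finite_H1 a R w g"
 shows "set_integrable lebesgue (cyl R) (%p. (1 + snd p powr a) * \<bar>w p\<bar>)"
  "set_integrable lebesgue (cyl R) (%p. (1 + snd p powr a) * norm (g p))"
proof -
 have le: "(\<integral>\<^sup>+p\<in>cyl R. ennreal (snd p powr a * t p) \<partial>lebesgue) < \<infinity>"
  if "!!p. t p \<le> (w p)\<^sup>2 + (norm (g p))\<^sup>2" for t :: "'a \<times> real => real"
 proof -
  have "(\<integral>\<^sup>+p\<in>cyl R. ennreal (snd p powr a * t p) \<partial>lebesgue) \<le> (\<integral>\<^sup>+p\<in>cyl R. ennreal (snd p powr a * ((w p)\<^sup>2 + (norm (g p))\<^sup>2)) \<partial>lebesgue)"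
   by (intro nn_integral_mono mult_right_mono ennreal_leI mult_left_mono that) auto
  also have "... < \<infinity>" using f by (simp add: finite_H1_def)
  finally show ?thesis .
 qed
 show "set_integrable lebesgue (cyl R) (%p. (1 + snd p powr a) * \<bar>w p\<bar>)"
  by (rule weighted_L2_integrable[OF a finite_H1_measurable(1)[OF f] le]) simp
 have "(%p. indicator (cyl R) p *\<^sub>R norm (g p)) = (%p. norm (indicator (cyl R) p *\<^sub>R g p))" by (simp add: indicator_def)
 hence "(%p. indicator (cyl R) p *\<^sub>R norm (g p)) \<in> borel_measurable lebesgue"
  using measurable_compose[OF finite_H1_measurable(2)[OF f], of norm borel] by simp
 from weighted_L2_integrable[OF a this le]
 show "set_integrable lebesgue (cyl R) (%p. (1 + snd p powr a) * norm (g p))" by simp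
qed

lemma finite_H1_mult_integrable:
 fixes w H :: "'a::euclidean_space \<times> real => real" and g :: "'a \<times> real => 'a \<times> real"
 assumes a: "-1 < a" "a < 1" and f: "finite_H1 a R w g" and H: "H \<in> borel_measurable borel"
  and b: "!!p. p \<in> cyl R ==> \<bar>H p\<bar> \<le> C * (1 + snd p powr a)"
 shows "set_integrable lebesgue (cyl R) (%p. w p * H p)"
  "v \<in> Basis ==> set_integrable lebesgue (cyl R) (%p. (g p \<bullet> v) * H p)"
proof -
 note i = finite_H1_integrable[OF a f]
 show "set_integrable lebesgue (cyl R) (%p. w p * H p)"
 proof (rule set_integrable_dominated[OF finite_H1_measurable(1)[OF f] borel_lebesgue[OF H] set_integrable_mult_right[of C, OF i(1)]])
  fix p :: "'a \<times> real" assume "p \<in> cyl R"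
  thus "\<bar>w p * H p\<bar> \<le> C * ((1 + snd p powr a) * \<bar>w p\<bar>)"
   using mult_left_mono[OF b, of p "\<bar>w p\<bar>"] by (simp add: abs_mult mult_ac)
 qed
 show "set_integrable lebesgue (cyl R) (%p. (g p \<bullet> v) * H p)" if v: "v \<in> Basis"
 proof (rule set_integrable_dominated[OF finite_H1_measurable(3)[OF f] borel_lebesgue[OF H] set_integrable_mult_right[of C, OF i(2)]])
  fix p :: "'a \<times> real" assume "p \<in> cyl R"
  hence "\<bar>g p \<bullet> v\<bar> * \<bar>H p\<bar> \<le> norm (g p) * (C * (1 + snd p powr a))"
   using b[of p] Basis_le_norm[OF v, of "g p"] by (intro mult_mono) auto
  thus "\<bar>(g p \<bullet> v) * H p\<bar> \<le> C * ((1 + snd p powr a) * norm (g p))" by (simp add: abs_mult mult_ac)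
 qed
qed

context
 fixes s r :: real
 assumes s: "0 < s" "s < 1" and r: "0 \<le> r"
begin

text \<open>The first-order system expresses each derivative by the other function and a power of
  \<open>y\<close>, so regularity is gained by a joint induction.\<close>

lemma profile_flux_C_k_on: "C_k_on k {0<..<1} (profile s r) \<and> C_k_on k {0<..<1} (flux s r)"
proof (induction k)
 case 0
 show ?case using continuous_profile_flux[OF s, of r] by (auto intro: continuous_on_subset)
next
 case (Suc k)
 have "C_k_on k {0<..<1} (%y. (-1) * (y powr (2 * s - 1) * flux s r y))"
  using Suc by (intro C_k_on_mult C_k_on_const C_k_on_powr) auto
 hence 1: "C_k_on (Suc k) {0<..<1} (profile s r)"
  by (rule C_k_on_SucI[rotated]) (use DERIV_profile[OF s] in auto)
 have "C_k_on k {0<..<1} (%y. (- (r\<^sup>2)) * (y powr (1 - 2 * s) * profile s r y))"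
  using Suc by (intro C_k_on_mult C_k_on_const C_k_on_powr) auto
 hence 2: "C_k_on (Suc k) {0<..<1} (flux s r)"
  by (rule C_k_on_SucI[rotated]) (use DERIV_flux[OF s] in \<open>auto simp: mult.assoc\<close>)
 show ?case using 1 2 ..
qed

text \<open>The gradient is tested vertically with \<open>h x * (flux s r y * cutoff k y)\<close>.
  Differentiating the flux gives the volume term, differentiating the cutoff gives the boundary
  values; continuity of \<open>\<phi>\<close> up to the closure is what gives these a pointwise
  meaning.\<close>

lemma trace_identity_continuous:
 fixes \<phi> :: "'a::euclidean_space \<times> real => real"
 assumes R: "R > 0" and \<phi>: "continuous_on (closure (cyl R)) \<phi>" and f: "finite_H1 (1 - 2 * s) R \<phi> g"
  and h: "test_function (ball 0 R) h"
 shows "(LINT p:cyl R|lebesgue. (g p \<bullet> (0, 1)) * (h (fst p) * flux s r (snd p))) =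
  r\<^sup>2 * (LINT p:cyl R|lebesgue. \<phi> p * (h (fst p) * (snd p powr (1 - 2 * s) * profile s r (snd p))))
   - flux s r 0 * (LINT x:ball 0 R|lebesgue. \<phi> (x, 0) * h x)"
proof -
 define a where "a = 1 - 2 * s"
 have a: "-1 < a" "a < 1" using s by (auto simp: a_def)
 define th q where "th = profile s r" and "q = flux s r"
 interpret P: neumann_profile a r th q unfolding a_def th_def q_def by (rule neumann_profile_Bessel[OF s r])
 note [measurable] = profile_measurable[OF s]
 have thme[measurable]: "th \<in> borel_measurable borel"
  unfolding th_def by (rule profile_measurable(1)[OF s, of "%_. r" borel "%y. y"]) simp_all
 have qm[measurable]: "q \<in> borel_measurable borel"
  unfolding q_def by (rule profile_measurable(2)[OF s, of "%_. r" borel "%y. y"]) simp_all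
 have f: "finite_H1 a R \<phi> g" using f by (simp add: a_def)
 from test_function_bounds[OF h] obtain K Mh where K: "smooth h" "K \<subseteq> ball 0 R" "compact K" "\<forall>x. x \<notin> K --> h x = 0 \<and> (\<forall>b. frechet_derivative h (at x) b = 0)"    "Mh > 0" "\<forall>x. \<bar>h x\<bar> \<le> Mh \<and> (\<forall>b\<in>Basis. \<bar>frechet_derivative h (at x) b\<bar> \<le> Mh)"
  by (elim exE conjE)
 have Mh: "!!x. \<bar>h x\<bar> \<le> Mh" "Mh > 0" using K(5,6) by auto
 have hz: "h x = 0" if "x \<notin> ball 0 R" for x using K(2,4) that by blast
 have hc: "continuous_on UNIV h" by (rule smooth_continuous[OF K(1)])
 have hm[measurable]: "h \<in> borel_measurable borel" using hc by (rule borel_measurable_continuous_onI)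
 have b1: "(0::'a, 1::real) \<in> Basis" by (auto simp: Basis_prod_def)
 define Q where "Q = r\<^sup>2 / (1 + a)"
 have Q: "Q \<ge> 0" "!!y. 0 \<le> y ==> y \<le> 1 ==> \<bar>q y\<bar> \<le> Q" using a P.q_le by (auto simp: Q_def)
 define f' where "f' y = - (r\<^sup>2 * y powr a * th y)" for y
 have f'm[measurable]: "f' \<in> borel_measurable borel" unfolding f'_def[abs_def] by measurable
 have dm[measurable]: "dcutoff k \<in> borel_measurable borel" "cutoff k \<in> borel_measurable borel" for k
  using dcutoff_continuous cutoff_continuous by (auto intro: borel_measurable_continuous_onI)
 have y01: "0 < snd p" "snd p < 1" "fst p \<in> ball 0 R" if "p \<in> cyl R" for p :: "'a \<times> real" using that by (auto simp: cyl_def)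
 have i1: "set_integrable lebesgue (cyl R) (%p. (g p \<bullet> (0, 1)) * (h (fst p) * q (snd p)))"
 proof (rule finite_H1_mult_integrable(2)[OF a f _ _ b1, of _ "Mh * Q"])
  show "(%p::'a \<times> real. h (fst p) * q (snd p)) \<in> borel_measurable borel" by measurable
  fix p :: "'a \<times> real" assume p: "p \<in> cyl R"
  have "\<bar>h (fst p) * q (snd p)\<bar> \<le> Mh * Q" unfolding abs_mult using Mh Q y01[OF p] by (intro mult_mono) auto
  also have "... \<le> (Mh * Q) * (1 + snd p powr a)" using Mh Q by (simp add: distrib_left)
  finally show "\<bar>h (fst p) * q (snd p)\<bar> \<le> (Mh * Q) * (1 + snd p powr a)" .
 qed
 have i2: "set_integrable lebesgue (cyl R) (%p. \<phi> p * (h (fst p) * f' (snd p)))"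
 proof (rule finite_H1_mult_integrable(1)[OF a f, of _ "Mh * r\<^sup>2"])
  show "(%p::'a \<times> real. h (fst p) * f' (snd p)) \<in> borel_measurable borel" by measurable
  fix p :: "'a \<times> real" assume p: "p \<in> cyl R"
  have "\<bar>f' (snd p)\<bar> = r\<^sup>2 * snd p powr a * \<bar>th (snd p)\<bar>" by (simp add: f'_def abs_mult)
  also have "... \<le> r\<^sup>2 * snd p powr a * 1" using P.th_le_1[of "snd p"] y01[OF p] by (intro mult_left_mono) auto
  also have "... \<le> r\<^sup>2 * (1 + snd p powr a)" by (simp add: distrib_left)
  finally have "\<bar>h (fst p)\<bar> * \<bar>f' (snd p)\<bar> \<le> Mh * (r\<^sup>2 * (1 + snd p powr a))" using Mh by (intro mult_mono) auto
  thus "\<bar>h (fst p) * f' (snd p)\<bar> \<le> (Mh * r\<^sup>2) * (1 + snd p powr a)" by (simp add: abs_mult mult_ac)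
 qed
 have i3: "set_integrable lebesgue (cyl R) (%p. \<phi> p * (h (fst p) * f' (snd p)) * cutoff k (snd p))" for k
 proof -
  have "set_integrable lebesgue (cyl R) (%p. \<phi> p * (h (fst p) * f' (snd p) * cutoff k (snd p)))"
  proof (rule finite_H1_mult_integrable(1)[OF a f, of _ "Mh * r\<^sup>2"])
   show "(%p::'a \<times> real. h (fst p) * f' (snd p) * cutoff k (snd p)) \<in> borel_measurable borel" by measurable
   fix p :: "'a \<times> real" assume p: "p \<in> cyl R"
   have "\<bar>f' (snd p)\<bar> = r\<^sup>2 * snd p powr a * \<bar>th (snd p)\<bar>" by (simp add: f'_def abs_mult)
   also have "... \<le> r\<^sup>2 * snd p powr a * 1" using P.th_le_1[of "snd p"] y01[OF p] by (intro mult_left_mono) auto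
   also have "... \<le> r\<^sup>2 * (1 + snd p powr a)" by (simp add: distrib_left)
   finally have "\<bar>h (fst p)\<bar> * \<bar>f' (snd p)\<bar> * \<bar>cutoff k (snd p)\<bar> \<le> Mh * (r\<^sup>2 * (1 + snd p powr a)) * 1"
    using Mh cutoff_range[of k "snd p"] by (intro mult_mono) auto
   thus "\<bar>h (fst p) * f' (snd p) * cutoff k (snd p)\<bar> \<le> (Mh * r\<^sup>2) * (1 + snd p powr a)" by (simp add: abs_mult mult_ac)
  qed
  thus ?thesis by (simp only: mult.assoc)
 qed
 \<comment> \<open>The term in which the cutoff is differentiated; its limit is the boundary
   term.\<close>
 define D where "D k = (LINT p:cyl R|lebesgue. \<phi> p * (h (fst p) * (dcutoff k (snd p) * q (snd p))))" for k
 have cl: "closure (cyl R) = cball 0 R \<times> {0..1::real}"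
  unfolding cyl_def closure_Times using R by simp
 have "compact (closure (cyl R :: ('a \<times> real) set))" unfolding cl by (intro compact_Times compact_cball compact_Icc)
 hence "bounded (\<phi> ` closure (cyl R))" using \<phi> by (intro compact_imp_bounded compact_continuous_image)
 then obtain M\<phi> where M\<phi>': "M\<phi> > 0" "\<forall>p\<in>closure (cyl R). \<bar>\<phi> p\<bar> \<le> M\<phi>" unfolding bounded_pos by auto
 \<comment> \<open>\<open>\<phi>\<close> is controlled on the closed cylinder only; extended by 0 it
   is a bounded Borel function on the whole space, to which Fubini in \<open>x\<close> and
   \<open>y\<close> applies.\<close>
 define \<psi> where "\<psi> p = indicator (closure (cyl R)) p *\<^sub>R \<phi> p" for p
 have \<psi>m[measurable]: "\<psi> \<in> borel_measurable borel"
  unfolding \<psi>_def[abs_def] using \<phi> by (intro borel_measurable_continuous_on_indicator) auto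
 have \<psi>b: "\<bar>\<psi> p\<bar> \<le> M\<phi>" for p using M\<phi>' by (cases "p \<in> closure (cyl R)") (auto simp: \<psi>_def)
 define G where "G k p = h (fst p) * (\<psi> p * (indicator {0..1} (snd p) * q (snd p)) * dcutoff k (snd p))" for k p
 have Gm[measurable]: "G k \<in> borel_measurable borel" for k unfolding G_def[abs_def] by measurable
 have dz: "dcutoff k y = 0" if "y \<notin> {0<..<1}" for k y
 proof (rule dcutoff_eq_0)
  define e where "e = 1 / real (k + 3)"
  have "e > 0" unfolding e_def by (rule cutoff_ends)
  thus "y \<notin> {1 / real (k + 3)<..<1 - 1 / real (k + 3)}" using that unfolding e_def[symmetric] by auto
 qed
 have qi: "\<bar>indicator {0..1} y * q y\<bar> \<le> Q" for y using Q by (cases "y \<in> {0..1}") auto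
 have GD: "D k = (LINT p|lborel. G k p)" for k
 proof -
  have "D k = (LINT p|lebesgue. G k p)"
   unfolding D_def set_lebesgue_integral_def
  proof (intro Bochner_Integration.integral_cong refl)
   fix p :: "'a \<times> real"
   show "indicat_real (cyl R) p *\<^sub>R (\<phi> p * (h (fst p) * (dcutoff k (snd p) * q (snd p)))) = G k p"
   proof (cases "p \<in> cyl R")
    case True
    hence "p \<in> closure (cyl R)" using closure_subset by blast
    thus ?thesis using True y01[OF True] by (simp add: G_def \<psi>_def)
   next
    case False
    hence "fst p \<notin> ball 0 R \<or> snd p \<notin> {0<..<1}" by (cases p) (auto simp: cyl_def)
    hence "h (fst p) = 0 \<or> dcutoff k (snd p) = 0" using hz dz by blast
    thus ?thesis using False by (auto simp: G_def)
   qed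
  qed
  also have "... = (LINT p|lborel. G k p)" using Gm by (intro integral_completion) simp
  finally show ?thesis .
 qed
 have hi: "integrable lborel (%x. \<bar>h x\<bar>)"
 proof -
  have "integrable lborel (%x. indicator K x *\<^sub>R \<bar>h x\<bar>)"
   using hc K(3) by (intro borel_integrable_compact continuous_intros) (auto intro: continuous_on_subset)
  also have "(%x. indicator K x *\<^sub>R \<bar>h x\<bar>) = (%x. \<bar>h x\<bar>)"
   using K(4) by (force simp: indicator_def)
  finally show ?thesis .
 qed
 have di: "integrable lborel (%y. \<bar>dcutoff k y\<bar>)" for k
 proof -
  have "integrable lborel (%y. indicator {0..1} y *\<^sub>R \<bar>dcutoff k y\<bar>)"
   by (intro borel_integrable_compact continuous_intros dcutoff_continuous) auto
  also have "(%y. indicator {0..1} y *\<^sub>R \<bar>dcutoff k y\<bar>) = (%y. \<bar>dcutoff k y\<bar>)"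
  proof
   fix y show "indicator {0..1} y *\<^sub>R \<bar>dcutoff k y\<bar> = \<bar>dcutoff k y\<bar>"
    using dz[of y k] by (cases "y \<in> {0..1}") auto
  qed
  finally show ?thesis .
 qed
 have Gi: "integrable (lborel \<Otimes>\<^sub>M lborel) (G k)" for k
 proof (rule lborel_pair.integrable_tensor_bound[OF integrable_mult_right[OF hi, of "M\<phi> * Q"] di[of k]])
  show "G k \<in> borel_measurable (lborel \<Otimes>\<^sub>M lborel)" using Gm by (simp add: lborel_prod)
  fix x :: 'a and y :: real
  have "\<bar>\<psi> (x, y)\<bar> * \<bar>indicator {0..1} y * q y\<bar> \<le> M\<phi> * Q" using \<psi>b qi M\<phi>' by (intro mult_mono) auto
  hence "\<bar>h x\<bar> * (\<bar>\<psi> (x, y)\<bar> * \<bar>indicator {0..1} y * q y\<bar> * \<bar>dcutoff k y\<bar>) \<le> \<bar>h x\<bar> * ((M\<phi> * Q) * \<bar>dcutoff k y\<bar>)"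
   by (intro mult_left_mono mult_right_mono) auto
  thus "norm (G k (x, y)) \<le> M\<phi> * Q * \<bar>h x\<bar> * \<bar>dcutoff k y\<bar>" by (simp add: G_def abs_mult mult_ac)
 qed
 define J where "J k x = (LINT y|lborel. G k (x, y))" for k x
 have DJ: "D k = (LINT x|lborel. J k x)" for k
  unfolding GD J_def lborel_pair.integral_fst'[OF Gi] by (simp add: lborel_prod)
 have Jx: "J k x = h x * (LINT y:{0..1}|lborel. dcutoff k y * (\<phi> (x, y) * q y))" if "x \<in> ball 0 R" for k x
 proof -
  have "J k x = (LINT y|lborel. h x * (indicator {0..1} y *\<^sub>R (dcutoff k y * (\<phi> (x, y) * q y))))"
   unfolding J_def
  proof (intro Bochner_Integration.integral_cong refl)
   fix y :: real
   show "G k (x, y) = h x * (indicat_real {0..1} y *\<^sub>R (dcutoff k y * (\<phi> (x, y) * q y)))"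
    using that by (cases "y \<in> {0..1}") (auto simp: G_def \<psi>_def cl)
  qed
  thus ?thesis unfolding set_lebesgue_integral_def by simp
 qed
 have J0: "J k x = 0" if "x \<notin> ball 0 R" for k x using hz[OF that] by (simp add: J_def G_def)
 have c\<Psi>: "continuous_on {0..1} (%y. \<phi> (x, y) * q y)" if "x \<in> ball 0 R" for x
 proof (intro continuous_on_mult P.c_q)
  show "continuous_on {0..1} (%y. \<phi> (x, y))"
   by (rule continuous_on_compose2[OF \<phi>]) (use that in \<open>auto simp: cl intro!: continuous_intros\<close>)
 qed
 \<comment> \<open>For fixed \<open>x\<close> the derivatives of the cutoffs select
   \<open>\<phi> (x, 0) * q 0 - \<phi> (x, 1) * q 1\<close>, and \<open>q 1 = 0\<close>. Their
   uniform \<open>L1\<close> bound 2 supplies the dominating function in \<open>x\<close>.\<close>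
 have "(%k. LINT x|lborel. J k x) \<longlonglongrightarrow> (LINT x|lborel. h x * (\<psi> (x, 0) * q 0))"
 proof (rule integral_dominated_convergence[where w="%x. (2 * (M\<phi> * Q)) * \<bar>h x\<bar>"])
  have "(%x::'a. \<psi> (x, 0)) \<in> borel_measurable borel"
   by (rule measurable_compose[OF _ \<psi>m]) (intro borel_measurable_continuous_onI continuous_intros)
  note [measurable] = this
  show "(%x. h x * (\<psi> (x, 0) * q 0)) \<in> borel_measurable lborel" by measurable
  show "J k \<in> borel_measurable lborel" for k
   unfolding J_def[abs_def] using lborel_pair.integrable_fst'[OF Gi[of k]] by (rule borel_measurable_integrable)
  show "integrable lborel (%x. (2 * (M\<phi> * Q)) * \<bar>h x\<bar>)" by (intro integrable_mult_right hi)
  show "AE x in lborel. (%k. J k x) \<longlonglongrightarrow> h x * (\<psi> (x, 0) * q 0)"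
  proof (rule AE_I2)
   fix x :: 'a
   show "(%k. J k x) \<longlonglongrightarrow> h x * (\<psi> (x, 0) * q 0)"
   proof (cases "x \<in> ball 0 R")
    case True
    have "(%k. h x * (LINT y:{0..1}|lborel. dcutoff k y * (\<phi> (x, y) * q y))) \<longlonglongrightarrow> h x * (\<phi> (x, 0) * q 0 - \<phi> (x, 1) * q 1)"
     by (intro tendsto_mult tendsto_const dcutoff_integral_tendsto[OF c\<Psi>[OF True]])
    thus ?thesis using True P.q_1 by (simp add: Jx[OF True] \<psi>_def cl)
   qed (simp add: J0 hz)
  qed
  show "AE x in lborel. norm (J k x) \<le> (2 * (M\<phi> * Q)) * \<bar>h x\<bar>" for k
  proof (rule AE_I2)
   fix x :: 'a
   show "norm (J k x) \<le> (2 * (M\<phi> * Q)) * \<bar>h x\<bar>"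
   proof (cases "x \<in> ball 0 R")
    case True
    have "\<bar>LINT y:{0..1}|lborel. dcutoff k y * (\<phi> (x, y) * q y)\<bar> \<le> 2 * (M\<phi> * Q)"
    proof (rule dcutoff_integral_bound[OF c\<Psi>[OF True]])
     fix y :: real assume y: "y \<in> {0..1}"
     have "(x, y) \<in> closure (cyl R)" using True y by (simp add: cl)
     hence "\<bar>\<phi> (x, y)\<bar> \<le> M\<phi>" using M\<phi>'(2) by blast
     thus "\<bar>\<phi> (x, y) * q y\<bar> \<le> M\<phi> * Q" unfolding abs_mult using Q y M\<phi>' by (intro mult_mono) auto
    qed
    from mult_left_mono[OF this, of "\<bar>h x\<bar>"] show ?thesis by (simp add: Jx[OF True] abs_mult mult_ac)
   qed (simp add: J0 hz)
  qed
 qed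
 moreover have "(LINT x|lborel. h x * (\<psi> (x, 0) * q 0)) = q 0 * (LINT x:ball 0 R|lebesgue. \<phi> (x, 0) * h x)"
 proof -
  have m: "(%x::'a. \<psi> (x, 0)) \<in> borel_measurable borel"
   by (rule measurable_compose[OF _ \<psi>m]) (intro borel_measurable_continuous_onI continuous_intros)
  have "(LINT x|lborel. h x * (\<psi> (x, 0) * q 0)) = (LINT x|lborel. q 0 * (\<psi> (x, 0) * h x))" by (simp add: mult_ac)
  also have "... = q 0 * (LINT x|lborel. \<psi> (x, 0) * h x)" by simp
  also have "(LINT x|lborel. \<psi> (x, 0) * h x) = (LINT x|lebesgue. \<psi> (x, 0) * h x)"
   using borel_measurable_times[OF m hm] by (intro integral_completion[symmetric]) simp
  also have "... = (LINT x:ball 0 R|lebesgue. \<phi> (x, 0) * h x)"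
   unfolding set_lebesgue_integral_def
  proof (intro Bochner_Integration.integral_cong refl)
   fix x :: 'a
   show "\<psi> (x, 0) * h x = indicat_real (ball 0 R) x *\<^sub>R (\<phi> (x, 0) * h x)"
    using hz[of x] by (cases "x \<in> ball 0 R") (simp_all add: \<psi>_def cl)
  qed
  finally show ?thesis .
 qed
 ultimately have D: "D \<longlonglongrightarrow> q 0 * (LINT x:ball 0 R|lebesgue. \<phi> (x, 0) * h x)" unfolding DJ[symmetric] by simp
 \<comment> \<open>The product rule for \<open>q * cutoff k\<close>: the first term has a limit by
   dominated convergence, the second is \<open>D k\<close>.\<close>
 have split: "(LINT p:cyl R|lebesgue. \<phi> p * (h (fst p) * f' (snd p)) * cutoff k (snd p)) + D k
  = - (LINT p:cyl R|lebesgue. (g p \<bullet> (0, 1)) * (h (fst p) * q (snd p)) * cutoff k (snd p))" for k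
 proof -
  have "bounded (dcutoff k ` {0..1})" by (intro compact_imp_bounded compact_continuous_image dcutoff_continuous compact_Icc)
  then obtain Md where Md': "Md > 0" "\<forall>y\<in>{0..1}. \<bar>dcutoff k y\<bar> \<le> Md" unfolding bounded_pos by auto
  have Md: "\<bar>dcutoff k y\<bar> \<le> Md" for y using Md' dz[of y k] by (cases "y \<in> {0<..<1}") auto
  have Di: "set_integrable lebesgue (cyl R) (%p. \<phi> p * (h (fst p) * (dcutoff k (snd p) * q (snd p))))"
  proof (rule finite_H1_mult_integrable(1)[OF a f, of _ "Mh * (Md * Q)"])
   show "(%p::'a \<times> real. h (fst p) * (dcutoff k (snd p) * q (snd p))) \<in> borel_measurable borel" by measurable
   fix p :: "'a \<times> real" assume p: "p \<in> cyl R"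
   have "\<bar>h (fst p)\<bar> * (\<bar>dcutoff k (snd p)\<bar> * \<bar>q (snd p)\<bar>) \<le> Mh * (Md * Q)"
    using Mh Md Md'(1) Q y01[OF p] by (intro mult_mono) auto
   also have "... \<le> (Mh * (Md * Q)) * (1 + snd p powr a)" using Mh Q Md'(1) by (simp add: distrib_left)
   finally show "\<bar>h (fst p) * (dcutoff k (snd p) * q (snd p))\<bar> \<le> (Mh * (Md * Q)) * (1 + snd p powr a)"
    by (simp add: abs_mult)
  qed
  have "(LINT p:cyl R|lebesgue. \<phi> p * (h (fst p) * f' (snd p)) * cutoff k (snd p)) + D k
   = (LINT p:cyl R|lebesgue. \<phi> p * (h (fst p) * f' (snd p)) * cutoff k (snd p) + \<phi> p * (h (fst p) * (dcutoff k (snd p) * q (snd p))))"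
   unfolding D_def by (rule set_integral_add(2)[OF i3 Di, symmetric])
  also have "... = (LINT p:cyl R|lebesgue. \<phi> p * (h (fst p) * (f' (snd p) * cutoff k (snd p) + dcutoff k (snd p) * q (snd p))))"
   by (simp add: algebra_simps)
  also have "... = - (LINT p:cyl R|lebesgue. (g p \<bullet> (0, 1)) * (h (fst p) * (q (snd p) * cutoff k (snd p))))"
  proof (rule weak_ibp_tensor(1)[OF _ h])
   show "has_weak_gradient (cyl R) \<phi> g" using f by (simp add: finite_H1_def)
   show "C_k_on k {0<..<1} q" for k using profile_flux_C_k_on by (simp add: q_def)
   show "(q has_real_derivative f' y) (at y)" if "0 < y" "y < 1" for y unfolding f'_def by (rule P.d_q[OF that])
  qed
  finally show ?thesis by (simp only: mult.assoc)
 qed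
 have l1: "(%k. (LINT p:cyl R|lebesgue. \<phi> p * (h (fst p) * f' (snd p)) * cutoff k (snd p)) + D k) \<longlonglongrightarrow>
  (LINT p:cyl R|lebesgue. \<phi> p * (h (fst p) * f' (snd p))) + q 0 * (LINT x:ball 0 R|lebesgue. \<phi> (x, 0) * h x)"
  by (intro tendsto_add D cutoff_set_integral_tendsto[OF i2 cyl_slab])
 have l2: "(%k. - (LINT p:cyl R|lebesgue. (g p \<bullet> (0, 1)) * (h (fst p) * q (snd p)) * cutoff k (snd p))) \<longlonglongrightarrow>
  - (LINT p:cyl R|lebesgue. (g p \<bullet> (0, 1)) * (h (fst p) * q (snd p)))"
  by (intro tendsto_minus cutoff_set_integral_tendsto[OF i1 cyl_slab])
 have "(LINT p:cyl R|lebesgue. \<phi> p * (h (fst p) * f' (snd p))) + q 0 * (LINT x:ball 0 R|lebesgue. \<phi> (x, 0) * h x)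
   = - (LINT p:cyl R|lebesgue. (g p \<bullet> (0, 1)) * (h (fst p) * q (snd p)))"
  by (rule LIMSEQ_unique[OF l1[unfolded split] l2])
 moreover have "(LINT p:cyl R|lebesgue. \<phi> p * (h (fst p) * f' (snd p))) = - (r\<^sup>2) * (LINT p:cyl R|lebesgue. \<phi> p * (h (fst p) * (snd p powr a * th (snd p))))"
 proof -
  have "\<phi> p * (h (fst p) * f' (snd p)) = - (r\<^sup>2) * (\<phi> p * (h (fst p) * (snd p powr a * th (snd p))))" for p
   by (simp add: f'_def mult_ac)
  thus ?thesis by (simp only: set_integral_mult_right)
 qed
 ultimately show ?thesis unfolding a_def th_def q_def by linarith
qed

end

text \<open>The error is split into \<open>e k\<close>, which is \<open>y^(a/2)\<close> times the
  pointwise distance and whose square is the integrand of the \<open>H1\<close> distance, and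
  \<open>\<gamma> = (1 + y^a) * y^(-a/2)\<close>, whose square \<open>y^(-a) + 2 + y^a\<close> is
  integrable on the cylinder. Cauchy-Schwarz concludes.\<close>

lemma finite_H1_tendsto:
 fixes w H :: "'a::euclidean_space \<times> real => real" and g :: "'a \<times> real => 'a \<times> real"
 assumes a: "-1 < a" "a < 1" and f: "finite_H1 a R w g" and fk: "!!k. finite_H1 a R (\<phi> k) (G k)"
  and lim: "(%k. \<integral>\<^sup>+p\<in>cyl R. ennreal (snd p powr a * ((\<phi> k p - w p)\<^sup>2 + (norm (G k p - g p))\<^sup>2)) \<partial>lebesgue) \<longlonglongrightarrow> 0"
  and H: "H \<in> borel_measurable borel" and b: "!!p. p \<in> cyl R ==> \<bar>H p\<bar> \<le> C * (1 + snd p powr a)" and C: "C \<ge> 0"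
 shows "(%k. LINT p:cyl R|lebesgue. \<phi> k p * H p) \<longlonglongrightarrow> (LINT p:cyl R|lebesgue. w p * H p)"
  "v \<in> Basis ==> (%k. LINT p:cyl R|lebesgue. (G k p \<bullet> v) * H p) \<longlonglongrightarrow> (LINT p:cyl R|lebesgue. (g p \<bullet> v) * H p)"
proof -
 define E where "E k p = sqrt ((indicator (cyl R) p *\<^sub>R \<phi> k p - indicator (cyl R) p *\<^sub>R w p)\<^sup>2
   + (norm (indicator (cyl R) p *\<^sub>R G k p - indicator (cyl R) p *\<^sub>R g p))\<^sup>2)" for k and p :: "'a \<times> real"
 define e where "e k p = snd p powr (a / 2) * E k p" for k and p :: "'a \<times> real"
 define \<gamma> where "\<gamma> p = (1 + snd p powr a) * snd p powr (- (a / 2))" for p :: "'a \<times> real"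
 have wm: "(%p::'a \<times> real. snd p powr b) \<in> borel_measurable lebesgue" for b
  by (intro borel_lebesgue) measurable
 have Em: "E k \<in> borel_measurable lebesgue" for k
  unfolding E_def[abs_def]
  by (intro measurable_compose[OF _ borel_measurable_sqrt] borel_measurable_add borel_measurable_power
    measurable_compose[OF _ borel_measurable_norm] borel_measurable_diff finite_H1_measurable[OF f] finite_H1_measurable[OF fk])
 have em: "e k \<in> borel_measurable lebesgue" for k
  unfolding e_def[abs_def] by (intro borel_measurable_times wm Em)
 have \<gamma>m: "\<gamma> \<in> borel_measurable lebesgue"
  unfolding \<gamma>_def[abs_def] by (intro borel_measurable_times borel_measurable_add wm) auto
 have Ein: "E k p = sqrt ((\<phi> k p - w p)\<^sup>2 + (norm (G k p - g p))\<^sup>2)" if "p \<in> cyl R" for k p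
  using that by (simp add: E_def)
 have E0: "E k p = 0" if "p \<notin> cyl R" for k p using that by (simp add: E_def)
 have Epos: "E k p \<ge> 0" for k p by (simp add: E_def)
 have sq: "(e k p)\<^sup>2 = snd p powr a * (E k p)\<^sup>2" for k p
  by (simp add: e_def power_mult_distrib power2_eq_square powr_add[symmetric])
 have "(\<integral>\<^sup>+p. (ennreal (e k p))\<^sup>2 \<partial>lebesgue)
  = (\<integral>\<^sup>+p\<in>cyl R. ennreal (snd p powr a * ((\<phi> k p - w p)\<^sup>2 + (norm (G k p - g p))\<^sup>2)) \<partial>lebesgue)" for k
 proof (intro nn_integral_cong)
  fix p :: "'a \<times> real"
  have "(ennreal (e k p))\<^sup>2 = ennreal ((e k p)\<^sup>2)" using Epos by (simp add: ennreal_power e_def)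
  also have "... = ennreal (snd p powr a * ((\<phi> k p - w p)\<^sup>2 + (norm (G k p - g p))\<^sup>2)) * indicator (cyl R) p"
   unfolding sq by (cases "p \<in> cyl R") (simp_all add: E0 Ein)
  finally show "(ennreal (e k p))\<^sup>2 = ennreal (snd p powr a * ((\<phi> k p - w p)\<^sup>2 + (norm (G k p - g p))\<^sup>2)) * indicator (cyl R) p" .
 qed
 hence l: "(%k. \<integral>\<^sup>+p. (ennreal (e k p))\<^sup>2 \<partial>lebesgue) \<longlonglongrightarrow> 0" using lim by simp
 have "(\<integral>\<^sup>+p. (ennreal (\<gamma> p) * indicator (cyl R) p)\<^sup>2 \<partial>lebesgue)
   = (\<integral>\<^sup>+p\<in>cyl R. ennreal (snd p powr (- a) + 2 * snd p powr 0 + snd p powr a) \<partial>(lebesgue :: ('a \<times> real) measure))"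
 proof (intro nn_integral_cong)
  fix p :: "'a \<times> real"
  show "(ennreal (\<gamma> p) * indicator (cyl R) p)\<^sup>2 = ennreal (snd p powr (- a) + 2 * snd p powr 0 + snd p powr a) * indicator (cyl R) p"
  proof (cases "p \<in> cyl R")
   case True
   hence y: "snd p > 0" by (auto simp: cyl_def)
   have m: "snd p powr a * snd p powr (- a) = 1" using y by (simp add: powr_add[symmetric])
   have h2: "(snd p powr (- (a / 2)))\<^sup>2 = snd p powr (- a)" by (simp add: power2_eq_square powr_add[symmetric])
   have "(\<gamma> p)\<^sup>2 = (1 + snd p powr a)\<^sup>2 * snd p powr (- a)" unfolding \<gamma>_def power_mult_distrib h2 ..
   also have "... = snd p powr (- a) + 2 * (snd p powr a * snd p powr (- a)) + snd p powr a * (snd p powr a * snd p powr (- a))"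
    by (simp add: power2_eq_square algebra_simps)
   also have "... = snd p powr (- a) + 2 * snd p powr 0 + snd p powr a" unfolding m using y by simp
   finally have "(\<gamma> p)\<^sup>2 = snd p powr (- a) + 2 * snd p powr 0 + snd p powr a" .
   moreover have "\<gamma> p \<ge> 0" by (simp add: \<gamma>_def)
   ultimately show ?thesis using True by (simp add: ennreal_power)
  qed simp
 qed
 also have "... < \<infinity>"
 proof -
  have "set_integrable lebesgue (cyl R :: ('a \<times> real) set) (%p. snd p powr (- a) + 2 * snd p powr 0 + snd p powr a)"
   by (intro set_integral_add(1) set_integrable_mult_right cyl_powr_integrable) (use a in auto)
  hence "(\<integral>\<^sup>+p. ennreal (norm (indicator (cyl R) p *\<^sub>R (snd p powr (- a) + 2 * snd p powr 0 + snd p powr a))) \<partial>(lebesgue :: ('a \<times> real) measure)) < \<infinity>"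
   unfolding set_integrable_def integrable_iff_bounded by blast
  also have "(\<integral>\<^sup>+p. ennreal (norm (indicator (cyl R) p *\<^sub>R (snd p powr (- a) + 2 * snd p powr 0 + snd p powr a))) \<partial>(lebesgue :: ('a \<times> real) measure))
   = (\<integral>\<^sup>+p\<in>cyl R. ennreal (snd p powr (- a) + 2 * snd p powr 0 + snd p powr a) \<partial>(lebesgue :: ('a \<times> real) measure))"
   by (intro nn_integral_cong) (auto simp: indicator_def)
  finally show ?thesis .
 qed
 finally have fin: "(\<integral>\<^sup>+p. (ennreal (\<gamma> p) * indicator (cyl R) p)\<^sup>2 \<partial>lebesgue) < \<infinity>" .
 have cm: "cyl R \<in> sets (lebesgue :: ('a \<times> real) measure)" by (simp add: cyl_borel)
 have gim: "(%p. ennreal (\<gamma> p) * indicator (cyl R) p) \<in> borel_measurable lebesgue"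
  using \<gamma>m cm by (intro borel_measurable_times_ennreal measurable_compose[OF _ measurable_ennreal] borel_measurable_indicator)
 have eem: "(%p. ennreal (e k p)) \<in> borel_measurable lebesgue" for k
  by (rule measurable_compose[OF em measurable_ennreal])
 have L: "(%k. \<integral>\<^sup>+p. ennreal (e k p) * (ennreal (\<gamma> p) * indicator (cyl R) p) \<partial>lebesgue) \<longlonglongrightarrow> 0"
  by (rule L2_imp_L1_tendsto[OF eem gim l fin])
 have dd: "ennreal (e k p) * (ennreal (\<gamma> p) * indicator (cyl R) p) = ennreal (e k p * \<gamma> p) * indicator (cyl R) p" for k p
  using Epos[of k p] by (simp add: ennreal_mult e_def \<gamma>_def mult_ac)
 have bd: "\<bar>A * H p - B * H p\<bar> \<le> C * (e k p * \<gamma> p)" if p: "p \<in> cyl R" and AB: "\<bar>A - B\<bar> \<le> E k p" for k p A B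
 proof -
  have y: "snd p > 0" using p by (auto simp: cyl_def)
  have "\<bar>A * H p - B * H p\<bar> = \<bar>A - B\<bar> * \<bar>H p\<bar>" by (simp add: abs_mult[symmetric] left_diff_distrib)
  also have "... \<le> E k p * (C * (1 + snd p powr a))" using AB b[OF p] Epos by (intro mult_mono) auto
  also have "... = C * (E k p * (1 + snd p powr a)) * (snd p powr (a / 2) * snd p powr (- (a / 2)))"
   using y by (simp add: powr_add[symmetric])
  also have "... = C * (e k p * \<gamma> p)" by (simp only: e_def \<gamma>_def mult_ac)
  finally show ?thesis .
 qed
 have dm: "(%p. ennreal (e k p * \<gamma> p) * indicator (cyl R) p) \<in> borel_measurable lebesgue" for k
  unfolding dd[symmetric] by (intro borel_measurable_times_ennreal eem gim)
 have d0: "e k p * \<gamma> p \<ge> 0" for k p using Epos by (simp add: e_def \<gamma>_def)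
 show "(%k. LINT p:cyl R|lebesgue. \<phi> k p * H p) \<longlonglongrightarrow> (LINT p:cyl R|lebesgue. w p * H p)"
 proof (rule set_integral_tendsto_L1[OF finite_H1_mult_integrable(1)[OF a fk H b] finite_H1_mult_integrable(1)[OF a f H b] bd C d0 dm L[unfolded dd]])
  fix k and p :: "'a \<times> real" assume "p \<in> cyl R"
  show "\<bar>\<phi> k p - w p\<bar> \<le> E k p"
   unfolding Ein[OF \<open>p \<in> cyl R\<close>] by (rule real_le_rsqrt) simp
 qed
 show "(%k. LINT p:cyl R|lebesgue. (G k p \<bullet> v) * H p) \<longlonglongrightarrow> (LINT p:cyl R|lebesgue. (g p \<bullet> v) * H p)" if v: "v \<in> Basis"
 proof (rule set_integral_tendsto_L1[OF finite_H1_mult_integrable(2)[OF a fk H b v] finite_H1_mult_integrable(2)[OF a f H b v] bd C d0 dm L[unfolded dd]])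
  fix k and p :: "'a \<times> real" assume "p \<in> cyl R"
  have "\<bar>G k p \<bullet> v - g p \<bullet> v\<bar> \<le> norm (G k p - g p)"
   using Basis_le_norm[OF v, of "G k p - g p"] by (simp add: inner_diff_left)
  also have "... \<le> E k p" unfolding Ein[OF \<open>p \<in> cyl R\<close>] by (rule real_le_rsqrt) simp
  finally show "\<bar>G k p \<bullet> v - g p \<bullet> v\<bar> \<le> E k p" .
 qed
qed

text \<open>A ball has finite measure, so convergence in \<open>L2\<close> implies convergence in
  \<open>L1\<close>, and \<open>h\<close> is bounded.\<close>

lemma L2_ball_tendsto:
 fixes u h :: "'a::euclidean_space => real"
 assumes \<phi>: "!!k. continuous_on (cball 0 R) (f k)" and u: "set_integrable lebesgue (ball 0 R) u"
  and lim: "(%k. \<integral>\<^sup>+x\<in>ball 0 R. ennreal ((f k x - u x)\<^sup>2) \<partial>lebesgue) \<longlonglongrightarrow> 0"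
  and h: "continuous_on UNIV h" and hb: "!!x. \<bar>h x\<bar> \<le> B"
 shows "(%k. LINT x:ball 0 R|lebesgue. f k x * h x) \<longlonglongrightarrow> (LINT x:ball 0 R|lebesgue. u x * h x)"
proof -
 have hm: "h \<in> borel_measurable lebesgue" using h by (rule borel_measurable_lebesgue_continuous)
 have um: "(%x. indicator (ball 0 R) x *\<^sub>R u x) \<in> borel_measurable lebesgue"
  using u unfolding set_integrable_def by (rule borel_measurable_integrable)
 have fi: "set_integrable lebesgue (ball 0 R) (f k)" for k
 proof -
  have "integrable lborel (%x. indicator (cball 0 R) x *\<^sub>R f k x)"
   by (rule borel_integrable_compact[OF compact_cball \<phi>])
  hence "set_integrable lebesgue (cball 0 R) (f k)"
   unfolding set_integrable_def by (subst integrable_completion; use borel_measurable_integrable in fastforce)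
  thus ?thesis by (rule set_integrable_subset) auto
 qed
 have fm: "(%x. indicator (ball 0 R) x *\<^sub>R f k x) \<in> borel_measurable lebesgue" for k
  using fi unfolding set_integrable_def by (rule borel_measurable_integrable)
 have hi: "set_integrable lebesgue (ball 0 R) (%x. v x * h x)" if v: "set_integrable lebesgue (ball 0 R) v" for v
 proof (rule set_integrable_dominated[OF _ hm set_integrable_mult_right[of B, OF set_integrable_norm[OF v]]])
  show "(%x. indicator (ball 0 R) x *\<^sub>R v x) \<in> borel_measurable lebesgue"
   using v unfolding set_integrable_def by (rule borel_measurable_integrable)
  fix x show "\<bar>v x * h x\<bar> \<le> B * norm (v x)"
   using mult_left_mono[OF hb[of x], of "\<bar>v x\<bar>"] by (simp add: abs_mult mult.commute)
 qed
 define d where "d k x = \<bar>indicator (ball 0 R) x *\<^sub>R f k x - indicator (ball 0 R) x *\<^sub>R u x\<bar>" for k x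
 have dm: "(%x. ennreal (d k x)) \<in> borel_measurable lebesgue" for k
  unfolding d_def by (intro measurable_compose[OF _ measurable_ennreal] borel_measurable_abs borel_measurable_diff fm um)
 have "(\<integral>\<^sup>+x. (ennreal (d k x))\<^sup>2 \<partial>lebesgue) = (\<integral>\<^sup>+x\<in>ball 0 R. ennreal ((f k x - u x)\<^sup>2) \<partial>lebesgue)" for k
  by (intro nn_integral_cong) (auto simp: d_def ennreal_power indicator_def)
 hence l: "(%k. \<integral>\<^sup>+x. (ennreal (d k x))\<^sup>2 \<partial>lebesgue) \<longlonglongrightarrow> 0" using lim by simp
 have im: "(indicator (ball 0 R) :: 'a => ennreal) \<in> borel_measurable lebesgue" by (intro borel_measurable_indicator) simp
 have "(\<integral>\<^sup>+x. (indicator (ball 0 R) x)\<^sup>2 \<partial>(lebesgue :: 'a measure)) = (\<integral>\<^sup>+x. indicator (ball 0 R) x \<partial>(lebesgue :: 'a measure))"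
  by (intro nn_integral_cong) (auto simp: indicator_def)
 also have "... = emeasure lebesgue (ball 0 R :: 'a set)" by simp
 also have "... < \<infinity>" using emeasure_bounded_finite[of "ball 0 R :: 'a set"] by simp
 finally have fin: "(\<integral>\<^sup>+x. (indicator (ball 0 R) x)\<^sup>2 \<partial>(lebesgue :: 'a measure)) < \<infinity>" .
 have B: "B \<ge> 0" using hb[of 0] by linarith
 show ?thesis
 proof (rule set_integral_tendsto_L1[where d=d, OF hi[OF fi] hi[OF u] _ B])
  show "\<bar>f k x * h x - u x * h x\<bar> \<le> B * d k x" if "x \<in> ball 0 R" for k x
   using mult_left_mono[OF hb[of x], of "\<bar>f k x - u x\<bar>"] that
   unfolding left_diff_distrib[symmetric] abs_mult by (simp add: d_def mult.commute)
  show "d k x \<ge> 0" for k x by (simp add: d_def)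
  show "(%x. ennreal (d k x) * indicator (ball 0 R) x) \<in> borel_measurable lebesgue" for k
   by (intro borel_measurable_times_ennreal dm im)
  show "(%k. \<integral>\<^sup>+x\<in>ball 0 R. ennreal (d k x) \<partial>lebesgue) \<longlonglongrightarrow> 0"
   by (rule L2_imp_L1_tendsto[OF dm im l fin])
 qed
qed

context
 fixes s r :: real
 assumes s: "0 < s" "s < 1" and r: "0 \<le> r"
begin

lemma tensor_bounds:
 fixes h :: "'a::euclidean_space => real"
 assumes h: "continuous_on UNIV h" "!!x. \<bar>h x\<bar> \<le> B"
 shows "(%p::'a \<times> real. h (fst p) * flux s r (snd p)) \<in> borel_measurable borel"
  "(%p::'a \<times> real. h (fst p) * (snd p powr (1 - 2 * s) * profile s r (snd p))) \<in> borel_measurable borel"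
  "p \<in> cyl R ==> \<bar>h (fst p) * flux s r (snd p)\<bar> \<le> (B * (r\<^sup>2 / (2 - 2 * s))) * (1 + snd p powr (1 - 2 * s))"
  "p \<in> cyl R ==> \<bar>h (fst p) * (snd p powr (1 - 2 * s) * profile s r (snd p))\<bar> \<le> B * (1 + snd p powr (1 - 2 * s))"
  "B * (r\<^sup>2 / (2 - 2 * s)) \<ge> 0" "B \<ge> 0"
proof -
 interpret P: neumann_profile "1 - 2 * s" r "profile s r" "flux s r" by (rule neumann_profile_Bessel[OF s r])
 note [measurable] = profile_measurable[OF s]
 have hm[measurable]: "h \<in> borel_measurable borel" using h(1) by (rule borel_measurable_continuous_onI)
 show "(%p::'a \<times> real. h (fst p) * flux s r (snd p)) \<in> borel_measurable borel"
  "(%p::'a \<times> real. h (fst p) * (snd p powr (1 - 2 * s) * profile s r (snd p))) \<in> borel_measurable borel"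
  by measurable
 show B: "B \<ge> 0" using h(2)[of 0] by linarith
 define Q where "Q = r\<^sup>2 / (2 - 2 * s)"
 have Q: "Q \<ge> 0" using s by (simp add: Q_def)
 show "B * (r\<^sup>2 / (2 - 2 * s)) \<ge> 0" unfolding Q_def[symmetric] using B Q by simp
 assume "p \<in> cyl R"
 hence y: "0 < snd p" "snd p < 1" by (auto simp: cyl_def)
 have "\<bar>flux s r (snd p)\<bar> \<le> Q" using P.q_le[of "snd p"] y by (simp add: Q_def)
 hence "\<bar>h (fst p)\<bar> * \<bar>flux s r (snd p)\<bar> \<le> B * Q" using h(2) B by (intro mult_mono) auto
 also have "... \<le> (B * Q) * (1 + snd p powr (1 - 2 * s))" using B Q by (simp add: distrib_left)
 finally show "\<bar>h (fst p) * flux s r (snd p)\<bar> \<le> (B * (r\<^sup>2 / (2 - 2 * s))) * (1 + snd p powr (1 - 2 * s))"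
  by (simp add: abs_mult Q_def)
 have "\<bar>profile s r (snd p)\<bar> \<le> 1" using P.th_le_1[of "snd p"] y by simp
 hence "\<bar>h (fst p)\<bar> * (snd p powr (1 - 2 * s) * \<bar>profile s r (snd p)\<bar>) \<le> B * (snd p powr (1 - 2 * s) * 1)"
  using h(2) B by (intro mult_mono) auto
 also have "... \<le> B * (1 + snd p powr (1 - 2 * s))" using B by (intro mult_left_mono) auto
 finally show "\<bar>h (fst p) * (snd p powr (1 - 2 * s) * profile s r (snd p))\<bar> \<le> B * (1 + snd p powr (1 - 2 * s))"
  by (simp add: abs_mult)
qed

text \<open>The continuous functions in \<open>has_trace\<close> converge in the weighted
  \<open>H1\<close> norm and their values at \<open>y = 0\<close> converge in \<open>L2\<close>;
  each of the three terms is continuous under these convergences.\<close>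

lemma trace_identity:
 fixes w :: "'a::euclidean_space \<times> real => real"
 assumes R: "R > 0" and f: "finite_H1 (1 - 2 * s) R w g" and t: "has_trace (1 - 2 * s) (ball 0 R) w u"
  and u: "set_integrable lebesgue (ball 0 R) u" and h: "test_function (ball 0 R) h"
 shows "(LINT p:cyl R|lebesgue. (g p \<bullet> (0, 1)) * (h (fst p) * flux s r (snd p))) =
  r\<^sup>2 * (LINT p:cyl R|lebesgue. w p * (h (fst p) * (snd p powr (1 - 2 * s) * profile s r (snd p))))
   - flux s r 0 * (LINT x:ball 0 R|lebesgue. u x * h x)"
proof -
 define a where "a = 1 - 2 * s"
 have a: "-1 < a" "a < 1" using s by (auto simp: a_def)
 from t obtain \<phi> where \<phi>: "!!k. \<phi> k \<in> H1 a (cyl R)" "!!k. continuous_on (closure (cyl R)) (\<phi> k)"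
  "(%k. H1_sqnorm a (cyl R) (%p. \<phi> k p - w p)) \<longlonglongrightarrow> 0"
  "(%k. \<integral>\<^sup>+x\<in>ball 0 R. ennreal ((\<phi> k (x, 0) - u x)\<^sup>2) \<partial>lebesgue) \<longlonglongrightarrow> 0"
  unfolding has_trace_def cyl_def a_def by auto
 define G where "G k = weak_gradient (cyl R) (\<phi> k)" for k
 have wG: "has_weak_gradient (cyl R) (\<phi> k) (G k)" for k
 proof -
  have "\<exists>g. has_weak_gradient (cyl R) (\<phi> k) g" using \<phi>(1)[of k] by (simp add: H1_def)
  thus ?thesis unfolding G_def weak_gradient_def by (rule someI_ex)
 qed
 have fk: "finite_H1 a R (\<phi> k) (G k)" for k
  using wG[of k] \<phi>(1)[of k] unfolding finite_H1_def H1_def H1_sqnorm_def G_def by auto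
 have fw: "finite_H1 a R w g" using f by (simp add: a_def)
 have wg: "has_weak_gradient (cyl R) w g" using f by (simp add: finite_H1_def)
 have lim: "(%k. \<integral>\<^sup>+p\<in>cyl R. ennreal (snd p powr a * ((\<phi> k p - w p)\<^sup>2 + (norm (G k p - g p))\<^sup>2)) \<partial>lebesgue) \<longlonglongrightarrow> 0"
  using \<phi>(3) unfolding H1_sqnorm_eq[OF cyl_open has_weak_gradient_diff[OF wG wg]] .
 from test_function_bounds[OF h] obtain K B where K: "smooth h"
  "\<forall>x. \<bar>h x\<bar> \<le> B \<and> (\<forall>b\<in>Basis. \<bar>frechet_derivative h (at x) b\<bar> \<le> B)"
  by (elim exE conjE)
 have hc: "continuous_on UNIV h" by (rule smooth_continuous[OF K(1)])
 have hB: "!!x. \<bar>h x\<bar> \<le> B" using K(2) by auto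
 note T = tensor_bounds[OF hc hB, folded a_def]
 have b1: "(0::'a, 1::real) \<in> Basis" by (auto simp: Basis_prod_def)
 have cl: "closure (cyl R) = cball 0 R \<times> {0..1::real}"
  unfolding cyl_def closure_Times using R by simp
 have \<phi>0: "continuous_on (cball 0 R) (%x. \<phi> k (x, 0))" for k
  by (rule continuous_on_compose2[OF \<phi>(2)]) (auto simp: cl intro!: continuous_intros)
 have l1: "(%k. LINT p:cyl R|lebesgue. (G k p \<bullet> (0, 1)) * (h (fst p) * flux s r (snd p))) \<longlonglongrightarrow>
  (LINT p:cyl R|lebesgue. (g p \<bullet> (0, 1)) * (h (fst p) * flux s r (snd p)))"
  by (rule finite_H1_tendsto(2)[OF a fw fk lim T(1) T(3) T(5) b1])
 have l2: "(%k. LINT p:cyl R|lebesgue. \<phi> k p * (h (fst p) * (snd p powr a * profile s r (snd p)))) \<longlonglongrightarrow>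
  (LINT p:cyl R|lebesgue. w p * (h (fst p) * (snd p powr a * profile s r (snd p))))"
  by (rule finite_H1_tendsto(1)[OF a fw fk lim T(2) T(4) T(6)])
 have l3: "(%k. LINT x:ball 0 R|lebesgue. \<phi> k (x, 0) * h x) \<longlonglongrightarrow> (LINT x:ball 0 R|lebesgue. u x * h x)"
  by (rule L2_ball_tendsto[OF \<phi>0 u \<phi>(4) hc hB])
 have e: "(LINT p:cyl R|lebesgue. (G k p \<bullet> (0, 1)) * (h (fst p) * flux s r (snd p))) =
  r\<^sup>2 * (LINT p:cyl R|lebesgue. \<phi> k p * (h (fst p) * (snd p powr a * profile s r (snd p))))
   - flux s r 0 * (LINT x:ball 0 R|lebesgue. \<phi> k (x, 0) * h x)" for k
  unfolding a_def by (rule trace_identity_continuous[OF s r R \<phi>(2) fk[unfolded a_def] h])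
 show ?thesis unfolding a_def[symmetric]
  by (rule LIMSEQ_unique[OF l1[unfolded e]]) (intro tendsto_intros l2 l3)
qed

text \<open>There is no boundary term: the derivative is horizontal, so the vertical cutoff is not
  differentiated and simply tends to 1.\<close>

lemma horizontal_identity:
 fixes w :: "'a::euclidean_space \<times> real => real"
 assumes f: "finite_H1 (1 - 2 * s) R w g" and h: "test_function (ball 0 R) h" and b: "b \<in> Basis"
 shows "(LINT p:cyl R|lebesgue. w p * (frechet_derivative h (at (fst p)) b * (snd p powr (1 - 2 * s) * profile s r (snd p)))) =
  - (LINT p:cyl R|lebesgue. (g p \<bullet> (b, 0)) * (h (fst p) * (snd p powr (1 - 2 * s) * profile s r (snd p))))"
proof -
 define a where "a = 1 - 2 * s"
 have a: "-1 < a" "a < 1" using s by (auto simp: a_def)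
 define f where "f y = y powr a * profile s r y" for y
 have fC: "C_k_on k {0<..<1} f" for k
  unfolding f_def[abs_def] using profile_flux_C_k_on[OF s r] by (intro C_k_on_mult C_k_on_powr) auto
 obtain f' where f': "!!y. 0 < y ==> y < 1 ==> (f has_real_derivative f' y) (at y)"
 proof -
  from fC[of "Suc 0"] obtain d where "\<forall>y\<in>{0<..<1}. (f has_real_derivative d y) (at y)" by auto
  thus thesis using that[of d] by simp
 qed
 from test_function_bounds[OF h] obtain K B where K: "smooth h"
  "\<forall>x. \<bar>h x\<bar> \<le> B \<and> (\<forall>b\<in>Basis. \<bar>frechet_derivative h (at x) b\<bar> \<le> B)"
  by (elim exE conjE)
 have hc: "continuous_on UNIV h" by (rule smooth_continuous[OF K(1)])
 have hB: "!!x. \<bar>h x\<bar> \<le> B" using K(2) by auto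
 have dc: "continuous_on UNIV (%x. frechet_derivative h (at x) b)" by (rule smooth_continuous[OF smooth_partial[OF K(1) b]])
 have dB: "!!x. \<bar>frechet_derivative h (at x) b\<bar> \<le> B" using K(2) b by auto
 note T1 = tensor_bounds[OF hc hB] and T2 = tensor_bounds[OF dc dB]
 have b0: "(b, 0::real) \<in> Basis" using b by (auto simp: Basis_prod_def)
 note fw = assms(1)
 have wg: "has_weak_gradient (cyl R) w g" using fw by (simp add: finite_H1_def)
 have i1: "set_integrable lebesgue (cyl R) (%p. w p * (frechet_derivative h (at (fst p)) b * f (snd p)))"
  unfolding f_def a_def by (rule finite_H1_mult_integrable(1)[OF a[unfolded a_def] fw T2(2) T2(4)])
 have i2: "set_integrable lebesgue (cyl R) (%p. (g p \<bullet> (b, 0)) * (h (fst p) * f (snd p)))"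
  unfolding f_def a_def by (rule finite_H1_mult_integrable(2)[OF a[unfolded a_def] fw T1(2) T1(4) b0])
 note l1 = cutoff_set_integral_tendsto[OF i1 cyl_slab]
 note l2 = tendsto_minus[OF cutoff_set_integral_tendsto[OF i2 cyl_slab]]
 have e: "(LINT p:cyl R|lebesgue. w p * (frechet_derivative h (at (fst p)) b * f (snd p)) * cutoff k (snd p)) =
  - (LINT p:cyl R|lebesgue. (g p \<bullet> (b, 0)) * (h (fst p) * f (snd p)) * cutoff k (snd p))" for k
  using weak_ibp_tensor(2)[OF wg h fC f' b, of k] by (simp only: mult.assoc)
 show ?thesis using LIMSEQ_unique[OF l1[unfolded e] l2] unfolding f_def a_def .
qed

end

section \<open>Real plane waves\<close>

text \<open>The real part of a complex exponential with coefficient \<open>c\<close>, written with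
  sine and cosine so that smoothness is immediate. Keeping \<open>c\<close> complex lets a
  derivative be expressed through the wave with coefficient \<open>\<i> * c\<close>.\<close>

definition plane_wave :: "complex => 'a::euclidean_space => 'a => real" where
 "plane_wave c xi x = Re c * cos (x \<bullet> xi) + (- Im c) * sin (x \<bullet> xi)"

lemma plane_wave_eq: "plane_wave c xi x = Re (c * exp (\<i> * of_real (x \<bullet> xi)))"
 unfolding plane_wave_def exp_Euler[symmetric] by (simp add: cos_of_real sin_of_real exp_Euler)

lemma smooth_plane_wave: "smooth (plane_wave c xi)"
 unfolding plane_wave_def[abs_def]
 by (intro smooth_add smooth_mult smooth_const smooth_cos_inner smooth_sin_inner)

lemma frechet_derivative_plane_wave:
 "frechet_derivative (plane_wave c xi) (at x) v = (v \<bullet> xi) * plane_wave (\<i> * c) xi x"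
proof -
 have "(plane_wave c xi has_derivative (%v. (v \<bullet> xi) * plane_wave (\<i> * c) xi x)) (at x)"
  unfolding plane_wave_def[abs_def]
  by (auto intro!: derivative_eq_intros simp: algebra_simps)
 from frechet_derivative_at[OF this] show ?thesis by metis
qed

lemma plane_wave_bound: "\<bar>plane_wave c xi x\<bar> \<le> norm c"
proof -
 have "\<bar>plane_wave c xi x\<bar> \<le> norm (c * exp (\<i> * of_real (x \<bullet> xi)))" unfolding plane_wave_eq by (rule abs_Re_le_cmod)
 thus ?thesis by (simp add: norm_mult norm_exp_ii)
qed

lemma plane_wave_continuous: "continuous_on UNIV (plane_wave c xi)"
 by (rule smooth_continuous[OF smooth_plane_wave])

section \<open>Testing with plane waves\<close>

lemma has_weak_gradient_cong_AE:
 assumes \<Omega>: "open \<Omega>" and g: "has_weak_gradient \<Omega> w g" and g': "g' \<in> borel_measurable borel"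
  and eq: "AE p in lebesgue. p \<in> \<Omega> --> g p = g' p"
 shows "has_weak_gradient \<Omega> w g'"
 unfolding has_weak_gradient_def
proof (intro conjI allI impI ballI)
 have g'm: "g' \<in> borel_measurable lebesgue" by (rule borel_lebesgue[OF g'])
 show "locally_integrable \<Omega> w" using g by (simp add: has_weak_gradient_def)
 show "locally_integrable \<Omega> g'"
  unfolding locally_integrable_def
 proof (intro allI impI)
  fix K assume K: "compact K \<and> K \<subseteq> \<Omega>"
  hence i: "integrable lebesgue (%p. indicator K p *\<^sub>R g p)"
   using g unfolding has_weak_gradient_def locally_integrable_def set_integrable_def by blast
  have Km: "K \<in> sets lebesgue" using K by (auto intro: lmeasurable_compact fmeasurableD)
  show "g' absolutely_integrable_on K" unfolding set_integrable_def
  proof (rule integrable_cong_AE_imp[OF i])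
   show "(%p. indicat_real K p *\<^sub>R g' p) \<in> borel_measurable lebesgue"
    by (intro borel_measurable_scaleR borel_measurable_indicator Km g'm)
   show "AE p in lebesgue. indicat_real K p *\<^sub>R g p = indicat_real K p *\<^sub>R g' p"
    by (rule eventually_mono[OF eq]) (use K in \<open>auto simp: indicator_def\<close>)
  qed
 qed
 fix \<phi> and b :: 'a assume t: "test_function \<Omega> \<phi>" and b: "b \<in> Basis"
 from test_function_bounds[OF t] obtain K M where K: "smooth \<phi>" by (elim exE conjE)
 have \<phi>m: "\<phi> \<in> borel_measurable lebesgue"
  by (rule borel_measurable_lebesgue_continuous[OF smooth_continuous[OF K]])
 have "(LINT p:\<Omega>|lebesgue. (g p \<bullet> b) * \<phi> p) = (LINT p:\<Omega>|lebesgue. (g' p \<bullet> b) * \<phi> p)"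
  unfolding set_lebesgue_integral_def
 proof (rule integral_cong_AE)
  show "(%p. indicat_real \<Omega> p *\<^sub>R ((g p \<bullet> b) * \<phi> p)) \<in> borel_measurable lebesgue"
   using weak_gradient_integrable(2)[OF g t b] unfolding set_integrable_def by (rule borel_measurable_integrable)
  have "\<Omega> \<in> sets lebesgue" using \<Omega> by (auto intro: borel_open)
  thus "(%p. indicat_real \<Omega> p *\<^sub>R ((g' p \<bullet> b) * \<phi> p)) \<in> borel_measurable lebesgue"
   by (intro borel_measurable_scaleR borel_measurable_indicator borel_measurable_times \<phi>m
     measurable_compose[OF g'm, of "%x. x \<bullet> b"]) (simp_all add: borel_measurable_continuous_onI continuous_intros)
  show "AE p in lebesgue. indicat_real \<Omega> p *\<^sub>R ((g p \<bullet> b) * \<phi> p) = indicat_real \<Omega> p *\<^sub>R ((g' p \<bullet> b) * \<phi> p)"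
   by (rule eventually_mono[OF eq]) (auto simp: indicator_def)
 qed
 thus "(LINT p:\<Omega>|lebesgue. w p * frechet_derivative \<phi> (at p) b) = - (LINT p:\<Omega>|lebesgue. (g' p \<bullet> b) * \<phi> p)"
  using has_weak_gradient_ibp[OF g t b] by simp
qed

text \<open>Fubini will be applied to products with \<open>lborel\<close>, for which a Borel
  representative is required; each component has one up to a null set.\<close>

lemma has_weak_gradient_borel:
 assumes \<Omega>: "open \<Omega>" and g: "has_weak_gradient \<Omega> w g"
 obtains g' where "g' \<in> borel_measurable borel" "has_weak_gradient \<Omega> w g'"
proof -
 have m: "(%p. indicator \<Omega> p *\<^sub>R g p) \<in> borel_measurable lebesgue"
  using g locally_integrable_measurable[OF \<Omega>] unfolding has_weak_gradient_def by blast
 have "\<exists>h\<in>borel_measurable lborel. AE p in lborel. (indicator \<Omega> p *\<^sub>R g p) \<bullet> b = h p" for b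
  by (rule completion_ex_borel_measurable_real, rule measurable_compose[OF m])
   (simp add: borel_measurable_continuous_onI continuous_intros)
 then obtain h where h': "\<forall>b. h b \<in> borel_measurable lborel \<and> (AE p in lborel. (indicator \<Omega> p *\<^sub>R g p) \<bullet> b = h b p)"
  using choice[of "%b h. h \<in> borel_measurable lborel \<and> (AE p in lborel. (indicator \<Omega> p *\<^sub>R g p) \<bullet> b = h p)"] by blast
 have h: "!!b. h b \<in> borel_measurable lborel" "!!b. AE p in lborel. (indicator \<Omega> p *\<^sub>R g p) \<bullet> b = h b p"
  using h'[rule_format] by blast+
 define g' where "g' p = (\<Sum>b\<in>Basis. h b p *\<^sub>R b)" for p
 have hm: "h b \<in> borel_measurable borel" for b using h(1)[of b] by simp
 have g'm: "g' \<in> borel_measurable borel"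
  unfolding g'_def[abs_def] by (intro borel_measurable_sum borel_measurable_scaleR hm) auto
 have "AE p in lebesgue. \<forall>b\<in>Basis. (indicator \<Omega> p *\<^sub>R g p) \<bullet> b = h b p"
  by (intro AE_finite_allI AE_completion h(2)) auto
 hence "AE p in lebesgue. p \<in> \<Omega> --> g p = g' p"
 proof (rule eventually_mono, intro impI)
  fix p assume p: "\<forall>b\<in>Basis. (indicator \<Omega> p *\<^sub>R g p) \<bullet> b = h b p" "p \<in> \<Omega>"
  show "g p = g' p"
   by (rule euclidean_eqI) (use p in \<open>simp add: g'_def\<close>)
 qed
 from has_weak_gradient_cong_AE[OF \<Omega> g g'm this] g'm show thesis using that by blast
qed

lemma test_function_times_smooth:
 assumes "test_function \<Omega> \<zeta>" "smooth f" shows "test_function \<Omega> (%x. \<zeta> x * f x)"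
proof -
 from test_function_bounds[OF assms(1)] obtain K M where K: "smooth \<zeta>" "compact K" "K \<subseteq> \<Omega>"
  "\<forall>x. x \<notin> K --> \<zeta> x = 0 \<and> (\<forall>b. frechet_derivative \<zeta> (at x) b = 0)" by (elim exE conjE)
 show ?thesis by (rule test_functionI[OF smooth_mult[OF K(1) assms(2)] K(2,3)]) (use K(4) in auto)
qed

lemma test_function_partial:
 assumes "test_function \<Omega> \<zeta>" "b \<in> Basis" shows "test_function \<Omega> (%x. frechet_derivative \<zeta> (at x) b)"
proof -
 from test_function_bounds[OF assms(1)] obtain K M where K: "smooth \<zeta>" "compact K" "K \<subseteq> \<Omega>"
  "\<forall>x. x \<notin> K --> \<zeta> x = 0 \<and> (\<forall>b. frechet_derivative \<zeta> (at x) b = 0)" by (elim exE conjE)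
 show ?thesis by (rule test_functionI[OF smooth_partial[OF K(1) assms(2)] K(2,3)]) (use K(4) in auto)
qed

lemma test_function_sum:
 assumes "finite I" "!!i. i \<in> I ==> test_function \<Omega> (F i)"
 shows "test_function \<Omega> (%x. \<Sum>i\<in>I. F i x)"
proof -
 define K where "K = (\<Union>i\<in>I. closure {x. F i x \<noteq> 0})"
 show ?thesis
 proof (rule test_functionI[of _ K])
  show "smooth (%x. \<Sum>i\<in>I. F i x)" by (rule smooth_sum) (use assms(2) in \<open>simp add: test_function_def\<close>)
  show "compact K" unfolding K_def using assms by (intro compact_UN) (auto simp: test_function_def)
  show "K \<subseteq> \<Omega>" unfolding K_def using assms(2) by (auto simp: test_function_def)
  fix x assume x: "x \<notin> K"
  have "F i x = 0" if "i \<in> I" for i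
   using x that closure_subset[of "{x. F i x \<noteq> 0}"] unfolding K_def by blast
  thus "(\<Sum>i\<in>I. F i x) = 0" by simp
 qed
qed

lemma test_function_continuous_bounded:
 assumes "test_function \<Omega> \<zeta>"
 obtains B where "continuous_on UNIV \<zeta>" "!!x. \<bar>\<zeta> x\<bar> \<le> B"
proof -
 from test_function_bounds[OF assms] obtain K B where K: "smooth \<zeta>"
  "\<forall>x. \<bar>\<zeta> x\<bar> \<le> B \<and> (\<forall>b\<in>Basis. \<bar>frechet_derivative \<zeta> (at x) b\<bar> \<le> B)" by (elim exE conjE)
 show thesis by (rule that[of B]) (use K smooth_continuous in auto)
qed

lemma sum_Basis_prod:
 "(\<Sum>v\<in>(Basis :: ('a::euclidean_space \<times> real) set). F v) = (\<Sum>b\<in>Basis. F (b, 0)) + F (0, 1)"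
proof -
 have "(Basis :: ('a \<times> real) set) = (%b. (b, 0)) ` Basis \<union> {(0, 1)}" by (auto simp: Basis_prod_def)
 moreover have "(\<Sum>v\<in>(%b. (b::'a, 0::real)) ` Basis \<union> {(0, 1)}. F v) = (\<Sum>v\<in>(%b. (b, 0)) ` Basis. F v) + (\<Sum>v\<in>{(0, 1)}. F v)"
  by (rule sum.union_disjoint) auto
 moreover have "(\<Sum>v\<in>(%b. (b::'a, 0::real)) ` Basis. F v) = (\<Sum>b\<in>Basis. F (b, 0))"
  by (subst sum.reindex) (auto simp: inj_on_def)
 ultimately show ?thesis by simp
qed

context
 fixes s :: real
 assumes s: "0 < s" "s < 1"
begin

context
 fixes c :: "'a::euclidean_space => complex" and M :: real
 assumes c: "c \<in> borel_measurable borel" and cM: "!!xi. norm (c xi) \<le> M"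
begin

text \<open>The weight cancels the singular power in the vertical component and leaves the flux,
  which is bounded up to \<open>y = 0\<close>; both components take the tensor form that the trace
  and the horizontal identities admit.\<close>

lemma dwave_eq_plane_wave:
 assumes y: "0 < snd p"
 shows "snd p powr (1 - 2 * s) * dwave s c xi p (b, 0) =
   - (b \<bullet> xi) * plane_wave (- \<i> * c xi) xi (fst p) * (snd p powr (1 - 2 * s) * profile s (norm xi) (snd p))"
  "snd p powr (1 - 2 * s) * dwave s c xi p (0, 1) = - plane_wave (c xi) xi (fst p) * flux s (norm xi) (snd p)"
proof -
 have 1: "snd p powr (1 - 2 * s) * snd p powr (2 * s - 1) = 1" using y by (simp add: powr_add[symmetric])
 show "snd p powr (1 - 2 * s) * dwave s c xi p (b, 0) =
   - (b \<bullet> xi) * plane_wave (- \<i> * c xi) xi (fst p) * (snd p powr (1 - 2 * s) * profile s (norm xi) (snd p))"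
  unfolding dwave_def[OF s c cM] gmul_def[OF s] plane_wave_eq by (simp add: algebra_simps)
 have "snd p powr (1 - 2 * s) * dwave s c xi p (0, 1) = (snd p powr (1 - 2 * s) * snd p powr (2 * s - 1)) * (- plane_wave (c xi) xi (fst p) * flux s (norm xi) (snd p))"
  unfolding dwave_def[OF s c cM] gmul_def[OF s] plane_wave_eq by (simp add: algebra_simps)
 thus "snd p powr (1 - 2 * s) * dwave s c xi p (0, 1) = - plane_wave (c xi) xi (fst p) * flux s (norm xi) (snd p)"
  unfolding 1 by simp
qed

text \<open>The vertical part of the pairing is treated by \<open>trace_identity\<close>, the
  horizontal part by \<open>horizontal_identity\<close>. Both produce the same volume integral
  \<open>S\<close> of \<open>w\<close>, which cancels because the wave solves the equation. The
  source term remains, together with terms in which \<open>\<zeta>\<close> is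
  differentiated.\<close>

lemma plane_wave_identity:
 fixes w :: "'a \<times> real => real" and \<zeta> :: "'a => real"
 assumes xi: "xi \<noteq> 0" and R: "R > 0" and f: "finite_H1 (1 - 2 * s) R w g" and t: "has_trace (1 - 2 * s) (ball 0 R) w u"
  and u: "set_integrable lebesgue (ball 0 R) u" and h: "test_function (ball 0 R) \<zeta>"
 shows "(LINT p:cyl R|lebesgue. \<zeta> (fst p) * (snd p powr (1 - 2 * s) * (\<Sum>v\<in>Basis. (g p \<bullet> v) * dwave s c xi p v))) =
  flux s (norm xi) 0 * (LINT x:ball 0 R|lebesgue. u x * (\<zeta> x * plane_wave (c xi) xi x)) +
  ((LINT p:cyl R|lebesgue. (g p \<bullet> (0, 1)) * ((\<Sum>b\<in>Basis. (b \<bullet> xi) * frechet_derivative \<zeta> (at (fst p)) b)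
    * plane_wave (- \<i> * c xi) xi (fst p) * flux s (norm xi) (snd p)))
   + flux s (norm xi) 0 * (LINT x:ball 0 R|lebesgue. u x * ((\<Sum>b\<in>Basis. (b \<bullet> xi) * frechet_derivative \<zeta> (at x) b)
    * plane_wave (- \<i> * c xi) xi x))) / (norm xi)\<^sup>2"
proof -
 define a where "a = 1 - 2 * s"
 have a: "-1 < a" "a < 1" using s by (auto simp: a_def)
 define r where "r = norm xi"
 have r: "0 \<le> r" "r > 0" using xi by (auto simp: r_def)
 define e f where "e = plane_wave (c xi) xi" and "f = plane_wave (- \<i> * c xi) xi"
 define D where "D x = (\<Sum>b\<in>Basis. (b \<bullet> xi) * frechet_derivative \<zeta> (at x) b)" for x
 \<comment> \<open>\<open>f\<close> is chosen so that its derivative in direction \<open>v\<close>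
   is \<open>(v \<bullet> xi) * e\<close>. The functions \<open>hb b\<close> are the horizontal
   coefficients of the localised wave, and their divergence is \<open>- h\<close>.\<close>
 define hb where "hb b x = - (b \<bullet> xi) * (\<zeta> x * f x)" for b x
 define h0 h2 where "h0 x = D x * f x" and "h2 x = \<zeta> x * e x" for x
 define h where "h x = h0 x + r\<^sup>2 * h2 x" for x
 define P q where "P y = y powr a * profile s r y" and "q = flux s r" for y
 have sm: "smooth e" "smooth f" unfolding e_def f_def by (rule smooth_plane_wave)+
 have sz: "smooth \<zeta>" using assms(6) by (simp add: test_function_def)
 have df: "frechet_derivative f (at x) v = (v \<bullet> xi) * e x" for x v
  unfolding f_def e_def frechet_derivative_plane_wave by simp
 have th2: "test_function (ball 0 R) h2"
  unfolding h2_def[abs_def] by (rule test_function_times_smooth[OF assms(6) sm(1)])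
 have tzf: "test_function (ball 0 R) (%x. \<zeta> x * f x)" by (rule test_function_times_smooth[OF assms(6) sm(2)])
 have thb: "test_function (ball 0 R) (hb b)" for b
  using test_function_times_smooth[OF tzf smooth_const[of "- (b \<bullet> xi)"]] unfolding hb_def[abs_def] by (simp only: mult.commute)
 have tD: "test_function (ball 0 R) D"
  unfolding D_def[abs_def]
  by (intro test_function_sum)
   (use test_function_times_smooth[OF test_function_partial[OF assms(6)] smooth_const] in \<open>auto simp: mult.commute\<close>)
 have th0: "test_function (ball 0 R) h0"
  unfolding h0_def[abs_def] by (rule test_function_times_smooth[OF tD sm(2)])
 have dhb: "frechet_derivative (hb b) (at x) b = - (b \<bullet> xi) * (frechet_derivative \<zeta> (at x) b * f x + \<zeta> x * ((b \<bullet> xi) * e x))" for b x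
 proof -
  have "(hb b has_derivative (%v. - (b \<bullet> xi) * (\<zeta> x * frechet_derivative f (at x) v + frechet_derivative \<zeta> (at x) v * f x))) (at x)"
   unfolding hb_def[abs_def]
   by (intro has_derivative_mult_right has_derivative_mult smooth_has_derivative sz sm)
  from fun_cong[OF frechet_derivative_at[OF this], of b] show ?thesis by (simp add: df algebra_simps)
 qed
 have sdhb: "(\<Sum>b\<in>Basis. frechet_derivative (hb b) (at x) b) = - h x" for x
 proof -
  have "(\<Sum>b\<in>Basis. frechet_derivative (hb b) (at x) b) = - ((\<Sum>b\<in>Basis. (b \<bullet> xi) * frechet_derivative \<zeta> (at x) b) * f x + (\<Sum>b\<in>Basis. (xi \<bullet> b)\<^sup>2) * (\<zeta> x * e x))"
   unfolding dhb sum_distrib_right sum_negf[symmetric] sum.distrib[symmetric]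
   by (intro sum.cong refl) (simp add: power2_eq_square algebra_simps inner_commute)
  thus ?thesis unfolding h_def h0_def h2_def D_def r_def norm_sq_sum_Basis[of xi] .
 qed
 have th: "test_function (ball 0 R) h"
 proof -
  have "test_function (ball 0 R) (%x. \<Sum>i\<in>(Basis::'a set). - 1 * frechet_derivative (hb i) (at x) i)"
   by (intro test_function_sum)
    (use test_function_times_smooth[OF test_function_partial[OF thb] smooth_const[of "-1"]] in \<open>auto simp: mult.commute\<close>)
  also have "(%x. \<Sum>i\<in>(Basis::'a set). - 1 * frechet_derivative (hb i) (at x) i) = h"
   using sdhb by (auto simp: sum_negf)
  finally show ?thesis .
 qed
 have fw: "finite_H1 a R w g" using assms(3) by (simp add: a_def)
 have b1: "(0::'a, 1::real) \<in> Basis" and b0: "!!b::'a. b \<in> Basis ==> (b, 0::real) \<in> Basis" by (auto simp: Basis_prod_def)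
 have I: "set_integrable lebesgue (cyl R) (%p. (g p \<bullet> (0, 1)) * (k (fst p) * q (snd p)))"
  "set_integrable lebesgue (cyl R) (%p. w p * (k (fst p) * P (snd p)))"
  "b \<in> Basis ==> set_integrable lebesgue (cyl R) (%p. (g p \<bullet> (b, 0)) * (k (fst p) * P (snd p)))"
  "set_integrable lebesgue (ball 0 R) (%x. u x * k x)"
  if k: "test_function (ball 0 R) k" for k b
 proof -
  from test_function_continuous_bounded[OF k] obtain B where B: "continuous_on UNIV k" "!!x. \<bar>k x\<bar> \<le> B" by metis
  note T = tensor_bounds[OF s r(1) B, folded a_def P_def q_def]
  show "set_integrable lebesgue (cyl R) (%p. (g p \<bullet> (0, 1)) * (k (fst p) * q (snd p)))"
   by (rule finite_H1_mult_integrable(2)[OF a fw T(1) T(3) b1])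
  show "set_integrable lebesgue (cyl R) (%p. w p * (k (fst p) * P (snd p)))"
   by (rule finite_H1_mult_integrable(1)[OF a fw T(2) T(4)])
  show "set_integrable lebesgue (cyl R) (%p. (g p \<bullet> (b, 0)) * (k (fst p) * P (snd p)))" if "b \<in> Basis"
   by (rule finite_H1_mult_integrable(2)[OF a fw T(2) T(4) b0[OF that]])
  show "set_integrable lebesgue (ball 0 R) (%x. u x * k x)"
  proof (rule set_integrable_dominated[OF _ borel_measurable_lebesgue_continuous[OF B(1)] set_integrable_mult_right[of B, OF set_integrable_norm[OF u]]])
   show "(%x. indicator (ball 0 R) x *\<^sub>R u x) \<in> borel_measurable lebesgue"
    using u unfolding set_integrable_def by (rule borel_measurable_integrable)
   fix x show "\<bar>u x * k x\<bar> \<le> B * norm (u x)"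
    using mult_left_mono[OF B(2)[of x], of "\<bar>u x\<bar>"] by (simp add: abs_mult mult.commute)
  qed
 qed
 define S where "S = (LINT p:cyl R|lebesgue. w p * (h (fst p) * P (snd p)))"
 define T0 T2 where "T0 = (LINT p:cyl R|lebesgue. (g p \<bullet> (0, 1)) * (h0 (fst p) * q (snd p)))"
  and "T2 = (LINT p:cyl R|lebesgue. (g p \<bullet> (0, 1)) * (h2 (fst p) * q (snd p)))"
 define U0 U2 where "U0 = (LINT x:ball 0 R|lebesgue. u x * h0 x)" and "U2 = (LINT x:ball 0 R|lebesgue. u x * h2 x)"
 \<comment> \<open>The trace identity for the divergence \<open>h\<close>, split into the part
   \<open>h0\<close> with derivatives of \<open>\<zeta>\<close> and the multiple
   \<open>r\<^sup>2 * h2\<close> of the localised wave.\<close>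
 have A: "T0 + r\<^sup>2 * T2 = r\<^sup>2 * S - q 0 * (U0 + r\<^sup>2 * U2)"
 proof -
  have "(LINT p:cyl R|lebesgue. (g p \<bullet> (0, 1)) * (h (fst p) * q (snd p))) = r\<^sup>2 * S - q 0 * (LINT x:ball 0 R|lebesgue. u x * h x)"
   unfolding S_def P_def q_def a_def by (rule trace_identity[OF s r(1) R assms(3) t u th])
  also have "(LINT p:cyl R|lebesgue. (g p \<bullet> (0, 1)) * (h (fst p) * q (snd p)))
   = (LINT p:cyl R|lebesgue. (g p \<bullet> (0, 1)) * (h0 (fst p) * q (snd p)) + r\<^sup>2 * ((g p \<bullet> (0, 1)) * (h2 (fst p) * q (snd p))))"
   by (rule set_lebesgue_integral_cong) (auto simp: h_def algebra_simps cyl_borel)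
  also have "... = T0 + r\<^sup>2 * T2" unfolding T0_def T2_def
   using set_integral_add(2)[OF I(1)[OF th0] set_integrable_mult_right[of "r\<^sup>2", OF I(1)[OF th2]]] by simp
  also have "(LINT x:ball 0 R|lebesgue. u x * h x) = (LINT x:ball 0 R|lebesgue. u x * h0 x + r\<^sup>2 * (u x * h2 x))"
   by (rule set_lebesgue_integral_cong) (auto simp: h_def algebra_simps)
  also have "... = U0 + r\<^sup>2 * U2" unfolding U0_def U2_def
   using set_integral_add(2)[OF I(4)[OF th0] set_integrable_mult_right[of "r\<^sup>2", OF I(4)[OF th2]]] by simp
  finally show ?thesis .
 qed
 have B: "(\<Sum>b\<in>Basis. (LINT p:cyl R|lebesgue. (g p \<bullet> (b, 0)) * (hb b (fst p) * P (snd p)))) = S"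
 proof -
  have "(\<Sum>b\<in>Basis. LINT p:cyl R|lebesgue. (g p \<bullet> (b, 0)) * (hb b (fst p) * P (snd p)))
   = - (\<Sum>b\<in>Basis. (LINT p:cyl R|lebesgue. w p * (frechet_derivative (hb b) (at (fst p)) b * P (snd p))))"
   unfolding P_def a_def sum_negf[symmetric]
   by (intro sum.cong refl, subst horizontal_identity[OF s r(1) assms(3) thb]) auto
  also have "(\<Sum>b\<in>Basis. LINT p:cyl R|lebesgue. w p * (frechet_derivative (hb b) (at (fst p)) b * P (snd p)))
   = (LINT p|lebesgue. (\<Sum>b\<in>Basis. indicator (cyl R) p *\<^sub>R (w p * (frechet_derivative (hb b) (at (fst p)) b * P (snd p)))))"
   unfolding set_lebesgue_integral_def
   by (rule Bochner_Integration.integral_sum[symmetric]) (use I(2)[OF test_function_partial[OF thb]] in \<open>simp add: set_integrable_def\<close>)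
  also have "... = (LINT p|lebesgue. - (indicator (cyl R) p *\<^sub>R (w p * (h (fst p) * P (snd p)))))"
  proof (intro Bochner_Integration.integral_cong refl)
   fix p :: "'a \<times> real"
   have "(\<Sum>b\<in>Basis. indicat_real (cyl R) p *\<^sub>R (w p * (frechet_derivative (hb b) (at (fst p)) b * P (snd p))))
    = indicat_real (cyl R) p *\<^sub>R (w p * ((\<Sum>b\<in>Basis. frechet_derivative (hb b) (at (fst p)) b) * P (snd p)))"
    by (simp add: sum_distrib_left sum_distrib_right)
   thus "(\<Sum>b\<in>Basis. indicat_real (cyl R) p *\<^sub>R (w p * (frechet_derivative (hb b) (at (fst p)) b * P (snd p))))
    = - (indicat_real (cyl R) p *\<^sub>R (w p * (h (fst p) * P (snd p))))" unfolding sdhb by simp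
  qed
  also have "... = - S" unfolding S_def set_lebesgue_integral_def by simp
  finally show ?thesis by simp
 qed
 have "(LINT p:cyl R|lebesgue. \<zeta> (fst p) * (snd p powr a * (\<Sum>v\<in>Basis. (g p \<bullet> v) * dwave s c xi p v)))
  = (LINT p|lebesgue. (\<Sum>b\<in>Basis. indicator (cyl R) p *\<^sub>R ((g p \<bullet> (b, 0)) * (hb b (fst p) * P (snd p))))
     - indicator (cyl R) p *\<^sub>R ((g p \<bullet> (0, 1)) * (h2 (fst p) * q (snd p))))"
  unfolding set_lebesgue_integral_def
 proof (intro Bochner_Integration.integral_cong refl)
  fix p :: "'a \<times> real"
  show "indicat_real (cyl R) p *\<^sub>R (\<zeta> (fst p) * (snd p powr a * (\<Sum>v\<in>Basis. (g p \<bullet> v) * dwave s c xi p v))) =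
   (\<Sum>b\<in>Basis. indicat_real (cyl R) p *\<^sub>R ((g p \<bullet> (b, 0)) * (hb b (fst p) * P (snd p))))
     - indicat_real (cyl R) p *\<^sub>R ((g p \<bullet> (0, 1)) * (h2 (fst p) * q (snd p)))"
  proof (cases "p \<in> cyl R")
   case True
   hence y: "0 < snd p" by (auto simp: cyl_def)
   note dw = dwave_eq_plane_wave[OF y, where xi=xi, folded a_def r_def e_def f_def q_def P_def]
   have "\<zeta> (fst p) * (snd p powr a * (\<Sum>v\<in>Basis. (g p \<bullet> v) * dwave s c xi p v))
    = (\<Sum>b\<in>Basis. \<zeta> (fst p) * ((g p \<bullet> (b, 0)) * (snd p powr a * dwave s c xi p (b, 0)))) + \<zeta> (fst p) * ((g p \<bullet> (0, 1)) * (snd p powr a * dwave s c xi p (0, 1)))"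
    unfolding sum_Basis_prod distrib_left sum_distrib_left by (simp only: mult_ac)
   also have "... = (\<Sum>b\<in>Basis. (g p \<bullet> (b, 0)) * (hb b (fst p) * P (snd p))) - (g p \<bullet> (0, 1)) * (h2 (fst p) * q (snd p))"
    unfolding dw(2) by (subst dw(1)) (simp add: hb_def h2_def P_def q_def mult_ac)
   finally show ?thesis using True by simp
  qed simp
 qed
 also have "... = (\<Sum>b\<in>Basis. (LINT p:cyl R|lebesgue. (g p \<bullet> (b, 0)) * (hb b (fst p) * P (snd p)))) - T2"
 proof -
  define F where "F b p = indicat_real (cyl R) p *\<^sub>R ((g p \<bullet> (b, 0)) * (hb b (fst p) * P (snd p)))" for b p
  have i: "integrable lebesgue (F b)" if "b \<in> Basis" for b
   using I(3)[OF thb that] unfolding set_integrable_def F_def .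
  have "(LINT p|lebesgue. (\<Sum>b\<in>Basis. F b p) - indicator (cyl R) p *\<^sub>R ((g p \<bullet> (0, 1)) * (h2 (fst p) * q (snd p))))
   = (LINT p|lebesgue. (\<Sum>b\<in>Basis. F b p)) - T2"
   unfolding T2_def set_lebesgue_integral_def
   by (intro Bochner_Integration.integral_diff Bochner_Integration.integrable_sum i I(1)[OF th2, unfolded set_integrable_def])
  also have "(LINT p|lebesgue. (\<Sum>b\<in>Basis. F b p)) = (\<Sum>b\<in>Basis. (LINT p|lebesgue. F b p))"
   by (rule Bochner_Integration.integral_sum[OF i])
  finally show ?thesis unfolding F_def set_lebesgue_integral_def .
 qed
 also have "... = S - T2" unfolding B ..
 \<comment> \<open>\<open>S\<close> is eliminated between the two identities; the division by
   \<open>r\<^sup>2\<close> requires \<open>xi \<noteq> 0\<close>.\<close>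
 also have "... = q 0 * U2 + (T0 + q 0 * U0) / r\<^sup>2"
  using A r by (simp add: field_simps)
 finally show ?thesis
  unfolding T0_def U0_def U2_def h0_def h2_def D_def e_def f_def q_def r_def a_def .
qed

end

end

section \<open>Superposition of plane waves\<close>

context
 fixes s \<rho> :: real and c :: "'a::euclidean_space => complex" and M :: real
 assumes s: "0 < s" "s < 1" and \<rho>: "\<rho> \<ge> 1"
  and c: "c \<in> borel_measurable borel" and cM: "!!xi. norm (c xi) \<le> M"
  and c0: "!!xi. \<not> (1 / \<rho> \<le> norm xi \<and> norm xi \<le> \<rho>) ==> c xi = 0"
begin

definition "annulus = {xi::'a. 1 / \<rho> \<le> norm xi \<and> norm xi \<le> \<rho>}"

lemma annulus_borel[measurable]: "annulus \<in> sets borel"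
 unfolding annulus_def by measurable

lemma annulus_integrable: "integrable lborel (%xi. C * indicat_real annulus xi)"
proof (intro integrable_mult_right integrable_real_indicator)
 have "emeasure lborel annulus < \<infinity>"
  by (rule emeasure_bounded_finite) (auto simp: annulus_def bounded_iff)
 thus "emeasure lborel annulus < \<infinity>" .
qed (use annulus_borel in simp)

lemma M_ge_0: "M \<ge> 0" using cM[of 0] norm_ge_zero order_trans by blast

lemma dwave_measurable_pair:
 "(%q. dwave s c (snd q) (fst q) v) \<in> borel_measurable (lborel \<Otimes>\<^sub>M lborel)"
 using wave_measurable(2)[OF s c cM, of v] by (simp add: split_beta')

lemma flux_bounds:
 assumes "0 < y" "y < 1"
 shows "\<bar>flux s (norm xi) y\<bar> \<le> (norm xi)\<^sup>2 / (2 - 2 * s)" "\<bar>profile s (norm xi) y\<bar> \<le> 1"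
proof -
 interpret P: neumann_profile "1 - 2 * s" "norm xi" "profile s (norm xi)" "flux s (norm xi)"
  by (rule neumann_profile_Bessel[OF s norm_ge_zero])
 show "\<bar>flux s (norm xi) y\<bar> \<le> (norm xi)\<^sup>2 / (2 - 2 * s)" "\<bar>profile s (norm xi) y\<bar> \<le> 1"
  using P.q_le[of y] P.th_le_1[of y] assms by simp_all
qed

lemma integrable_dwave:
 assumes y: "0 < snd p" "snd p < 1" and v: "v \<in> Basis"
 shows "integrable lborel (%xi. dwave s c xi p v)"
proof -
 note I = integrable_multiplier(2)[OF s c cM y v]
 have "integrable lborel (%xi. (gmul s v (snd p) xi * c xi) * exp (\<i> * of_real (fst p \<bullet> xi)))"
  by (rule Bochner_Integration.integrable_bound[OF integrable_norm[OF I]])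
   (use borel_measurable_integrable[OF I] in \<open>auto simp: norm_mult norm_exp_ii\<close>)
 thus ?thesis unfolding dwave_def[OF s c cM] by (rule integrable_Re)
qed

text \<open>Exchanging the integrals turns the superposed \<open>dwave\<close> into
  \<open>gextn\<close>. Pointwise the pairing of \<open>g\<close> with it is at most half the sum of
  the squares, and the localisation, with values in \<open>[0, 1]\<close>, does not increase the
  bound.\<close>

lemma superposed_energy_le:
 fixes g :: "'a \<times> real => 'a \<times> real" and z :: "'a => real"
 assumes gm[measurable]: "g \<in> borel_measurable borel" and zm[measurable]: "z \<in> borel_measurable borel"
  and z01: "!!x. 0 \<le> z x" "!!x. z x \<le> 1"
  and Gi: "integrable lborel (%p. indicat_real (cyl R) p * ((1 + snd p powr (1 - 2 * s)) * norm (g p)))"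
  and Eg: "integrable lborel (%p. indicat_real slab p * (snd p powr (1 - 2 * s) * (norm (g p))\<^sup>2))"
  and Ec: "integrable lborel (%p. indicat_real slab p * (snd p powr (1 - 2 * s) * (norm (gextn s c p))\<^sup>2))"
 defines "F \<equiv> %p xi. indicat_real (cyl R) p * (z (fst p) * (snd p powr (1 - 2 * s) * (\<Sum>v\<in>Basis. (g p \<bullet> v) * dwave s c xi p v)))"
 shows "integrable lborel (%xi. LINT p|lborel. F p xi)"
  "(LINT xi|lborel. (LINT p|lborel. F p xi)) \<le>
   ((LINT p|lborel. indicat_real slab p * (snd p powr (1 - 2 * s) * (norm (g p))\<^sup>2))
    + (LINT p|lborel. indicat_real slab p * (snd p powr (1 - 2 * s) * (norm (gextn s c p))\<^sup>2))) / 2"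
proof -
 define a where "a = 1 - 2 * s"
 define Q where "Q = \<rho>\<^sup>2 / (2 - 2 * s)"
 have Q: "Q \<ge> 0" using s by (simp add: Q_def)
 define C where "C = (real DIM('a) * \<rho> + Q) * M"
 have C: "C \<ge> 0" unfolding C_def using Q \<rho> M_ge_0 by simp
 \<comment> \<open>Horizontal components carry the factor \<open>y^a\<close>, the vertical one a
   bounded flux; \<open>1 + y^a\<close> dominates both. Compactness of the annulus bounds the
   frequency factors.\<close>
 have F: "integrable (lborel \<Otimes>\<^sub>M lborel) (%(p, xi). F p xi)"
 proof (rule lborel_pair.integrable_tensor_bound[OF Gi annulus_integrable[of C]])
  note [measurable] = dwave_measurable_pair
  have [measurable]: "(%p. g p \<bullet> v) \<in> borel_measurable borel" for v by measurable
  show "(%(p, xi). F p xi) \<in> borel_measurable (lborel \<Otimes>\<^sub>M lborel)"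
   unfolding F_def split_beta' by measurable
  fix p :: "'a \<times> real" and xi :: 'a
  show "norm (case (p, xi) of (p, xi) => F p xi) \<le> indicat_real (cyl R) p * ((1 + snd p powr (1 - 2 * s)) * norm (g p)) * (C * indicat_real annulus xi)"
  proof (cases "p \<in> cyl R \<and> xi \<in> annulus")
   case True
   hence y: "0 < snd p" "snd p < 1" by (auto simp: cyl_def)
   have xi: "norm xi \<le> \<rho>" using True by (simp add: annulus_def)
   have fl: "\<bar>flux s (norm xi) (snd p)\<bar> \<le> Q"
    using flux_bounds(1)[OF y, of xi] xi s unfolding Q_def
    by (elim order_trans) (intro divide_right_mono power_mono, auto)
   have pw: "\<bar>plane_wave k xi (fst p)\<bar> \<le> M" if "norm k \<le> M" for k using plane_wave_bound[of k xi "fst p"] that by linarith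
   have d1: "\<bar>snd p powr a * dwave s c xi p (b, 0)\<bar> \<le> (1 + snd p powr a) * (\<rho> * M)" if b: "b \<in> Basis" for b
   proof -
    have "\<bar>b \<bullet> xi\<bar> \<le> \<rho>" using Basis_le_norm[OF b, of xi] xi by (simp add: inner_commute)
    hence "\<bar>b \<bullet> xi\<bar> * \<bar>plane_wave (- \<i> * c xi) xi (fst p)\<bar> * (snd p powr a * \<bar>profile s (norm xi) (snd p)\<bar>) \<le> \<rho> * M * (snd p powr a * 1)"
     using flux_bounds(2)[OF y] pw[of "- \<i> * c xi"] cM[of xi] \<rho> M_ge_0 by (intro mult_mono) (auto simp: norm_mult)
    also have "... = snd p powr a * (\<rho> * M)" by simp
    also have "... \<le> (1 + snd p powr a) * (\<rho> * M)" using \<rho> M_ge_0 by (intro mult_right_mono) auto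
    finally show ?thesis unfolding a_def dwave_eq_plane_wave(1)[OF s c cM y(1)] by (simp add: abs_mult)
   qed
   have d2: "\<bar>snd p powr a * dwave s c xi p (0, 1)\<bar> \<le> (1 + snd p powr a) * (Q * M)"
   proof -
    have "\<bar>plane_wave (c xi) xi (fst p)\<bar> * \<bar>flux s (norm xi) (snd p)\<bar> \<le> M * Q"
     using fl pw[of "c xi"] cM[of xi] M_ge_0 Q by (intro mult_mono) auto
    also have "... = 1 * (Q * M)" by simp
    also have "... \<le> (1 + snd p powr a) * (Q * M)" using Q M_ge_0 by (intro mult_right_mono) auto
    finally show ?thesis unfolding a_def dwave_eq_plane_wave(2)[OF s c cM y(1)] by (simp add: abs_mult)
   qed
   have gb: "\<bar>g p \<bullet> v\<bar> \<le> norm (g p)" if "v \<in> Basis" for v using Basis_le_norm[OF that] .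
   have "snd p powr a * (\<Sum>v\<in>Basis. (g p \<bullet> v) * dwave s c xi p v)
    = (\<Sum>b\<in>Basis. (g p \<bullet> (b, 0)) * (snd p powr a * dwave s c xi p (b, 0))) + (g p \<bullet> (0, 1)) * (snd p powr a * dwave s c xi p (0, 1))"
    unfolding sum_Basis_prod distrib_left sum_distrib_left by (simp only: mult_ac)
   also have "\<bar>...\<bar> \<le> (\<Sum>b\<in>(Basis::'a set). norm (g p) * ((1 + snd p powr a) * (\<rho> * M))) + norm (g p) * ((1 + snd p powr a) * (Q * M))"
   proof (intro order_trans[OF abs_triangle_ineq] add_mono order_trans[OF sum_abs] sum_mono)
    fix b :: 'a assume b: "b \<in> Basis"
    hence "(b, 0::real) \<in> Basis" by (auto simp: Basis_prod_def)
    thus "\<bar>(g p \<bullet> (b, 0)) * (snd p powr a * dwave s c xi p (b, 0))\<bar> \<le> norm (g p) * ((1 + snd p powr a) * (\<rho> * M))"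
     unfolding abs_mult[of "g p \<bullet> (b, 0)"] using d1[OF b] by (intro mult_mono gb) auto
   next
    have "(0::'a, 1::real) \<in> Basis" by (auto simp: Basis_prod_def)
    thus "\<bar>(g p \<bullet> (0, 1)) * (snd p powr a * dwave s c xi p (0, 1))\<bar> \<le> norm (g p) * ((1 + snd p powr a) * (Q * M))"
     unfolding abs_mult[of "g p \<bullet> (0, 1)"] using d2 by (intro mult_mono gb) auto
   qed
   also have "... = ((1 + snd p powr a) * norm (g p)) * C" by (simp add: C_def algebra_simps)
   finally have 1: "\<bar>snd p powr a * (\<Sum>v\<in>Basis. (g p \<bullet> v) * dwave s c xi p v)\<bar> \<le> ((1 + snd p powr a) * norm (g p)) * C" .
   have "\<bar>z (fst p)\<bar> * \<bar>snd p powr a * (\<Sum>v\<in>Basis. (g p \<bullet> v) * dwave s c xi p v)\<bar> \<le> 1 * (((1 + snd p powr a) * norm (g p)) * C)"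
    using z01[of "fst p"] 1 by (intro mult_mono) auto
   thus ?thesis using True by (simp add: F_def a_def abs_mult)
  next
   case False
   hence "p \<notin> cyl R \<or> xi \<notin> annulus" by simp
   hence "F p xi = 0"
   proof
    assume "p \<notin> cyl R" thus ?thesis by (simp add: F_def)
   qed (use c0[of xi] in \<open>auto simp: F_def annulus_def dwave_def[OF s c cM]\<close>)
   thus ?thesis using C by simp
  qed
 qed
 show "integrable lborel (%xi. LINT p|lborel. F p xi)" by (rule lborel_pair.integrable_snd[OF F])
 have i1: "integrable lborel (%p. LINT xi|lborel. F p xi)" by (rule lborel_pair.integrable_fst[OF F])
 have "(LINT xi|lborel. (LINT p|lborel. F p xi)) = (LINT p|lborel. (LINT xi|lborel. F p xi))"
  by (rule lborel_pair.Fubini_integral[OF F])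
 also have "... \<le> (LINT p|lborel. (indicat_real slab p * (snd p powr (1 - 2 * s) * (norm (g p))\<^sup>2)
   + indicat_real slab p * (snd p powr (1 - 2 * s) * (norm (gextn s c p))\<^sup>2)) / 2)"
 proof (rule integral_mono[OF i1])
  show "integrable lborel (%p. (indicat_real slab p * (snd p powr (1 - 2 * s) * (norm (g p))\<^sup>2)
   + indicat_real slab p * (snd p powr (1 - 2 * s) * (norm (gextn s c p))\<^sup>2)) / 2)"
   by (intro integrable_divide Bochner_Integration.integrable_add Eg Ec)
  fix p :: "'a \<times> real"
  show "(LINT xi|lborel. F p xi) \<le> (indicat_real slab p * (snd p powr (1 - 2 * s) * (norm (g p))\<^sup>2)
   + indicat_real slab p * (snd p powr (1 - 2 * s) * (norm (gextn s c p))\<^sup>2)) / 2"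
  proof (cases "p \<in> cyl R")
   case True
   hence y: "0 < snd p" "snd p < 1" "p \<in> slab" using cyl_slab by (auto simp: cyl_def)
   have "(LINT xi|lborel. F p xi) = z (fst p) * (snd p powr a * (\<Sum>v\<in>Basis. (g p \<bullet> v) * (gextn s c p \<bullet> v)))"
    unfolding F_def a_def[symmetric] using True
    by (simp add: extn_eq_wave(2)[OF s c cM y(1,2)] Bochner_Integration.integral_sum integrable_dwave[OF y(1,2)])
   also have "... = z (fst p) * (snd p powr a * (g p \<bullet> gextn s c p))" by (simp only: euclidean_inner[symmetric])
   also have "... \<le> \<bar>z (fst p)\<bar> * (snd p powr a * \<bar>g p \<bullet> gextn s c p\<bar>)"
    using z01[of "fst p"] by (auto intro!: mult_left_mono)
   also have "... \<le> 1 * (snd p powr a * (((norm (g p))\<^sup>2 + (norm (gextn s c p))\<^sup>2) / 2))"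
   proof (intro mult_mono)
    have "\<bar>g p \<bullet> gextn s c p\<bar> \<le> norm (g p) * norm (gextn s c p)" by (rule Cauchy_Schwarz_ineq2)
    also have "... \<le> ((norm (g p))\<^sup>2 + (norm (gextn s c p))\<^sup>2) / 2"
     using sum_squares_bound[of "norm (g p)" "norm (gextn s c p)"] by simp
    finally show "\<bar>g p \<bullet> gextn s c p\<bar> \<le> ((norm (g p))\<^sup>2 + (norm (gextn s c p))\<^sup>2) / 2" .
   qed (use z01[of "fst p"] in auto)
   finally show ?thesis using y(3) by (simp add: a_def algebra_simps add_divide_distrib)
  next
   case False thus ?thesis by (simp add: F_def)
  qed
 qed
 also have "... = ((LINT p|lborel. indicat_real slab p * (snd p powr (1 - 2 * s) * (norm (g p))\<^sup>2))
    + (LINT p|lborel. indicat_real slab p * (snd p powr (1 - 2 * s) * (norm (gextn s c p))\<^sup>2))) / 2"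
  using Eg Ec by simp
 finally show "(LINT xi|lborel. (LINT p|lborel. F p xi)) \<le>
   ((LINT p|lborel. indicat_real slab p * (snd p powr (1 - 2 * s) * (norm (g p))\<^sup>2))
    + (LINT p|lborel. indicat_real slab p * (snd p powr (1 - 2 * s) * (norm (gextn s c p))\<^sup>2))) / 2" .
qed

section \<open>The remainders of the localisation\<close>

text \<open>The superposition over the frequencies of the error that arises when the localisation is
  differentiated in direction \<open>b\<close>. It is square integrable over the slab with weight
  \<open>y^(-a)\<close>, which no nonzero single wave could be.\<close>

definition vflux :: "'a => 'a \<times> real => real" where
 "vflux b p = Re (ift (%xi. of_real ((b \<bullet> xi) * flux s (norm xi) (snd p) / (norm xi)\<^sup>2) * (- \<i> * c xi)) (fst p))"

text \<open>The flux is at most a multiple of the square of \<open>norm xi\<close>, which offsets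
  the division by this square.\<close>

lemma vflux_symbol:
 assumes b: "b \<in> Basis" and y: "0 < y" "y < 1"
 shows "norm (of_real ((b \<bullet> xi) * flux s (norm xi) y / (norm xi)\<^sup>2) * (- \<i> * c xi)) \<le> (\<rho> * M / (2 - 2 * s)) * indicat_real annulus xi"
proof (cases "xi \<in> annulus")
 case True
 have n: "norm xi > 0" "norm xi \<le> \<rho>"
  using True \<rho> by (auto simp: annulus_def intro: less_le_trans[of 0 "1 / \<rho>"])
 have "\<bar>flux s (norm xi) y\<bar> / (norm xi)\<^sup>2 \<le> 1 / (2 - 2 * s)"
  using flux_bounds(1)[OF y, of xi] n s by (simp add: field_simps)
 moreover have "\<bar>b \<bullet> xi\<bar> \<le> \<rho>" using Basis_le_norm[OF b, of xi] n by (simp add: inner_commute)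
 ultimately have "\<bar>b \<bullet> xi\<bar> * (\<bar>flux s (norm xi) y\<bar> / (norm xi)\<^sup>2) * norm (c xi) \<le> \<rho> * (1 / (2 - 2 * s)) * M"
  using cM[of xi] \<rho> s by (intro mult_mono) auto
 thus ?thesis using True by (simp add: norm_mult norm_divide abs_mult norm_power)
next
 case False thus ?thesis using c0[of xi] by (simp add: annulus_def)
qed

lemma vflux_symbol_measurable:
 "(%p. of_real ((b \<bullet> snd p) * flux s (norm (snd p)) (fst p) / (norm (snd p))\<^sup>2) * (- \<i> * c (snd p))) \<in> borel_measurable (borel \<Otimes>\<^sub>M borel)"
proof -
 note [measurable] = profile_measurable[OF s] c
 show ?thesis by measurable
qed

lemma vflux_symbol_integrable:
 assumes b: "b \<in> Basis" and y: "0 < y" "y < 1"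
 shows "integrable lborel (%xi. of_real ((b \<bullet> xi) * flux s (norm xi) y / (norm xi)\<^sup>2) * (- \<i> * c xi))"
proof (rule Bochner_Integration.integrable_bound[OF annulus_integrable[of "\<rho> * M / (2 - 2 * s)"]])
 note [measurable] = profile_measurable[OF s] c
 show "(%xi. of_real ((b \<bullet> xi) * flux s (norm xi) y / (norm xi)\<^sup>2) * (- \<i> * c xi)) \<in> borel_measurable lborel"
  by measurable
 show "AE xi in lborel. norm (of_real ((b \<bullet> xi) * flux s (norm xi) y / (norm xi)\<^sup>2) * (- \<i> * c xi)) \<le> norm (\<rho> * M / (2 - 2 * s) * indicat_real annulus xi)"
  by (intro AE_I2 order_trans[OF vflux_symbol[OF assms]]) (simp only: real_norm_def abs_ge_self)
qed

lemma vflux_measurable[measurable]: "vflux b \<in> borel_measurable borel"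
 unfolding vflux_def[abs_def]
 using measurable_compose[OF ift_param_measurable[where F="%y xi. of_real ((b \<bullet> xi) * flux s (norm xi) y / (norm xi)\<^sup>2) * (- \<i> * c xi)", OF vflux_symbol_measurable[of b]], of Re borel]
 by simp

text \<open>Plancherel with the dual weight \<open>y^(-a)\<close>, the one that pairs with the
  weight \<open>y^a\<close> of \<open>g\<close>; its integrability over \<open>(0, 1)\<close> rests
  on \<open>a < 1\<close>.\<close>

lemma vflux_energy:
 assumes b: "b \<in> Basis"
 shows "integrable lborel (%p. indicat_real slab p * (snd p powr (- (1 - 2 * s)) * (vflux b p)\<^sup>2))"
proof (rule integrableI_nonneg)
 have [measurable]: "slab \<in> sets (borel :: ('a \<times> real) measure)" using open_slab by (rule borel_open)
 show "(%p. indicat_real slab p * (snd p powr (- (1 - 2 * s)) * (vflux b p)\<^sup>2)) \<in> borel_measurable lborel" by measurable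
 define K where "K = \<rho> * M / (2 - 2 * s)"
 let ?m = "%y xi. of_real ((b \<bullet> xi) * flux s (norm xi) y / (norm xi)\<^sup>2) * (- \<i> * c xi)"
 have "(\<integral>\<^sup>+p. ennreal (indicat_real slab p * (snd p powr (- (1 - 2 * s)) * (vflux b p)\<^sup>2)) \<partial>lborel)
  = (\<integral>\<^sup>+p\<in>slab. ennreal (snd p powr (- (1 - 2 * s)) * (Re (ift (?m (snd p)) (fst p)))\<^sup>2) \<partial>lborel)"
  unfolding vflux_def by (intro nn_integral_cong) (auto simp: indicator_def)
 also have "... \<le> ennreal ((2 * pi) ^ DIM('a)) * (\<integral>\<^sup>+xi. (\<integral>\<^sup>+y\<in>{0<..<1}. ennreal (y powr (- (1 - 2 * s)) * (norm (?m y xi))\<^sup>2) \<partial>lborel) \<partial>lborel)"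
  by (rule slab_Plancherel[where g="%y. y powr (- (1 - 2 * s))", OF vflux_symbol_measurable _ _ vflux_symbol_integrable[OF b]]) auto
 also have "... \<le> ennreal ((2 * pi) ^ DIM('a)) * (\<integral>\<^sup>+xi. ennreal (K\<^sup>2 * (1 / (1 + - (1 - 2 * s))) * indicat_real annulus xi) \<partial>lborel)"
 proof (rule mult_left_mono[OF nn_integral_mono])
  fix xi :: 'a
  have "(\<integral>\<^sup>+y\<in>{0<..<1}. ennreal (y powr (- (1 - 2 * s)) * (norm (?m y xi))\<^sup>2) \<partial>lborel)
   \<le> (\<integral>\<^sup>+y. ennreal ((K * indicat_real annulus xi)\<^sup>2) * (ennreal (y powr (- (1 - 2 * s))) * indicator {0<..<1} y) \<partial>lborel)"
  proof (rule nn_integral_mono)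
   fix y :: real
   show "ennreal (y powr (- (1 - 2 * s)) * (norm (?m y xi))\<^sup>2) * indicator {0<..<1} y \<le> ennreal ((K * indicat_real annulus xi)\<^sup>2) * (ennreal (y powr (- (1 - 2 * s))) * indicator {0<..<1} y)"
   proof (cases "y \<in> {0<..<1}")
    case True
    have "(norm (?m y xi))\<^sup>2 \<le> (K * indicat_real annulus xi)\<^sup>2"
     unfolding K_def using True by (intro power_mono vflux_symbol[OF b]) auto
    hence "y powr (- (1 - 2 * s)) * (norm (?m y xi))\<^sup>2 \<le> (K * indicat_real annulus xi)\<^sup>2 * y powr (- (1 - 2 * s))"
     by (subst mult.commute) (intro mult_right_mono, auto)
    from ennreal_leI[OF this] show ?thesis using True by (simp add: ennreal_mult)
   qed simp
  qed
  also have "... = ennreal ((K * indicat_real annulus xi)\<^sup>2) * (\<integral>\<^sup>+y\<in>{0<..<1}. ennreal (y powr (- (1 - 2 * s))) \<partial>lborel)"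
   by (rule nn_integral_cmult) measurable
  also have "(\<integral>\<^sup>+y\<in>{0<..<1}. ennreal (y powr (- (1 - 2 * s))) \<partial>lborel) = ennreal (1 / (1 + - (1 - 2 * s)))"
   by (rule nn_integral_powr_unit) (use s in auto)
  also have "ennreal ((K * indicat_real annulus xi)\<^sup>2) * ennreal (1 / (1 + - (1 - 2 * s))) = ennreal (K\<^sup>2 * (1 / (1 + - (1 - 2 * s))) * indicat_real annulus xi)"
   using s by (subst ennreal_mult[symmetric]) (auto simp: indicator_def power_mult_distrib)
  finally show "(\<integral>\<^sup>+y\<in>{0<..<1}. ennreal (y powr (- (1 - 2 * s)) * (norm (?m y xi))\<^sup>2) \<partial>lborel) \<le> ennreal (K\<^sup>2 * (1 / (1 + - (1 - 2 * s))) * indicat_real annulus xi)" .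
 qed simp
 also have "... < \<infinity>"
 proof -
  define K' where "K' = K\<^sup>2 * (1 / (1 + - (1 - 2 * s)))"
  have "K' \<ge> 0" using s by (simp add: K'_def)
  hence n: "norm (K' * indicat_real annulus xi) = K' * indicat_real annulus xi" for xi by simp
  have "(\<integral>\<^sup>+xi. ennreal (norm (K' * indicat_real annulus xi)) \<partial>lborel) < \<infinity>"
   using annulus_integrable[of K'] unfolding integrable_iff_bounded by blast
  hence "(\<integral>\<^sup>+xi. ennreal (K' * indicat_real annulus xi) \<partial>lborel) < \<infinity>" unfolding n .
  thus ?thesis unfolding K'_def[symmetric] by (simp add: ennreal_mult_less_top)
 qed
 finally show "(\<integral>\<^sup>+p. ennreal (indicat_real slab p * (snd p powr (- (1 - 2 * s)) * (vflux b p)\<^sup>2)) \<partial>lborel) < \<infinity>" .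
qed (auto intro: AE_I2)

lemma plane_wave_vflux_symbol:
 "(b \<bullet> xi) * plane_wave (- \<i> * c xi) xi (fst p) * flux s (norm xi) (snd p) / (norm xi)\<^sup>2 =
  Re (of_real ((b \<bullet> xi) * flux s (norm xi) (snd p) / (norm xi)\<^sup>2) * (- \<i> * c xi) * exp (\<i> * of_real (fst p \<bullet> xi)))"
proof -
 have T: "Re (of_real t * (- \<i> * c xi) * exp (\<i> * of_real (fst p \<bullet> xi))) = t * plane_wave (- \<i> * c xi) xi (fst p)" for t
  unfolding plane_wave_eq mult.assoc by (simp add: algebra_simps)
 show ?thesis unfolding T by simp
qed

text \<open>\<open>B\<close> bounds the derivatives of the localisation and will tend to 0 as the
  radius grows, whereas the integral on the right extends over the whole slab and does not depend on
  \<open>R\<close>. It is obtained by superposing before estimating.\<close>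

lemma superposed_flux_le:
 fixes g :: "'a \<times> real => 'a \<times> real" and \<eta> :: "'a => 'a => real"
 assumes gm[measurable]: "g \<in> borel_measurable borel" and \<eta>m: "!!b. b \<in> Basis ==> \<eta> b \<in> borel_measurable borel"
  and \<eta>: "!!b x. b \<in> Basis ==> \<bar>\<eta> b x\<bar> \<le> B" and B: "B \<ge> 0"
  and Gi: "integrable lborel (%p. indicat_real (cyl R) p * ((1 + snd p powr (1 - 2 * s)) * norm (g p)))"
  and Eg: "integrable lborel (%p. indicat_real slab p * (snd p powr (1 - 2 * s) * (norm (g p))\<^sup>2))"
 defines "F \<equiv> %p xi. indicat_real (cyl R) p * ((g p \<bullet> (0, 1)) * ((\<Sum>b\<in>Basis. (b \<bullet> xi) * \<eta> b (fst p))
    * plane_wave (- \<i> * c xi) xi (fst p) * flux s (norm xi) (snd p))) / (norm xi)\<^sup>2"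
 shows "integrable lborel (%xi. LINT p|lborel. F p xi)"
  "\<bar>LINT xi|lborel. (LINT p|lborel. F p xi)\<bar> \<le> B *
   (LINT p|lborel. (\<Sum>b\<in>Basis. indicat_real slab p * (snd p powr (1 - 2 * s) * (norm (g p))\<^sup>2)
    + indicat_real slab p * (snd p powr (- (1 - 2 * s)) * (vflux b p)\<^sup>2)))"
proof -
 define a where "a = 1 - 2 * s"
 define m where "m b p xi = of_real ((b \<bullet> xi) * flux s (norm xi) (snd p) / (norm xi)\<^sup>2) * (- \<i> * c xi)" for b xi and p :: "'a \<times> real"
 define K where "K = \<rho> * M / (2 - 2 * s)"
 have K: "K \<ge> 0" unfolding K_def using \<rho> M_ge_0 s by simp
 have Feq: "F p xi = indicat_real (cyl R) p * ((g p \<bullet> (0, 1)) * (\<Sum>b\<in>Basis. \<eta> b (fst p) * Re (m b p xi * exp (\<i> * of_real (fst p \<bullet> xi)))))" for p xi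
  unfolding F_def m_def plane_wave_vflux_symbol[symmetric]
  by (simp add: sum_distrib_left sum_distrib_right sum_divide_distrib mult_ac)
 have b1: "(0::'a, 1::real) \<in> Basis" by (auto simp: Basis_prod_def)
 have g1: "\<bar>g p \<bullet> (0, 1)\<bar> \<le> norm (g p)" for p using Basis_le_norm[OF b1] .
 have mb: "\<bar>Re (m b p xi * exp (\<i> * of_real (fst p \<bullet> xi)))\<bar> \<le> K * indicat_real annulus xi" if "b \<in> Basis" "p \<in> cyl R" for b p xi
 proof -
  have y: "0 < snd p" "snd p < 1" using that by (auto simp: cyl_def)
  have "\<bar>Re (m b p xi * exp (\<i> * of_real (fst p \<bullet> xi)))\<bar> \<le> norm (m b p xi)"
   using abs_Re_le_cmod[of "m b p xi * exp (\<i> * of_real (fst p \<bullet> xi))"] by (simp add: norm_mult norm_exp_ii)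
  also have "... \<le> K * indicat_real annulus xi" unfolding m_def K_def by (rule vflux_symbol[OF that(1) y])
  finally show ?thesis .
 qed
 define C where "C = real DIM('a) * (B * K)"
 have F: "integrable (lborel \<Otimes>\<^sub>M lborel) (%(p, xi). F p xi)"
 proof (rule lborel_pair.integrable_tensor_bound[OF Gi annulus_integrable[of C]])
  note [measurable] = profile_measurable[OF s] c
  have "(%q::('a \<times> real) \<times> 'a. \<Sum>b\<in>Basis. (b \<bullet> snd q) * \<eta> b (fst (fst q))) \<in> borel_measurable (lborel \<Otimes>\<^sub>M lborel)"
  proof (rule borel_measurable_sum)
   fix b :: 'a assume "b \<in> Basis"
   note [measurable] = \<eta>m[OF this]
   show "(%q::('a \<times> real) \<times> 'a. (b \<bullet> snd q) * \<eta> b (fst (fst q))) \<in> borel_measurable (lborel \<Otimes>\<^sub>M lborel)" by measurable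
  qed
  note [measurable] = this
  show "(%(p, xi). F p xi) \<in> borel_measurable (lborel \<Otimes>\<^sub>M lborel)"
   unfolding F_def split_beta' plane_wave_def by measurable
  fix p :: "'a \<times> real" and xi :: 'a
  show "norm (case (p, xi) of (p, xi) => F p xi) \<le> indicat_real (cyl R) p * ((1 + snd p powr (1 - 2 * s)) * norm (g p)) * (C * indicat_real annulus xi)"
  proof (cases "p \<in> cyl R")
   case True
   have "\<bar>\<Sum>b\<in>Basis. \<eta> b (fst p) * Re (m b p xi * exp (\<i> * of_real (fst p \<bullet> xi)))\<bar> \<le> (\<Sum>b\<in>(Basis::'a set). B * (K * indicat_real annulus xi))"
    by (intro order_trans[OF sum_abs] sum_mono) (use \<eta> mb[OF _ True] B in \<open>auto simp: abs_mult intro!: mult_mono\<close>)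
   also have "... = C * indicat_real annulus xi" by (simp add: C_def)
   finally have "\<bar>F p xi\<bar> \<le> norm (g p) * (C * indicat_real annulus xi)"
    using True unfolding Feq by (simp add: abs_mult) (intro mult_mono g1, auto)
   also have "... \<le> ((1 + snd p powr (1 - 2 * s)) * norm (g p)) * (C * indicat_real annulus xi)"
    using B K by (intro mult_right_mono) (auto simp: C_def distrib_right)
   finally show ?thesis using True by simp
  qed (simp add: F_def)
 qed
 show "integrable lborel (%xi. LINT p|lborel. F p xi)" by (rule lborel_pair.integrable_snd[OF F])
 have i1: "integrable lborel (%p. LINT xi|lborel. F p xi)" by (rule lborel_pair.integrable_fst[OF F])
 let ?H = "%p. \<Sum>b\<in>Basis. indicat_real slab p * (snd p powr (1 - 2 * s) * (norm (g p))\<^sup>2)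
    + indicat_real slab p * (snd p powr (- (1 - 2 * s)) * (vflux b p)\<^sup>2)"
 have Hi: "integrable lborel (%p. B * ?H p)"
  by (intro integrable_mult_right Bochner_Integration.integrable_sum Bochner_Integration.integrable_add Eg vflux_energy)
 have "\<bar>LINT xi|lborel. (LINT p|lborel. F p xi)\<bar> = norm (LINT p|lborel. (LINT xi|lborel. F p xi))"
  by (subst lborel_pair.Fubini_integral[OF F]) simp
 also have "... \<le> (LINT p|lborel. B * ?H p)"
 proof (rule Bochner_Integration.integral_norm_bound_integral[OF i1 Hi])
  fix p :: "'a \<times> real"
  show "norm (LINT xi|lborel. F p xi) \<le> B * ?H p"
  proof (cases "p \<in> cyl R")
   case True
   hence y: "0 < snd p" "snd p < 1" "p \<in> slab" using cyl_slab by (auto simp: cyl_def)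
   have mi: "integrable lborel (%xi. m b p xi * exp (\<i> * of_real (fst p \<bullet> xi)))" if b: "b \<in> Basis" for b
   proof -
    have I: "integrable lborel (m b p)" unfolding m_def by (rule vflux_symbol_integrable[OF b y(1,2)])
    show ?thesis
     by (rule Bochner_Integration.integrable_bound[OF integrable_norm[OF I]])
      (use borel_measurable_integrable[OF I] in \<open>auto simp: norm_mult norm_exp_ii\<close>)
   qed
   have vf: "(LINT xi|lborel. Re (m b p xi * exp (\<i> * of_real (fst p \<bullet> xi)))) = vflux b p" if b: "b \<in> Basis" for b
    unfolding vflux_def ift_def using integral_Re[OF mi[OF b]] by (simp add: m_def)
   have "(LINT xi|lborel. F p xi) = (g p \<bullet> (0, 1)) * (LINT xi|lborel. (\<Sum>b\<in>Basis. \<eta> b (fst p) * Re (m b p xi * exp (\<i> * of_real (fst p \<bullet> xi)))))"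
    unfolding Feq using True by simp
   also have "(LINT xi|lborel. (\<Sum>b\<in>Basis. \<eta> b (fst p) * Re (m b p xi * exp (\<i> * of_real (fst p \<bullet> xi)))))
    = (\<Sum>b\<in>Basis. LINT xi|lborel. \<eta> b (fst p) * Re (m b p xi * exp (\<i> * of_real (fst p \<bullet> xi))))"
    by (rule Bochner_Integration.integral_sum) (intro integrable_mult_right integrable_Re mi)
   also have "... = (\<Sum>b\<in>Basis. \<eta> b (fst p) * vflux b p)"
    by (intro sum.cong refl) (simp only: integral_mult_right_zero vf)
   finally have e: "(LINT xi|lborel. F p xi) = (\<Sum>b\<in>Basis. (g p \<bullet> (0, 1)) * (\<eta> b (fst p) * vflux b p))"
    by (simp only: sum_distrib_left)
   have "\<bar>\<Sum>b\<in>Basis. (g p \<bullet> (0, 1)) * (\<eta> b (fst p) * vflux b p)\<bar>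
    \<le> (\<Sum>b\<in>Basis. B * (snd p powr a * (norm (g p))\<^sup>2 + snd p powr (- a) * (vflux b p)\<^sup>2))"
   proof (intro order_trans[OF sum_abs] sum_mono)
    fix b :: 'a assume b: "b \<in> Basis"
    define A where "A = snd p powr a"
    have A: "A > 0" "snd p powr (- a) = 1 / A" using y by (auto simp: A_def powr_minus_divide)
    define X where "X = norm (g p)" define Y where "Y = \<bar>vflux b p\<bar>"
    have "0 \<le> (A * X - Y)\<^sup>2 / A" using A by simp
    also have "... = A * X\<^sup>2 - 2 * (X * Y) + 1 / A * Y\<^sup>2" using A(1) by (simp add: power2_eq_square field_simps)
    finally have 1: "2 * (X * Y) \<le> A * X\<^sup>2 + 1 / A * Y\<^sup>2" by simp
    have "X * Y \<ge> 0" by (simp add: X_def Y_def)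
    hence 2: "X * Y \<le> A * X\<^sup>2 + 1 / A * Y\<^sup>2" using 1 by linarith
    have "\<bar>(g p \<bullet> (0, 1)) * (\<eta> b (fst p) * vflux b p)\<bar> \<le> X * (B * Y)"
     unfolding abs_mult X_def Y_def using g1[of p] \<eta>[OF b] B by (intro mult_mono) auto
    also have "... = B * (X * Y)" by simp
    also have "... \<le> B * (A * X\<^sup>2 + 1 / A * Y\<^sup>2)" using 2 B by (intro mult_left_mono)
    finally show "\<bar>(g p \<bullet> (0, 1)) * (\<eta> b (fst p) * vflux b p)\<bar> \<le> B * (snd p powr a * (norm (g p))\<^sup>2 + snd p powr (- a) * (vflux b p)\<^sup>2)"
     unfolding A(2) A_def[symmetric] X_def Y_def by simp
   qed
   thus ?thesis unfolding e using y(3) by (simp add: a_def sum_distrib_left)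
  next
   case False
   have "?H p \<ge> 0" by (intro sum_nonneg add_nonneg_nonneg mult_nonneg_nonneg) auto
   thus ?thesis using False B by (simp add: F_def)
  qed
 qed
 also have "... = B * (LINT p|lborel. ?H p)" by simp
 finally show "\<bar>LINT xi|lborel. (LINT p|lborel. F p xi)\<bar> \<le> B * (LINT p|lborel. ?H p)" .
qed

lemma abs_integral_le:
 fixes f h :: "'b => real"
 assumes h: "integrable N h" and le: "!!x. \<bar>f x\<bar> \<le> h x"
 shows "\<bar>LINT x|N. f x\<bar> \<le> (LINT x|N. h x)"
proof (cases "integrable N f")
 case True
 have "\<bar>LINT x|N. f x\<bar> \<le> (LINT x|N. \<bar>f x\<bar>)" by (rule integral_abs_bound)
 also have "... \<le> (LINT x|N. h x)" by (intro integral_mono integrable_abs True h le)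
 finally show ?thesis .
next
 case False
 have "h x \<ge> 0" for x using le[of x] by linarith
 thus ?thesis using False by (simp add: not_integrable_integral_eq)
qed

text \<open>Here an estimate for each frequency suffices, because \<open>u\<close> is integrable
  over the whole space.\<close>

lemma source_remainder_le:
 fixes u :: "'a => real" and \<eta> :: "'a => 'a => real"
 assumes u: "integrable lborel u" and \<eta>: "!!b x. b \<in> Basis ==> \<bar>\<eta> b x\<bar> \<le> B" and B: "B \<ge> 0"
 shows "\<bar>flux s (norm xi) 0 * (LINT x|lborel. u x * ((\<Sum>b\<in>Basis. (b \<bullet> xi) * \<eta> b x) * plane_wave (- \<i> * c xi) xi x)) / (norm xi)\<^sup>2\<bar>
  \<le> B * (1 / (2 - 2 * s) * (real DIM('a) * \<rho> * M * (LINT x|lborel. \<bar>u x\<bar>)) * indicat_real annulus xi)"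
proof (cases "xi \<in> annulus")
 case True
 have n: "norm xi > 0" "norm xi \<le> \<rho>"
  using True \<rho> by (auto simp: annulus_def intro: less_le_trans[of 0 "1 / \<rho>"])
 define I where "I = (LINT x|lborel. u x * ((\<Sum>b\<in>Basis. (b \<bullet> xi) * \<eta> b x) * plane_wave (- \<i> * c xi) xi x))"
 have "\<bar>I\<bar> \<le> (LINT x|lborel. \<bar>u x\<bar> * (real DIM('a) * (\<rho> * B) * M))"
  unfolding I_def
 proof (rule abs_integral_le)
  show "integrable lborel (%x. \<bar>u x\<bar> * (real DIM('a) * (\<rho> * B) * M))"
   using u by (intro integrable_mult_left integrable_abs)
  fix x
  have "\<bar>\<Sum>b\<in>Basis. (b \<bullet> xi) * \<eta> b x\<bar> \<le> (\<Sum>b\<in>(Basis::'a set). \<rho> * B)"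
  proof (intro order_trans[OF sum_abs] sum_mono)
   fix b :: 'a assume b: "b \<in> Basis"
   have "\<bar>b \<bullet> xi\<bar> \<le> \<rho>" using Basis_le_norm[OF b, of xi] n by (simp add: inner_commute)
   thus "\<bar>(b \<bullet> xi) * \<eta> b x\<bar> \<le> \<rho> * B" unfolding abs_mult using \<eta>[OF b] \<rho> by (intro mult_mono) auto
  qed
  hence 1: "\<bar>\<Sum>b\<in>Basis. (b \<bullet> xi) * \<eta> b x\<bar> \<le> real DIM('a) * (\<rho> * B)" by simp
  have 2: "\<bar>plane_wave (- \<i> * c xi) xi x\<bar> \<le> M"
   using plane_wave_bound[of "- \<i> * c xi" xi x] cM[of xi] by (simp add: norm_mult)
  show "\<bar>u x * ((\<Sum>b\<in>Basis. (b \<bullet> xi) * \<eta> b x) * plane_wave (- \<i> * c xi) xi x)\<bar> \<le> \<bar>u x\<bar> * (real DIM('a) * (\<rho> * B) * M)"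
   unfolding abs_mult using 1 2 B \<rho> by (intro mult_left_mono mult_mono) auto
 qed
 hence I: "\<bar>I\<bar> \<le> B * (real DIM('a) * \<rho> * M * (LINT x|lborel. \<bar>u x\<bar>))" by (simp add: mult_ac)
 have f: "\<bar>flux s (norm xi) 0\<bar> / (norm xi)\<^sup>2 \<le> 1 / (2 - 2 * s)"
  using flux_0_bounds[OF s norm_ge_zero[of xi]] n s by (simp add: field_simps)
 have "\<bar>flux s (norm xi) 0 * I / (norm xi)\<^sup>2\<bar> = (\<bar>flux s (norm xi) 0\<bar> / (norm xi)\<^sup>2) * \<bar>I\<bar>" by (simp add: abs_mult)
 also have "... \<le> 1 / (2 - 2 * s) * (B * (real DIM('a) * \<rho> * M * (LINT x|lborel. \<bar>u x\<bar>)))"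
  using f I s by (intro mult_mono) auto
 finally show ?thesis using True unfolding I_def by (simp add: mult_ac)
next
 case False
 thus ?thesis using c0[of xi] by (simp add: annulus_def plane_wave_def)
qed

text \<open>Dominated convergence in \<open>x\<close> with \<open>\<bar>u x\<bar> * M\<close>, then
  in \<open>xi\<close> on the annulus. In the limit the integral of \<open>u\<close> against the
  complex wave is the conjugate of \<open>fourier u\<close>.\<close>

lemma source_tendsto:
 fixes u :: "'a => real" and z :: "nat => 'a => real"
 assumes u: "integrable lborel u" and zm[measurable]: "!!k. z k \<in> borel_measurable borel"
  and zb: "!!k x. \<bar>z k x\<bar> \<le> 1" and zl: "!!x. (%k. z k x) \<longlonglongrightarrow> l"
 defines "X \<equiv> %k xi. flux s (norm xi) 0 * (LINT x|lborel. u x * (z k x * plane_wave (c xi) xi x))"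
 shows "integrable lborel (X k)"
  "(%k. LINT xi|lborel. X k xi) \<longlonglongrightarrow> l * (LINT xi|lborel. flux s (norm xi) 0 * Re (c xi * cnj (fourier u xi)))"
proof -
 have um[measurable]: "u \<in> borel_measurable borel" using borel_measurable_integrable[OF u] by simp
 note [measurable] = profile_measurable[OF s] c flux_0_measurable[OF s] fourier_measurable[OF u]
 have pm: "(%(xi, x). u x * (z k x * plane_wave (c xi) xi x)) \<in> borel_measurable (lborel \<Otimes>\<^sub>M lborel)" for k
  unfolding plane_wave_def split_beta' by measurable
 have Xm[measurable]: "X k \<in> borel_measurable borel" for k
 proof -
  have "(%xi. LINT x|lborel. u x * (z k x * plane_wave (c xi) xi x)) \<in> borel_measurable lborel"
   by (rule lborel.borel_measurable_lebesgue_integral[OF pm])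
  hence [measurable]: "(%xi. LINT x|lborel. u x * (z k x * plane_wave (c xi) xi x)) \<in> borel_measurable borel" by simp
  show ?thesis unfolding X_def by measurable
 qed
 define L where "L = (LINT x|lborel. \<bar>u x\<bar>)"
 define K where "K = \<rho>\<^sup>2 / (2 - 2 * s) * (L * M)"
 have zpb: "\<bar>z k x * plane_wave (c xi) xi x\<bar> \<le> M" for k x xi
 proof -
  have "\<bar>z k x\<bar> * \<bar>plane_wave (c xi) xi x\<bar> \<le> 1 * M"
   using zb[of k x] plane_wave_bound[of "c xi" xi x] cM[of xi] by (intro mult_mono) auto
  thus ?thesis by (simp add: abs_mult)
 qed
 have uM: "integrable lborel (%x. \<bar>u x\<bar> * M)" using u by (intro integrable_mult_left integrable_abs)
 have ub: "\<bar>u x * (z k x * plane_wave (c xi) xi x)\<bar> \<le> \<bar>u x\<bar> * M" for k x xi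
  unfolding abs_mult[of "u x"] by (rule mult_left_mono[OF zpb]) simp
 have Xb: "\<bar>X k xi\<bar> \<le> K * indicat_real annulus xi" for k xi
 proof (cases "xi \<in> annulus")
  case True
  have "\<bar>LINT x|lborel. u x * (z k x * plane_wave (c xi) xi x)\<bar> \<le> L * M"
   using abs_integral_le[OF uM ub] by (simp add: L_def)
  moreover have "\<bar>flux s (norm xi) 0\<bar> \<le> \<rho>\<^sup>2 / (2 - 2 * s)"
  proof -
   have "(norm xi)\<^sup>2 / (2 - 2 * s) \<le> \<rho>\<^sup>2 / (2 - 2 * s)"
    using True s by (intro divide_right_mono power_mono) (auto simp: annulus_def)
   thus ?thesis using flux_0_bounds[OF s norm_ge_zero[of xi]] by simp
  qed
  ultimately have "\<bar>X k xi\<bar> \<le> K" unfolding X_def K_def abs_mult using s by (intro mult_mono) auto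
  thus ?thesis using True by simp
 next
  case False
  thus ?thesis using c0[of xi] by (simp add: annulus_def plane_wave_def X_def)
 qed
 show "integrable lborel (X k)"
  by (rule Bochner_Integration.integrable_bound[OF annulus_integrable[of K]])
   (simp, intro AE_I2, simp only: real_norm_def, rule order_trans[OF Xb abs_ge_self])
 have lim: "(%k. X k xi) \<longlonglongrightarrow> l * (flux s (norm xi) 0 * Re (c xi * cnj (fourier u xi)))" for xi
 proof -
  have "(%k. LINT x|lborel. u x * (z k x * plane_wave (c xi) xi x)) \<longlonglongrightarrow> (LINT x|lborel. u x * (l * plane_wave (c xi) xi x))"
  proof (rule integral_dominated_convergence[OF _ _ uM])
   show "AE x in lborel. (%k. u x * (z k x * plane_wave (c xi) xi x)) \<longlonglongrightarrow> u x * (l * plane_wave (c xi) xi x)"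
    by (intro AE_I2 tendsto_intros zl)
   show "AE x in lborel. norm (u x * (z k x * plane_wave (c xi) xi x)) \<le> \<bar>u x\<bar> * M" for k
    using ub by (intro AE_I2) simp
  qed (unfold plane_wave_def, measurable)
  moreover have "(LINT x|lborel. u x * (l * plane_wave (c xi) xi x)) = l * Re (c xi * cnj (fourier u xi))"
  proof -
   have i: "integrable lborel (%x. complex_of_real (u x) * exp (\<i> * of_real (x \<bullet> xi)))"
    by (rule Bochner_Integration.integrable_bound[OF u]) (measurable, auto simp: norm_mult norm_exp_ii)
   have cf: "cnj (fourier u xi) = (LINT x|lborel. complex_of_real (u x) * exp (\<i> * of_real (x \<bullet> xi)))"
    unfolding fourier_def Bochner_Integration.integral_cnj[symmetric] by (simp add: exp_cnj)
   have "Re (c xi * cnj (fourier u xi)) = Re (LINT x|lborel. c xi * (complex_of_real (u x) * exp (\<i> * of_real (x \<bullet> xi))))"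
    unfolding cf by simp
   also have "... = (LINT x|lborel. Re (c xi * (complex_of_real (u x) * exp (\<i> * of_real (x \<bullet> xi)))))"
    by (rule integral_Re[symmetric]) (intro integrable_mult_right i)
   also have "... = (LINT x|lborel. u x * plane_wave (c xi) xi x)"
    unfolding plane_wave_eq by (intro Bochner_Integration.integral_cong refl) (simp add: algebra_simps)
   finally have e: "Re (c xi * cnj (fourier u xi)) = (LINT x|lborel. u x * plane_wave (c xi) xi x)" .
   have "(LINT x|lborel. u x * (l * plane_wave (c xi) xi x)) = (LINT x|lborel. l * (u x * plane_wave (c xi) xi x))" by (simp add: mult_ac)
   thus ?thesis unfolding e by simp
  qed
  ultimately have "(%k. X k xi) \<longlonglongrightarrow> flux s (norm xi) 0 * (l * Re (c xi * cnj (fourier u xi)))"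
   unfolding X_def by (intro tendsto_mult tendsto_const) simp
  thus ?thesis by (simp add: mult_ac)
 qed
 have "(%k. LINT xi|lborel. X k xi) \<longlonglongrightarrow> (LINT xi|lborel. l * (flux s (norm xi) 0 * Re (c xi * cnj (fourier u xi))))"
 proof (rule integral_dominated_convergence[OF _ _ annulus_integrable[of K]])
  show "AE xi in lborel. (%k. X k xi) \<longlonglongrightarrow> l * (flux s (norm xi) 0 * Re (c xi * cnj (fourier u xi)))"
   by (intro AE_I2 lim)
  show "AE xi in lborel. norm (X k xi) \<le> K * indicat_real annulus xi" for k using Xb by (intro AE_I2) simp
  show "(%xi. l * (flux s (norm xi) 0 * Re (c xi * cnj (fourier u xi)))) \<in> borel_measurable lborel"
   unfolding measurable_lborel1 times_complex.sel complex_cnj cnj.sel by measurable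
  show "X k \<in> borel_measurable lborel" for k using Xm[of k] by simp
 qed
 thus "(%k. LINT xi|lborel. X k xi) \<longlonglongrightarrow> l * (LINT xi|lborel. flux s (norm xi) 0 * Re (c xi * cnj (fourier u xi)))" by simp
qed

end

section \<open>The lower bound\<close>

lemma set_integral_lebesgue_eq_lborel:
 fixes F :: "'a::euclidean_space => real"
 assumes "F \<in> borel_measurable borel" "S \<in> sets borel"
 shows "(LINT p:S|lebesgue. F p) = (LINT p|lborel. indicat_real S p * F p)"
proof -
 have "(%p. indicat_real S p * F p) \<in> borel_measurable lborel"
  using assms by (simp add: borel_measurable_times borel_measurable_indicator)
 thus ?thesis unfolding set_lebesgue_integral_def by (simp add: integral_completion)
qed

text \<open>The energy of the superposition is at most \<open>X\<close>, the number that the source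
  terms produce, so \<open>X\<close> occurs on both sides. Letting the radius grow removes the
  remainders but freezes the localisation at the constant \<open>z 0\<close>, which may be less than
  1 and is removed afterwards.\<close>

lemma truncated_energy_cutoff_le:
 fixes u z :: "'a::euclidean_space => real" and w :: "'a \<times> real => real" and g :: "'a \<times> real => 'a \<times> real"
 assumes s: "0 < s" "s < 1" and \<rho>: "\<rho> \<ge> 1" and w: "w \<in> H_class (1 - 2 * s) u"
  and g: "has_weak_gradient slab w g" and gm[measurable]: "g \<in> borel_measurable borel"
  and Eg: "integrable lborel (%p. indicat_real slab p * (snd p powr (1 - 2 * s) * (norm (g p))\<^sup>2))"
  and u: "integrable lborel u" and z: "test_function (ball 0 1) z" and z01: "!!x. 0 \<le> z x" "!!x. z x \<le> 1"
 defines "c \<equiv> %xi. if 1 / \<rho> \<le> norm xi \<and> norm xi \<le> \<rho> then fourier u xi / of_real ((2 * pi) ^ DIM('a)) else 0"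
 defines "X \<equiv> LINT xi|lborel. flux s (norm xi) 0 * Re (c xi * cnj (fourier u xi))"
 shows "integrable lborel (%xi. flux s (norm xi) 0 * Re (c xi * cnj (fourier u xi)))"
  "z 0 * X \<le> ((LINT p|lborel. indicat_real slab p * (snd p powr (1 - 2 * s) * (norm (g p))\<^sup>2)) + X) / 2"
proof -
 define a where "a = 1 - 2 * s"
 have a: "-1 < a" "a < 1" using s by (auto simp: a_def)
 define N where "N = (2 * pi) ^ DIM('a)"
 have N: "N > 0" by (simp add: N_def)
 define L where "L = (LINT x|lborel. \<bar>u x\<bar>)"
 define M where "M = L / N"
 have L: "L \<ge> 0" by (simp add: L_def)
 have um[measurable]: "u \<in> borel_measurable borel" using borel_measurable_integrable[OF u] by simp
 note [measurable] = flux_0_measurable[OF s] fourier_measurable[OF u]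
 have cm[measurable]: "c \<in> borel_measurable borel" unfolding c_def by measurable
 have cM: "norm (c xi) \<le> M" for xi
  using fourier_bound[of u xi] L N unfolding c_def M_def N_def[symmetric] L_def[symmetric]
  by (auto simp: norm_divide intro!: divide_right_mono)
 have c0: "c xi = 0" if "\<not> (1 / \<rho> \<le> norm xi \<and> norm xi \<le> \<rho>)" for xi using that by (auto simp: c_def)
 note P = s \<rho> cm cM c0
 \<comment> \<open>With this amplitude the source integrand is \<open>N\<close> times the flux times
   the squared modulus of \<open>c\<close>, exactly the integrand in the Plancherel bound for
   \<open>gextn s c\<close>.\<close>
 have sqc: "Re (c xi * cnj (fourier u xi)) = N * (norm (c xi))\<^sup>2" for xi
 proof (cases "1 / \<rho> \<le> norm xi \<and> norm xi \<le> \<rho>")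
  case True
  hence "fourier u xi = of_real N * c xi" using N by (simp add: c_def N_def)
  hence "c xi * cnj (fourier u xi) = of_real N * (c xi * cnj (c xi))" by (simp add: mult_ac)
  also have "... = of_real (N * (norm (c xi))\<^sup>2)" by (simp add: complex_norm_square[symmetric])
  finally show ?thesis by simp
 qed (simp add: c0)
 show Xi: "integrable lborel (%xi. flux s (norm xi) 0 * Re (c xi * cnj (fourier u xi)))"
 proof (rule Bochner_Integration.integrable_bound[OF annulus_integrable[OF P, of "\<rho>\<^sup>2 / (2 - 2 * s) * (N * M\<^sup>2)"]])
  show "(%xi. flux s (norm xi) 0 * Re (c xi * cnj (fourier u xi))) \<in> borel_measurable lborel"
   unfolding sqc by measurable
  show "AE xi in lborel. norm (flux s (norm xi) 0 * Re (c xi * cnj (fourier u xi))) \<le> norm (\<rho>\<^sup>2 / (2 - 2 * s) * (N * M\<^sup>2) * indicat_real (annulus \<rho>) xi)"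
  proof (rule AE_I2)
   fix xi :: 'a
   show "norm (flux s (norm xi) 0 * Re (c xi * cnj (fourier u xi))) \<le> norm (\<rho>\<^sup>2 / (2 - 2 * s) * (N * M\<^sup>2) * indicat_real (annulus \<rho>) xi)"
   proof (cases "xi \<in> annulus \<rho>")
    case True
    have "(norm xi)\<^sup>2 / (2 - 2 * s) \<le> \<rho>\<^sup>2 / (2 - 2 * s)"
     using True s by (intro divide_right_mono power_mono) (auto simp: annulus_def[OF P])
    hence "flux s (norm xi) 0 * (N * (norm (c xi))\<^sup>2) \<le> \<rho>\<^sup>2 / (2 - 2 * s) * (N * M\<^sup>2)"
     using flux_0_bounds[OF s norm_ge_zero[of xi]] N cM[of xi] s by (intro mult_mono power_mono) auto
    moreover have "flux s (norm xi) 0 * (N * (norm (c xi))\<^sup>2) \<ge> 0"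
     using flux_0_bounds[OF s norm_ge_zero[of xi]] N by simp
    ultimately have le: "\<bar>flux s (norm xi) 0 * (N * (norm (c xi))\<^sup>2)\<bar> \<le> \<rho>\<^sup>2 / (2 - 2 * s) * (N * M\<^sup>2)" by simp
    show ?thesis using order_trans[OF le abs_ge_self] True unfolding sqc by (simp only: real_norm_def indicator_simps mult_1_right)
   next
    case False
    hence "c xi = 0" using c0 by (simp add: annulus_def[OF P])
    thus ?thesis by simp
   qed
  qed
 qed
 have Xnn: "flux s (norm xi) 0 * Re (c xi * cnj (fourier u xi)) \<ge> 0" for xi
  unfolding sqc using flux_0_bounds[OF s norm_ge_zero[of xi]] N by simp
 define G where "G = gextn s c"
 have Gm[measurable]: "G \<in> borel_measurable borel" unfolding G_def by (rule gextn_measurable[OF s cm cM])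
 have [measurable]: "slab \<in> sets (borel :: ('a \<times> real) measure)" using open_slab by (rule borel_open)
 have "(\<integral>\<^sup>+p. ennreal (indicat_real slab p * (snd p powr a * (norm (G p))\<^sup>2)) \<partial>lborel)
   = (\<integral>\<^sup>+p\<in>slab. ennreal (snd p powr a * (norm (G p))\<^sup>2) \<partial>lborel)"
  by (intro nn_integral_cong) (auto simp: indicator_def)
 also have "... \<le> ennreal N * (\<integral>\<^sup>+xi. ennreal (flux s (norm xi) 0 * (norm (c xi))\<^sup>2) \<partial>lborel)"
  unfolding G_def a_def N_def by (rule gextn_energy_bound[OF s cm cM])
 also have "... = (\<integral>\<^sup>+xi. ennreal N * ennreal (flux s (norm xi) 0 * (norm (c xi))\<^sup>2) \<partial>lborel)"
  by (rule nn_integral_cmult[symmetric]) measurable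
 also have "... = (\<integral>\<^sup>+xi. ennreal (flux s (norm xi) 0 * Re (c xi * cnj (fourier u xi))) \<partial>lborel)"
 proof (rule nn_integral_cong)
  fix xi :: 'a
  have "ennreal N * ennreal (flux s (norm xi) 0 * (norm (c xi))\<^sup>2) = ennreal (N * (flux s (norm xi) 0 * (norm (c xi))\<^sup>2))"
   by (rule ennreal_mult[symmetric]) (use N flux_0_bounds(1)[OF s norm_ge_zero[of xi]] in auto)
  thus "ennreal N * ennreal (flux s (norm xi) 0 * (norm (c xi))\<^sup>2) = ennreal (flux s (norm xi) 0 * Re (c xi * cnj (fourier u xi)))"
   unfolding sqc by (simp only: mult_ac)
 qed
 also have "... = ennreal X" unfolding X_def by (rule nn_integral_eq_integral[OF Xi]) (use Xnn in auto)
 finally have Ec': "(\<integral>\<^sup>+p. ennreal (indicat_real slab p * (snd p powr a * (norm (G p))\<^sup>2)) \<partial>lborel) \<le> ennreal X" .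
 have Ec: "integrable lborel (%p. indicat_real slab p * (snd p powr a * (norm (G p))\<^sup>2))"
  by (rule integrableI_nonneg) (measurable, auto intro!: le_less_trans[OF Ec'])
 have X0: "X \<ge> 0" unfolding X_def by (rule Bochner_Integration.integral_nonneg) (rule Xnn)
 have EcX: "(LINT p|lborel. indicat_real slab p * (snd p powr a * (norm (G p))\<^sup>2)) \<le> X"
  using Ec' X0 by (subst (asm) nn_integral_eq_integral[OF Ec]) (auto simp: ennreal_le_iff)
 define E where "E = (LINT p|lborel. indicat_real slab p * (snd p powr a * (norm (g p))\<^sup>2))"
 define R where "R k = real (Suc k)" for k
 have R: "R k > 0" for k by (simp add: R_def)
 from test_function_bounds[OF z] obtain K B where K: "smooth z" "compact K" "K \<subseteq> ball 0 1" "B > 0"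
  "\<forall>x. x \<notin> K --> z x = 0 \<and> (\<forall>b. frechet_derivative z (at x) b = 0)"
  "\<forall>x. \<bar>z x\<bar> \<le> B \<and> (\<forall>b\<in>Basis. \<bar>frechet_derivative z (at x) b\<bar> \<le> B)" by (elim exE conjE)
 \<comment> \<open>Dilating \<open>z\<close> to radius \<open>R k\<close> divides its derivatives by
   \<open>R k\<close>.\<close>
 define zk where "zk k x = z ((1 / R k) *\<^sub>R x)" for k x
 define \<eta> where "\<eta> k b x = frechet_derivative (zk k) (at x) b" for k b x
 have szk: "smooth (zk k)" for k
  unfolding zk_def[abs_def] using smooth_compose_affine[OF bounded_linear_scaleR_right K(1), of "1 / R k" 0] by simp
 have \<eta>eq: "\<eta> k b x = 1 / R k * frechet_derivative z (at ((1 / R k) *\<^sub>R x)) b" for k b x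
 proof -
  have "(zk k has_derivative (%v. frechet_derivative z (at ((1 / R k) *\<^sub>R x)) ((1 / R k) *\<^sub>R v))) (at x)"
   unfolding zk_def[abs_def]
   by (rule has_derivative_compose[where f="%x. (1 / R k) *\<^sub>R x" and g=z, OF _ smooth_has_derivative[OF K(1)]])
    (auto intro!: derivative_eq_intros)
  from fun_cong[OF frechet_derivative_at[OF this], of b] show ?thesis
   unfolding \<eta>_def using linear_scale[OF has_derivative_linear[OF smooth_has_derivative[OF K(1)]]] by simp
 qed
 have tz: "test_function (ball 0 (R k)) (zk k)" for k
 proof (rule test_functionI[OF szk])
  show "compact ((%x. R k *\<^sub>R x) ` K)" by (intro compact_scaling K)
  show "(%x. R k *\<^sub>R x) ` K \<subseteq> ball 0 (R k)" using K(3) R[of k] by (auto simp: subset_iff)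
  fix x assume x: "x \<notin> (%x. R k *\<^sub>R x) ` K"
  have "(1 / R k) *\<^sub>R x \<notin> K"
  proof
   assume "(1 / R k) *\<^sub>R x \<in> K"
   hence "R k *\<^sub>R ((1 / R k) *\<^sub>R x) \<in> (%x. R k *\<^sub>R x) ` K" by blast
   thus False using x R[of k] by simp
  qed
  thus "zk k x = 0" using K(5) by (simp add: zk_def)
 qed
 have zout: "zk k x = 0" "\<eta> k b x = 0" if "x \<notin> ball 0 (R k)" for k b x
 proof -
  have "(1 / R k) *\<^sub>R x \<notin> ball 0 1" using that R[of k] by (simp add: field_simps)
  hence "(1 / R k) *\<^sub>R x \<notin> K" using K(3) by blast
  thus "zk k x = 0" "\<eta> k b x = 0" using K(5) by (simp_all add: zk_def \<eta>eq)
 qed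
 have zkm[measurable]: "zk k \<in> borel_measurable borel" for k
  by (rule borel_measurable_continuous_onI[OF smooth_continuous[OF szk]])
 have \<eta>m: "\<eta> k b \<in> borel_measurable borel" if "b \<in> Basis" for k b
  unfolding \<eta>_def[abs_def] by (rule borel_measurable_continuous_onI[OF smooth_continuous[OF smooth_partial[OF szk that]]])
 have \<eta>b: "\<bar>\<eta> k b x\<bar> \<le> B / R k" if "b \<in> Basis" for k b x
  unfolding \<eta>eq abs_mult using K(6) that R[of k] by (simp add: divide_right_mono)
 have BR: "B / R k \<ge> 0" for k using K(4) R[of k] by simp
 have fH: "finite_H1 a (R k) w g" for k
 proof -
  have wg: "has_weak_gradient (cyl (R k)) w g" by (rule has_weak_gradient_mono[OF g cyl_slab])
  have "w \<in> H1 a (cyl (R k))" using w R[of k] unfolding H_class_def H1_loc_def cyl_def a_def by simp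
  thus ?thesis unfolding finite_H1_def H1_def using wg H1_sqnorm_eq[OF cyl_open wg, of a] by simp
 qed
 have tr: "has_trace a (ball 0 (R k)) w u" for k using w R[of k] unfolding H_class_def a_def by simp
 have us: "set_integrable lebesgue (ball 0 (R k)) u" for k
 proof -
  have "integrable lebesgue u" using u by (subst integrable_completion) auto
  thus ?thesis unfolding set_integrable_def by (intro integrable_mult_indicator) auto
 qed
 have Gi: "integrable lborel (%p. indicat_real (cyl (R k)) p * ((1 + snd p powr a) * norm (g p)))" for k
 proof -
  have "integrable lebesgue (%p. indicat_real (cyl (R k)) p * ((1 + snd p powr a) * norm (g p)))"
   using finite_H1_integrable(2)[OF a fH[of k]] unfolding set_integrable_def by simp
  thus ?thesis by (subst (asm) integrable_completion) simp_all
 qed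
 define D where "D k xi x = (\<Sum>b\<in>Basis. (b \<bullet> xi) * \<eta> k b x)" for k xi x
 have Dm[measurable]: "D k xi \<in> borel_measurable borel" for k xi
  unfolding D_def[abs_def] by (intro borel_measurable_sum borel_measurable_times \<eta>m) auto
 have pwm[measurable]: "plane_wave d xi \<in> borel_measurable borel" for d and xi :: 'a
  by (rule borel_measurable_continuous_onI[OF plane_wave_continuous])
 have fm[measurable]: "(%p::'a \<times> real. flux s r (snd p)) \<in> borel_measurable borel" for r
  by (rule profile_measurable(2)[OF s]) measurable
 have dwm[measurable]: "(%p. dwave s c xi p v) \<in> borel_measurable borel" for xi v
  using measurable_compose[OF measurable_Pair2' dwave_measurable_pair[OF P, of v], of xi] by simp
 have cf: "(%p::'a \<times> real. h (fst p)) \<in> borel_measurable borel" if "h \<in> borel_measurable borel" for h :: "'a => real"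
  by (rule measurable_compose[OF fst_measurable that])
 have gv: "(%p. g p \<bullet> v) \<in> borel_measurable borel" for v by measurable
 have ym: "(%p::'a \<times> real. snd p powr b) \<in> borel_measurable borel" for b by measurable
 define FL where "FL k p xi = indicat_real (cyl (R k)) p * (zk k (fst p) * (snd p powr (1 - 2 * s) * (\<Sum>v\<in>Basis. (g p \<bullet> v) * dwave s c xi p v)))" for k p xi
 define XX where "XX k xi = flux s (norm xi) 0 * (LINT x|lborel. u x * (zk k x * plane_wave (c xi) xi x))" for k xi
 define FT where "FT k p xi = indicat_real (cyl (R k)) p * ((g p \<bullet> (0, 1)) * ((\<Sum>b\<in>Basis. (b \<bullet> xi) * \<eta> k b (fst p))
    * plane_wave (- \<i> * c xi) xi (fst p) * flux s (norm xi) (snd p))) / (norm xi)\<^sup>2" for k p xi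
 define U where "U k xi = flux s (norm xi) 0 * (LINT x|lborel. u x * ((\<Sum>b\<in>Basis. (b \<bullet> xi) * \<eta> k b x) * plane_wave (- \<i> * c xi) xi x)) / (norm xi)\<^sup>2" for k xi
 \<comment> \<open>The localised pairing equals source term plus flux remainder plus source
   remainder. At \<open>xi = 0\<close> all of them vanish with the amplitude, since the annulus
   omits the origin.\<close>
 have id: "(LINT p|lborel. FL k p xi) = XX k xi + ((LINT p|lborel. FT k p xi) + U k xi)" for k xi
 proof (cases "xi = 0")
  case True
  have "c xi = 0" using \<rho> True by (intro c0) auto
  thus ?thesis by (simp add: FL_def XX_def FT_def U_def plane_wave_def dwave_def[OF s cm cM])
 next
  case False
  have src: "(LINT x:ball 0 (R k)|lebesgue. u x * (h x * plane_wave d xi x)) = (LINT x|lborel. u x * (h x * plane_wave d xi x))"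
   if [measurable]: "h \<in> borel_measurable borel" and out: "!!x. x \<notin> ball 0 (R k) ==> h x = 0" for h d
  proof -
   have "(LINT x:ball 0 (R k)|lebesgue. u x * (h x * plane_wave d xi x)) = (LINT x|lborel. indicat_real (ball 0 (R k)) x * (u x * (h x * plane_wave d xi x)))"
    by (rule set_integral_lebesgue_eq_lborel) (intro borel_measurable_times um that(1) pwm, simp)
   also have "... = (LINT x|lborel. u x * (h x * plane_wave d xi x))"
    using out by (intro Bochner_Integration.integral_cong) (auto simp: indicator_def)
   finally show ?thesis .
  qed
  have Dout: "D k xi x = 0" if "x \<notin> ball 0 (R k)" for x using zout(2)[OF that] by (simp add: D_def)
  have 1: "(LINT p:cyl (R k)|lebesgue. zk k (fst p) * (snd p powr (1 - 2 * s) * (\<Sum>v\<in>Basis. (g p \<bullet> v) * dwave s c xi p v))) = (LINT p|lborel. FL k p xi)"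
   unfolding FL_def
   by (rule set_integral_lebesgue_eq_lborel[OF _ cyl_borel]) (intro borel_measurable_times borel_measurable_sum cf zkm gv dwm ym)
  have 2: "(LINT p:cyl (R k)|lebesgue. (g p \<bullet> (0, 1)) * (D k xi (fst p) * plane_wave (- \<i> * c xi) xi (fst p) * flux s (norm xi) (snd p))) / (norm xi)\<^sup>2 = (LINT p|lborel. FT k p xi)"
  proof -
   have "(LINT p:cyl (R k)|lebesgue. (g p \<bullet> (0, 1)) * (D k xi (fst p) * plane_wave (- \<i> * c xi) xi (fst p) * flux s (norm xi) (snd p)))
    = (LINT p|lborel. indicat_real (cyl (R k)) p * ((g p \<bullet> (0, 1)) * (D k xi (fst p) * plane_wave (- \<i> * c xi) xi (fst p) * flux s (norm xi) (snd p))))"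
    by (rule set_integral_lebesgue_eq_lborel[OF _ cyl_borel]) (intro borel_measurable_times gv cf Dm pwm fm)
   thus ?thesis unfolding FT_def D_def[symmetric] by simp
  qed
  have 3: "(LINT x:ball 0 (R k)|lebesgue. u x * (zk k x * plane_wave (c xi) xi x)) = (LINT x|lborel. u x * (zk k x * plane_wave (c xi) xi x))"
   by (rule src[OF zkm zout(1)])
  have 4: "(LINT x:ball 0 (R k)|lebesgue. u x * (D k xi x * plane_wave (- \<i> * c xi) xi x)) = (LINT x|lborel. u x * (D k xi x * plane_wave (- \<i> * c xi) xi x))"
   by (rule src[OF Dm Dout])
  note id = plane_wave_identity[OF s cm cM False R fH[unfolded a_def] tr[unfolded a_def] us tz, of k, folded \<eta>_def D_def]
  show ?thesis using id unfolding 1 3 4 U_def D_def[symmetric] XX_def 2[symmetric]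
   by (simp only: add_divide_distrib)
 qed

 have zk01: "0 \<le> zk k x" "zk k x \<le> 1" for k x using z01 by (simp_all add: zk_def)
 have iL: "integrable lborel (%xi. LINT p|lborel. FL k p xi)" for k
  unfolding FL_def by (rule superposed_energy_le(1)[OF P gm zkm zk01 Gi[unfolded a_def] Eg Ec[unfolded a_def G_def]])
 have LE: "(LINT xi|lborel. (LINT p|lborel. FL k p xi)) \<le> (E + (LINT p|lborel. indicat_real slab p * (snd p powr a * (norm (G p))\<^sup>2))) / 2" for k
  unfolding FL_def E_def a_def G_def
  by (rule superposed_energy_le(2)[OF P gm zkm zk01 Gi[unfolded a_def] Eg Ec[unfolded a_def G_def]])
 define C1 where "C1 = (LINT p|lborel. (\<Sum>b\<in>Basis. indicat_real slab p * (snd p powr (1 - 2 * s) * (norm (g p))\<^sup>2)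
    + indicat_real slab p * (snd p powr (- (1 - 2 * s)) * (vflux s c b p)\<^sup>2)))"
 have iT: "integrable lborel (%xi. LINT p|lborel. FT k p xi)"
  and TE: "\<bar>LINT xi|lborel. (LINT p|lborel. FT k p xi)\<bar> \<le> B / R k * C1" for k
  unfolding FT_def C1_def
  by (rule superposed_flux_le[OF P gm \<eta>m \<eta>b BR Gi[unfolded a_def] Eg]; assumption?)+
 have zl: "(%k. zk k x) \<longlonglongrightarrow> z 0" for x
 proof -
  have "(%k. (1 / R k) *\<^sub>R x) \<longlonglongrightarrow> 0 *\<^sub>R x"
   unfolding R_def by (intro tendsto_scaleR tendsto_const) real_asymp
  moreover have "isCont z 0"
   using smooth_continuous[OF K(1), of UNIV] unfolding continuous_on_eq_continuous_at[OF open_UNIV] by simp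
  ultimately show ?thesis unfolding zk_def using isCont_tendsto_compose[of 0 z "%k. (1 / R k) *\<^sub>R x" sequentially] by simp
 qed
 have zb: "\<bar>zk k x\<bar> \<le> 1" for k x using z01 by (simp add: zk_def)
 have ST1: "integrable lborel (XX k)" for k
  unfolding XX_def[abs_def] by (rule source_tendsto(1)[OF P u zkm zb zl])
 have ST2: "(%k. LINT xi|lborel. XX k xi) \<longlonglongrightarrow> z 0 * X"
  unfolding XX_def X_def by (rule source_tendsto(2)[OF P u zkm zb zl])
 \<comment> \<open>Integrability of the source remainder is read off from the identity, in which the
   other three terms are integrable.\<close>
 have iU: "integrable lborel (U k)" for k
 proof -
  have "integrable lborel (%xi. (LINT p|lborel. FL k p xi) - XX k xi - (LINT p|lborel. FT k p xi))"
   by (intro Bochner_Integration.integrable_diff iL iT ST1)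
  thus ?thesis unfolding id by simp
 qed
 define C2 where "C2 = (LINT xi|lborel. 1 / (2 - 2 * s) * (real DIM('a) * \<rho> * M * L) * indicat_real (annulus \<rho>) (xi::'a))"
 have UE: "\<bar>LINT xi|lborel. U k xi\<bar> \<le> B / R k * C2" for k
 proof -
  define h where "h xi = 1 / (2 - 2 * s) * (real DIM('a) * \<rho> * M * L) * indicat_real (annulus \<rho>) xi" for xi :: 'a
  have hi: "integrable lborel h" unfolding h_def by (rule annulus_integrable[OF P])
  have Uh: "\<bar>U k xi\<bar> \<le> B / R k * h xi" for xi
   unfolding U_def h_def L_def by (rule source_remainder_le[OF P u \<eta>b BR]; assumption)
  have "\<bar>LINT xi|lborel. U k xi\<bar> \<le> (LINT xi|lborel. \<bar>U k xi\<bar>)" by (rule integral_abs_bound)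
  also have "... \<le> (LINT xi|lborel. B / R k * h xi)"
   by (intro integral_mono integrable_abs iU integrable_mult_right hi Uh)
  also have "... = B / R k * C2" unfolding C2_def h_def[symmetric] by (rule integral_mult_right_zero)
  finally show ?thesis .
 qed
 \<comment> \<open>The superposed pairing is bounded by the energies, and both remainders carry the
   factor \<open>B / R k\<close>; \<open>C1\<close> and \<open>C2\<close> are independent of
   \<open>k\<close>.\<close>
 have main: "(LINT xi|lborel. XX k xi) \<le> (E + X) / 2 + B / R k * (C1 + C2)" for k
 proof -
  have "(LINT xi|lborel. (LINT p|lborel. FL k p xi)) = (LINT xi|lborel. XX k xi) + ((LINT xi|lborel. (LINT p|lborel. FT k p xi)) + (LINT xi|lborel. U k xi))"
   unfolding id by (simp add: ST1 iT iU)
  moreover define \<beta> where "\<beta> = B / R k * C1"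
  moreover define \<gamma> where "\<gamma> = B / R k * C2"
  moreover define e where "e = (LINT p|lborel. indicat_real slab p * (snd p powr a * (norm (G p))\<^sup>2))"
  moreover have "B / R k * (C1 + C2) = \<beta> + \<gamma>" unfolding \<beta>_def \<gamma>_def by (rule distrib_left)
  ultimately show ?thesis
   using LE[of k, folded e_def] TE[of k, folded \<beta>_def] UE[of k, folded \<gamma>_def] EcX[folded e_def]
   by (simp only: abs_le_iff) argo
 qed
 have lim: "(%k. (E + X) / 2 + B / R k * (C1 + C2)) \<longlonglongrightarrow> (E + X) / 2 + 0 * (C1 + C2)"
  unfolding R_def by (intro tendsto_intros) real_asymp
 have "z 0 * X \<le> (E + X) / 2 + 0 * (C1 + C2)"
  by (rule LIMSEQ_le[OF ST2 lim]) (use main in blast)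
 thus "z 0 * X \<le> ((LINT p|lborel. indicat_real slab p * (snd p powr (1 - 2 * s) * (norm (g p))\<^sup>2)) + X) / 2"
  by (simp add: E_def a_def)
qed

text \<open>Infinite energy leaves nothing to prove. Otherwise the bound is shown on each annulus,
  where \<open>X\<close> is a finite real number that may be absorbed, and monotone convergence
  exhausts the frequencies.\<close>

lemma energy_lower_bound:
 fixes u :: "'a::euclidean_space => real"
 assumes s: "0 < s" "s < 1" and w: "w \<in> H_class (1 - 2 * s) u" and u: "integrable lborel u"
 shows "ennreal (1 / (2 * (2 * pi) ^ DIM('a))) * (\<integral>\<^sup>+xi. ennreal (flux s (norm xi) 0 * (norm (fourier u xi))\<^sup>2) \<partial>lborel)
  \<le> E_K (1 - 2 * s) w"
proof -
 define N where "N = (2 * pi) ^ DIM('a)"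
 have N: "N > 0" by (simp add: N_def)
 have "w \<in> H1_loc (1 - 2 * s)" using w by (simp add: H_class_def)
 from H1_loc_has_weak_gradient_slab[OF this] obtain g0 where "has_weak_gradient slab w g0" by (elim exE)
 from has_weak_gradient_borel[OF open_slab this] obtain g where gm[measurable]: "g \<in> borel_measurable borel" and g: "has_weak_gradient slab w g" .
 have [measurable]: "slab \<in> sets (borel :: ('a \<times> real) measure)" using open_slab by (rule borel_open)
 define I where "I = (\<integral>\<^sup>+p. ennreal (indicat_real slab p * (snd p powr (1 - 2 * s) * (norm (g p))\<^sup>2)) \<partial>lborel)"
 have EK: "E_K (1 - 2 * s) w = 1 / 2 * I"
  unfolding E_K_eq[OF g] I_def nn_integral_completion
  by (intro arg_cong[where f="times (1 / 2)"] nn_integral_cong) (auto simp: indicator_def)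
 note [measurable] = flux_0_measurable[OF s] fourier_measurable[OF u]
 have q0: "flux s (norm xi) 0 \<ge> 0" for xi :: 'a by (rule flux_0_bounds(1)[OF s norm_ge_zero])
 define F where "F xi = flux s (norm xi) 0 * (norm (fourier u xi))\<^sup>2 / N" for xi
 have Fm[measurable]: "F \<in> borel_measurable borel" unfolding F_def[abs_def] by measurable
 have F0: "F xi \<ge> 0" for xi using q0[of xi] N by (simp add: F_def)
 have main: "(\<integral>\<^sup>+xi. ennreal (F xi) \<partial>lborel) \<le> I"
 proof (cases "I = \<infinity>")
  case False
  hence Ifin: "I < \<infinity>" by (simp add: less_top)
  have Eg: "integrable lborel (%p. indicat_real slab p * (snd p powr (1 - 2 * s) * (norm (g p))\<^sup>2))"
   by (rule integrableI_nonneg) (measurable, use Ifin in \<open>auto simp: I_def\<close>)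
  define E where "E = (LINT p|lborel. indicat_real slab p * (snd p powr (1 - 2 * s) * (norm (g p))\<^sup>2))"
  have IE: "I = ennreal E" unfolding I_def E_def by (rule nn_integral_eq_integral[OF Eg]) auto
  define A where "A k = {xi::'a. 1 / real (Suc k) \<le> norm xi \<and> norm xi \<le> real (Suc k)}" for k
  have [measurable]: "A k \<in> sets borel" for k unfolding A_def by measurable
  have trunc: "(\<integral>\<^sup>+xi. ennreal (F xi) * indicator (A k) xi \<partial>lborel) \<le> ennreal E" for k
  proof -
   define \<rho> where "\<rho> = real (Suc k)"
   have \<rho>: "\<rho> \<ge> 1" by (simp add: \<rho>_def)
   define c where "c = (%xi. if 1 / \<rho> \<le> norm xi \<and> norm xi \<le> \<rho> then fourier u xi / of_real ((2 * pi) ^ DIM('a)) else 0)"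
   define X where "X = (LINT xi|lborel. flux s (norm xi) 0 * Re (c xi * cnj (fourier u xi)))"
   \<comment> \<open>A cube of half-width \<open>d\<close> has points of \<open>l1\<close> norm at
     most \<open>1 / 2\<close>, so it lies in the unit ball.\<close>
   define d where "d = 1 / (2 * real DIM('a))"
   have d: "d > 0" by (simp add: d_def)
   define l r where "l = - (d *\<^sub>R (One::'a))" and "r = d *\<^sub>R (One::'a)"
   define b where "b j = box_bump (1 / real (Suc j)) l r" for j
   have sub: "cbox l r \<subseteq> ball 0 1"
   proof
    fix x assume x: "x \<in> cbox l r"
    have "norm x \<le> (\<Sum>i\<in>Basis. \<bar>x \<bullet> i\<bar>)" by (rule norm_le_l1)
    also have "... \<le> (\<Sum>i\<in>(Basis::'a set). d)"
     by (rule sum_mono) (use x in \<open>auto simp: mem_box l_def r_def abs_le_iff minus_le_iff\<close>)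
    also have "... = 1 / 2" by (simp add: d_def)
    finally show "x \<in> ball 0 1" by simp
   qed
   have tb: "test_function (ball 0 1) (b j)" for j unfolding b_def by (rule test_function_box_bump[OF _ sub]) simp
   have b01: "0 \<le> b j x" "b j x \<le> 1" for j x
    unfolding b_def by (rule box_bump_bounds; simp)+
   have T1: "integrable lborel (%xi. flux s (norm xi) 0 * Re (c xi * cnj (fourier u xi)))"
    unfolding c_def by (rule truncated_energy_cutoff_le(1)[OF s \<rho> w g gm Eg u tb[of 0] b01(1)[of 0] b01(2)[of 0]])
   have T2: "b j 0 * X \<le> (E + X) / 2" for j
    unfolding X_def E_def c_def by (rule truncated_energy_cutoff_le(2)[OF s \<rho> w g gm Eg u tb[of j] b01(1)[of j] b01(2)[of j]])
   have "(%j. b j 0 * X) \<longlonglongrightarrow> indicator (box l r) (0::'a) * X"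
    unfolding b_def by (intro tendsto_mult tendsto_const box_bump_tendsto)
   moreover have "(0::'a) \<in> box l r" using d by (simp add: mem_box l_def r_def)
   ultimately have l1: "(%j. b j 0 * X) \<longlonglongrightarrow> X" by simp
   \<comment> \<open>The bumps tend to 1 at the origin, which replaces \<open>z 0\<close> by 1;
     since \<open>X\<close> is a real number, the half on the right can be absorbed.\<close>
   have "X \<le> (E + X) / 2"
    by (rule LIMSEQ_le_const2[OF l1]) (intro exI[of _ 0] allI impI T2)
   hence XE: "X \<le> E" by simp
   have Feq: "flux s (norm xi) 0 * Re (c xi * cnj (fourier u xi)) = F xi * indicator (A k) xi" for xi
   proof (cases "xi \<in> A k")
    case True
    hence "c xi = fourier u xi / of_real N" by (simp add: c_def N_def A_def \<rho>_def)
    hence "c xi * cnj (fourier u xi) = (fourier u xi * cnj (fourier u xi)) / of_real N" by simp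
    also have "... = of_real ((norm (fourier u xi))\<^sup>2) / of_real N" by (simp only: complex_norm_square)
    also have "... = of_real ((norm (fourier u xi))\<^sup>2 / N)" by simp
    finally have "Re (c xi * cnj (fourier u xi)) = (norm (fourier u xi))\<^sup>2 / N" by (metis Re_complex_of_real)
    thus ?thesis using True by (simp add: F_def)
   next
    case False
    hence "c xi = 0" by (auto simp: c_def A_def \<rho>_def)
    thus ?thesis using False by simp
   qed
   have "(\<integral>\<^sup>+xi. ennreal (F xi) * indicator (A k) xi \<partial>lborel) = (\<integral>\<^sup>+xi. ennreal (flux s (norm xi) 0 * Re (c xi * cnj (fourier u xi))) \<partial>lborel)"
    unfolding Feq by (intro nn_integral_cong) (auto simp: indicator_def)
   also have "... = ennreal X"
    unfolding X_def by (rule nn_integral_eq_integral[OF T1], rule AE_I2, unfold Feq, intro mult_nonneg_nonneg F0) simp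
   also have "... \<le> ennreal E" using XE by (rule ennreal_leI)
   finally show ?thesis .
  qed
  have inc: "incseq (%k xi. ennreal (F xi) * indicator (A k) xi)"
  proof (rule incseq_SucI, rule le_funI, rule mult_left_mono)
   fix k and xi :: 'a
   have "A k \<subseteq> A (Suc k)"
   proof
    fix xi :: 'a assume x: "xi \<in> A k"
    have "1 / real (Suc (Suc k)) \<le> 1 / real (Suc k)" by (intro divide_left_mono) auto
    thus "xi \<in> A (Suc k)" using x unfolding A_def by auto
   qed
   thus "indicator (A k) xi \<le> (indicator (A (Suc k)) xi :: ennreal)" by (auto simp: indicator_def)
  qed simp
  have "(\<integral>\<^sup>+xi. ennreal (F xi) \<partial>lborel) \<le> (\<integral>\<^sup>+xi. (SUP k. ennreal (F xi) * indicator (A k) xi) \<partial>lborel)"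
  proof (rule nn_integral_mono)
   fix xi :: 'a
   show "ennreal (F xi) \<le> (SUP k. ennreal (F xi) * indicator (A k) xi)"
   proof (cases "xi = 0")
    case True
    \<comment> \<open>The origin lies in no annulus, but there the bound
      \<open>flux s 0 0 \<le> 0\<close> makes the integrand 0.\<close>
    have "F xi = 0" using flux_0_bounds[OF s, of 0] True by (simp add: F_def)
    thus ?thesis by simp
   next
    case False
    obtain k where k: "real k \<ge> max (norm xi) (1 / norm xi)" using real_arch_simple by blast
    have "norm xi \<le> real (Suc k)" "1 / norm xi \<le> real (Suc k)" using k by auto
    hence "xi \<in> A k" using False by (simp add: A_def field_simps)
    thus ?thesis by (intro SUP_upper2[of k]) auto
   qed
  qed
  also have "... = (SUP k. \<integral>\<^sup>+xi. ennreal (F xi) * indicator (A k) xi \<partial>lborel)"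
   by (rule nn_integral_monotone_convergence_SUP[OF inc]) measurable
  also have "... \<le> ennreal E" by (rule SUP_least) (rule trunc)
  finally show ?thesis unfolding IE .
 qed simp
 have "ennreal (1 / (2 * N)) * (\<integral>\<^sup>+xi. ennreal (flux s (norm xi) 0 * (norm (fourier u xi))\<^sup>2) \<partial>lborel)
  = (\<integral>\<^sup>+xi. ennreal (1 / (2 * N)) * ennreal (flux s (norm xi) 0 * (norm (fourier u xi))\<^sup>2) \<partial>lborel)"
  by (rule nn_integral_cmult[symmetric]) measurable
 also have "... = (\<integral>\<^sup>+xi. ennreal (1 / 2) * ennreal (F xi) \<partial>lborel)"
 proof (rule nn_integral_cong)
  fix xi :: 'a
  have "ennreal (1 / (2 * N)) * ennreal (flux s (norm xi) 0 * (norm (fourier u xi))\<^sup>2) = ennreal (1 / (2 * N) * (flux s (norm xi) 0 * (norm (fourier u xi))\<^sup>2))"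
   by (rule ennreal_mult[symmetric]) (use N q0[of xi] in auto)
  also have "1 / (2 * N) * (flux s (norm xi) 0 * (norm (fourier u xi))\<^sup>2) = 1 / 2 * F xi" by (simp add: F_def)
  also have "ennreal (1 / 2 * F xi) = ennreal (1 / 2) * ennreal (F xi)" by (rule ennreal_mult) (use F0 in auto)
  finally show "ennreal (1 / (2 * N)) * ennreal (flux s (norm xi) 0 * (norm (fourier u xi))\<^sup>2) = ennreal (1 / 2) * ennreal (F xi)" .
 qed
 also have "... = ennreal (1 / 2) * (\<integral>\<^sup>+xi. ennreal (F xi) \<partial>lborel)" by (rule nn_integral_cmult) measurable
 also have "... \<le> E_K (1 - 2 * s) w" unfolding EK ennreal_half by (intro mult_left_mono main) simp
 finally show ?thesis unfolding N_def .
qed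

theorem corollary1p2:
  fixes u :: "real ^ 'n \<Rightarrow> real" and v :: "(real ^ 'n) \<times> real \<Rightarrow> real" and s a :: real
  assumes "0 < s" and "s < 1" and "a = 1 - 2 * s"
    and "smooth u" and "bounded (range u)" and "integrable lborel u"
    and "is_arg_min (E_K a) (\<lambda>w. w \<in> H_class a u) v"
  shows "E_K a v =
    ennreal (1 / (2 * (2 * pi) ^ CARD('n))) *
    (\<integral>\<^sup>+\<xi>. ennreal (Re (S_symbol s \<xi>) * (cmod (fourier u \<xi>))\<^sup>2) \<partial>(lborel :: (real ^ 'n) measure))"
proof -
  note s = assms(1,2)
  define Q where "Q = (\<integral>\<^sup>+\<xi>. ennreal (flux s (norm \<xi>) 0 * (norm (fourier u \<xi>))\<^sup>2) \<partial>(lborel :: (real ^ 'n) measure))"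
  \<comment> \<open>The symbol agrees with the flux at 0 off the origin, and one point is a null
    set.\<close>
  have Q: "(\<integral>\<^sup>+\<xi>. ennreal (Re (S_symbol s \<xi>) * (cmod (fourier u \<xi>))\<^sup>2) \<partial>(lborel :: (real ^ 'n) measure)) = Q"
    unfolding Q_def
    by (rule nn_integral_cong_AE, rule eventually_mono[OF AE_lborel_singleton[of 0]]) (simp add: S_symbol_eq_flux[OF s])
  obtain B where B: "\<And>x. \<bar>u x\<bar> \<le> B" using assms(5) by (auto simp: bounded_iff)
  have v: "v \<in> H_class (1 - 2 * s) u" and min: "\<And>w. w \<in> H_class (1 - 2 * s) u \<Longrightarrow> E_K (1 - 2 * s) v \<le> E_K (1 - 2 * s) w"
    using assms(7) unfolding is_arg_min_def assms(3) by (auto simp: not_less)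
  have lower: "ennreal (1 / (2 * (2 * pi) ^ DIM(real ^ 'n))) * Q \<le> E_K (1 - 2 * s) v"
    unfolding Q_def by (rule energy_lower_bound[OF s v assms(6)])
  have "E_K (1 - 2 * s) v \<le> ennreal (1 / (2 * (2 * pi) ^ DIM(real ^ 'n))) * Q"
  proof (cases "Q < \<infinity>")
    case True
    from competitor[OF s smooth_continuous[OF assms(4)] B assms(6) True[unfolded Q_def]] obtain w
      where "w \<in> H_class (1 - 2 * s) u" "E_K (1 - 2 * s) w \<le> ennreal (1 / (2 * (2 * pi) ^ DIM(real ^ 'n))) * Q"
      unfolding Q_def by blast
    thus ?thesis using min order_trans by blast
  next
    case False
    \<comment> \<open>The constant in front is positive, so the asserted upper bound is
      infinite.\<close>
    hence "Q = \<infinity>" by (simp add: less_top[symmetric])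
    thus ?thesis by (simp add: ennreal_mult_top)
  qed
  thus ?thesis using lower unfolding Q assms(3) by (intro antisym) simp_all
qed

end
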